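(* Let $D$ and $D'$ be oriented virtual knot diagrams each having exactly one wen. If $D$ is related to $D'$ by a finite sequence of Reidemeister moves R1--R8 and wen moves W1--W4 (where intermediate diagrams may have any finite number of wens), then $D$ and $D'$ are related by a finite sequence of moves R1--R8 and W1--W3, without the need of W4.
   Context: A virtual knot diagram is a generic immersion of an oriented circle in the plane with finitely many transverse double points, each being either a real crossing (with over/under information) or a virtual crossing (without such information), considered up to planar isotopy. A virtual knot diagram with $n$ wens is such a diagram together with $n$ marked dots, called wens, placed on the curve away from the crossings. The moves below are local (performed inside a disk, the rest of the diagram being unchanged; the pictured strands carry no other crossings or wens in the disk), may be applied in either direction, and are allowed for all orientations of the strands. R1, R2, R3: the three classical Reidemeister moves on real crossings. R4--R7: the virtual Reidemeister moves, i.e. the analogues of R1, R2, R3 in which all crossings are virtual, and the mixed move in which a strand meeting the two other strands only at virtual crossings is moved across a real crossing of those two strands. R8 (upper forbidden move): a strand passing over two other strands at two real crossings is moved across a virtual crossing of those two strands. W1: a wen on the under-strand of a real crossing slides through the crossing, nothing else changing. W2: a wen on the over-strand of a real crossing slides through the crossing, and the crossing is replaced, in the disk, by three consecutive crossings of the same two strands: a virtual crossing, a real crossing, and a virtual crossing (met in this order along the strands), where the new real crossing has the same over-strand as the old one but the opposite sign. (In braid-like notation a crossing $\sigma$ becomes $v\,\sigma^{-1}v$ with $v$ a virtual crossing.) W3: a wen slides through a virtual crossing, nothing else changing. W4: two wens adjacent on the curve (with no crossing between them) are deleted or created. *)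

theory Defs
  imports "HOL-Analysis.Analysis"
begin

section \<open>Virtual knot diagrams with wens\<close>

text \<open>
  The oriented circle is \<open>\<real>/\<int>\<close> with its increasing direction, so a closed curve in the plane is
  a 1-periodic map \<open>real \<Rightarrow> complex\<close>. The decorations of a diagram are recorded on the source circle:
  every parameter at which the curve passes through a crossing carries \<open>Over\<close>, \<open>Under\<close> or \<open>Virtual\<close>,
  and the parameters of the marked dots carry \<open>Wen\<close>.
\<close>

datatype label = Plain | Over | Under | Virtual | Wen

datatype diagram = Diagram (curve: "real \<Rightarrow> complex") (label: "real \<Rightarrow> label")

text \<open>Labels of the two passages through a crossing.\<close>

definition real_crossing :: "(label \<times> label) set" where
  "real_crossing = {(Over, Under), (Under, Over)}"

definition virtual_crossing :: "(label \<times> label) set" where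
  "virtual_crossing = {(Virtual, Virtual)}"

definition double_pair :: "(real \<Rightarrow> complex) \<Rightarrow> real \<Rightarrow> real \<Rightarrow> bool" where
  "double_pair \<gamma> s t \<longleftrightarrow> s - t \<notin> \<int> \<and> \<gamma> s = \<gamma> t"

definition generic_immersion :: "(real \<Rightarrow> complex) \<Rightarrow> bool" where
  "generic_immersion \<gamma> \<longleftrightarrow>
     (\<forall>t. \<gamma> (t + 1) = \<gamma> t) \<and>
     \<gamma> C1_differentiable_on UNIV \<and>
     (\<forall>t. vector_derivative \<gamma> (at t) \<noteq> 0) \<and>
     finite {t \<in> {0..<1}. \<exists>s. double_pair \<gamma> s t} \<and>
     (\<forall>r s t. \<not> (double_pair \<gamma> r s \<and> double_pair \<gamma> s t \<and> double_pair \<gamma> r t)) \<and>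
     (\<forall>s t. double_pair \<gamma> s t \<longrightarrow>
        \<not> collinear {0, vector_derivative \<gamma> (at s), vector_derivative \<gamma> (at t)})"

definition virtual_knot_diagram :: "diagram \<Rightarrow> bool" where
  "virtual_knot_diagram D \<longleftrightarrow>
     generic_immersion (curve D) \<and>
     (\<forall>t. label D (t + 1) = label D t) \<and>
     (\<forall>s t. double_pair (curve D) s t \<longrightarrow>
        (label D s, label D t) \<in> real_crossing \<union> virtual_crossing) \<and>
     (\<forall>t. label D t \<in> {Over, Under, Virtual} \<longrightarrow> (\<exists>s. double_pair (curve D) s t)) \<and>
     finite {t \<in> {0..<1}. label D t = Wen}"

definition wens :: "diagram \<Rightarrow> nat" where
  "wens D = card {t \<in> {0..<1}. label D t = Wen}"

section \<open>Planar isotopy\<close>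

definition ambient_isotopy :: "(real \<Rightarrow> complex \<Rightarrow> complex) \<Rightarrow> bool" where
  "ambient_isotopy H \<longleftrightarrow>
     continuous_on ({0..1} \<times> UNIV) (\<lambda>(s, z). H s z) \<and>
     (\<forall>s\<in>{0..1}. \<exists>G. homeomorphism UNIV UNIV (H s) G) \<and>
     (\<forall>z. H 0 z = z)"

text \<open>
  The map \<open>\<alpha>\<close> is the lift of an orientation preserving homeomorphism of the circle: the two oriented
  decorated curves agree after the isotopy, irrespective of their parametrisations.
\<close>

definition isotopic :: "diagram \<Rightarrow> diagram \<Rightarrow> bool" where
  "isotopic D D' \<longleftrightarrow>
     virtual_knot_diagram D \<and> virtual_knot_diagram D' \<and>
     (\<exists>H \<alpha>. ambient_isotopy H \<and>
        continuous_on UNIV \<alpha> \<and> strict_mono \<alpha> \<and> (\<forall>t. \<alpha> (t + 1) = \<alpha> t + 1) \<and>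
        (\<forall>t. curve D' t = H 1 (curve D (\<alpha> t)) \<and> label D' t = label D (\<alpha> t)))"

section \<open>Local moves\<close>

text \<open>
  A strand of a local picture is an arc parametrised by \<open>[-1,1]\<close>, together with the list of the
  parameters whose label is not \<open>Plain\<close>. All pictures are drawn in the square \<open>[-1,1] \<times> [-1,1]\<close>, with
  exactly the end points of the strands on its boundary. In a pair of pictures, corresponding strands
  have the same end points and the same velocities there.
\<close>

type_synonym strand = "(real \<Rightarrow> complex) \<times> (real \<times> label) list"
type_synonym picture = "strand list"

definition disk :: "complex set" where
  "disk = cbox (Complex (-1) (-1)) (Complex 1 1)"

definition mark :: "(real \<times> label) list \<Rightarrow> real \<Rightarrow> label" where
  "mark ps x = (case map_of ps x of None \<Rightarrow> Plain | Some l \<Rightarrow> l)"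

text \<open>
  The \<open>j\<close>-th strand of the picture sits on the arc of the circle with midpoint \<open>m j\<close> and half-width
  \<open>\<bar>r j\<bar>\<close>; it is traversed forwards if \<open>r j > 0\<close> and backwards if \<open>r j < 0\<close>, so that a
  picture stands for all orientations of its strands.
\<close>

definition arc_param :: "(nat \<Rightarrow> real) \<Rightarrow> (nat \<Rightarrow> real) \<Rightarrow> nat \<Rightarrow> real \<Rightarrow> real" where
  "arc_param m r j x = m j + r j * x"

definition disjoint_arcs :: "(nat \<Rightarrow> real) \<Rightarrow> (nat \<Rightarrow> real) \<Rightarrow> nat \<Rightarrow> bool" where
  "disjoint_arcs m r k \<longleftrightarrow>
     (\<forall>i<k. \<forall>j<k. \<forall>x\<in>{-1..1}. \<forall>y\<in>{-1..1}.
        arc_param m r i x - arc_param m r j y \<in> \<int> \<longrightarrow> i = j \<and> x = y)"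

definition shows_picture :: "(nat \<Rightarrow> real) \<Rightarrow> (nat \<Rightarrow> real) \<Rightarrow> picture \<Rightarrow> diagram \<Rightarrow> bool" where
  "shows_picture m r A D \<longleftrightarrow>
     (\<forall>j<length A. \<forall>x\<in>{-1..1}.
        curve D (arc_param m r j x) = fst (A ! j) x \<and>
        label D (arc_param m r j x) = mark (snd (A ! j)) x)"

text \<open>
  Moves are only performed in the standard square; a move in an arbitrary disk is
  a planar isotopy taking that disk to the square, such a move, and another planar isotopy.
\<close>

definition local_move :: "(picture \<times> picture) set \<Rightarrow> diagram \<Rightarrow> diagram \<Rightarrow> bool" where
  "local_move M D D' \<longleftrightarrow>
     virtual_knot_diagram D \<and> virtual_knot_diagram D' \<and>
     (\<exists>(A, B)\<in>M. \<exists>m r.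
        length A = length B \<and> disjoint_arcs m r (length A) \<and>
        shows_picture m r A D \<and> shows_picture m r B D' \<and>
        (\<forall>t. (\<forall>j<length A. \<forall>x\<in>{-1..1}. t - arc_param m r j x \<notin> \<int>) \<longrightarrow>
           curve D t = curve D' t \<and> label D t = label D' t \<and> curve D t \<notin> disk))"

text \<open>\<open>equivclp\<close> makes the moves available in both directions.\<close>

definition move_equivalent :: "(picture \<times> picture) set \<Rightarrow> diagram \<Rightarrow> diagram \<Rightarrow> bool" where
  "move_equivalent M = equivclp (\<lambda>D D'. isotopic D D' \<or> local_move M D D')"

section \<open>The pictures\<close>

text \<open>
  Both \<open>bump\<close> and its derivative vanish at \<open>\<plusminus>1\<close>, so that adding a multiple of \<open>bump\<close> to a straight
  strand keeps its end points and end velocities; \<open>bump (\<plusminus>1/2) = 9/16\<close> and \<open>bump 0 = 1\<close>.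
\<close>

definition bump :: "real \<Rightarrow> real" where
  "bump x = (1 - x\<^sup>2)\<^sup>2"

definition horizontal :: "real \<Rightarrow> real \<Rightarrow> complex" where
  "horizontal c x = Complex x c"

definition vertical :: "real \<Rightarrow> complex" where
  "vertical x = Complex 0 x"

text \<open>A loop with one double point, at the parameters \<open>-1/2\<close> and \<open>1/2\<close>.\<close>

definition kink :: "real \<Rightarrow> complex" where
  "kink x = Complex (x - 16/9 * x * bump x) (bump x / 2)"

definition kink_moves :: "(label \<times> label) set \<Rightarrow> (picture \<times> picture) set" where
  "kink_moves X =
     {([(horizontal 0, [])], [(kink, [(-1/2, a), (1/2, b)])]) | a b. (a, b) \<in> X}"

text \<open>The arc \<open>dip\<close> starts and ends above the real axis, which it meets at \<open>-1/2\<close> and \<open>1/2\<close>.\<close>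

definition dip :: "real \<Rightarrow> complex" where
  "dip x = Complex x (9/16 - bump x)"

definition bigon_moves :: "(label \<times> label) set \<Rightarrow> (picture \<times> picture) set" where
  "bigon_moves X =
     {([(horizontal 0, []), (horizontal (9/16), [])],
       [(horizontal 0, [(-1/2, a), (1/2, a)]), (dip, [(-1/2, b), (1/2, b)])]) | a b. (a, b) \<in> X}"

text \<open>
  The strand \<open>bent\<close> is moved across the crossing of the two diagonals at the origin. Above the origin
  it meets them at \<open>(\<plusminus>1/2, 1/2)\<close>, below at \<open>(\<plusminus>1/2, -1/2)\<close>. The three arguments of
  \<open>triangle_move\<close> label the crossings rising/falling, rising/bent and falling/bent.
\<close>

definition rising :: "real \<Rightarrow> complex" where
  "rising x = Complex x x"

definition falling :: "real \<Rightarrow> complex" where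
  "falling x = Complex x (- x)"

definition bent :: "real \<Rightarrow> real \<Rightarrow> complex" where
  "bent \<epsilon> x = Complex x (\<epsilon> * 8/9 * bump x)"

fun triangle_move ::
    "label \<times> label \<Rightarrow> label \<times> label \<Rightarrow> label \<times> label \<Rightarrow> picture \<times> picture" where
  "triangle_move (a, a') (b, b') (c, c') =
     ([(rising,  [(0, a),     (1/2, b)]),
       (falling, [(0, a'),    (-1/2, c)]),
       (bent 1,  [(1/2, b'),  (-1/2, c')])],
      [(rising,  [(0, a),     (-1/2, b)]),
       (falling, [(0, a'),    (1/2, c)]),
       (bent (-1), [(-1/2, b'), (1/2, c')])])"

text \<open>Crossing of two strands at heights \<open>i\<close> and \<open>j\<close>.\<close>

definition stacked :: "nat \<Rightarrow> nat \<Rightarrow> label \<times> label" where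
  "stacked i j = (if i > j then (Over, Under) else (Under, Over))"

definition R1 :: "(picture \<times> picture) set" where
  "R1 = kink_moves real_crossing"

definition R2 :: "(picture \<times> picture) set" where
  "R2 = bigon_moves real_crossing"

definition R3 :: "(picture \<times> picture) set" where
  "R3 = {triangle_move (stacked i j) (stacked i k) (stacked j k) | i j k. distinct [i, j, k]}"

definition R4 :: "(picture \<times> picture) set" where
  "R4 = kink_moves virtual_crossing"

definition R5 :: "(picture \<times> picture) set" where
  "R5 = bigon_moves virtual_crossing"

definition R6 :: "(picture \<times> picture) set" where
  "R6 = {triangle_move (Virtual, Virtual) (Virtual, Virtual) (Virtual, Virtual)}"

definition R7 :: "(picture \<times> picture) set" where
  "R7 = {triangle_move X (Virtual, Virtual) (Virtual, Virtual) | X. X \<in> real_crossing}"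

definition R8 :: "(picture \<times> picture) set" where
  "R8 = {triangle_move (Virtual, Virtual) (Under, Over) (Under, Over)}"

definition W1 :: "(picture \<times> picture) set" where
  "W1 = {([(horizontal 0, [(-1/2, Wen), (0, Under)]), (vertical, [(0, Over)])],
          [(horizontal 0, [(0, Under), (1/2, Wen)]), (vertical, [(0, Over)])])}"

text \<open>
  The strand \<open>twist \<epsilon>\<close> has the end points of \<open>vertical\<close>; it meets the real axis three times, at its
  parameters \<open>-1/2\<close>, \<open>0\<close>, \<open>1/2\<close>, in the points \<open>-\<epsilon>/2\<close>, \<open>0\<close>, \<open>\<epsilon>/2\<close>. It crosses the axis upwards,
  downwards and upwards, so the middle crossing has the opposite sign to the one with \<open>vertical\<close>.
  The two values \<open>\<plusminus>1\<close> of \<open>\<epsilon>\<close> are mirror images; they are the braid-like pictures for the two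
  kinds of crossings.
\<close>

definition twist :: "real \<Rightarrow> real \<Rightarrow> complex" where
  "twist \<epsilon> x = Complex (\<epsilon> * 16/9 * x * bump x) (x - 16/9 * x * bump x)"

definition W2 :: "(picture \<times> picture) set" where
  "W2 = {([(horizontal 0, [(-3/4, Wen), (0, Over)]), (vertical, [(0, Under)])],
          [(horizontal 0, [(-1/2, Virtual), (0, Over), (1/2, Virtual), (3/4, Wen)]),
           (twist \<epsilon>, [(-1/2, Virtual), (0, Under), (1/2, Virtual)])]) | \<epsilon>. \<epsilon> \<in> {1, -1}}"

definition W3 :: "(picture \<times> picture) set" where
  "W3 = {([(horizontal 0, [(-1/2, Wen), (0, Virtual)]), (vertical, [(0, Virtual)])],
          [(horizontal 0, [(0, Virtual), (1/2, Wen)]), (vertical, [(0, Virtual)])])}"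

definition W4 :: "(picture \<times> picture) set" where
  "W4 = {([(horizontal 0, [(-1/2, Wen), (1/2, Wen)])], [(horizontal 0, [])])}"

definition reidemeister_moves :: "(picture \<times> picture) set" where
  "reidemeister_moves = R1 \<union> R2 \<union> R3 \<union> R4 \<union> R5 \<union> R6 \<union> R7 \<union> R8"

end

theory Submission
 imports Defs
begin

text \<open>
  Only diagrams with an odd number of wens matter, because W4 changes the number of wens by two and
  the other moves preserve it. Such a diagram can be reduced to one wen without W4. Walk along the
  curve and count the wens modulo two; after one turn the count is the opposite one, so that it is a
  function \<open>N\<close> on the line, the double cover of the circle (\<open>counter\<close>). Remove all wens, put a single
  wen at a point \<open>p\<close>, and twist every real crossing whose over-passage \<open>t\<close> in the turn after \<open>p\<close> has an
  odd count, where a twist is the replacement of a crossing in the move W2 (\<open>swept\<close>).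

  Imagine the single wen moving along the curve. It passes under-passages by W1 and virtual crossings
  by W3, while W2, at an over-passage, twists the crossing or untwists it. When \<open>p\<close> moves past an
  over-passage, the set of crossings to be twisted changes in just this way, so that the reduction does
  not depend on \<open>p\<close> up to the moves without W4 (\<open>swept_local\<close>); nor does it depend on the choice
  between the two counters, because the opposite counter amounts to \<open>p + 1\<close> in place of \<open>p\<close>
  (\<open>sweep_class_equivalent\<close>). The reduction is also invariant under all moves on
  the diagram. For a Reidemeister move in a disk start at a point \<open>p\<close> for which no crossing in the disk
  gets twisted; then the same move is possible after the reduction (\<open>sweep_reidemeister\<close>). Such
  a \<open>p\<close> exists since the over-passages of a move lie on at most two of its strands. The moves W1,
  W3 and W4 then do not change the reduced diagram at all (\<open>sweep_plain_wen_move\<close>), and W2 itself becomes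
  a W2 move if \<open>p\<close> is the moving wen (\<open>sweep_W2\<close>). Finally a diagram with one wen is its own
  reduction (\<open>sweep_one_wen\<close>), and the theorem follows along the given sequence of moves.

  Most of the work goes into twists. Planar isotopies are merely continuous here, and a homeomorphism
  that carries one crossing to another may distort it badly; nevertheless twists have to be well
  defined up to isotopy (\<open>twist_at_unique\<close>) and to commute (\<open>twist_at_swap\<close>). For this, every germ of
  a plane homeomorphism which maps the cross of the two coordinate axes to itself, half-axis by
  half-axis, is realised by a homeomorphism that preserves the axes and is the identity outside a
  square (\<open>cross_germ\<close>). On each quadrant this is done by the commutator with a push towards the inside.
  The curve itself is differentiable, and a chart straightens the two strands near a crossing
  (\<open>transversal_chart\<close>); in a straight crossing the twist is explicit.
\<close>

section \<open>Homeomorphisms of the plane that end an ambient isotopy\<close>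

definition isotopic_to_id :: "(complex => complex) => bool" where
 "isotopic_to_id h \<longleftrightarrow> (\<exists>H. ambient_isotopy H \<and> H 1 = h)"

lemma homeomorphism_of_bij:
 fixes f :: "'a::euclidean_space => 'a"
 assumes "continuous_on UNIV f" "bij f"
 shows "homeomorphism UNIV UNIV f (inv f)"
proof -
 obtain g where "homeomorphism UNIV (f ` UNIV) f g"
  using invariance_of_domain_homeomorphism[of UNIV f] assms by (auto simp: bij_def)
 then have g: "homeomorphism UNIV UNIV f g"
  using assms by (simp add: bij_def)
 then have "g = inv f"
  by (metis UNIV_I homeomorphism_apply1 homeomorphism_apply2 inv_equality ext)
 with g show ?thesis by simp
qed

lemma ambient_isotopy_bij:
 assumes "ambient_isotopy H" "s \<in> {0..1}"
 shows "bij (H s)"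
proof -
 obtain G where "homeomorphism UNIV UNIV (H s) G"
  using assms unfolding ambient_isotopy_def by meson
 then show ?thesis
  unfolding homeomorphism_def by (intro bij_betw_byWitness[where f' = G]) auto
qed

lemma isotopic_to_idD:
 assumes "isotopic_to_id h"
 shows "continuous_on UNIV h" "bij h"
proof -
 obtain H where H: "ambient_isotopy H" "H 1 = h"
  using assms isotopic_to_id_def by auto
 have "(1::real) \<in> {0..1}" by simp
 then show "bij h"
  using ambient_isotopy_bij[OF H(1)] H(2) by metis
 obtain G where "homeomorphism UNIV UNIV (H 1) G"
  using H(1) \<open>(1::real) \<in> {0..1}\<close> unfolding ambient_isotopy_def by meson
 then show "continuous_on UNIV h"
  using H(2) by (simp add: homeomorphism_def)
qed

text \<open>Packages the definition: bijectivity of each stage is enough, by invariance of domain.\<close>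

lemma isotopic_to_idI:
 fixes H :: "real => complex => complex"
 assumes "continuous_on ({0..1} \<times> UNIV) (\<lambda>(s, z). H s z)"
  and "\<And>s. s \<in> {0..1} ==> bij (H s)"
  and "\<And>z. H 0 z = z" and "\<And>z. H 1 z = h z"
 shows "isotopic_to_id h"
proof -
 have cont: "continuous_on UNIV (H s)" if "s \<in> {0..1}" for s
 proof -
  have "continuous_on UNIV (\<lambda>z. (\<lambda>(s, z). H s z) (s, z))"
   by (rule continuous_on_compose2[OF assms(1)]) (use that in \<open>auto intro: continuous_on_Pair\<close>)
  then show ?thesis by simp
 qed
 have "\<exists>G. homeomorphism UNIV UNIV (H s) G" if "s \<in> {0..1}" for s
  using homeomorphism_of_bij[OF cont[OF that] assms(2)[OF that]] by metis
 then have "ambient_isotopy H"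
  unfolding ambient_isotopy_def using assms(1,3) by simp
 moreover have "H 1 = h" using assms(4) by (simp add: fun_eq_iff)
 ultimately show ?thesis
  unfolding isotopic_to_id_def by metis
qed

lemma isotopic_to_id_compose:
 assumes "isotopic_to_id f" "isotopic_to_id g"
 shows "isotopic_to_id (f \<circ> g)"
proof -
 obtain F G where F: "ambient_isotopy F" "F 1 = f" and G: "ambient_isotopy G" "G 1 = g"
  using assms isotopic_to_id_def by auto
 have 1: "continuous_on ({0..1} \<times> UNIV) (\<lambda>(s, z). F s (G s z))"
 proof -
  have "continuous_on ({0..1} \<times> UNIV) (\<lambda>p. (\<lambda>(s, z). F s z) (fst p, (\<lambda>(s, z). G s z) p))"
   by (rule continuous_on_compose2[of "{0..1} \<times> UNIV" "\<lambda>(s, z). F s z"])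
    (use F(1) G(1) in \<open>auto simp: ambient_isotopy_def intro!: continuous_on_Pair continuous_on_fst continuous_on_id\<close>)
  then show ?thesis by (simp add: case_prod_beta)
 qed
 show ?thesis
 proof (rule isotopic_to_idI[OF 1])
  show "bij (\<lambda>z. F s (G s z))" if "s \<in> {0..1}" for s
   using bij_comp[OF ambient_isotopy_bij[OF G(1) that] ambient_isotopy_bij[OF F(1) that]] by (simp add: comp_def)
 qed (use F G in \<open>auto simp: ambient_isotopy_def\<close>)
qed

lemma isotopic_to_id_inv:
 assumes "isotopic_to_id h"
 shows "isotopic_to_id (inv h)"
proof -
 obtain H where H: "ambient_isotopy H" "H 1 = h"
  using assms isotopic_to_id_def by auto
 define c :: "real => real" where "c s = max 0 (min 1 s)" for s
 have c: "c s \<in> {0..1}" and c01: "s \<in> {0..1} ==> c s = s" for s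
  by (auto simp: c_def)
 have bijH: "bij (H s)" if "s \<in> {0..1}" for s
  using ambient_isotopy_bij[OF H(1) that] .
 define K where "K = (\<lambda>p::real \<times> complex. (fst p, H (c (fst p)) (snd p)))"
 have "continuous_on UNIV K"
 proof -
  have "continuous_on UNIV (\<lambda>p::real \<times> complex. (\<lambda>(s, z). H s z) (c (fst p), snd p))"
   by (rule continuous_on_compose2[of "{0..1} \<times> UNIV" "\<lambda>(s, z). H s z"])
    (use H(1) c in \<open>auto simp: ambient_isotopy_def c_def intro!: continuous_intros\<close>)
  then show ?thesis
   unfolding K_def by (auto intro!: continuous_intros)
 qed
 moreover have "bij K"
 proof (rule bijI)
  show "inj K"
   using bijH[OF c] unfolding K_def inj_def bij_def by auto
  have "\<exists>x. y = K x" for y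
  proof -
   obtain z where "H (c (fst y)) z = snd y"
    using bijH[OF c] by (metis bij_pointE)
   then have "y = K (fst y, z)" by (simp add: K_def prod_eq_iff)
   then show ?thesis by blast
  qed
  then show "surj K" by (simp add: surj_def)
 qed
 ultimately have hK: "homeomorphism UNIV UNIV K (inv K)"
  using homeomorphism_of_bij by blast
 have inv_K: "inv K (s, z) = (s, inv (H (c s)) z)" for s z
 proof -
  have "K (s, inv (H (c s)) z) = (s, z)"
   using bijH[OF c] by (simp add: K_def bij_def surj_f_inv_f)
  then show ?thesis
   using \<open>bij K\<close> by (metis bij_def inv_f_f)
 qed
 show ?thesis
 proof (rule isotopic_to_idI[of "\<lambda>s. inv (H s)"])
  have "continuous_on ({0..1} \<times> UNIV) (\<lambda>p. snd (inv K p))"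
   using hK by (auto simp: homeomorphism_def intro!: continuous_on_snd elim: continuous_on_subset)
  then show "continuous_on ({0..1} \<times> UNIV) (\<lambda>(s, z). inv (H s) z)"
   by (rule continuous_on_cong[THEN iffD1, rotated -1]) (auto simp: inv_K c01)
  show "bij (inv (H s))" if "s \<in> {0..1}" for s
   using bijH[OF that] by (rule bij_imp_bij_inv)
  have "H 0 = id" using H(1) by (auto simp: ambient_isotopy_def)
  then show "inv (H 0) z = z" for z by simp
 qed (use H in simp)
qed

lemma isotopic_to_id_id: "isotopic_to_id (\<lambda>z. z)"
 by (rule isotopic_to_idI[of "\<lambda>s z. z"]) (auto intro!: continuous_intros simp: case_prod_beta bij_def inj_def)

lemma isotopic_to_id_translate: "isotopic_to_id (\<lambda>z. a + z)"
proof (rule isotopic_to_idI[of "\<lambda>s z. s *\<^sub>R a + z"])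
 show "bij (\<lambda>z. s *\<^sub>R a + z)" for s :: real
  by (rule bij_betw_byWitness[where f' = "\<lambda>z. z - s *\<^sub>R a"]) auto
qed (auto intro!: continuous_intros simp: case_prod_beta)

lemma isotopic_to_id_mult:
 assumes "a ~= 0"
 shows "isotopic_to_id (\<lambda>z. a * z)"
proof (rule isotopic_to_idI[of "\<lambda>s z. exp (of_real s * Ln a) * z"])
 show "bij (\<lambda>z. exp (of_real s * Ln a) * z)" for s :: real
  by (rule bij_betw_byWitness[where f' = "\<lambda>z. z / exp (of_real s * Ln a)"]) auto
qed (use assms in \<open>auto intro!: continuous_intros simp: case_prod_beta\<close>)

lemma bij_shear:
 assumes "Im w > 0"
 shows "bij (\<lambda>z. of_real (Re z) + w * of_real (Im z))"
 by (rule bij_betw_byWitness[where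
    f' = "\<lambda>z. Complex (Re z - Re w * (Im z / Im w)) (Im z / Im w)"])
  (use assms in \<open>auto simp: complex_eq_iff\<close>)

text \<open>
 Shears and complex multiplications generate the linear maps of positive determinant.
\<close>

lemma isotopic_to_id_shear:
 assumes "Im w > 0"
 shows "isotopic_to_id (\<lambda>z. of_real (Re z) + w * of_real (Im z))"
proof (rule isotopic_to_idI[of
   "\<lambda>s z. of_real (Re z) + ((1 - of_real s) * \<i> + of_real s * w) * of_real (Im z)"])
 show "bij (\<lambda>z. of_real (Re z) + ((1 - of_real s) * \<i> + of_real s * w) * of_real (Im z))"
  if "s \<in> {0..1}" for s :: real
 proof (rule bij_shear)
  have "(1 - s) + s * Im w > 0"
  proof (cases "s = 0")
   case False
   then show ?thesis using that assms
    by (intro add_nonneg_pos) auto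
  qed simp
  then show "Im ((1 - of_real s) * \<i> + of_real s * w) > 0" by simp
 qed
qed (auto intro!: continuous_intros simp: case_prod_beta complex_eq_iff)

text \<open>
 A map at Lipschitz distance less than one from the identity is bijective: surjectivity is the
 contraction principle, and the straight line homotopy stays in this class.
\<close>

lemma bij_contraction_perturbation:
 fixes g :: "complex => complex"
 assumes g: "\<And>z w. dist (g z) (g w) <= dist z w / 2"
 shows "bij (\<lambda>z. z + g z)"
proof (rule bijI)
 show "inj (\<lambda>z. z + g z)"
 proof (rule injI)
  fix z w assume "z + g z = w + g w"
  then have "dist (g z) (g w) = dist z w"
   by (metis add_diff_cancel_left' dist_commute dist_norm add.commute diff_diff_eq2 diff_add_cancel add_diff_eq)
  then show "z = w" using g[of z w] by (smt (verit) dist_pos_lt field_sum_of_halves)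
 qed
 have "\<exists>x. y = x + g x" for y
 proof -
  have "\<exists>!x. x \<in> (UNIV::complex set) \<and> y - g x = x"
   by (rule Banach_fix[where c = "1/2"]) (use g in \<open>auto simp: dist_norm norm_minus_commute complete_UNIV\<close>)
  then show ?thesis by (metis diff_eq_eq)
 qed
 then show "surj (\<lambda>z. z + g z)" by (simp add: surj_def)
qed

lemma isotopic_to_id_perturbation:
 fixes g :: "complex => complex"
 assumes g: "\<And>z w. dist (g z) (g w) <= dist z w / 2"
 shows "isotopic_to_id (\<lambda>z. z + g z)"
proof (rule isotopic_to_idI[of "\<lambda>s z. z + s *\<^sub>R g z"])
 have "continuous_on UNIV g"
  unfolding continuous_on_iff using g by (smt (verit) field_sum_of_halves zero_le_dist)
 then show "continuous_on ({0..1} \<times> UNIV) (\<lambda>(s, z). z + s *\<^sub>R g z)"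
  by (auto simp: case_prod_beta intro!: continuous_intros elim: continuous_on_compose2)
 show "bij (\<lambda>z. z + s *\<^sub>R g z)" if "s \<in> {0..1}" for s
 proof (rule bij_contraction_perturbation)
  fix z w
  have "dist (s *\<^sub>R g z) (s *\<^sub>R g w) = s * dist (g z) (g w)"
   using that by (simp add: dist_norm flip: scaleR_diff_right)
  also have "\<dots> <= 1 * (dist z w / 2)"
   using that g[of z w] by (intro mult_mono) auto
  finally show "dist (s *\<^sub>R g z) (s *\<^sub>R g w) <= dist z w / 2" by simp
 qed
qed auto

text \<open>
 Alexander's trick. Surjectivity comes from invariance of domain: the range is open, and it is
 closed because the map is the identity outside a compact set.
\<close>

lemma bij_compact_support:
 fixes f :: "complex => complex"
 assumes "continuous_on UNIV f" "inj f" "\<And>z. R <= norm z ==> f z = z"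
 shows "bij f"
proof -
 have 1: "open (range f)"
  using invariance_of_domain assms by blast
 have "range f = f ` cball 0 R \<union> {z. R <= norm z}"
 proof -
  have "UNIV = cball 0 R \<union> {z::complex. R <= norm z}" by auto
  then have "range f = f ` cball 0 R \<union> f ` {z. R <= norm z}" by (metis image_Un)
  moreover have "f ` {z. R <= norm z} = {z. R <= norm z}"
   using assms(3) by force
  ultimately show ?thesis by simp
 qed
 moreover have "closed (f ` cball 0 R)"
  by (intro compact_imp_closed compact_continuous_image compact_cball continuous_on_subset[OF assms(1)]) auto
 moreover have "closed {z::complex. R <= norm z}"
  by (intro closed_Collect_le continuous_intros)
 ultimately have "closed (range f)" by auto
 with 1 have "range f = UNIV"
  using clopen by blast
 then show ?thesis using assms(2) by (simp add: bij_def)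
qed

lemma isotopic_to_id_compact_support:
 fixes f :: "complex => complex"
 assumes f: "continuous_on UNIV f" "inj f" "\<And>z. R <= norm z ==> f z = z"
 shows "isotopic_to_id f"
proof -
 define g where "g z = f z - z" for z
 have gc: "continuous_on UNIV g"
  unfolding g_def by (intro continuous_intros f)
 have g0: "g z = 0" if "R <= norm z" for z using f(3) that by (simp add: g_def)
 obtain B where B: "\<And>z. norm (g z) <= B" "B \<ge> 0"
 proof -
  have "bounded (g ` cball 0 R)"
   by (intro compact_imp_bounded compact_continuous_image compact_cball continuous_on_subset[OF gc]) auto
  then obtain b where "\<forall>w\<in>g ` cball 0 R. norm w <= b"
   unfolding bounded_iff by blast
  then have b: "norm (g z) <= b" if "norm z <= R" for z
   using that by simp
  have "norm (g z) <= max 0 b" for z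
   using b[of z] g0[of z] by (cases "norm z <= R") auto
  then show ?thesis using that by (metis max.cobounded1)
 qed
 define H where "H s z = z + s *\<^sub>R g (z /\<^sub>R s)" for s :: real and z
 have cont: "continuous_on ({0..1} \<times> UNIV) (\<lambda>p. snd p + fst p *\<^sub>R g (snd p /\<^sub>R fst p))"
 proof -
  have lim: "((\<lambda>p. fst p *\<^sub>R g (snd p /\<^sub>R fst p)) \<longlongrightarrow> fst q *\<^sub>R g (snd q /\<^sub>R fst q)) (at q within {0..1} \<times> UNIV)"
   for q :: "real \<times> complex"
  proof (cases "fst q = 0")
   case True
   have "((\<lambda>p. fst p *\<^sub>R g (snd p /\<^sub>R fst p)) \<longlongrightarrow> 0) (at q within {0..1} \<times> UNIV)"
   proof (rule Lim_null_comparison)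
    show "\<forall>\<^sub>F p in at q within {0..1} \<times> UNIV. norm (fst p *\<^sub>R g (snd p /\<^sub>R fst p)) <= \<bar>fst p\<bar> * B"
     by (rule always_eventually) (auto intro!: mult_left_mono B)
    have "((\<lambda>p::real\<times>complex. \<bar>fst p\<bar> * B) \<longlongrightarrow> \<bar>fst q\<bar> * B) (at q within {0..1} \<times> UNIV)"
     by (intro tendsto_intros)
    then show "((\<lambda>p::real\<times>complex. \<bar>fst p\<bar> * B) \<longlongrightarrow> 0) (at q within {0..1} \<times> UNIV)"
     using True by simp
   qed
   then show ?thesis using True by simp
  next
   case False
   have "isCont g z" for z using gc by (simp add: continuous_on_eq_continuous_at)
   then show ?thesis
    by (intro tendsto_intros isCont_tendsto_compose[of _ g] False)
  qed
  then show ?thesis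
   unfolding continuous_on_def by (intro ballI tendsto_add lim tendsto_snd tendsto_ident_at)
 qed
 show ?thesis
 proof (rule isotopic_to_idI[of H])
  show "continuous_on ({0..1} \<times> UNIV) (\<lambda>(s, z). H s z)"
   using cont by (simp add: H_def case_prod_beta)
  show "bij (H s)" if "s \<in> {0..1}" for s
  proof (cases "s = 0")
   case True
   then show ?thesis by (simp add: H_def bij_def inj_def)
  next
   case False
   have "H s = (\<lambda>z. s *\<^sub>R z) \<circ> f \<circ> (\<lambda>z. z /\<^sub>R s)"
    using False by (auto simp: H_def g_def fun_eq_iff scaleR_diff_right)
   moreover have "bij (\<lambda>z::complex. s *\<^sub>R z)" "bij (\<lambda>z::complex. z /\<^sub>R s)"
    using False by (auto intro!: bij_betw_byWitness[where f' = "\<lambda>z. z /\<^sub>R s"]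
     bij_betw_byWitness[where f' = "\<lambda>z. s *\<^sub>R z" and f = "\<lambda>z. z /\<^sub>R s"])
   ultimately show ?thesis
    using bij_compact_support[OF f] by (auto intro!: bij_comp)
  qed
 qed (auto simp: H_def g_def)
qed

section \<open>Diffeomorphisms act on diagrams\<close>

abbreviation valid :: "diagram => bool" where
 "valid == virtual_knot_diagram"

definition cross :: "complex => complex => real" where
 "cross a b = Re a * Im b - Im a * Re b"

lemma collinear_0_iff_cross: "collinear {0, a, b} \<longleftrightarrow> cross a b = 0"
proof -
 have "\<exists>c. b = c *\<^sub>R a" if c: "cross a b = 0" and "a ~= 0"
 proof (cases "Re a = 0")
  case True
  then have "Im a ~= 0" using \<open>a ~= 0\<close> by (simp add: complex_eq_iff)
  then have "b = (Im b / Im a) *\<^sub>R a"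
   using c True by (simp add: complex_eq_iff cross_def)
  then show ?thesis by blast
 next
  case False
  then have "b = (Re b / Re a) *\<^sub>R a"
   using c by (simp add: complex_eq_iff cross_def field_simps)
  then show ?thesis by blast
 qed
 moreover have "cross a (c *\<^sub>R a) = 0" for c
  by (simp add: cross_def)
 ultimately show ?thesis
  unfolding collinear_lemma by (auto simp: cross_def)
qed

lemma continuous_on_cross [continuous_intros]:
 assumes "continuous_on S f" "continuous_on S g"
 shows "continuous_on S (\<lambda>x. cross (f x) (g x))"
 unfolding cross_def by (intro continuous_intros assms)

text \<open>
 Derivatives are recorded by the images \<open>A\<close>, \<open>B\<close> of \<open>1\<close> and \<open>\<i>\<close>: invertibility is
 \<open>cross A B ~= 0\<close>, and Cramer's rule gives the derivative of the inverse.
\<close>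

definition diffeo :: "(complex => complex) => bool" where
 "diffeo G \<longleftrightarrow> isotopic_to_id G \<and>
   (\<exists>A B. continuous_on UNIV A \<and> continuous_on UNIV B \<and>
    (\<forall>z. cross (A z) (B z) ~= 0 \<and>
       (G has_derivative (\<lambda>w. Re w *\<^sub>R A z + Im w *\<^sub>R B z)) (at z)))"

lemma diffeoE:
 assumes "diffeo G"
 obtains A B where "continuous_on UNIV A" "continuous_on UNIV B"
  "\<And>z. cross (A z) (B z) ~= 0"
  "\<And>z. (G has_derivative (\<lambda>w. Re w *\<^sub>R A z + Im w *\<^sub>R B z)) (at z)"
 using assms unfolding diffeo_def by blast

lemma diffeoD: "diffeo G ==> isotopic_to_id G" "diffeo G ==> bij G" "diffeo G ==> continuous_on UNIV G"
 unfolding diffeo_def using isotopic_to_idD by blast+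

lemma diffeo_compose:
 assumes "diffeo F" "diffeo G"
 shows "diffeo (F \<circ> G)"
proof -
 obtain A B where AB: "continuous_on UNIV A" "continuous_on UNIV B"
  "\<And>z. cross (A z) (B z) ~= 0"
  "\<And>z. (G has_derivative (\<lambda>w. Re w *\<^sub>R A z + Im w *\<^sub>R B z)) (at z)"
  using diffeoE[OF assms(2)] by metis
 obtain C D where CD: "continuous_on UNIV C" "continuous_on UNIV D"
  "\<And>z. cross (C z) (D z) ~= 0"
  "\<And>z. (F has_derivative (\<lambda>w. Re w *\<^sub>R C z + Im w *\<^sub>R D z)) (at z)"
  using diffeoE[OF assms(1)] by metis
 have G: "continuous_on UNIV G" using assms(2) diffeoD by blast
 define A' where "A' z = Re (A z) *\<^sub>R C (G z) + Im (A z) *\<^sub>R D (G z)" for z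
 define B' where "B' z = Re (B z) *\<^sub>R C (G z) + Im (B z) *\<^sub>R D (G z)" for z
 have c: "continuous_on UNIV (\<lambda>z. C (G z))" "continuous_on UNIV (\<lambda>z. D (G z))"
  using continuous_on_compose2[OF CD(1) G] continuous_on_compose2[OF CD(2) G] by auto
 have "continuous_on UNIV A'" "continuous_on UNIV B'"
  unfolding A'_def B'_def by (intro continuous_intros c AB)+
 moreover have "cross (A' z) (B' z) ~= 0" for z
 proof -
  have "cross (A' z) (B' z) = cross (A z) (B z) * cross (C (G z)) (D (G z))"
   by (simp add: A'_def B'_def cross_def algebra_simps)
  then show ?thesis using AB(3) CD(3) by simp
 qed
 moreover have "(F \<circ> G has_derivative (\<lambda>w. Re w *\<^sub>R A' z + Im w *\<^sub>R B' z)) (at z)" for z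
  by (rule has_derivative_eq_rhs[OF diff_chain_at[OF AB(4) CD(4)]])
   (auto simp: A'_def B'_def fun_eq_iff algebra_simps)
 moreover have "isotopic_to_id (F \<circ> G)"
  using assms diffeoD isotopic_to_id_compose by blast
 ultimately show ?thesis unfolding diffeo_def by blast
qed

lemma diffeo_inv:
 assumes "diffeo G"
 shows "diffeo (inv G)"
proof -
 obtain A B where AB: "continuous_on UNIV A" "continuous_on UNIV B"
  "\<And>z. cross (A z) (B z) ~= 0"
  "\<And>z. (G has_derivative (\<lambda>w. Re w *\<^sub>R A z + Im w *\<^sub>R B z)) (at z)"
  using diffeoE[OF assms(1)] by metis
 have i: "isotopic_to_id (inv G)"
  using assms diffeoD isotopic_to_id_inv by blast
 then have ci: "continuous_on UNIV (inv G)" using isotopic_to_idD by blast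
 have bij: "bij G" using assms diffeoD by blast
 define A' where "A' y = (let z = inv G y in Complex (Im (B z) / cross (A z) (B z)) (- Im (A z) / cross (A z) (B z)))" for y
 define B' where "B' y = (let z = inv G y in Complex (- Re (B z) / cross (A z) (B z)) (Re (A z) / cross (A z) (B z)))" for y
 have c: "continuous_on UNIV (\<lambda>y. A (inv G y))" "continuous_on UNIV (\<lambda>y. B (inv G y))"
  using continuous_on_compose2[OF AB(1) ci] continuous_on_compose2[OF AB(2) ci] by auto
 have "continuous_on UNIV A'" "continuous_on UNIV B'"
  unfolding A'_def B'_def Let_def Complex_eq using AB(3) by (auto intro!: continuous_intros c)
 moreover have "cross (A' y) (B' y) ~= 0" for y
 proof -
  define z where "z = inv G y"
  have "cross (A' y) (B' y) * (cross (A z) (B z) * cross (A z) (B z)) = cross (A z) (B z)"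
   using AB(3)[of z] by (simp add: A'_def B'_def z_def[symmetric] Let_def cross_def[of "Complex _ _"] divide_simps)
    (simp add: cross_def algebra_simps)
  then show ?thesis using AB(3)[of z] by auto
 qed
 moreover have "(inv G has_derivative (\<lambda>w. Re w *\<^sub>R A' y + Im w *\<^sub>R B' y)) (at y)" for y
 proof (rule has_derivative_inverse_basic[where f = G and T = UNIV])
  define z where "z = inv G y"
  show "(G has_derivative (\<lambda>w. Re w *\<^sub>R A z + Im w *\<^sub>R B z)) (at (inv G y))"
   using AB(4) by (simp add: z_def)
  show "bounded_linear (\<lambda>w. Re w *\<^sub>R A' y + Im w *\<^sub>R B' y)"
   by (intro bounded_linear_intros bounded_linear_Re bounded_linear_Im)
  show "(\<lambda>w. Re w *\<^sub>R A' y + Im w *\<^sub>R B' y) \<circ> (\<lambda>w. Re w *\<^sub>R A z + Im w *\<^sub>R B z) = id"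
   using AB(3)[of z]
   by (auto simp: fun_eq_iff complex_eq_iff A'_def B'_def z_def[symmetric] Let_def divide_simps)
    (auto simp: cross_def algebra_simps)
  show "isCont (inv G) y" using ci by (simp add: continuous_on_eq_continuous_at)
  show "G (inv G w) = w" for w using bij by (simp add: bij_def surj_f_inv_f)
 qed auto
 ultimately show ?thesis using i unfolding diffeo_def by blast
qed

lemma diffeo_mult:
 assumes "a ~= 0"
 shows "diffeo (\<lambda>z. a * z)"
proof -
 have "cross a (a * \<i>) ~= 0"
  using assms by (auto simp: cross_def complex_eq_iff)
 then show ?thesis
  unfolding diffeo_def
  by (intro conjI exI[of _ "\<lambda>_. a"] exI[of _ "\<lambda>_. a * \<i>"])
   (auto simp: isotopic_to_id_mult[OF assms] complex_eq_iff fun_eq_iff algebra_simps intro!: derivative_eq_intros)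
qed

definition map_diagram :: "(complex => complex) => diagram => diagram" where
 "map_diagram h D = Diagram (\<lambda>t. h (curve D t)) (label D)"

lemma map_diagram_simps [simp]:
 "curve (map_diagram h D) t = h (curve D t)" "label (map_diagram h D) = label D"
 by (simp_all add: map_diagram_def)

lemma map_diagram_inv: "bij h ==> map_diagram (inv h) (map_diagram h D) = D"
 "bij h ==> map_diagram h (map_diagram (inv h) D) = D"
 by (cases D; simp add: map_diagram_def bij_def surj_f_inv_f)+

lemma validD:
 assumes "valid D"
 shows "curve D (t + 1) = curve D t" "label D (t + 1) = label D t"
  "\<And>r s t. \<not> (double_pair (curve D) r s \<and> double_pair (curve D) s t \<and> double_pair (curve D) r t)"
  "\<And>s t. double_pair (curve D) s t ==> (label D s, label D t) \<in> real_crossing \<union> virtual_crossing"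
  "\<And>t. label D t \<in> {Over, Under, Virtual} ==> \<exists>s. double_pair (curve D) s t"
  "finite {t \<in> {0..<1}. label D t = Wen}"
  "finite {t \<in> {0..<1}. \<exists>s. double_pair (curve D) s t}"
 using assms unfolding virtual_knot_diagram_def generic_immersion_def by blast+

text \<open>The analytic half of a virtual knot diagram with the derivative of the curve named.\<close>

lemma valid_velocity:
 assumes "valid D"
 obtains V where "\<And>t. (curve D has_vector_derivative V t) (at t)" "continuous_on UNIV V"
  "\<And>t. V t ~= 0" "\<And>s t. double_pair (curve D) s t ==> cross (V s) (V t) ~= 0"
proof -
 have g: "generic_immersion (curve D)" using assms virtual_knot_diagram_def by blast
 obtain V where V: "\<And>t. (curve D has_vector_derivative V t) (at t)" "continuous_on UNIV V"
  using g unfolding generic_immersion_def C1_differentiable_on_def by blast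
 then have v: "vector_derivative (curve D) (at t) = V t" for t
  using vector_derivative_at by blast
 have "\<And>t. V t ~= 0" "\<And>s t. double_pair (curve D) s t ==> cross (V s) (V t) ~= 0"
  using g unfolding generic_immersion_def collinear_0_iff_cross v by simp_all
 with V show ?thesis
  by (rule that)
qed

lemma generic_immersionI:
 assumes "\<And>t. \<gamma> (t + 1) = \<gamma> t"
  and V: "\<And>t. (\<gamma> has_vector_derivative V t) (at t)" "continuous_on UNIV V" "\<And>t. V t ~= 0"
  and "finite {t \<in> {0..<1}. \<exists>s. double_pair \<gamma> s t}"
  and "\<And>r s t. \<not> (double_pair \<gamma> r s \<and> double_pair \<gamma> s t \<and> double_pair \<gamma> r t)"
  and "\<And>s t. double_pair \<gamma> s t ==> cross (V s) (V t) ~= 0"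
 shows "generic_immersion \<gamma>"
proof -
 have "vector_derivative \<gamma> (at t) = V t" for t
  using V vector_derivative_at by blast
 then show ?thesis
  unfolding generic_immersion_def collinear_0_iff_cross C1_differentiable_on_def using assms by auto
qed

lemma valid_map:
 assumes "diffeo h" "valid D"
 shows "valid (map_diagram h D)"
proof -
 obtain A B where AB: "continuous_on UNIV A" "continuous_on UNIV B"
  "\<And>z. cross (A z) (B z) ~= 0"
  "\<And>z. (h has_derivative (\<lambda>w. Re w *\<^sub>R A z + Im w *\<^sub>R B z)) (at z)"
  using diffeoE[OF assms(1)] by metis
 obtain V where V: "\<And>t. (curve D has_vector_derivative V t) (at t)" "continuous_on UNIV V"
  "\<And>t. V t ~= 0" "\<And>s t. double_pair (curve D) s t ==> cross (V s) (V t) ~= 0"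
  using valid_velocity[OF assms(2)] by metis
 have inj: "h x = h y \<longleftrightarrow> x = y" for x y
  using diffeoD(2)[OF assms(1)] by (auto simp: bij_def inj_def)
 have dp: "double_pair (curve (map_diagram h D)) = double_pair (curve D)"
  by (auto simp: double_pair_def fun_eq_iff inj)
 define W where "W t = Re (V t) *\<^sub>R A (curve D t) + Im (V t) *\<^sub>R B (curve D t)" for t
 have cc: "continuous_on UNIV (curve D)"
  using V(1) by (meson continuous_at_imp_continuous_on has_vector_derivative_continuous)
 have c: "continuous_on UNIV (\<lambda>t. A (curve D t))" "continuous_on UNIV (\<lambda>t. B (curve D t))"
  using continuous_on_compose2[OF AB(1) cc] continuous_on_compose2[OF AB(2) cc] by auto
 have cr: "cross (Re v *\<^sub>R a + Im v *\<^sub>R b) (Re w *\<^sub>R a + Im w *\<^sub>R b) = cross v w * cross a b" for v w a b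
  by (simp add: cross_def algebra_simps)
 have "generic_immersion (curve (map_diagram h D))"
 proof (rule generic_immersionI[of _ W])
  show "(curve (map_diagram h D) has_vector_derivative W t) (at t)" for t
  proof -
   have "((\<lambda>t. h (curve D t)) has_derivative (\<lambda>x. Re (x *\<^sub>R V t) *\<^sub>R A (curve D t) + Im (x *\<^sub>R V t) *\<^sub>R B (curve D t))) (at t)"
    using diff_chain_at[OF V(1)[unfolded has_vector_derivative_def] AB(4)] by (simp add: comp_def)
   then show ?thesis
    unfolding has_vector_derivative_def map_diagram_def W_def by (simp add: algebra_simps)
  qed
  show "continuous_on UNIV W"
   unfolding W_def by (intro continuous_intros c V)
  show "W t ~= 0" for t
  proof
   assume "W t = 0"
   then have "cross (W t) (Re w *\<^sub>R A (curve D t) + Im w *\<^sub>R B (curve D t)) = 0" for w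
    by (simp add: cross_def)
   then have "cross (V t) w = 0" for w
    using AB(3) unfolding W_def cr by simp
   from this[of 1] this[of \<i>] have "V t = 0"
    by (simp add: cross_def complex_eq_iff)
   then show False using V by simp
  qed
  show "cross (W s) (W t) ~= 0" if "double_pair (curve (map_diagram h D)) s t" for s t
  proof -
   have d: "double_pair (curve D) s t" using that dp by simp
   then have "curve D s = curve D t" by (simp add: double_pair_def)
   then show ?thesis
    using V(4)[OF d] AB(3) unfolding W_def by (simp add: cr)
  qed
 qed (use validD[OF assms(2)] in \<open>auto simp: dp\<close>)
 then show ?thesis
  using assms(2) unfolding virtual_knot_diagram_def dp by simp
qed

section \<open>Isotopies with control of the parametrisation\<close>

definition reparam :: "(real => real) => bool" where
 "reparam \<alpha> \<longleftrightarrow> continuous_on UNIV \<alpha> \<and> strict_mono \<alpha> \<and> (\<forall>t. \<alpha> (t + 1) = \<alpha> t + 1)"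

definition isotopic_by :: "(real => real) => diagram => diagram => bool" where
 "isotopic_by \<alpha> D D' \<longleftrightarrow> valid D \<and> valid D' \<and> reparam \<alpha> \<and>
   (\<exists>h. isotopic_to_id h \<and> (\<forall>t. curve D' t = h (curve D (\<alpha> t)) \<and> label D' t = label D (\<alpha> t)))"

lemma isotopic_iff_isotopic_by: "isotopic D D' \<longleftrightarrow> (\<exists>\<alpha>. isotopic_by \<alpha> D D')"
 unfolding isotopic_def isotopic_by_def reparam_def isotopic_to_id_def by blast

lemma periodic_int:
 fixes f :: "real => 'a"
 assumes "\<And>t. f (t + 1) = f t"
 shows "f (t + of_int n) = f t"
proof (induction n rule: int_induct[of _ 0])
 case (step1 i)
 then show ?case using assms[of "t + of_int i"] by (simp add: ac_simps)
next
 case (step2 i)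
 then show ?case using assms[of "t + of_int (i - 1)"] by (simp add: ac_simps)
qed simp

lemma reparam_int:
 assumes "reparam \<alpha>"
 shows "\<alpha> (t + of_int n) = \<alpha> t + of_int n"
proof -
 have "(\<lambda>t. \<alpha> t - t) (t + of_int n) = (\<lambda>t. \<alpha> t - t) t"
  by (rule periodic_int) (use assms in \<open>auto simp: reparam_def\<close>)
 then show ?thesis by simp
qed

lemma reparam_bij:
 assumes "reparam \<alpha>"
 shows "bij \<alpha>"
proof -
 have inj: "inj \<alpha>" using assms by (auto simp: reparam_def intro: strict_mono_imp_inj_on)
 have "\<exists>x. y = \<alpha> x" for y
 proof -
  define n where "n = \<lfloor>y - \<alpha> 0\<rfloor>"
  have "\<alpha> (0 + of_int n) <= y" "y <= \<alpha> (0 + of_int (n + 1))"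
   unfolding reparam_int[OF assms] n_def by linarith+
  then obtain x where "\<alpha> x = y"
   using IVT'[of \<alpha> "0 + of_int n" y "0 + of_int (n + 1)"] assms
   unfolding reparam_def by (metis add_left_mono continuous_on_subset of_int_le_iff subset_UNIV zle_add1_eq_le less_imp_le zless_add1_eq)
  then show ?thesis by blast
 qed
 then have "surj \<alpha>" by (simp add: surj_def)
 with inj show ?thesis by (simp add: bij_def)
qed

lemma reparam_id: "reparam (\<lambda>t. t)"
 by (simp add: reparam_def strict_mono_def)

lemma reparam_compose:
 assumes "reparam \<alpha>" "reparam \<beta>"
 shows "reparam (\<alpha> \<circ> \<beta>)"
proof -
 have "continuous_on UNIV (\<alpha> \<circ> \<beta>)"
  using assms unfolding reparam_def by (metis continuous_on_compose continuous_on_subset subset_UNIV)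
 then show ?thesis
  using assms unfolding reparam_def by (auto simp: strict_mono_def)
qed

lemma reparam_inv:
 assumes "reparam \<alpha>"
 shows "reparam (inv \<alpha>)"
proof -
 have b: "bij \<alpha>" by (rule reparam_bij[OF assms])
 have sm: "strict_mono \<alpha>" using assms reparam_def by blast
 have "strict_mono (inv \<alpha>)"
 proof (rule strict_monoI)
  fix x y :: real assume "x < y"
  then have "\<alpha> (inv \<alpha> x) < \<alpha> (inv \<alpha> y)"
   using b by (simp add: bij_def surj_f_inv_f)
  then show "inv \<alpha> x < inv \<alpha> y"
   using strict_mono_less[OF sm] by simp
 qed
 moreover have "continuous_on UNIV (inv \<alpha>)"
  using homeomorphism_of_bij[of \<alpha>] assms b by (auto simp: reparam_def homeomorphism_def)
 moreover have "inv \<alpha> (t + 1) = inv \<alpha> t + 1" for t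
  using b assms unfolding reparam_def by (metis bij_inv_eq_iff)
 ultimately show ?thesis by (simp add: reparam_def)
qed

lemma isotopic_byD: "isotopic_by \<alpha> D D' ==> valid D" "isotopic_by \<alpha> D D' ==> valid D'"
 "isotopic_by \<alpha> D D' ==> reparam \<alpha>" "isotopic_by \<alpha> D D' ==> label D' t = label D (\<alpha> t)"
 unfolding isotopic_by_def by blast+

lemma isotopic_by_refl: "valid D ==> isotopic_by (\<lambda>t. t) D D"
 unfolding isotopic_by_def using reparam_id isotopic_to_id_id by blast

lemma isotopic_by_map:
 assumes "valid D" "diffeo h"
 shows "isotopic_by (\<lambda>t. t) D (map_diagram h D)"
 unfolding isotopic_by_def
 using assms valid_map reparam_id diffeoD(1) by (auto intro!: exI[of _ h])

lemma isotopic_by_trans: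
 assumes "isotopic_by \<alpha> D E" "isotopic_by \<beta> E F"
 shows "isotopic_by (\<alpha> \<circ> \<beta>) D F"
proof -
 obtain h where h: "isotopic_to_id h" "\<And>t. curve E t = h (curve D (\<alpha> t)) \<and> label E t = label D (\<alpha> t)"
  using assms(1) unfolding isotopic_by_def by blast
 obtain k where k: "isotopic_to_id k" "\<And>t. curve F t = k (curve E (\<beta> t)) \<and> label F t = label E (\<beta> t)"
  using assms(2) unfolding isotopic_by_def by blast
 have "\<forall>t. curve F t = (k \<circ> h) (curve D ((\<alpha> \<circ> \<beta>) t)) \<and> label F t = label D ((\<alpha> \<circ> \<beta>) t)"
  using h k by simp
 then show ?thesis
  unfolding isotopic_by_def
  using isotopic_byD[OF assms(1)] isotopic_byD[OF assms(2)] reparam_compose isotopic_to_id_compose[OF k(1) h(1)] by blast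
qed

lemma isotopic_by_sym:
 assumes "isotopic_by \<alpha> D E"
 shows "isotopic_by (inv \<alpha>) E D"
proof -
 obtain h where h: "isotopic_to_id h" "\<And>t. curve E t = h (curve D (\<alpha> t)) \<and> label E t = label D (\<alpha> t)"
  using assms(1) unfolding isotopic_by_def by blast
 have b: "bij h" "bij \<alpha>" using isotopic_to_idD h reparam_bij isotopic_byD[OF assms] by blast+
 have "\<forall>t. curve D t = inv h (curve E (inv \<alpha> t)) \<and> label D t = label E (inv \<alpha> t)"
  using h b by (metis bij_def inv_f_f surj_f_inv_f)
 then show ?thesis
  unfolding isotopic_by_def
  using isotopic_byD[OF assms(1)] reparam_inv isotopic_to_id_inv[OF h(1)] by blast
qed

text \<open>
 Isotopies that keep the parameters of all over-passages. This is what makes it possible to name a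
 crossing by the parameter of its over-passage while diagrams are moved about.
\<close>

definition isotopic_rel_over :: "diagram => diagram => bool" where
 "isotopic_rel_over D E \<longleftrightarrow> (\<exists>\<alpha>. isotopic_by \<alpha> D E \<and> (\<forall>t. label E t = Over --> \<alpha> t = t))"

lemma isotopic_rel_over_refl: "valid D ==> isotopic_rel_over D D"
 unfolding isotopic_rel_over_def using isotopic_by_refl by blast

lemma isotopic_rel_over_sym:
 assumes "isotopic_rel_over D E"
 shows "isotopic_rel_over E D"
proof -
 obtain \<alpha> where a: "isotopic_by \<alpha> D E" "\<forall>t. label E t = Over --> \<alpha> t = t"
  using assms isotopic_rel_over_def by blast
 have b: "bij \<alpha>" using a isotopic_byD reparam_bij by blast
 have "inv \<alpha> t = t" if "label D t = Over" for t
 proof -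
  have "label E (inv \<alpha> t) = Over"
   using isotopic_byD(4)[OF a(1), of "inv \<alpha> t"] b that by (simp add: bij_def surj_f_inv_f)
  then show ?thesis using a(2) b by (metis bij_def surj_f_inv_f)
 qed
 then show ?thesis
  unfolding isotopic_rel_over_def using isotopic_by_sym[OF a(1)] by blast
qed

lemma isotopic_rel_over_trans:
 assumes "isotopic_rel_over D E" "isotopic_rel_over E F"
 shows "isotopic_rel_over D F"
proof -
 obtain \<alpha> where a: "isotopic_by \<alpha> D E" "\<forall>t. label E t = Over --> \<alpha> t = t"
  using assms isotopic_rel_over_def by blast
 obtain \<beta> where b: "isotopic_by \<beta> E F" "\<forall>t. label F t = Over --> \<beta> t = t"
  using assms isotopic_rel_over_def by blast
 have "(\<alpha> \<circ> \<beta>) t = t" if "label F t = Over" for t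
  using a b that isotopic_byD(4)[OF b(1), of t] by simp
 then show ?thesis
  unfolding isotopic_rel_over_def using isotopic_by_trans[OF a(1) b(1)] by blast
qed

section \<open>Positions on the circle\<close>

text \<open>The signed distance from \<open>a\<close> to \<open>t\<close> on the circle \<open>\<real>/\<int>\<close>, in \<open>[-1/2, 1/2)\<close>.\<close>

definition off :: "real => real => real" where
 "off a t = t - a - of_int (round (t - a))"

lemma off_bounds: "- 1/2 <= off a t" "off a t < 1/2"
 unfolding off_def round_def by linarith+

lemma off_decomp: obtains n where "t = a + off a t + of_int n"
 using that[of "round (t - a)"] by (simp add: off_def)

lemma off_unique:
 assumes "t = a + x + of_int n" "- 1/2 <= x" "x < 1/2"
 shows "off a t = x"
proof -
 have "round (t - a) = n"
  unfolding round_def using assms by linarith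
 then show ?thesis using assms by (simp add: off_def)
qed

lemma off_self [simp]: "\<bar>x\<bar> < 1/2 ==> off a (a + x) = x"
 by (rule off_unique[of _ _ _ 0]) auto

lemma off_add_int [simp]: "off a (t + of_int n) = off a t"
proof -
 obtain m where "t = a + off a t + of_int m" by (rule off_decomp)
 then have "t + of_int n = a + off a t + of_int (m + n)" by simp
 then show ?thesis by (rule off_unique) (use off_bounds[of a t] in auto)
qed

lemma off_add_int_base [simp]: "off (a + of_int n) t = off a t"
proof -
 obtain m where "t = a + off a t + of_int m" by (rule off_decomp)
 then have "t = (a + of_int n) + off a t + of_int (m - n)" by simp
 then show ?thesis by (rule off_unique) (use off_bounds[of a t] in auto)
qed

lemma off_eq_iff: "off a s = off a t \<longleftrightarrow> s - t \<in> \<int>"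
proof
 assume e: "off a s = off a t"
 obtain m n where "s = a + off a s + of_int m" "t = a + off a t + of_int n"
  by (metis off_decomp)
 then have "s - t = of_int (m - n)" using e by simp
 then show "s - t \<in> \<int>" by (metis Ints_of_int)
next
 assume "s - t \<in> \<int>"
 then obtain n where "s = t + of_int n" by (metis Ints_cases add.commute diff_add_cancel)
 then show "off a s = off a t" by simp
qed

lemma finite_off: "finite {t \<in> {0..<1}. off a t = c}"
proof -
 have "x = y" if "x \<in> {t \<in> {0..<1}. off a t = c}" "y \<in> {t \<in> {0..<1}. off a t = c}" for x y
 proof -
  have "x - y \<in> \<int>" using that off_eq_iff[of a x y] by auto
  then obtain n where "x - y = of_int n" by (auto elim: Ints_cases)
  moreover have "\<bar>x - y\<bar> < 1" using that by auto
  ultimately have "\<bar>n\<bar> < 1" by linarith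
  then show ?thesis using \<open>x - y = of_int n\<close> by simp
 qed
 then have "\<exists>y. {t \<in> {0..<1}. off a t = c} \<subseteq> {y}" by blast
 then show ?thesis using finite_subset by blast
qed

lemma periodic_off:
 fixes f :: "real => 'a"
 assumes "\<And>t. f (t + 1) = f t"
 shows "f t = f (a + off a t)"
proof -
 obtain n where "t = a + off a t + of_int n" by (rule off_decomp)
 then show ?thesis using periodic_int[of f "a + off a t" n] assms by simp
qed

text \<open>Near a point at distance less than half a turn, \<open>off\<close> is a translation.\<close>

lemma off_locally:
 assumes "\<bar>off a t\<bar> < c" "c <= 1/2"
 obtains n where "t \<in> {a + of_int n - c <..< a + of_int n + c}"
  "\<forall>u\<in>{a + of_int n - c <..< a + of_int n + c}. off a u = u - a - of_int n"
proof -
 obtain n where n: "t = a + off a t + of_int n" by (rule off_decomp)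
 have "off a u = u - a - of_int n" if "u \<in> {a + of_int n - c <..< a + of_int n + c}" for u
  by (rule off_unique[of _ _ _ n]) (use that assms(2) in auto)
 moreover have "t \<in> {a + of_int n - c <..< a + of_int n + c}"
  using n assms by (auto simp: abs_less_iff)
 ultimately show ?thesis using that by blast
qed

lemma open_off_greater: "open {t. c < \<bar>off a t\<bar>}"
proof (cases "c < 1/2 \<and> 0 <= c")
 case False
 then consider "c \<ge> 1/2" | "c < 0" by linarith
 then have "{t. c < \<bar>off a t\<bar>} = {} \<or> {t. c < \<bar>off a t\<bar>} = UNIV"
 proof cases
  case 1
  then have "\<not> c < \<bar>off a t\<bar>" for t using off_bounds[of a t] by auto
  then show ?thesis by blast
 next
  case 2
  then have "c < \<bar>off a t\<bar>" for t by linarith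
  then show ?thesis by blast
 qed
 then show ?thesis by (metis open_UNIV open_empty)
next
 case True
 have "{t. c < \<bar>off a t\<bar>} = (\<Union>n. {a + of_int n + c <..< a + of_int (n + 1) - c})" (is "?L = ?R")
 proof (intro equalityI subsetI)
  fix t assume t: "t \<in> ?L"
  obtain n where n: "t = a + off a t + of_int n" by (rule off_decomp)
  show "t \<in> ?R"
  proof (cases "off a t > 0")
   case True
   then have "t \<in> {a + of_int n + c <..< a + of_int (n + 1) - c}"
    using n t off_bounds[of a t] \<open>c < 1/2 \<and> 0 <= c\<close> by auto
   then show ?thesis by blast
  next
   case False
   then have "t \<in> {a + of_int (n - 1) + c <..< a + of_int ((n - 1) + 1) - c}"
    using n t off_bounds[of a t] \<open>c < 1/2 \<and> 0 <= c\<close> by auto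
   then show ?thesis by blast
  qed
 next
  fix t assume "t \<in> ?R"
  then obtain n where n: "t \<in> {a + of_int n + c <..< a + of_int (n + 1) - c}" by blast
  show "t \<in> ?L"
  proof (cases "t < a + of_int n + 1/2")
   case True
   then have "off a t = t - a - of_int n"
    by (intro off_unique[of _ _ _ n]) (use n \<open>c < 1/2 \<and> 0 <= c\<close> in auto)
   then show ?thesis using n by auto
  next
   case False
   then have "off a t = t - a - of_int (n + 1)"
    by (intro off_unique[of _ _ _ "n + 1"]) (use n \<open>c < 1/2 \<and> 0 <= c\<close> in auto)
   then show ?thesis using n by auto
  qed
 qed
 then show ?thesis by (simp add: open_UN)
qed

lemma continuous_strict_mono_surj:
 fixes f :: "real => real"
 assumes "strict_mono f" "surj f"
 shows "continuous_on UNIV f"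
 by (rule continuous_onI_mono) (use assms in \<open>auto simp: strict_mono_less_eq\<close>)

lemma surj_if_id_outside:
 fixes f :: "real => real"
 assumes "continuous_on UNIV f" "\<And>x. 1 <= \<bar>x\<bar> ==> f x = x"
 shows "surj f"
proof -
 have "\<exists>x. f x = y" for y
 proof (cases "1 <= \<bar>y\<bar>")
  case False
  then have "\<exists>x. -1 <= x \<and> x <= 1 \<and> f x = y"
   by (intro IVT' continuous_on_subset[OF assms(1)]) (auto simp: assms(2))
  then show ?thesis by blast
 qed (use assms(2) in blast)
 then show ?thesis by (metis surjI)
qed

text \<open>Reparametrisation of the circle by \<open>f\<close> on the arc with centre \<open>a\<close> and half-width \<open>dl\<close>.\<close>

definition bend :: "real => real => (real => real) => real => real" where
 "bend a dl f t = t - off a t + dl * f (off a t / dl)"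

lemma bend_outside:
 assumes "\<And>x. 1 <= \<bar>x\<bar> ==> f x = x" "0 < dl" "dl <= \<bar>off a t\<bar>"
 shows "bend a dl f t = t"
proof -
 have "1 <= \<bar>off a t / dl\<bar>" using assms by (simp add: abs_divide)
 then show ?thesis using assms(1,2) by (simp add: bend_def)
qed

lemma abs_le_if_id_outside:
 fixes f :: "real => real"
 assumes "strict_mono f" "\<And>x. 1 <= \<bar>x\<bar> ==> f x = x" "\<bar>x\<bar> <= 1"
 shows "\<bar>f x\<bar> <= 1"
proof -
 have "f (-1) <= f x" "f x <= f 1"
  using assms(1,3) by (auto simp: strict_mono_less_eq)
 then show ?thesis using assms(2)[of 1] assms(2)[of "-1"] by auto
qed

lemma off_bend:
 assumes f: "strict_mono f" "\<And>x. 1 <= \<bar>x\<bar> ==> f x = x" and d: "0 < dl" "dl < 1/2"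
 shows "off a (bend a dl f t) = dl * f (off a t / dl)"
proof (cases "dl <= \<bar>off a t\<bar>")
 case True
 then have "1 <= \<bar>off a t / dl\<bar>" using assms by (simp add: abs_divide)
 then show ?thesis using bend_outside[of f dl a t] f(2) True d by simp
next
 case False
 then have "\<bar>off a t / dl\<bar> <= 1" using d by (simp add: abs_divide)
 then have "\<bar>f (off a t / dl)\<bar> <= 1" 
  using abs_le_if_id_outside[of f] f by blast
 then have "\<bar>dl * f (off a t / dl)\<bar> <= dl" using d by (simp add: abs_mult)
 moreover obtain n where "t = a + off a t + of_int n" by (rule off_decomp)
 then have "bend a dl f t = a + dl * f (off a t / dl) + of_int n" by (simp add: bend_def)
 ultimately show ?thesis by (intro off_unique) (use d in auto)
qed

lemma reparam_bend:
 assumes f: "strict_mono f" "continuous_on UNIV f" "\<And>x. 1 <= \<bar>x\<bar> ==> f x = x" and d: "0 < dl" "dl < 1/2"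
 shows "reparam (bend a dl f)"
proof -
 have sm: "strict_mono (bend a dl f)"
 proof (rule strict_monoI)
  fix x y :: real assume xy: "x < y"
  obtain m where m: "x = a + off a x + of_int m" by (rule off_decomp)
  obtain n where n: "y = a + off a y + of_int n" by (rule off_decomp)
  have bx: "bend a dl f x = a + off a (bend a dl f x) + of_int m"
   using m off_bend[OF f(1,3) d] by (simp add: bend_def)
  have b_y: "bend a dl f y = a + off a (bend a dl f y) + of_int n"
   using n off_bend[OF f(1,3) d] by (simp add: bend_def)
  show "bend a dl f x < bend a dl f y"
  proof (cases "m = n")
   case True
   then have "off a x < off a y" using xy m n by linarith
   then have "f (off a x / dl) < f (off a y / dl)"
    using d f(1) by (auto simp: strict_mono_less divide_strict_right_mono)
   then show ?thesis using bx b_y True d off_bend[OF f(1,3) d] by auto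
  next
   case False
   then have "m < n" using xy m n off_bounds[of a x] off_bounds[of a y] by linarith
   then have "m + 1 <= n" by simp
   then have "real_of_int m + 1 <= real_of_int n" by linarith
   then show ?thesis
    using bx b_y off_bounds[of a "bend a dl f x"] off_bounds[of a "bend a dl f y"] by linarith
  qed
 qed
 have "\<exists>x. y = bend a dl f x" for y
 proof -
  obtain z where z: "off a y / dl = f z"
   using surj_if_id_outside[OF f(2,3)] by (metis surj_def)
  obtain n where n: "y = a + off a y + of_int n" by (rule off_decomp)
  have "- 1/2 <= dl * z \<and> dl * z < 1/2"
  proof (cases "1 <= \<bar>z\<bar>")
   case True
   then have "dl * z = off a y" using f(3) z d by (simp add: field_simps)
   then show ?thesis using off_bounds[of a y] by simp
  next
   case False
   then have "\<bar>dl * z\<bar> <= dl" using d by (simp add: abs_mult)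
   then show ?thesis using d by linarith
  qed
  then have "off a (a + dl * z + of_int n) = dl * z"
   by (intro off_unique) auto
  then have "bend a dl f (a + dl * z + of_int n) = y"
   using z[symmetric] n d by (simp add: bend_def)
  then show ?thesis by metis
 qed
 then have "surj (bend a dl f)" by (simp add: surj_def)
 moreover have "bend a dl f (t + 1) = bend a dl f t + 1" for t
  using off_add_int[of a t 1] by (simp add: bend_def)
 ultimately show ?thesis
  using sm continuous_strict_mono_surj by (simp add: reparam_def)
qed

section \<open>Straight crossings and their twists\<close>

definition cflip :: "real => complex => complex" where
 "cflip sg z = Complex (Re z) (sg * Im z)"

lemma cflip_simps [simp]: "Re (cflip sg z) = Re z" "Im (cflip sg z) = sg * Im z"
 by (simp_all add: cflip_def)

lemma cflip_cflip: "sg \<in> {1, -1} ==> cflip sg (cflip sg z) = z"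
 by (auto simp: complex_eq_iff)

lemma cflip_eq_iff: "sg \<in> {1, -1} ==> cflip sg z = cflip sg w \<longleftrightarrow> z = w"
 by (metis cflip_cflip)

lemma mem_disk_iff: "z \<in> disk \<longleftrightarrow> \<bar>Re z\<bar> <= 1 \<and> \<bar>Im z\<bar> <= 1"
 by (auto simp: disk_def in_cbox_complex_iff)

text \<open>
 In a straight crossing the strand at \<open>t\<close> runs along the real axis and the one at \<open>s\<close> along the
 imaginary axis, upwards or downwards according to the orientation \<open>sg\<close> of the crossing. Allowing
 both signs here is what spares all considerations of orientation later on.
\<close>

definition straight :: "diagram => real => real => real => real => bool" where
 "straight D t s dl sg \<longleftrightarrow> 0 < dl \<and> dl < 1/2 \<and> sg \<in> {1, -1} \<and>
   (\<forall>x. \<bar>x\<bar> <= 1 --> curve D (t + dl * x) = Complex x 0 \<and> curve D (s + dl * x) = Complex 0 (sg * x)) \<and>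
   (\<forall>x. \<bar>x\<bar> <= 1 \<and> x ~= 0 --> label D (t + dl * x) = Plain \<and> label D (s + dl * x) = Plain) \<and>
   (\<forall>u. curve D u \<in> disk --> \<bar>off t u\<bar> <= dl \<or> \<bar>off s u\<bar> <= dl)"

lemma straightD:
 assumes "straight D t s dl sg"
 shows "0 < dl" "dl < 1/2" "sg \<in> {1, -1}" "sg * sg = 1"
  "curve D u \<in> disk ==> \<bar>off t u\<bar> <= dl \<or> \<bar>off s u\<bar> <= dl"
 using assms unfolding straight_def by auto

lemma straight_curve:
 assumes "straight D t s dl sg" "valid D"
 shows "\<bar>off t u\<bar> <= dl ==> curve D u = Complex (off t u / dl) 0"
  "\<bar>off s u\<bar> <= dl ==> curve D u = Complex 0 (sg * (off s u / dl))"
  "\<bar>off t u\<bar> <= dl ==> off t u ~= 0 ==> label D u = Plain"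
  "\<bar>off s u\<bar> <= dl ==> off s u ~= 0 ==> label D u = Plain"
proof -
 note per = validD(1,2)[OF assms(2)]
 have d: "0 < dl" using assms straightD by blast
 have 1: "curve D u = curve D (a + dl * (off a u / dl))" "label D u = label D (a + dl * (off a u / dl))" for a
  using periodic_off[of "curve D" u a] periodic_off[of "label D" u a] per d by auto
 have 2: "\<bar>off a u / dl\<bar> <= 1" if "\<bar>off a u\<bar> <= dl" for a
  using that d by (simp add: abs_divide)
 show "\<bar>off t u\<bar> <= dl ==> curve D u = Complex (off t u / dl) 0"
  using 1[of t] 2[of t] assms(1) unfolding straight_def by metis
 show "\<bar>off s u\<bar> <= dl ==> curve D u = Complex 0 (sg * (off s u / dl))"
  using 1[of s] 2[of s] assms(1) unfolding straight_def by metis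
 show "\<bar>off t u\<bar> <= dl ==> off t u ~= 0 ==> label D u = Plain"
  using 1[of t] 2[of t] assms(1) d unfolding straight_def by (metis divide_eq_0_iff less_irrefl)
 show "\<bar>off s u\<bar> <= dl ==> off s u ~= 0 ==> label D u = Plain"
  using 1[of s] 2[of s] assms(1) d unfolding straight_def by (metis divide_eq_0_iff less_irrefl)
qed

lemma straight_disjoint:
 assumes "straight D t s dl sg" "valid D"
 shows "\<not> (\<bar>off t u\<bar> <= dl \<and> \<bar>off s u\<bar> <= dl)"
proof
 assume a: "\<bar>off t u\<bar> <= dl \<and> \<bar>off s u\<bar> <= dl"
 note d = straightD[OF assms(1)]
 have "Complex (off t u / dl) 0 = Complex 0 (sg * (off s u / dl))"
  using straight_curve[OF assms] a by metis
 then have "off t u = 0" "off s u = 0" using d by auto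
 then obtain m n where "u = t + of_int m" "u = s + of_int n"
  by (metis add.right_neutral off_decomp)
 then have "s + dl * 1 = t + dl * 1 + of_int (m - n)" by simp
 then have "off t (s + dl * 1) = off t (t + dl * 1)" by (metis off_add_int)
 also have "\<dots> = dl" using d by simp
 finally have "curve D (s + dl * 1) = Complex 1 0"
  using straight_curve(1)[OF assms, of "s + dl * 1"] d by simp
 moreover have "curve D (s + dl * 1) = Complex 0 (sg * 1)"
  using assms(1) unfolding straight_def by (metis abs_one order_refl)
 ultimately show False by simp
qed

lemma straight_double_pair:
 assumes "straight D t s dl sg" "valid D"
 shows "double_pair (curve D) t s" "curve D t = 0" "curve D s = 0"
proof -
 note d = straightD[OF assms(1)]
 show "curve D t = 0" "curve D s = 0"
  using straight_curve(1)[OF assms, of t] straight_curve(2)[OF assms, of s] d off_self[of 0]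
  by (auto simp: complex_eq_iff)
 moreover have "t - s \<notin> \<int>"
 proof
  assume "t - s \<in> \<int>"
  then have "off t t = off t s" "off s t = off s s" by (simp_all add: off_eq_iff)
  then show False
   using straight_disjoint[OF assms, of t] d off_self[of 0 t] off_self[of 0 s] by auto
 qed
 ultimately show "double_pair (curve D) t s" by (simp add: double_pair_def)
qed

text \<open>
 Half-size copy of \<open>twist 1\<close>, continued along the axis. The parameter is the sum of the two
 coordinates, hence the curve is embedded.
\<close>

definition hook_x :: "real => real" where
 "hook_x x = 16/9 * x * (max 0 (1 - 4 * x\<^sup>2))\<^sup>2"

definition hook :: "real => complex" where
 "hook x = Complex (hook_x x) (x - hook_x x)"

definition hook_dx :: "real => real" where
 "hook_dx x = 16/9 * (max 0 (1 - 4 * x\<^sup>2))\<^sup>2 - 256/9 * x\<^sup>2 * max 0 (1 - 4 * x\<^sup>2)"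

lemma hook_simps [simp]: "Re (hook x) = hook_x x" "Im (hook x) = x - hook_x x"
 by (simp_all add: hook_def)

lemma half_le_abs_iff: "1/2 <= \<bar>x\<bar> \<longleftrightarrow> 1 <= 4 * x\<^sup>2" for x :: real
proof -
 have "1/2 <= \<bar>x\<bar> \<longleftrightarrow> (1/2)\<^sup>2 <= x\<^sup>2"
  by (metis abs_le_square_iff abs_of_nonneg zero_le_divide_1_iff zero_le_numeral)
 then show ?thesis by (simp add: power2_eq_square mult.commute)
qed

lemma hook_outside: "1/2 <= \<bar>x\<bar> ==> hook x = Complex 0 x"
 unfolding half_le_abs_iff by (simp add: complex_eq_iff hook_x_def)

lemma hook_twist: "\<bar>x\<bar> <= 1/2 ==> hook x = (1/2) *\<^sub>R twist 1 (2 * x)"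
proof -
 assume "\<bar>x\<bar> <= 1/2"
 then have "\<bar>x\<bar>\<^sup>2 <= (1/2)\<^sup>2" by (intro power_mono) auto
 then have "max 0 (1 - 4 * x\<^sup>2) = 1 - (2 * x)\<^sup>2"
  by (simp add: power2_eq_square)
 then show ?thesis
  by (simp add: complex_eq_iff twist_def hook_x_def bump_def)
qed

lemma abs_hook_x: "\<bar>hook_x x\<bar> <= 1/2"
proof (cases "1/2 <= \<bar>x\<bar>")
 case True
 then show ?thesis using hook_outside[OF True] by (auto simp: complex_eq_iff)
next
 case False
 define y where "y = 2 * \<bar>x\<bar>"
 have y: "0 <= y" "y <= 1" using False by (auto simp: y_def)
 have y2: "y\<^sup>2 <= 1" using y by (simp add: power_le_one)
 have "max 0 (1 - 4 * x\<^sup>2) = 1 - y\<^sup>2"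
  using y2 by (simp add: y_def power_mult_distrib)
 then have "\<bar>hook_x x\<bar> = 8/9 * (y * (1 - y\<^sup>2)\<^sup>2)"
  by (simp add: hook_x_def abs_mult y_def)
 also have "\<dots> <= 8/9 * (1/2)"
 proof -
  have "(1 - y\<^sup>2)\<^sup>2 <= 1 - y\<^sup>2"
   using y2 by (simp add: power2_eq_square mult_left_le)
  then have "y * (1 - y\<^sup>2)\<^sup>2 <= y * (1 - y\<^sup>2)" using y by (intro mult_left_mono)
  also have "\<dots> = (y * (1 - y)) * (1 + y)" by (simp add: power2_eq_square algebra_simps)
  also have "\<dots> <= (1/4) * 2"
  proof (intro mult_mono)
   have "0 <= (y - 1/2)\<^sup>2" by simp
   then show "y * (1 - y) <= 1/4" by (simp add: power2_eq_square algebra_simps)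
  qed (use y in auto)
  finally show ?thesis by simp
 qed
 finally show ?thesis by simp
qed

lemma abs_hook_y: "\<bar>x\<bar> <= 1/2 ==> \<bar>x - hook_x x\<bar> <= 1/2"
proof -
 assume x: "\<bar>x\<bar> <= 1/2"
 define m where "m = (max 0 (1 - 4 * x\<^sup>2))\<^sup>2"
 have m: "0 <= m" "m <= 1" by (auto simp: m_def power_le_one)
 have "x - hook_x x = x * (1 - 16/9 * m)" by (simp add: hook_x_def m_def algebra_simps)
 also have "\<bar>\<dots>\<bar> <= 1/2 * 1"
  unfolding abs_mult by (intro mult_mono x) (use m in auto)
 finally show ?thesis by simp
qed

lemma hook_in_disk: "\<bar>x\<bar> <= 1 ==> hook x \<in> disk"
 using abs_hook_x[of x] abs_hook_y[of x] hook_outside[of x]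
 by (cases "\<bar>x\<bar> <= 1/2") (auto simp: mem_disk_iff)

lemma hook_inj: "hook x = hook y \<longleftrightarrow> x = y"
 by (auto simp: complex_eq_iff)

lemma hook_x_special: "hook_x 0 = 0" "hook_x (1/4) = 1/4" "hook_x (-1/4) = -1/4" "hook_x (-(1/4)) = -(1/4)"
 by (auto simp: hook_x_def power2_eq_square max_def)

lemma hook_real_iff: "x - hook_x x = 0 \<longleftrightarrow> x \<in> {0, 1/4, -1/4}"
proof
 assume h: "x - hook_x x = 0"
 show "x \<in> {0, 1/4, -1/4}"
 proof (cases "x = 0")
  case False
  then have m: "(max 0 (1 - 4 * x\<^sup>2))\<^sup>2 = (3/4)\<^sup>2"
   using h by (simp add: hook_x_def power2_eq_square)
  then have "max 0 (1 - 4 * x\<^sup>2) = 3/4"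
   by (rule power2_eq_imp_eq) auto
  then have "x\<^sup>2 = (1/4)\<^sup>2" by (simp add: power2_eq_square max_def split: if_splits)
  then show ?thesis by (metis power2_eq_iff insert_iff minus_divide_left)
 qed simp
next
 assume "x \<in> {0, 1/4, -1/4}"
 then consider "x = 0" | "x = 1/4" | "x = -1/4" by blast
 then show "x - hook_x x = 0"
  by cases (simp_all only: hook_x_special diff_self)
qed

lemma max_square_derivative: "((\<lambda>y. (max 0 y)\<^sup>2) has_real_derivative 2 * max 0 y) (at y)"
 for y :: real
proof -
 consider "y < 0" | "y = 0" | "y > 0" by linarith
 then show ?thesis
 proof cases
  case 1
  have "((\<lambda>y. 0) has_real_derivative 2 * max 0 y) (at y)" using 1 by simp
  then show ?thesis
   by (rule has_field_derivative_transform_within_open[of _ _ _ "{..<0}"]) (use 1 in auto)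
 next
  case 2
  have "(\<lambda>h. ((max 0 (0 + h))\<^sup>2 - (max 0 0)\<^sup>2) / h) \<midarrow>0\<rightarrow> (0::real)"
  proof (rule Lim_null_comparison)
   show "\<forall>\<^sub>F h in at (0::real). norm (((max 0 (0 + h))\<^sup>2 - (max 0 0)\<^sup>2) / h) <= \<bar>h\<bar>"
    by (rule always_eventually) (auto simp: max_def power2_eq_square)
   show "(\<lambda>h. \<bar>h\<bar>) \<midarrow>0\<rightarrow> (0::real)" by (rule tendsto_rabs_zero) simp
  qed
  then show ?thesis using 2 by (simp add: DERIV_def)
 next
  case 3
  have "((\<lambda>y. y\<^sup>2) has_real_derivative 2 * max 0 y) (at y)"
   using 3 by (auto intro!: derivative_eq_intros)
  then show ?thesis
   by (rule has_field_derivative_transform_within_open[of _ _ _ "{0<..}"]) (use 3 in auto)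
 qed
qed

lemma hook_x_derivative: "(hook_x has_real_derivative hook_dx x) (at x)"
proof -
 have "((\<lambda>x. (max 0 (1 - 4 * x\<^sup>2))\<^sup>2) has_real_derivative 2 * max 0 (1 - 4 * x\<^sup>2) * (- 8 * x)) (at x)"
  by (rule DERIV_chain2[OF max_square_derivative]) (auto intro!: derivative_eq_intros)
 then have "((\<lambda>x. 16/9 * x * (max 0 (1 - 4 * x\<^sup>2))\<^sup>2) has_real_derivative
   (16/9 * x) * (2 * max 0 (1 - 4 * x\<^sup>2) * (- 8 * x)) + (16/9) * (max 0 (1 - 4 * x\<^sup>2))\<^sup>2) (at x)"
  by (intro DERIV_mult[THEN DERIV_cong]) (auto intro!: derivative_eq_intros)
 then show ?thesis
  by (simp add: hook_x_def[abs_def] hook_dx_def power2_eq_square algebra_simps)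
qed

lemma continuous_hook_dx: "continuous_on UNIV hook_dx"
 unfolding hook_dx_def[abs_def] by (intro continuous_intros)

lemma hook_derivative: "(hook has_vector_derivative Complex (hook_dx x) (1 - hook_dx x)) (at x)"
proof -
 have "((\<lambda>x. complex_of_real (hook_x x) + \<i> * complex_of_real (x - hook_x x)) has_vector_derivative
   complex_of_real (hook_dx x) + \<i> * complex_of_real (1 - hook_dx x)) (at x)"
  using hook_x_derivative[of x]
  by (intro has_vector_derivative_add has_vector_derivative_mult_right has_vector_derivative_of_real
    has_vector_derivative_real_field)
   (auto intro!: derivative_eq_intros simp flip: has_real_derivative_iff_has_vector_derivative)
 then show ?thesis by (simp add: hook_def[abs_def] Complex_eq)
qed

text \<open>
 The diagram obtained from a straight crossing by the replacement in the move \<open>W2\<close>, without its wen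
 and at half the size. The collar that is left lets one shrink the replacement inside the square.
\<close>

definition twisted :: "diagram => real => real => real => real => diagram" where
 "twisted D t s dl sg = Diagram
   (\<lambda>u. if \<bar>off s u\<bar> <= dl then cflip sg (hook (off s u / dl)) else curve D u)
   (\<lambda>u. if \<bar>off s u\<bar> = dl/4 \<or> \<bar>off t u\<bar> = dl/4 then Virtual else label D u)"

lemma curve_twisted: "curve (twisted D t s dl sg) u =
  (if \<bar>off s u\<bar> <= dl then cflip sg (hook (off s u / dl)) else curve D u)"
 and label_twisted: "label (twisted D t s dl sg) u =
  (if \<bar>off s u\<bar> = dl/4 \<or> \<bar>off t u\<bar> = dl/4 then Virtual else label D u)"
 by (simp_all add: twisted_def)

lemma curve_twisted_outside:
 assumes "straight D t s dl sg" "valid D" "dl/2 <= \<bar>off s u\<bar>"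
 shows "curve (twisted D t s dl sg) u = curve D u"
proof (cases "\<bar>off s u\<bar> <= dl")
 case True
 have d: "0 < dl" using straightD(1)[OF assms(1)] .
 have "1/2 <= \<bar>off s u / dl\<bar>" using assms(3) d by (simp add: abs_divide field_simps)
 then show ?thesis
  using True straight_curve(2)[OF assms(1,2) True]
  by (simp add: curve_twisted hook_outside complex_eq_iff)
qed (simp add: curve_twisted)

lemma cflip_mem_disk: "sg \<in> {1, -1} ==> cflip sg z \<in> disk \<longleftrightarrow> z \<in> disk"
 by (auto simp: mem_disk_iff)

lemma double_pair_sym: "double_pair \<gamma> u v \<longleftrightarrow> double_pair \<gamma> v u"
 unfolding double_pair_def by (metis Ints_minus minus_diff_eq)

text \<open>Twisting adds two double points, the virtual crossings on either side.\<close>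

lemma double_pair_twisted:
 assumes "straight D t s dl sg" "valid D"
 shows "double_pair (curve (twisted D t s dl sg)) u v \<longleftrightarrow> double_pair (curve D) u v \<or>
  (\<exists>x\<in>{1/4, -1/4}. off s u = dl * x \<and> off t v = dl * x \<or> off t u = dl * x \<and> off s v = dl * x)"
proof -
 let ?E = "curve (twisted D t s dl sg)"
 note d = straightD[OF assms(1)]
 note sc = straight_curve[OF assms]
 note disj = straight_disjoint[OF assms]
 have E: "?E u = cflip sg (hook (off s u / dl))" if "\<bar>off s u\<bar> <= dl" for u
  using that by (simp add: curve_twisted)
 have E': "?E u = curve D u" if "\<not> \<bar>off s u\<bar> <= dl" for u
  using that by (simp add: curve_twisted)
 have le1: "\<bar>off a u / dl\<bar> <= 1" if "\<bar>off a u\<bar> <= dl" for a u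
  using that d by (simp add: abs_divide)
 have aux: "?E u = ?E v \<longleftrightarrow> \<bar>off t v\<bar> <= dl \<and> off s u = off t v \<and> off s u / dl \<in> {0, 1/4, -1/4}"
  if S: "\<bar>off s u\<bar> <= dl" "\<not> \<bar>off s v\<bar> <= dl" for u v
 proof
  assume e: "?E u = ?E v"
  have "?E u \<in> disk"
   using E[OF S(1)] hook_in_disk[OF le1[OF S(1)]] d cflip_mem_disk by metis
  then have "curve D v \<in> disk" using e E'[OF S(2)] by simp
  then have T: "\<bar>off t v\<bar> <= dl" using d(5) S(2) by blast
  have e2: "cflip sg (hook (off s u / dl)) = Complex (off t v / dl) 0"
   using e E[OF S(1)] E'[OF S(2)] sc(1)[OF T] by simp
  have h: "hook_x (off s u / dl) = off t v / dl"
   using arg_cong[OF e2, of Re] by simp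
  have h2: "off s u / dl - hook_x (off s u / dl) = 0"
   using arg_cong[OF e2, of Im] d(3) by auto
  then have "off s u / dl = off t v / dl" using h by simp
  then have "off s u = off t v" using d by simp
  moreover have "off s u / dl \<in> {0, 1/4, -1/4}" using h2 hook_real_iff by blast
  ultimately show "\<bar>off t v\<bar> <= dl \<and> off s u = off t v \<and> off s u / dl \<in> {0, 1/4, -1/4}"
   using T by blast
 next
  assume a: "\<bar>off t v\<bar> <= dl \<and> off s u = off t v \<and> off s u / dl \<in> {0, 1/4, -1/4}"
  then have "off s u / dl - hook_x (off s u / dl) = 0" using hook_real_iff by blast
  then have "cflip sg (hook (off s u / dl)) = Complex (off t v / dl) 0"
   using a by (simp add: complex_eq_iff)
  then show "?E u = ?E v" using E[OF S(1)] E'[OF S(2)] sc(1) a by simp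
 qed
 have auxD: "curve D u = curve D v \<longleftrightarrow> \<bar>off t v\<bar> <= dl \<and> off s u = 0 \<and> off t v = 0"
  if S: "\<bar>off s u\<bar> <= dl" "\<not> \<bar>off s v\<bar> <= dl" for u v
 proof
  assume e: "curve D u = curve D v"
  have "curve D u \<in> disk"
   using sc(2)[OF S(1)] le1[OF S(1)] d(3) by (auto simp: mem_disk_iff)
  then have T: "\<bar>off t v\<bar> <= dl" using d(5) S(2) e by metis
  have "Complex (off t v / dl) 0 = Complex 0 (sg * (off s u / dl))"
   using e sc(1)[OF T] sc(2)[OF S(1)] by simp
  then show "\<bar>off t v\<bar> <= dl \<and> off s u = 0 \<and> off t v = 0" using T d by auto
 next
  assume "\<bar>off t v\<bar> <= dl \<and> off s u = 0 \<and> off t v = 0"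
  then show "curve D u = curve D v" using sc(1)[of v] sc(2)[OF S(1)] d(1) by (simp add: complex_eq_iff)
 qed
 have ni: "u - v \<notin> \<int>" if "\<bar>off s u\<bar> <= dl" "\<not> \<bar>off s v\<bar> <= dl" for u v
  using that off_eq_iff[of s u v] by auto
 have mixed: "double_pair ?E u v \<longleftrightarrow> double_pair (curve D) u v \<or>
   (\<exists>x\<in>{1/4, -1/4}. off s u = dl * x \<and> off t v = dl * x \<or> off t u = dl * x \<and> off s v = dl * x)"
  if S: "\<bar>off s u\<bar> <= dl" "\<not> \<bar>off s v\<bar> <= dl" for u v
 proof -
  have q: "\<bar>dl * x\<bar> <= dl" if "x \<in> {1/4, -1/4}" for x :: real
   using that d(1) by auto
  have z: "off s u / dl \<in> {0, 1/4, -1/4} \<longleftrightarrow> off s u = 0 \<or> (\<exists>x\<in>{1/4, -1/4}. off s u = dl * x)"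
   using d(1) by (auto simp: field_simps)
  have "double_pair ?E u v \<longleftrightarrow>
   (\<bar>off t v\<bar> <= dl \<and> off s u = 0 \<and> off t v = 0) \<or> (\<exists>x\<in>{1/4, -1/4}. off s u = dl * x \<and> off t v = dl * x)"
   unfolding double_pair_def aux[OF S] z using ni[OF S] d(1) by auto
  moreover have "\<not> (\<exists>x\<in>{1/4, -1/4}. off t u = dl * x \<and> off s v = dl * x)"
   using d(1) S(2) by auto
  ultimately show ?thesis
   unfolding double_pair_def[of "curve D"] auxD[OF S] using ni[OF S] by blast
 qed
 consider "\<bar>off s u\<bar> <= dl" "\<bar>off s v\<bar> <= dl" | "\<bar>off s u\<bar> <= dl" "\<not> \<bar>off s v\<bar> <= dl"
  | "\<not> \<bar>off s u\<bar> <= dl" "\<bar>off s v\<bar> <= dl" | "\<not> \<bar>off s u\<bar> <= dl" "\<not> \<bar>off s v\<bar> <= dl" by blast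
 then show ?thesis
 proof cases
  case 1
  have "?E u = ?E v \<longleftrightarrow> off s u = off s v"
   using E[OF 1(1)] E[OF 1(2)] d cflip_eq_iff[OF d(3)] hook_inj by auto
  moreover have "curve D u = curve D v \<longleftrightarrow> off s u = off s v"
   using sc(2)[OF 1(1)] sc(2)[OF 1(2)] d by auto
  moreover have "off t v ~= dl * x" "off t u ~= dl * x" if "x \<in> {1/4, -1/4}" for x
   using disj[of u] disj[of v] 1 that d(1) by auto
  ultimately show ?thesis unfolding double_pair_def by blast
 next
  case 2
  then show ?thesis by (rule mixed)
 next
  case 3
  then show ?thesis
   using mixed[of v u] double_pair_sym[of ?E] double_pair_sym[of "curve D"] by blast
 next
  case 4
  have "off s u ~= dl * x" "off s v ~= dl * x" if "x \<in> {1/4, -1/4}" for x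
   using 4 that d(1) by auto
  then show ?thesis using E'[OF 4(1)] E'[OF 4(2)] unfolding double_pair_def by auto
 qed
qed

lemma double_pair_in_arcs:
 assumes "straight D t s dl sg" "valid D" "double_pair (curve D) u v"
 shows "\<bar>off s u\<bar> <= dl ==> off s u = 0 \<and> off t v = 0" "\<bar>off t u\<bar> <= dl ==> off t u = 0 \<and> off s v = 0"
proof -
 note d = straightD[OF assms(1)]
 note sc = straight_curve[OF assms(1,2)]
 have e: "u - v \<notin> \<int>" "curve D u = curve D v" using assms(3) double_pair_def by auto
 have le1: "\<bar>off a u / dl\<bar> <= 1" if "\<bar>off a u\<bar> <= dl" for a
  using that d by (simp add: abs_divide)
 { assume S: "\<bar>off s u\<bar> <= dl"
  then have "curve D u \<in> disk" using sc(2)[OF S] le1[OF S] d(3) by (auto simp: mem_disk_iff)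
  moreover have "\<not> \<bar>off s v\<bar> <= dl"
   using e sc(2)[of v] sc(2)[OF S] d off_eq_iff[of s u v] by auto
  ultimately have T: "\<bar>off t v\<bar> <= dl" using d(5) e by metis
  have "Complex (off t v / dl) 0 = Complex 0 (sg * (off s u / dl))"
   using e sc(1)[OF T] sc(2)[OF S] by simp
  then show "off s u = 0 \<and> off t v = 0" using d by auto }
 { assume S: "\<bar>off t u\<bar> <= dl"
  then have "curve D u \<in> disk" using sc(1)[OF S] le1[OF S] d(3) by (auto simp: mem_disk_iff)
  moreover have "\<not> \<bar>off t v\<bar> <= dl"
   using e sc(1)[of v] sc(1)[OF S] d off_eq_iff[of t u v] by auto
  ultimately have T: "\<bar>off s v\<bar> <= dl" using d(5) e by metis
  have "Complex (off t u / dl) 0 = Complex 0 (sg * (off s v / dl))"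
   using e sc(1)[OF S] sc(2)[OF T] by simp
  then show "off t u = 0 \<and> off s v = 0" using d by auto }
qed

lemma hook_dx_special: "hook_dx 0 = 16/9" "hook_dx (1/4) = -1/3" "hook_dx (-1/4) = -1/3" "hook_dx (-(1/4)) = -1/3"
 by (auto simp: hook_dx_def power2_eq_square max_def)

text \<open>
 Transversality at the three crossings: there the derivative of \<open>hook\<close> is not parallel to the axis.
\<close>

lemma valid_twisted:
 assumes st: "straight D t s dl sg" and v: "valid D"
 shows "valid (twisted D t s dl sg)"
proof -
 let ?E = "twisted D t s dl sg"
 note d = straightD[OF st] and sc = straight_curve[OF st v]
 note disj = straight_disjoint[OF st v] and dpE = double_pair_twisted[OF st v]
 note dpD = double_pair_in_arcs[OF st v]
 note vD = validD[OF v]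
 obtain V where V: "\<And>t. (curve D has_vector_derivative V t) (at t)" "continuous_on UNIV V"
  "\<And>t. V t ~= 0" "\<And>s t. double_pair (curve D) s t ==> cross (V s) (V t) ~= 0"
  using valid_velocity[OF v] by metis
 define hd where "hd x = Complex (hook_dx x) (1 - hook_dx x)" for x
 define W where "W u = (if \<bar>off s u\<bar> < dl then (1/dl) *\<^sub>R cflip sg (hd (off s u / dl)) else V u)" for u
 have d2: "dl <= 1/2" using d by simp
 have cflip_deriv: "((\<lambda>x. cflip sg (hook ((x - a) / dl))) has_vector_derivative (1/dl) *\<^sub>R cflip sg (hd ((x - a) / dl))) (at x)" for a x
 proof -
  have "((\<lambda>x. (x - a) / dl) has_vector_derivative (1/dl)) (at x)"
   using d(1) by (auto intro!: derivative_eq_intros simp flip: has_real_derivative_iff_has_vector_derivative)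
  then have "((\<lambda>x. hook ((x - a) / dl)) has_vector_derivative (1/dl) *\<^sub>R hd ((x - a) / dl)) (at x)"
   using vector_diff_chain_at[of "\<lambda>x. (x - a) / dl" "1/dl" x hook] hook_derivative
   unfolding hd_def comp_def by blast
  moreover have bl: "bounded_linear (cflip sg)"
   by (auto simp: linear_conv_bounded_linear[symmetric] linear_iff complex_eq_iff algebra_simps)
  ultimately have "((\<lambda>x. cflip sg (hook ((x - a) / dl))) has_vector_derivative
    cflip sg ((1/dl) *\<^sub>R hd ((x - a) / dl))) (at x)"
   using bounded_linear.has_vector_derivative[OF bl] by blast
  moreover have "cflip sg ((1/dl) *\<^sub>R w) = (1/dl) *\<^sub>R cflip sg w" for w
   by (simp add: complex_eq_iff)
  ultimately show ?thesis by simp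
 qed
 have W_in: "((\<lambda>u. curve ?E u) has_vector_derivative (1/dl) *\<^sub>R cflip sg (hd (off s u / dl))) (at u)"
  and W_in2: "\<exists>T n. open T \<and> u \<in> T \<and> (\<forall>w\<in>T. W w = (1/dl) *\<^sub>R cflip sg (hd ((w - s - of_int n) / dl)))"
  if u: "\<bar>off s u\<bar> < dl" for u
 proof -
  obtain n where n0: "u \<in> {s + of_int n - dl <..< s + of_int n + dl}"
   "\<forall>w\<in>{s + of_int n - dl <..< s + of_int n + dl}. off s w = w - s - of_int n"
   by (rule off_locally[OF u d2])
  note n = n0(1) n0(2)[rule_format]
  have eq: "off s u = u - (s + of_int n)" using n(2)[OF n(1)] by simp
  show "((\<lambda>u. curve ?E u) has_vector_derivative (1/dl) *\<^sub>R cflip sg (hd (off s u / dl))) (at u)"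
  proof (rule has_vector_derivative_transform_within_open[OF _ _ n(1)])
   show "((\<lambda>x. cflip sg (hook ((x - (s + of_int n)) / dl))) has_vector_derivative
     (1/dl) *\<^sub>R cflip sg (hd (off s u / dl))) (at u)"
    unfolding eq by (rule cflip_deriv)
  next
   fix w assume w: "w \<in> {s + of_int n - dl <..< s + of_int n + dl}"
   then have "\<bar>off s w\<bar> <= dl" "off s w = w - (s + of_int n)" using n(2)[OF w] by auto
   then show "cflip sg (hook ((w - (s + of_int n)) / dl)) = curve ?E w" by (simp add: curve_twisted)
  qed simp
  have "W w = (1/dl) *\<^sub>R cflip sg (hd ((w - s - of_int n) / dl))"
   if w: "w \<in> {s + of_int n - dl <..< s + of_int n + dl}" for w
   using n(2)[OF w] w by (auto simp: W_def)
  then show "\<exists>T n. open T \<and> u \<in> T \<and> (\<forall>w\<in>T. W w = (1/dl) *\<^sub>R cflip sg (hd ((w - s - of_int n) / dl)))"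
   using n(1) open_greaterThanLessThan by blast
 qed
 have W_out: "(curve ?E has_vector_derivative V u) (at u)" if u: "dl/2 < \<bar>off s u\<bar>" for u
  by (rule has_vector_derivative_transform_within_open[OF V(1) open_off_greater[of "dl/2" s]])
   (use u in \<open>auto simp: curve_twisted_outside[OF st v]\<close>)
 have W_V: "W u = V u" if u: "dl/2 < \<bar>off s u\<bar>" for u
 proof (cases "\<bar>off s u\<bar> < dl")
  case True
  have "(1/dl) *\<^sub>R cflip sg (hd (off s u / dl)) = V u"
   using W_in[OF True] W_out[OF u] by (rule vector_derivative_unique_at)
  then show ?thesis using True by (simp add: W_def)
 qed (simp add: W_def)
 have Wd: "(curve ?E has_vector_derivative W u) (at u)" for u
 proof (cases "\<bar>off s u\<bar> < dl")
  case True
  then show ?thesis using W_in by (simp add: W_def)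
 next
  case False
  then have "dl/2 < \<bar>off s u\<bar>" using d by linarith
  then show ?thesis using W_out W_V by simp
 qed
 have hdc: "continuous_on UNIV hd"
  unfolding hd_def Complex_eq by (intro continuous_intros continuous_hook_dx)
 have hdI: "isCont hd x" for x using hdc by (simp add: continuous_on_eq_continuous_at)
 have Wc: "isCont W u" for u
 proof (cases "\<bar>off s u\<bar> < dl")
  case True
  obtain T n where T: "open T" "u \<in> T" "\<forall>w\<in>T. W w = (1/dl) *\<^sub>R cflip sg (hd ((w - s - of_int n) / dl))"
   using W_in2[OF True] by blast
  have c1: "continuous_on UNIV (\<lambda>w. hd ((w - s - of_int n) / dl))"
   by (rule continuous_on_compose2[OF hdc]) (use d(1) in \<open>auto intro!: continuous_intros\<close>)
  have "continuous_on UNIV (\<lambda>w. (1/dl) *\<^sub>R cflip sg (hd ((w - s - of_int n) / dl)))"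
   unfolding cflip_def Complex_eq by (intro continuous_intros c1)
  then have "isCont (\<lambda>w. (1/dl) *\<^sub>R cflip sg (hd ((w - s - of_int n) / dl))) u"
   by (simp add: continuous_on_eq_continuous_at)
  moreover have "\<forall>\<^sub>F w in nhds u. (1/dl) *\<^sub>R cflip sg (hd ((w - s - of_int n) / dl)) = W w"
   unfolding eventually_nhds using T by metis
  ultimately show ?thesis by (subst (asm) isCont_cong) auto
 next
  case False
  then have u: "u \<in> {u. dl/2 < \<bar>off s u\<bar>}" using d by auto
  have "isCont V u" using V(2) by (simp add: continuous_on_eq_continuous_at)
  moreover have "\<forall>\<^sub>F w in nhds u. V w = W w"
   unfolding eventually_nhds using W_V open_off_greater u by (metis mem_Collect_eq)
  ultimately show ?thesis by (subst (asm) isCont_cong) auto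
 qed
 have W0: "W u ~= 0" for u
 proof (cases "\<bar>off s u\<bar> < dl")
  case True
  have "hd x ~= 0" for x by (simp add: hd_def complex_eq_iff)
  then have "cflip sg (hd (off s u / dl)) ~= 0"
   using d by (auto simp: complex_eq_iff)
  then show ?thesis using True d by (simp add: W_def)
 qed (use V(3) in \<open>simp add: W_def\<close>)
 have V_T: "V u = Complex (1/dl) 0" if u: "\<bar>off t u\<bar> < dl" for u
 proof -
  obtain n where n0: "u \<in> {t + of_int n - dl <..< t + of_int n + dl}"
   "\<forall>w\<in>{t + of_int n - dl <..< t + of_int n + dl}. off t w = w - t - of_int n"
   by (rule off_locally[OF u d2])
  note n = n0(1) n0(2)[rule_format]
  have "((\<lambda>w. of_real ((w - t - of_int n) / dl)) has_vector_derivative of_real (1/dl)) (at u)"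
   by (rule has_vector_derivative_of_real)
    (use d(1) in \<open>auto intro!: derivative_eq_intros simp flip: has_real_derivative_iff_has_vector_derivative\<close>)
  then have "(curve D has_vector_derivative of_real (1/dl)) (at u)"
  proof (rule has_vector_derivative_transform_within_open[OF _ _ n(1)])
   fix w assume w: "w \<in> {t + of_int n - dl <..< t + of_int n + dl}"
   then have "\<bar>off t w\<bar> <= dl" using n(2)[OF w] by auto
   then show "complex_of_real ((w - t - of_int n) / dl) = curve D w"
    using sc(1) n(2)[OF w] by (simp add: complex_eq_iff)
  qed simp
  then have "V u = of_real (1/dl)" using V(1) vector_derivative_unique_at by blast
  then show ?thesis by (simp add: complex_eq_iff)
 qed
 have cr: "cross (W a) (W b) ~= 0"
  if "off s a = dl * x" "off t b = dl * x" "x \<in> {0, 1/4, -1/4}" for a b x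
 proof -
  have xd: "\<bar>dl * x\<bar> < dl" using that d by auto
  then have "\<not> \<bar>off s b\<bar> <= dl" using disj[of b] that by auto
  then have "W b = Complex (1/dl) 0"
   using V_T[of b] that xd by (simp add: W_def)
  moreover have "W a = (1/dl) *\<^sub>R cflip sg (hd x)" using that xd d by (simp add: W_def)
  moreover have "Im (hd x) ~= 0"
  proof -
   from that(3) have "x = 0 \<or> x = 1/4 \<or> x = -1/4" by simp
   then consider "x = 0" | "x = 1/4" | "x = -1/4" by blast
   then show ?thesis
    by cases (simp_all only: hd_def hook_dx_special complex.sel, simp_all?)
  qed
  ultimately show ?thesis using d by (auto simp: cross_def)
 qed
 have cross_sym: "cross b a ~= 0" if "cross a b ~= 0" for a b
  using that by (simp add: cross_def algebra_simps)
 have newdef: "\<bar>off s u\<bar> = dl/4 \<or> \<bar>off t u\<bar> = dl/4"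
  if "x \<in> {1/4, -1/4}" "off s u = dl * x \<or> off t u = dl * x" for u x
  using that d by auto
 have newI: "\<exists>x\<in>{1/4, -1/4}. off a u = dl * x" if "\<bar>off a u\<bar> = dl/4" for a u
  using that by (auto simp: abs_if split: if_splits)
 have old_label: "\<not> (\<bar>off s u\<bar> = dl/4 \<or> \<bar>off t u\<bar> = dl/4)" if "double_pair (curve D) u w" for u w
  using dpD[OF that] d by auto
 have gen: "generic_immersion (curve ?E)"
 proof (rule generic_immersionI[of _ W])
  show "curve ?E (u + 1) = curve ?E u" for u
   using off_add_int[of s u 1] vD(1) by (simp add: curve_twisted)
  show "continuous_on UNIV W" using Wc by (simp add: continuous_on_eq_continuous_at)
  show "(curve ?E has_vector_derivative W u) (at u)" for u by (rule Wd)
  show "W u ~= 0" for u by (rule W0)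
  have "{u \<in> {0..<1}. \<exists>w. double_pair (curve ?E) w u} \<subseteq>
   {u \<in> {0..<1}. \<exists>w. double_pair (curve D) w u} \<union>
   ({u \<in> {0..<1}. off s u = dl * (1/4)} \<union> {u \<in> {0..<1}. off s u = dl * (-1/4)} \<union>
    {u \<in> {0..<1}. off t u = dl * (1/4)} \<union> {u \<in> {0..<1}. off t u = dl * (-1/4)})"
   unfolding dpE by blast
  then show "finite {u \<in> {0..<1}. \<exists>w. double_pair (curve ?E) w u}"
   by (rule finite_subset) (intro finite_UnI finite_off vD(7))
  show "cross (W a) (W b) ~= 0" if ab: "double_pair (curve ?E) a b" for a b
  proof -
   consider "double_pair (curve D) a b" "\<bar>off s a\<bar> <= dl" | "double_pair (curve D) a b" "\<bar>off s b\<bar> <= dl"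
    | "double_pair (curve D) a b" "\<not> \<bar>off s a\<bar> <= dl" "\<not> \<bar>off s b\<bar> <= dl"
    | x where "x \<in> {1/4, -1/4}" "off s a = dl * x" "off t b = dl * x"
    | x where "x \<in> {1/4, -1/4}" "off s b = dl * x" "off t a = dl * x"
    using ab unfolding dpE by blast
   then show ?thesis
   proof cases
    case 1
    then show ?thesis using dpD(1)[OF 1] cr[of a 0 b] by simp
   next
    case 2
    then show ?thesis
     using dpD(1)[of b a] double_pair_sym cr[of b 0 a] cross_sym by simp
   next
    case 3
    then show ?thesis using V(4) by (simp add: W_def)
   next
    case 4
    then show ?thesis using cr[of a x b] by simp
   next
    case 5
    then show ?thesis using cr[of b x a] cross_sym by simp
   qed
  qed
  show "\<not> (double_pair (curve ?E) a b \<and> double_pair (curve ?E) b c \<and> double_pair (curve ?E) a c)" for a b c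
  proof
   assume h: "double_pair (curve ?E) a b \<and> double_pair (curve ?E) b c \<and> double_pair (curve ?E) a c"
   let ?N = "\<lambda>u. \<bar>off s u\<bar> = dl/4 \<or> \<bar>off t u\<bar> = dl/4"
   have key: "off s u = off t w \<and> \<bar>off s u\<bar> = dl/4 \<or> off t u = off s w \<and> \<bar>off t u\<bar> = dl/4"
    if "double_pair (curve ?E) u w" "?N u" for u w
   proof -
    have "\<not> double_pair (curve D) u w" using that(2) old_label by blast
    with that(1) have "\<exists>x\<in>{1/4, -1/4}. off s u = dl * x \<and> off t w = dl * x \<or> off t u = dl * x \<and> off s w = dl * x"
     unfolding dpE by blast
    then obtain x where x: "x \<in> {1/4, -1/4}"
     "off s u = dl * x \<and> off t w = dl * x \<or> off t u = dl * x \<and> off s w = dl * x" by blast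
    have "\<bar>dl * x\<bar> = dl/4" using x(1) d(1) by auto
    then show ?thesis using x(2) by metis
   qed
   have N_sym: "?N w" if "double_pair (curve ?E) u w" "?N u" for u w
    using key[OF that] by metis
   have dis: "\<not> (\<bar>off s u\<bar> = dl/4 \<and> \<bar>off t u\<bar> = dl/4)" for u
    using disj[of u] d(1) by linarith
   have nint: "b - c \<notin> \<int>" using h by (simp add: double_pair_def)
   show False
   proof (cases "?N a")
    case True
    have "off s b = off s c \<or> off t b = off t c"
     using key[of a b] key[of a c] h True dis[of a] by metis
    then show False using nint off_eq_iff by blast
   next
    case False
    then have "\<not> ?N b" "\<not> ?N c"
     using N_sym[of b a] N_sym[of c a] h double_pair_sym[of "curve ?E"] by blast+
    with False have "double_pair (curve D) a b" "double_pair (curve D) b c" "double_pair (curve D) a c"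
     using h newdef unfolding dpE by blast+
    then show False using vD(3) by blast
   qed
  qed
 qed
 have quarter: "\<bar>dl * x\<bar> < 1/2" if "x \<in> {1/4, -1/4}" for x
 proof -
  from that have "x = 1/4 \<or> x = -1/4" by simp
  then show ?thesis by (elim disjE; hypsubst) (use d(1,2) in simp_all)
 qed
 have lab: "label ?E (u + 1) = label ?E u" for u
  using off_add_int[of s u 1] off_add_int[of t u 1] vD(2) by (simp add: label_twisted)
 have "(label ?E u, label ?E w) \<in> real_crossing \<union> virtual_crossing" if "double_pair (curve ?E) u w" for u w
 proof (cases "double_pair (curve D) u w")
  case True
  then have "\<not> (\<bar>off s u\<bar> = dl/4 \<or> \<bar>off t u\<bar> = dl/4)" "\<not> (\<bar>off s w\<bar> = dl/4 \<or> \<bar>off t w\<bar> = dl/4)"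
   using old_label[of u w] old_label[of w u] double_pair_sym by blast+
  then show ?thesis using vD(4)[OF True] by (simp add: label_twisted)
 next
  case False
  with that have "\<exists>x\<in>{1/4, -1/4}. off s u = dl * x \<and> off t w = dl * x \<or> off t u = dl * x \<and> off s w = dl * x"
   unfolding dpE by blast
  then obtain x where x: "x \<in> {1/4, -1/4}"
   "off s u = dl * x \<and> off t w = dl * x \<or> off t u = dl * x \<and> off s w = dl * x" by blast
  have "\<bar>off s u\<bar> = dl/4 \<or> \<bar>off t u\<bar> = dl/4" "\<bar>off s w\<bar> = dl/4 \<or> \<bar>off t w\<bar> = dl/4"
   using newdef[OF x(1)] x(2) by metis+
  then show ?thesis unfolding label_twisted virtual_crossing_def by simp
 qed
 moreover have "\<exists>w. double_pair (curve ?E) w u" if "label ?E u \<in> {Over, Under, Virtual}" for u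
 proof (cases "\<bar>off s u\<bar> = dl/4 \<or> \<bar>off t u\<bar> = dl/4")
  case True
  then have "(\<exists>x\<in>{1/4, -1/4}. off s u = dl * x) \<or> (\<exists>x\<in>{1/4, -1/4}. off t u = dl * x)"
   by (elim disjE) (rule disjI1, erule newI, rule disjI2, erule newI)
  then consider x where "x \<in> {1/4, -1/4}" "off s u = dl * x" | x where "x \<in> {1/4, -1/4}" "off t u = dl * x"
   by blast
  then show ?thesis
  proof cases
   case 1
   then have "\<bar>dl * x\<bar> < 1/2" using quarter by blast
   then have "off t (t + dl * x) = dl * x" by simp
   then have "double_pair (curve ?E) (t + dl * x) u" unfolding dpE using 1 by blast
   then show ?thesis by blast
  next
   case 2
   then have "\<bar>dl * x\<bar> < 1/2" using quarter by blast
   then have "off s (s + dl * x) = dl * x" by simp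
   then have "double_pair (curve ?E) (s + dl * x) u" unfolding dpE using 2 by blast
   then show ?thesis by blast
  qed
 next
  case False
  then have "label D u \<in> {Over, Under, Virtual}" using that by (simp add: label_twisted)
  then show ?thesis using vD(5) dpE by blast
 qed
 moreover have "finite {u \<in> {0..<1}. label ?E u = Wen}"
  by (rule finite_subset[OF _ vD(6)]) (auto simp: label_twisted split: if_splits)
 ultimately show ?thesis
  unfolding virtual_knot_diagram_def using gen lab by blast
qed

section \<open>Germs of homeomorphisms that preserve the axes\<close>

definition norm1 :: "complex => real" where
 "norm1 z = \<bar>Re z\<bar> + \<bar>Im z\<bar>"

lemma norm1_bounds: "norm z <= norm1 z" "norm1 z <= 2 * norm z"
 using cmod_le[of z] abs_Re_le_cmod[of z] abs_Im_le_cmod[of z] by (auto simp: norm1_def)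

lemma continuous_on_norm1 [continuous_intros]:
 "continuous_on S f ==> continuous_on S (\<lambda>x. norm1 (f x))"
 unfolding norm1_def by (intro continuous_intros)

lemma norm1_diff: "\<bar>norm1 z - norm1 w\<bar> <= 3/2 * dist z w"
proof -
 have "(\<bar>Re (z - w)\<bar> + \<bar>Im (z - w)\<bar>)\<^sup>2 <= 2 * (norm (z - w))\<^sup>2"
  unfolding cmod_power2 using sum_squares_bound[of "\<bar>Re (z - w)\<bar>" "\<bar>Im (z - w)\<bar>"]
  by (simp add: power2_sum)
 also have "\<dots> <= (3/2 * norm (z - w))\<^sup>2" by (simp add: power_mult_distrib power2_eq_square)
 finally have "\<bar>Re (z - w)\<bar> + \<bar>Im (z - w)\<bar> <= 3/2 * norm (z - w)"
  by (rule power2_le_imp_le) simp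
 moreover have "\<bar>norm1 z - norm1 w\<bar> <= \<bar>Re (z - w)\<bar> + \<bar>Im (z - w)\<bar>"
  unfolding norm1_def minus_complex.sel by linarith
 ultimately show ?thesis by (simp add: dist_norm)
qed

text \<open>Translation by a multiple of \<open>w\<close>, fading out at distance \<open>\<zeta>\<close> from the origin.\<close>

definition push :: "real => complex => complex => complex" where
 "push \<zeta> w z = z + max 0 (\<zeta> - norm1 z) *\<^sub>R w"

lemma isotopic_to_id_push:
 assumes "norm w <= 1/3"
 shows "isotopic_to_id (push \<zeta> w)"
proof -
 have "dist (max 0 (\<zeta> - norm1 x) *\<^sub>R w) (max 0 (\<zeta> - norm1 y) *\<^sub>R w) <= dist x y / 2" for x y
 proof -
  have "dist (max 0 (\<zeta> - norm1 x) *\<^sub>R w) (max 0 (\<zeta> - norm1 y) *\<^sub>R w)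
    = \<bar>max 0 (\<zeta> - norm1 x) - max 0 (\<zeta> - norm1 y)\<bar> * norm w"
   by (simp add: dist_norm flip: scaleR_diff_left)
  also have "\<dots> <= (3/2 * dist x y) * (1/3)"
  proof (intro mult_mono assms)
   have "\<bar>max 0 (\<zeta> - norm1 x) - max 0 (\<zeta> - norm1 y)\<bar> <= \<bar>norm1 x - norm1 y\<bar>"
    by (simp add: max_def abs_if)
   then show "\<bar>max 0 (\<zeta> - norm1 x) - max 0 (\<zeta> - norm1 y)\<bar> <= 3/2 * dist x y"
    using norm1_diff[of x y] by linarith
  qed auto
  finally show ?thesis by simp
 qed
 then show ?thesis
  unfolding push_def[abs_def] by (rule isotopic_to_id_perturbation)
qed

lemma push_outside: "\<zeta> <= norm1 z ==> push \<zeta> w z = z"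
 by (simp add: push_def)

text \<open>
 Let \<open>k\<close> fix the boundary of the first quadrant and preserve the quadrant, near the origin. Extended
 by the identity it is a local homeomorphism \<open>K\<close>. The commutator of \<open>K\<close> with a push \<open>\<psi>\<close> into the
 quadrant has small support, and it agrees with \<open>K\<close> where \<open>\<psi>\<close> comes from outside the quadrant, in
 particular near the origin.
\<close>

lemma quadrant_germ:
 fixes k k' :: "complex => complex"
 assumes k: "continuous_on UNIV k" "continuous_on UNIV k'" "\<And>z. k' (k z) = z" "\<And>z. k (k' z) = z"
  and \<rho>: "0 < \<rho>"
  and axes: "\<And>x. \<bar>x\<bar> < \<rho> ==> k (Complex x 0) = Complex x 0 \<and> k (Complex 0 x) = Complex 0 x"
  and quad: "\<And>z. norm z < \<rho> ==> 0 <= Re z ==> 0 <= Im z ==> 0 <= Re (k z) \<and> 0 <= Im (k z)"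
   "\<And>z. norm z < \<rho> ==> 0 <= Re z ==> 0 <= Im z ==> 0 <= Re (k' z) \<and> 0 <= Im (k' z)"
 shows "\<exists>C. continuous_on UNIV C \<and> inj C \<and> (\<forall>z. 1 <= norm1 z --> C z = z) \<and>
  (\<forall>z. \<not> (0 < Re z \<and> 0 < Im z) --> C z = z) \<and>
  (\<forall>\<^sub>F z in nhds 0. 0 <= Re z \<and> 0 <= Im z --> C z = k z)"
proof -
 define K where "K z = (if 0 <= Re z \<and> 0 <= Im z then k z else z)" for z
 define K' where "K' z = (if 0 <= Re z \<and> 0 <= Im z then k' z else z)" for z
 have axes': "k' (Complex x 0) = Complex x 0 \<and> k' (Complex 0 x) = Complex 0 x" if "\<bar>x\<bar> < \<rho>" for x
  using axes[OF that] k(3) by metis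
 have bd: "k z = z \<and> k' z = z" if "norm z < \<rho>" "Re z = 0 \<or> Im z = 0" for z
 proof -
  have "z = Complex (Re z) 0 \<and> \<bar>Re z\<bar> < \<rho> \<or> z = Complex 0 (Im z) \<and> \<bar>Im z\<bar> < \<rho>"
   using that abs_Re_le_cmod[of z] abs_Im_le_cmod[of z] by (auto simp: complex_eq_iff)
  then show ?thesis using axes axes' by metis
 qed
 have Kfix: "K z = z" "K' z = z" if "norm z < \<rho>" "\<not> (0 < Re z \<and> 0 < Im z)" for z
  using that bd[of z] by (auto simp: K_def K'_def)
 have K'K: "K' (K z) = z" "K (K' z) = z" if "norm z < \<rho>" for z
  using that quad k by (auto simp: K_def K'_def)
 have cont: "isCont (\<lambda>z. if 0 <= Re z \<and> 0 <= Im z then h z else z) z"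
  if h: "continuous_on UNIV h" "\<And>z. norm z < \<rho> ==> Re z = 0 \<or> Im z = 0 ==> h z = z" and z: "norm z < \<rho>" for h z
 proof -
  let ?S = "ball 0 \<rho> \<inter> {z. 0 <= Re z \<and> 0 <= Im z}" and ?T = "ball 0 \<rho> \<inter> {z. Re z <= 0 \<or> Im z <= 0}"
  have un: "?S \<union> ?T = ball 0 \<rho>" by auto
  have c: "closed {z. 0 <= Re z \<and> 0 <= Im z}" "closed {z. Re z <= 0 \<or> Im z <= 0}"
   by (intro closed_Collect_conj closed_Collect_disj closed_Collect_le continuous_intros)+
  have "continuous_on (?S \<union> ?T) (\<lambda>z. if 0 <= Re z \<and> 0 <= Im z then h z else z)"
  proof (rule continuous_on_cases_local)
   show "closedin (top_of_set (?S \<union> ?T)) ?S" "closedin (top_of_set (?S \<union> ?T)) ?T"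
    unfolding un using c by (auto simp: closedin_closed_Int)
   show "continuous_on ?S h" using h(1) continuous_on_subset by blast
   show "h x = x" if "x \<in> ?S \<and> \<not> (0 <= Re x \<and> 0 <= Im x) \<or> x \<in> ?T \<and> 0 <= Re x \<and> 0 <= Im x" for x
    using that h(2)[of x] by auto
  qed (auto intro: continuous_intros)
  then show ?thesis
   unfolding un using z by (simp add: continuous_on_eq_continuous_at)
 qed
 have Kc: "isCont K z" "isCont K' z" if "norm z < \<rho>" for z
  unfolding K_def[abs_def] K'_def[abs_def] using cont[OF _ _ that] k(1,2) bd by auto
 have small: "\<exists>d>0. d <= \<rho> \<and> (\<forall>z. norm z < d --> norm (K z) < e \<and> norm (K' z) < e)" if e: "0 < e" for e
 proof -
  have K0: "K 0 = 0" "K' 0 = 0" using Kfix[of 0] \<rho> by auto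
  obtain d1 where "d1 > 0" "\<forall>z. dist z 0 < d1 --> dist (K z) (K 0) < e"
   using Kc(1)[of 0] \<rho> e unfolding continuous_at_eps_delta by (metis norm_zero)
  moreover obtain d2 where "d2 > 0" "\<forall>z. dist z 0 < d2 --> dist (K' z) (K' 0) < e"
   using Kc(2)[of 0] \<rho> e unfolding continuous_at_eps_delta by (metis norm_zero)
  ultimately show ?thesis using K0 \<rho> by (intro exI[of _ "min \<rho> (min d1 d2)"]) auto
 qed
 obtain e1 where e1: "e1 > 0" "e1 <= \<rho>" "\<And>z. norm z < e1 ==> norm (K' z) < \<rho>/2"
  using small[of "\<rho>/2"] \<rho> by auto
 \<comment> \<open>\<open>K\<close> and \<open>K'\<close> are only to be applied within distance \<open>\<rho>\<close> of the origin, and the image under \<open>K\<close> of the support of the push is to stay within \<open>R3\<close>.\<close>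
 define R1 where "R1 = e1/2"
 have R1: "R1 > 0" using e1 by (simp add: R1_def)
 obtain e3 where e3: "e3 > 0" "\<And>z. norm z < e3 ==> norm (K z) < R1"
  using small[of R1] R1 by auto
 obtain e4 where e4: "e4 > 0" "\<And>z. norm z < e4 ==> norm (K' z) < e3/2"
  using small[of "e3/2"] e3 by auto
 define R3 where "R3 = min (1/2) (min (R1/2) (e4/2))"
 have R3: "R3 > 0" "R3 <= 1/2" "R3 < R1" "R3 <= e4/2" using R1 e4 by (auto simp: R3_def)
 obtain e5 where e5: "e5 > 0" "e5 <= \<rho>" "\<And>z. norm z < e5 ==> norm (K z) < R3"
  using small[of R3] R3 by auto
 define \<zeta> where "\<zeta> = min e5 (min R3 (min (e1/2) (min (\<rho>/2) (min (e4/2) (e3/2)))))"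
 have \<zeta>: "\<zeta> > 0" "\<zeta> <= e5" "\<zeta> <= R3" "\<zeta> <= e1/2" "\<zeta> <= \<rho>/2" "\<zeta> <= e4/2" "\<zeta> <= e3/2"
  using e1 e3 e4 e5 R3 \<rho> by (auto simp: \<zeta>_def)
 \<comment> \<open>A direction into the open quadrant, short enough for the push to be injective.\<close>
 define w where "w = Complex (1/6) (1/6)"
 have w: "norm w <= 1/3" "Re w > 0" "Im w > 0"
  using norm1_bounds(1)[of w] by (auto simp: w_def norm1_def)
 define \<psi> where "\<psi> = push \<zeta> w"
 define \<psi>' where "\<psi>' = inv \<psi>"
 have \<psi>i: "isotopic_to_id \<psi>" "isotopic_to_id \<psi>'"
  using isotopic_to_id_push[OF w(1)] isotopic_to_id_inv by (auto simp: \<psi>_def \<psi>'_def)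
 have \<psi>c: "isCont \<psi> z" "isCont \<psi>' z" for z
  using isotopic_to_idD(1)[OF \<psi>i(1)] isotopic_to_idD(1)[OF \<psi>i(2)] by (auto simp: continuous_on_eq_continuous_at)
 have \<psi>\<psi>': "\<psi> (\<psi>' z) = z" "\<psi>' (\<psi> z) = z" for z
  using isotopic_to_idD(2)[OF \<psi>i(1)] by (auto simp: \<psi>'_def bij_def surj_f_inv_f)
 have near: "norm (\<psi> z - z) <= \<zeta>" for z
 proof -
  have "norm (\<psi> z - z) = max 0 (\<zeta> - norm1 z) * norm w" by (simp add: \<psi>_def push_def)
  also have "\<dots> <= \<zeta> * 1"
   using w \<zeta> by (intro mult_mono) (auto simp: norm1_def)
  finally show ?thesis by simp
 qed
 have near1: "norm (\<psi> z) <= norm z + \<zeta>" for z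
  using near[of z] norm_triangle_ineq2[of "\<psi> z" z] by linarith
 have near2: "norm (\<psi>' z) <= norm z + \<zeta>" for z
  using near[of "\<psi>' z"] norm_triangle_ineq2[of "\<psi>' z" z] \<psi>\<psi>' by (simp add: norm_minus_commute)
 have \<psi>out: "\<psi> z = z" "\<psi>' z = z" if "\<zeta> <= norm1 z" for z
  using push_outside[OF that] \<psi>\<psi>'(2)[of z] by (auto simp: \<psi>_def)
 have \<psi>'shift: "\<exists>y\<ge>0. \<psi>' z = z - y *\<^sub>R w" for z
 proof -
  have "z = \<psi>' z + max 0 (\<zeta> - norm1 (\<psi>' z)) *\<^sub>R w"
   using \<psi>\<psi>'(1)[of z] by (simp add: \<psi>_def push_def)
  then show ?thesis by (metis add_diff_cancel max.cobounded1)
 qed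
 \<comment> \<open>Near the origin \<open>\<psi>'\<close> leads out of the quadrant, where \<open>K'\<close> is the identity; so only \<open>K\<close> remains.\<close>
 define C where "C z = (if norm z < R1 then K (\<psi> (K' (\<psi>' z))) else z)" for z
 have Cin: "C z = K (\<psi> (K' (\<psi>' z)))" if "norm z < R1" for z using that by (simp add: C_def)
 have b: "norm (\<psi>' z) < e1 \<and> norm (\<psi>' z) < \<rho> \<and> norm (K' (\<psi>' z)) < \<rho> \<and> norm (\<psi> (K' (\<psi>' z))) < \<rho>"
  if "norm z < R1" for z
 proof -
  have 1: "norm (\<psi>' z) < e1" using near2[of z] that \<zeta> by (simp add: R1_def)
  then have 2: "norm (K' (\<psi>' z)) < \<rho>/2" by (rule e1)
  then have "norm (\<psi> (K' (\<psi>' z))) < \<rho>" using near1[of "K' (\<psi>' z)"] \<zeta> by linarith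
  then show ?thesis using 1 2 e1 \<rho> by linarith
 qed
 have Cfar: "C z = z" if "R3 <= norm z" for z
 proof (cases "norm z < R1")
  case True
  then have z: "norm z < \<rho>" using e1 by (auto simp: R1_def)
  have "\<zeta> <= norm1 z" using \<zeta> that norm1_bounds(1)[of z] by linarith
  then have 1: "\<psi>' z = z" by (rule \<psi>out)
  have "\<zeta> <= norm1 (K' z)"
  proof (rule ccontr)
   assume "\<not> \<zeta> <= norm1 (K' z)"
   then have "norm (K' z) < e5" using norm1_bounds(1)[of "K' z"] \<zeta> by linarith
   then have "norm (K (K' z)) < R3" by (rule e5)
   then show False using K'K(2)[OF z] that by simp
  qed
  then have "\<psi> (K' z) = K' z" by (rule \<psi>out)
  then show ?thesis using Cin[OF True] 1 K'K(2)[OF z] by simp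
 qed (simp add: C_def)
 have Cnear: "norm (C z) < R1" if "norm z < R3" for z
 proof -
  have "norm (\<psi>' z) < e4" using near2[of z] that R3 \<zeta> by linarith
  then have "norm (K' (\<psi>' z)) < e3/2" by (rule e4)
  then have "norm (\<psi> (K' (\<psi>' z))) < e3" using near1[of "K' (\<psi>' z)"] \<zeta> by linarith
  then have "norm (K (\<psi> (K' (\<psi>' z)))) < R1" by (rule e3)
  then show ?thesis using that R3 by (simp add: C_def)
 qed
 have Cq: "C z = z" if "\<not> (0 < Re z \<and> 0 < Im z)" for z
 proof (cases "norm z < R1")
  case True
  obtain y where y: "y \<ge> 0" "\<psi>' z = z - y *\<^sub>R w" using \<psi>'shift by blast
  have "\<not> (0 < Re (\<psi>' z) \<and> 0 < Im (\<psi>' z))"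
  proof
   assume "0 < Re (\<psi>' z) \<and> 0 < Im (\<psi>' z)"
   then have "y * Re w < Re z" "y * Im w < Im z" using y(2) by auto
   moreover have "0 <= y * Re w" "0 <= y * Im w" using y(1) w by auto
   ultimately show False using that by linarith
  qed
  then have "K' (\<psi>' z) = \<psi>' z" using Kfix b[OF True] by blast
  moreover have "K z = z" using Kfix(1)[of z] that True e1 \<rho> by (auto simp: R1_def)
  ultimately show ?thesis using Cin[OF True] \<psi>\<psi>' by simp
 qed (simp add: C_def)
 have "isCont C z" for z
 proof (cases "norm z < R1")
  case True
  have "isCont (\<lambda>z. K (\<psi> (K' (\<psi>' z)))) z"
   by (intro isCont_o2[OF \<psi>c(2)] isCont_o2[OF _ Kc(1)] isCont_o2[OF _ \<psi>c(1)] isCont_o2[OF \<psi>c(2) Kc(2)])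
    (use b[OF True] in auto)
  moreover have "\<forall>\<^sub>F x in nhds z. K (\<psi> (K' (\<psi>' x))) = C x"
   unfolding eventually_nhds by (intro exI[of _ "ball 0 R1"]) (use True in \<open>auto simp: Cin\<close>)
  ultimately show ?thesis by (subst (asm) isCont_cong) auto
 next
  case False
  have "\<forall>\<^sub>F x in nhds z. x = C x"
   unfolding eventually_nhds
   by (intro exI[of _ "- cball 0 R3"]) (use False R3 in \<open>auto simp: Cfar\<close>)
  then show ?thesis using isCont_cong[of "\<lambda>x. x" C z] by auto
 qed
 then have "continuous_on UNIV C" by (simp add: continuous_on_eq_continuous_at)
 moreover have "inj C"
 proof (rule injI)
  fix x y assume xy: "C x = C y"
  have inB: "x = y" if "norm x < R1" "norm y < R1" "C x = C y" for x y
  proof -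
   have "\<psi> (K' (\<psi>' x)) = \<psi> (K' (\<psi>' y))"
    using that K'K(1) b[OF that(1)] b[OF that(2)] by (metis Cin)
   then have "K' (\<psi>' x) = K' (\<psi>' y)" by (metis \<psi>\<psi>'(2))
   then have "\<psi>' x = \<psi>' y" using K'K(2) b[OF that(1)] b[OF that(2)] by metis
   then show ?thesis by (metis \<psi>\<psi>'(1))
  qed
  show "x = y"
  proof (cases "norm x < R1"; cases "norm y < R1")
   assume a: "norm x < R1" "\<not> norm y < R1"
   have "C y = y" using a by (simp add: C_def)
   then have "\<not> norm x < R3" using Cnear[of x] xy a by auto
   then show ?thesis using Cfar[of x] xy \<open>C y = y\<close> by simp
  next
   assume a: "\<not> norm x < R1" "norm y < R1"
   have "C x = x" using a by (simp add: C_def)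
   then have "\<not> norm y < R3" using Cnear[of y] xy a by auto
   then show ?thesis using Cfar[of y] xy \<open>C x = x\<close> by simp
  next
   assume "norm x < R1" "norm y < R1" then show ?thesis using inB xy by blast
  next
   assume "\<not> norm x < R1" "\<not> norm y < R1" then show ?thesis using xy by (simp add: C_def)
  qed
 qed
 moreover have "C z = z" if "1 <= norm1 z" for z
 proof (rule Cfar)
  show "R3 <= norm z" using norm1_bounds(2)[of z] that R3 by linarith
 qed
 moreover have "\<forall>\<^sub>F z in nhds 0. 0 <= Re z \<and> 0 <= Im z --> C z = k z"
 proof -
  have "Re (\<psi>' 0) < 0"
  proof -
   have e: "\<psi>' 0 = - (max 0 (\<zeta> - norm1 (\<psi>' 0)) *\<^sub>R w)"
    using \<psi>\<psi>'(1)[of 0] by (simp add: \<psi>_def push_def eq_neg_iff_add_eq_0)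
   have "\<not> \<zeta> <= norm1 (\<psi>' 0)"
   proof
    assume "\<zeta> <= norm1 (\<psi>' 0)"
    then have "\<psi>' 0 = 0" using e by simp
    then show False using \<zeta> \<open>\<zeta> <= norm1 (\<psi>' 0)\<close> by (simp add: norm1_def)
   qed
   then show ?thesis using arg_cong[OF e, of Re] w by simp
  qed
  moreover have "((\<lambda>z. Re (\<psi>' z)) \<longlongrightarrow> Re (\<psi>' 0)) (nhds 0)"
   using \<psi>c(2)[of 0] by (intro tendsto_Re) (simp only: continuous_at tendsto_at_iff_tendsto_nhds)
  ultimately have "\<forall>\<^sub>F z in nhds 0. Re (\<psi>' z) < 0"
   by (simp add: order_tendstoD(2))
  moreover have "\<forall>\<^sub>F z::complex in nhds 0. norm z < R1"
   unfolding eventually_nhds by (intro exI[of _ "ball 0 R1"]) (use R1 in auto)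
  ultimately show ?thesis
  proof eventually_elim
   case (elim z)
   then have "K' (\<psi>' z) = \<psi>' z" by (simp add: K'_def)
   then show ?case using elim Cin[of z] \<psi>\<psi>' by (simp add: K_def)
  qed
 qed
 ultimately show ?thesis using Cq by blast
qed

lemma tendsto_nhds:
 fixes f :: "complex => complex"
 assumes "continuous_on UNIV f" "f 0 = 0"
 shows "filterlim f (nhds 0) (nhds 0)"
proof -
 have "isCont f 0" using assms(1) by (simp add: continuous_on_eq_continuous_at)
 then have "(f \<longlongrightarrow> f 0) (nhds 0)" by (simp only: continuous_at tendsto_at_iff_tendsto_nhds)
 then show ?thesis using assms(2) by simp
qed

lemma eventually_compose_nhds:
 fixes f :: "complex => complex"
 assumes "continuous_on UNIV f" "f 0 = 0" "\<forall>\<^sub>F z in nhds 0. P z"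
 shows "\<forall>\<^sub>F z in nhds 0. P (f z)"
 using tendsto_nhds[OF assms(1,2)] assms(3) by (auto simp: filterlim_iff)

text \<open>Reflections in the axes carry the lemma from the first quadrant to the others.\<close>

definition reflect :: "real => real => complex => complex" where
 "reflect a b z = Complex (a * Re z) (b * Im z)"

lemma reflect_simps [simp]: "Re (reflect a b z) = a * Re z" "Im (reflect a b z) = b * Im z"
 by (simp_all add: reflect_def)

lemma reflect_reflect: "a \<in> {1, -1} ==> b \<in> {1, -1} ==> reflect a b (reflect a b z) = z"
 by (auto simp: complex_eq_iff)

lemma norm1_reflect: "a \<in> {1, -1} ==> b \<in> {1, -1} ==> norm1 (reflect a b z) = norm1 z"
 by (auto simp: norm1_def)

lemma norm_reflect: "a \<in> {1, -1} ==> b \<in> {1, -1} ==> norm (reflect a b z) = norm z"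
 by (auto simp: cmod_def)

lemma continuous_on_reflect [continuous_intros]:
 "continuous_on S f ==> continuous_on S (\<lambda>x. reflect a b (f x))"
 unfolding reflect_def Complex_eq by (intro continuous_intros)

lemma quadrant_germ_reflected:
 fixes k k' :: "complex => complex"
 assumes k: "continuous_on UNIV k" "continuous_on UNIV k'" "\<And>z. k' (k z) = z" "\<And>z. k (k' z) = z"
  and \<rho>: "0 < \<rho>"
  and axes: "\<And>x. \<bar>x\<bar> < \<rho> ==> k (Complex x 0) = Complex x 0 \<and> k (Complex 0 x) = Complex 0 x"
  and quad: "\<And>z. norm z < \<rho> ==> 0 <= a * Re z ==> 0 <= b * Im z ==> 0 <= a * Re (k z) \<and> 0 <= b * Im (k z)"
   "\<And>z. norm z < \<rho> ==> 0 <= a * Re z ==> 0 <= b * Im z ==> 0 <= a * Re (k' z) \<and> 0 <= b * Im (k' z)"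
  and ab: "a \<in> {1, -1}" "b \<in> {1, -1}"
 shows "\<exists>C. continuous_on UNIV C \<and> inj C \<and> (\<forall>z. 1 <= norm1 z --> C z = z) \<and>
  (\<forall>z. \<not> (0 < a * Re z \<and> 0 < b * Im z) --> C z = z) \<and>
  (\<forall>\<^sub>F z in nhds 0. 0 <= a * Re z \<and> 0 <= b * Im z --> C z = k z)"
proof -
 let ?r = "reflect a b"
 have rr: "?r (?r z) = z" for z using reflect_reflect[OF ab] .
 have aa: "a * (a * x) = x" "b * (b * x) = x" "\<bar>a * x\<bar> = \<bar>x\<bar>" "\<bar>b * x\<bar> = \<bar>x\<bar>" for x using ab by auto
 have kc: "continuous_on UNIV (\<lambda>z. ?r (k (?r z)))" "continuous_on UNIV (\<lambda>z. ?r (k' (?r z)))"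
  by (intro continuous_intros continuous_on_compose2[OF k(1)] continuous_on_compose2[OF k(2)]; simp)+
 have ax: "?r (k (?r (Complex x 0))) = Complex x 0 \<and> ?r (k (?r (Complex 0 x))) = Complex 0 x" if "\<bar>x\<bar> < \<rho>" for x
 proof -
  have r: "?r (Complex x 0) = Complex (a * x) 0" "?r (Complex 0 x) = Complex 0 (b * x)" for x
   by (simp_all add: complex_eq_iff)
  have "k (Complex (a * x) 0) = Complex (a * x) 0" "k (Complex 0 (b * x)) = Complex 0 (b * x)"
   using axes[of "a * x"] axes[of "b * x"] that aa by simp_all
  then show ?thesis by (simp only: r aa)
 qed
 have "\<exists>C. continuous_on UNIV C \<and> inj C \<and> (\<forall>z. 1 <= norm1 z --> C z = z) \<and>
  (\<forall>z. \<not> (0 < Re z \<and> 0 < Im z) --> C z = z) \<and>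
  (\<forall>\<^sub>F z in nhds 0. 0 <= Re z \<and> 0 <= Im z --> C z = ?r (k (?r z)))"
 proof (rule quadrant_germ[OF kc _ _ \<rho> ax])
  show "0 <= Re (?r (k (?r z))) \<and> 0 <= Im (?r (k (?r z)))" if "norm z < \<rho>" "0 <= Re z" "0 <= Im z" for z
   using quad(1)[of "?r z"] that norm_reflect[OF ab] aa by simp
  show "0 <= Re (?r (k' (?r z))) \<and> 0 <= Im (?r (k' (?r z)))" if "norm z < \<rho>" "0 <= Re z" "0 <= Im z" for z
   using quad(2)[of "?r z"] that norm_reflect[OF ab] aa by simp
 qed (simp_all add: rr k)
 then obtain C where C: "continuous_on UNIV C" "inj C" "\<And>z. 1 <= norm1 z ==> C z = z"
  "\<And>z. \<not> (0 < Re z \<and> 0 < Im z) ==> C z = z"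
  "\<forall>\<^sub>F z in nhds 0. 0 <= Re z \<and> 0 <= Im z --> C z = ?r (k (?r z))"
  by blast
 show ?thesis
 proof (intro exI[of _ "\<lambda>z. ?r (C (?r z))"] conjI allI impI)
  show "continuous_on UNIV (\<lambda>z. ?r (C (?r z)))"
   by (intro continuous_intros continuous_on_compose2[OF C(1)]) simp
  show "inj (\<lambda>z. ?r (C (?r z)))"
   by (rule injI) (metis rr C(2) injD)
  show "?r (C (?r z)) = z" if "1 <= norm1 z" for z
   using that C(3) rr norm1_reflect[OF ab] by simp
  show "?r (C (?r z)) = z" if "\<not> (0 < a * Re z \<and> 0 < b * Im z)" for z
   using C(4)[of "?r z"] that rr by simp
  have "\<forall>\<^sub>F z in nhds 0. 0 <= Re (?r z) \<and> 0 <= Im (?r z) --> C (?r z) = ?r (k (?r (?r z)))"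
   by (rule eventually_compose_nhds[OF _ _ C(5)]) (auto intro!: continuous_intros simp: complex_eq_iff)
  then show "\<forall>\<^sub>F z in nhds 0. 0 <= a * Re z \<and> 0 <= b * Im z --> ?r (C (?r z)) = k z"
   by eventually_elim (simp add: rr)
 qed
qed

text \<open>
 A homeomorphism fixing both axes near the origin preserves the quadrants there: on a segment from a
 point of an open quadrant to a point of an adjacent half-axis no image lies on an axis.
\<close>

lemma quadrants_preserved:
 fixes k :: "complex => complex"
 assumes k: "continuous_on UNIV k" "inj k" and \<rho>: "0 < \<rho>"
  and axes: "\<And>x. \<bar>x\<bar> < \<rho> ==> k (Complex x 0) = Complex x 0 \<and> k (Complex 0 x) = Complex 0 x"
 shows "\<exists>r>0. \<forall>a b z. a \<in> {1, -1} --> b \<in> {1, -1} --> norm z < r --> 0 <= a * Re z --> 0 <= b * Im z -->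
  0 <= a * Re (k z) \<and> 0 <= b * Im (k z)"
proof -
 have k0: "k 0 = 0" using axes[of 0] \<rho> by (simp add: zero_complex.code[symmetric])
 have "isCont k 0" using k(1) by (simp add: continuous_on_eq_continuous_at)
 then obtain d where d: "d > 0" "\<And>z. dist z 0 < d ==> dist (k z) (k 0) < \<rho>"
  unfolding continuous_at_eps_delta using \<rho> by metis
 define r where "r = min d \<rho>"
 have r: "r > 0" "r <= \<rho>" "\<And>z. norm z < r ==> norm (k z) < \<rho>"
  using d \<rho> k0 by (auto simp: r_def)
 have off_axes: "Re (k z) ~= 0 \<and> Im (k z) ~= 0" if "norm z < r" "Re z ~= 0" "Im z ~= 0" for z
 proof -
  have n: "\<bar>Re (k z)\<bar> < \<rho>" "\<bar>Im (k z)\<bar> < \<rho>"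
   using r(3)[OF that(1)] abs_Re_le_cmod[of "k z"] abs_Im_le_cmod[of "k z"] by linarith+
  have "Re (k z) ~= 0"
  proof
   assume "Re (k z) = 0"
   then have "k z = Complex 0 (Im (k z))" by (simp add: complex_eq_iff)
   then have "k z = k (Complex 0 (Im (k z)))" using axes[OF n(2)] by simp
   then have "z = Complex 0 (Im (k z))" using k(2) by (meson injD)
   then show False using that(2) by (metis complex.sel(1))
  qed
  moreover have "Im (k z) ~= 0"
  proof
   assume "Im (k z) = 0"
   then have "k z = Complex (Re (k z)) 0" by (simp add: complex_eq_iff)
   then have "k z = k (Complex (Re (k z)) 0)" using axes[OF n(1)] by simp
   then have "z = Complex (Re (k z)) 0" using k(2) by (meson injD)
   then show False using that(3) by (metis complex.sel(2))
  qed
  ultimately show ?thesis by blast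
 qed
 have sgn: "0 <= L (k z)"
  if L: "continuous_on UNIV L" "\<And>w. norm w < r ==> Re w ~= 0 ==> Im w ~= 0 ==> L (k w) ~= 0"
   and p: "norm p < r" "L (k p) > 0"
   and z: "norm z < r" "\<And>t. 0 <= t ==> t < 1 ==> Re ((1 - t) *\<^sub>R z + t *\<^sub>R p) ~= 0 \<and> Im ((1 - t) *\<^sub>R z + t *\<^sub>R p) ~= 0"
  for L :: "complex => real" and p z
 proof (rule ccontr)
  assume neg: "\<not> 0 <= L (k z)"
  define c where "c t = (1 - t) *\<^sub>R z + t *\<^sub>R p" for t
  have "continuous_on {0..1} (\<lambda>t. L (k (c t)))"
   unfolding c_def by (intro continuous_on_compose2[OF L(1)] continuous_on_compose2[OF k(1)] continuous_intros) auto
  moreover have "L (k (c 0)) <= 0" "0 <= L (k (c 1))" using neg p by (auto simp: c_def)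
  ultimately obtain t where t: "0 <= t" "t <= 1" "L (k (c t)) = 0"
   using IVT'[of "\<lambda>t. L (k (c t))" 0 0 1] by auto
  then have "t < 1" using p(2) by (cases "t = 1") (auto simp: c_def)
  have "c t \<in> ball 0 r"
   using convexD_alt[OF convex_ball, of z 0 r p t] z(1) p(1) t unfolding c_def by simp
  then have "L (k (c t)) ~= 0" using L(2) z(2)[OF t(1) \<open>t < 1\<close>] unfolding c_def by simp
  then show False using t by simp
 qed
 have "0 <= a * Re (k z) \<and> 0 <= b * Im (k z)"
  if ab: "a \<in> {1, -1}" "b \<in> {1, -1}" and z: "norm z < r" "0 <= a * Re z" "0 <= b * Im z" for a b z
 proof (cases "Re z = 0 \<or> Im z = 0")
  case True
  have "\<bar>Re z\<bar> < \<rho>" "\<bar>Im z\<bar> < \<rho>"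
   using z(1) r(2) abs_Re_le_cmod[of z] abs_Im_le_cmod[of z] by linarith+
  moreover have "z = Complex (Re z) 0 \<or> z = Complex 0 (Im z)" using True by (auto simp: complex_eq_iff)
  ultimately have "k z = z" using axes by metis
  then show ?thesis using z by simp
 next
  case False
  then have pos: "0 < a * Re z" "0 < b * Im z" using z ab by auto
  have ab2: "a * a = 1" "b * b = 1" using ab by auto
  have aa: "a * (a * x) = x" "b * (b * x) = x" for x
   using ab2 by (simp_all add: mult.assoc[symmetric])
  have ab0: "a ~= 0" "b ~= 0" using ab by auto
  define p where "p = Complex (a * (r/2)) 0"
  define q where "q = Complex 0 (b * (r/2))"
  have abs_ab: "\<bar>a * (r/2)\<bar> = r/2" "\<bar>b * (r/2)\<bar> = r/2" using ab r(1) by auto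
  have np: "norm p < r" "norm q < r"
   using abs_ab r(1) by (simp_all add: p_def q_def cmod_def)
  have kp: "k p = p" "k q = q"
   unfolding p_def q_def using axes abs_ab r by (metis half_gt_zero_iff less_le_trans field_sum_of_halves less_add_same_cancel1)+
  have pq: "a * Re p = r/2" "b * Im p = 0" "a * Re q = 0" "b * Im q = r/2"
   unfolding p_def q_def complex.sel by (simp_all only: aa mult_zero_right)
  have nz: "Re ((1 - t) *\<^sub>R z + t *\<^sub>R w) ~= 0 \<and> Im ((1 - t) *\<^sub>R z + t *\<^sub>R w) ~= 0"
   if t: "0 <= t" "t < 1" and w: "w = p \<or> w = q" for t w
  proof -
   have "0 < (1 - t) * (a * Re z)" "0 < (1 - t) * (b * Im z)" using t pos by auto
   moreover have "0 <= t * (a * Re w)" "0 <= t * (b * Im w)"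
    using w t r(1) pq by auto
   ultimately have "0 < a * Re ((1 - t) *\<^sub>R z + t *\<^sub>R w)" "0 < b * Im ((1 - t) *\<^sub>R z + t *\<^sub>R w)"
    by (simp_all add: algebra_simps)
   then show ?thesis by auto
  qed
  have "0 <= a * Re (k z)"
  proof (rule sgn[of "\<lambda>w. a * Re w" p z])
   show "continuous_on UNIV (\<lambda>w. a * Re w)" by (intro continuous_intros)
   show "a * Re (k w) ~= 0" if "norm w < r" "Re w ~= 0" "Im w ~= 0" for w
    using off_axes[OF that] ab0 by simp
   show "0 < a * Re (k p)" using kp pq r(1) by simp
   show "Re ((1 - t) *\<^sub>R z + t *\<^sub>R p) ~= 0 \<and> Im ((1 - t) *\<^sub>R z + t *\<^sub>R p) ~= 0"
    if "0 <= t" "t < 1" for t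
    using nz[OF that] by blast
  qed (use np z in auto)
  moreover have "0 <= b * Im (k z)"
  proof (rule sgn[of "\<lambda>w. b * Im w" q z])
   show "continuous_on UNIV (\<lambda>w. b * Im w)" by (intro continuous_intros)
   show "b * Im (k w) ~= 0" if "norm w < r" "Re w ~= 0" "Im w ~= 0" for w
    using off_axes[OF that] ab0 by simp
   show "0 < b * Im (k q)" using kp pq r(1) by simp
   show "Re ((1 - t) *\<^sub>R z + t *\<^sub>R q) ~= 0 \<and> Im ((1 - t) *\<^sub>R z + t *\<^sub>R q) ~= 0"
    if "0 <= t" "t < 1" for t
    using nz[OF that] by blast
  qed (use np z in auto)
  ultimately show ?thesis by blast
 qed
 then show ?thesis using r(1) by blast
qed

text \<open>
 The map \<open>f\<close> on the first coordinate, with its displacement cut off. The median of three increasing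
 functions is increasing, hence this is injective.
\<close>

definition cut_re :: "(real => real) => complex => complex" where
 "cut_re f z = Complex (max (Re z - max 0 ((1 - norm1 z)/2)) (min (f (Re z)) (Re z + max 0 ((1 - norm1 z)/2)))) (Im z)"

lemma cut_re:
 fixes f :: "real => real"
 assumes f: "strict_mono f" "continuous_on UNIV f" "f 0 = 0"
 shows "continuous_on UNIV (cut_re f)" "inj (cut_re f)" "\<And>z. 1 <= norm1 z ==> cut_re f z = z"
  "\<And>y. cut_re f (Complex 0 y) = Complex 0 y"
  "\<exists>g. strict_mono g \<and> continuous_on UNIV g \<and> (\<forall>x. 1 <= \<bar>x\<bar> --> g x = x) \<and> (\<forall>x. cut_re f (Complex x 0) = Complex (g x) 0)"
  "\<forall>\<^sub>F z in nhds 0. cut_re f z = Complex (f (Re z)) (Im z)"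
proof -
 define e where "e u v = max 0 ((1 - (\<bar>u\<bar> + \<bar>v\<bar>))/2)" for u v :: real
 define g where "g v u = max (u - e u v) (min (f u) (u + e u v))" for u v :: real
 have cut: "cut_re f z = Complex (g (Im z) (Re z)) (Im z)" for z
  by (simp add: cut_re_def g_def e_def norm1_def)
 have gm: "strict_mono (g v)" for v
 proof (rule strict_monoI)
  fix x y :: real assume xy: "x < y"
  have "f x < f y" using f(1) xy by (simp add: strict_mono_less)
  moreover have "x - e x v < y - e y v" "x + e x v < y + e y v"
  proof -
   have le: "max 0 p <= max 0 q + d" if "p <= q + d" "0 <= d" for p q d :: real
    using that by linarith
   have ab: "\<bar>y\<bar> <= \<bar>x\<bar> + (y - x)" "\<bar>x\<bar> <= \<bar>y\<bar> + (y - x)" using xy by linarith+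
   have 1: "e x v <= e y v + (y - x)/2"
    unfolding e_def by (rule le) (use xy ab in \<open>simp_all add: field_simps\<close>)
   have 2: "e y v <= e x v + (y - x)/2"
    unfolding e_def by (rule le) (use xy ab in \<open>simp_all add: field_simps\<close>)
   show "x - e x v < y - e y v" using 1 2 xy by argo
   show "x + e x v < y + e y v" using 1 2 xy by argo
  qed
  ultimately show "g v x < g v y"
   unfolding g_def by (simp add: max_def min_def)
 qed
 have fc: "continuous_on S (\<lambda>x. f (h x))" if "continuous_on S h" for S and h :: "'a::topological_space => real"
  by (rule continuous_on_compose2[OF f(2) that]) simp
 show c: "continuous_on UNIV (cut_re f)"
  unfolding cut_re_def[abs_def] Complex_eq norm1_def by (intro continuous_intros fc) simp_all
 show "inj (cut_re f)"
 proof (rule injI)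
  fix z w assume e: "cut_re f z = cut_re f w"
  have "Im z = Im w" using arg_cong[OF e, of Im] by (simp only: cut complex.sel)
  moreover have "g (Im z) (Re z) = g (Im w) (Re w)" using arg_cong[OF e, of Re] by (simp only: cut complex.sel)
  ultimately show "z = w" using gm[of "Im w"] by (metis complex_eqI strict_mono_eq)
 qed
 show "cut_re f z = z" if "1 <= norm1 z" for z
  using that by (simp add: cut_re_def complex_eq_iff)
 show "cut_re f (Complex 0 y) = Complex 0 y" for y
  by (simp add: cut_re_def f(3))
 have "continuous_on UNIV (g 0)"
  unfolding g_def e_def by (intro continuous_intros fc) simp_all
 moreover have "g 0 x = x" if "1 <= \<bar>x\<bar>" for x using that by (simp add: g_def e_def)
 moreover have "cut_re f (Complex x 0) = Complex (g 0 x) 0" for x by (simp add: cut)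
 ultimately show "\<exists>g. strict_mono g \<and> continuous_on UNIV g \<and> (\<forall>x. 1 <= \<bar>x\<bar> --> g x = x) \<and> (\<forall>x. cut_re f (Complex x 0) = Complex (g x) 0)"
  using gm[of 0] by blast
 define q where "q z = \<bar>f (Re z) - Re z\<bar> - (1 - norm1 z)/2" for z
 have "continuous_on UNIV q"
  unfolding q_def[abs_def] by (intro continuous_intros fc) auto
 then have "isCont q 0" by (simp add: continuous_on_eq_continuous_at)
 then have "(q \<longlongrightarrow> q 0) (nhds 0)" by (simp only: continuous_at tendsto_at_iff_tendsto_nhds)
 moreover have "q 0 < 0" by (simp add: q_def f(3) norm1_def)
 ultimately have "\<forall>\<^sub>F z in nhds 0. q z < 0" by (rule order_tendstoD)
 then show "\<forall>\<^sub>F z in nhds 0. cut_re f z = Complex (f (Re z)) (Im z)"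
 proof eventually_elim
  case (elim z)
  have med: "max (x - max 0 m) (min y (x + max 0 m)) = y" if "\<bar>y - x\<bar> < m" for x y m :: real
   using that by linarith
  have "\<bar>f (Re z) - Re z\<bar> < (1 - norm1 z)/2" using elim by (simp add: q_def)
  then show ?case unfolding cut_re_def by (simp only: med)
 qed
qed

definition swap :: "complex => complex" where
 "swap z = Complex (Im z) (Re z)"

lemma swap_simps [simp]: "Re (swap z) = Im z" "Im (swap z) = Re z" "swap (swap z) = z" "norm1 (swap z) = norm1 z"
 "swap (Complex x y) = Complex y x" "swap 0 = 0"
 by (simp_all add: swap_def norm1_def complex_eq_iff)

lemma continuous_on_swap [continuous_intros]: "continuous_on S f ==> continuous_on S (\<lambda>x. swap (f x))"
 unfolding swap_def Complex_eq by (intro continuous_intros)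

text \<open>
 Every germ of a homeomorphism that preserves the four half-axes is the germ of a homeomorphism with
 support in the unit square which preserves the axes: divide by the product map with the same
 restriction to the axes, and treat the quadrants one by one.
\<close>

lemma cross_germ:
 fixes \<kappa> :: "complex => complex"
 assumes \<kappa>: "continuous_on UNIV \<kappa>" "bij \<kappa>"
  and f: "strict_mono f" "surj f" "f 0 = 0" and g: "strict_mono g" "surj g" "g 0 = 0"
  and \<rho>: "0 < \<rho>"
  and axes: "\<And>x. \<bar>x\<bar> < \<rho> ==> \<kappa> (Complex x 0) = Complex (f x) 0 \<and> \<kappa> (Complex 0 x) = Complex 0 (g x)"
 obtains C f' g' where "continuous_on UNIV C" "inj C" "\<And>z. 1 <= norm1 z ==> C z = z"
  "\<forall>\<^sub>F z in nhds 0. C z = \<kappa> z"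
  "strict_mono f'" "continuous_on UNIV f'" "\<And>x. 1 <= \<bar>x\<bar> ==> f' x = x" "\<And>x. C (Complex x 0) = Complex (f' x) 0"
  "strict_mono g'" "continuous_on UNIV g'" "\<And>x. 1 <= \<bar>x\<bar> ==> g' x = x" "\<And>x. C (Complex 0 x) = Complex 0 (g' x)"
proof -
 have fc: "continuous_on UNIV f" and gc: "continuous_on UNIV g"
  using f g continuous_strict_mono_surj by auto
 have bf: "bij f" "bij g" using f g strict_mono_imp_inj_on by (auto simp: bij_def)
 have fi: "inv f (f x) = x" "f (inv f x) = x" "inv g (g x) = x" "g (inv g x) = x" for x
  using bf by (auto simp: bij_def surj_f_inv_f)
 have fic: "continuous_on UNIV (inv f)" "continuous_on UNIV (inv g)"
  using homeomorphism_of_bij[OF fc bf(1)] homeomorphism_of_bij[OF gc bf(2)] by (auto simp: homeomorphism_def)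
 have \<kappa>i: "inv \<kappa> (\<kappa> z) = z" "\<kappa> (inv \<kappa> z) = z" for z using \<kappa>(2) by (auto simp: bij_def surj_f_inv_f)
 have \<kappa>ic: "continuous_on UNIV (inv \<kappa>)"
  using homeomorphism_of_bij[OF \<kappa>] by (auto simp: homeomorphism_def)
 \<comment> \<open>After division by the product map of \<open>f\<close> and \<open>g\<close> the axes are fixed pointwise near the origin.\<close>
 define k where "k z = Complex (inv f (Re (\<kappa> z))) (inv g (Im (\<kappa> z)))" for z
 define k' where "k' z = inv \<kappa> (Complex (f (Re z)) (g (Im z)))" for z
 have kk: "k' (k z) = z" "k (k' z) = z" for z by (simp_all add: k_def k'_def fi \<kappa>i)
 have "continuous_on UNIV (\<lambda>z. inv f (Re (\<kappa> z)))" "continuous_on UNIV (\<lambda>z. inv g (Im (\<kappa> z)))"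
  by (rule continuous_on_compose2[OF fic(1)] continuous_on_compose2[OF fic(2)]; use \<kappa>(1) in \<open>auto intro!: continuous_intros\<close>)+
 then have kc: "continuous_on UNIV k"
  unfolding k_def[abs_def] Complex_eq by (intro continuous_intros)
 have "continuous_on UNIV (\<lambda>z. f (Re z))" "continuous_on UNIV (\<lambda>z. g (Im z))"
  by (rule continuous_on_compose2[OF fc] continuous_on_compose2[OF gc]; auto intro!: continuous_intros)+
 then have "continuous_on UNIV (\<lambda>z. Complex (f (Re z)) (g (Im z)))"
  unfolding Complex_eq by (intro continuous_intros)
 then have kc': "continuous_on UNIV k'"
  unfolding k'_def[abs_def] by (intro continuous_on_compose2[OF \<kappa>ic]) auto
 have fi0: "inv f 0 = 0" "inv g 0 = 0" using fi f(3) g(3) by metis+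
 have kaxes: "k (Complex x 0) = Complex x 0 \<and> k (Complex 0 x) = Complex 0 x" if "\<bar>x\<bar> < \<rho>" for x
  using axes[OF that] by (simp add: k_def fi fi0)
 have kaxes': "k' (Complex x 0) = Complex x 0 \<and> k' (Complex 0 x) = Complex 0 x" if "\<bar>x\<bar> < \<rho>" for x
  using kaxes[OF that] kk by metis
 have inj: "inj k" "inj k'" using kk by (metis injI)+
 obtain r1 where r1: "r1 > 0" "\<And>a b z. a \<in> {1, -1} ==> b \<in> {1, -1} ==> norm z < r1 ==> 0 <= a * Re z ==> 0 <= b * Im z ==>
  0 <= a * Re (k z) \<and> 0 <= b * Im (k z)"
  using quadrants_preserved[OF kc inj(1) \<rho> kaxes] by blast
 obtain r2 where r2: "r2 > 0" "\<And>a b z. a \<in> {1, -1} ==> b \<in> {1, -1} ==> norm z < r2 ==> 0 <= a * Re z ==> 0 <= b * Im z ==>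
  0 <= a * Re (k' z) \<and> 0 <= b * Im (k' z)"
  using quadrants_preserved[OF kc' inj(2) \<rho> kaxes'] by blast
 define r where "r = min \<rho> (min r1 r2)"
 have r: "r > 0" "r <= \<rho>" "r <= r1" "r <= r2" using \<rho> r1 r2 by (auto simp: r_def)
 have Q: "\<exists>C. continuous_on UNIV C \<and> inj C \<and> (\<forall>z. 1 <= norm1 z --> C z = z) \<and>
  (\<forall>z. \<not> (0 < a * Re z \<and> 0 < b * Im z) --> C z = z) \<and>
  (\<forall>\<^sub>F z in nhds 0. 0 <= a * Re z \<and> 0 <= b * Im z --> C z = k z)"
  if ab: "a \<in> {1, -1}" "b \<in> {1, -1}" for a b
  by (rule quadrant_germ_reflected[OF kc kc' kk r(1)])
   (use kaxes r r1(2)[OF ab] r2(2)[OF ab] ab in auto)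
 obtain C1 where C1: "continuous_on UNIV C1" "inj C1" "\<And>z. 1 <= norm1 z ==> C1 z = z"
  "\<And>z. \<not> (0 < Re z \<and> 0 < Im z) ==> C1 z = z" "\<forall>\<^sub>F z in nhds 0. 0 <= Re z \<and> 0 <= Im z --> C1 z = k z"
  using Q[of 1 1] by auto
 obtain C2 where C2: "continuous_on UNIV C2" "inj C2" "\<And>z. 1 <= norm1 z ==> C2 z = z"
  "\<And>z. \<not> (Re z < 0 \<and> 0 < Im z) ==> C2 z = z" "\<forall>\<^sub>F z in nhds 0. Re z <= 0 \<and> 0 <= Im z --> C2 z = k z"
  using Q[of "-1" 1] by auto
 obtain C3 where C3: "continuous_on UNIV C3" "inj C3" "\<And>z. 1 <= norm1 z ==> C3 z = z"
  "\<And>z. \<not> (Re z < 0 \<and> Im z < 0) ==> C3 z = z" "\<forall>\<^sub>F z in nhds 0. Re z <= 0 \<and> Im z <= 0 --> C3 z = k z"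
  using Q[of "-1" "-1"] by auto
 obtain C4 where C4: "continuous_on UNIV C4" "inj C4" "\<And>z. 1 <= norm1 z ==> C4 z = z"
  "\<And>z. \<not> (0 < Re z \<and> Im z < 0) ==> C4 z = z" "\<forall>\<^sub>F z in nhds 0. 0 <= Re z \<and> Im z <= 0 --> C4 z = k z"
  using Q[of 1 "-1"] by auto
 \<comment> \<open>The factors are supported in the four open quadrants.\<close>
 define Ck where "Ck z = C1 (C2 (C3 (C4 z)))" for z
 have Ckc: "continuous_on UNIV Ck"
  unfolding Ck_def[abs_def]
  by (intro continuous_on_compose2[OF C1(1)] continuous_on_compose2[OF C2(1)] continuous_on_compose2[OF C3(1)] C4(1)) auto
 have Cki: "inj Ck"
 proof -
  have "Ck = C1 \<circ> (C2 \<circ> (C3 \<circ> C4))" by (simp add: Ck_def fun_eq_iff)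
  then show ?thesis using C1(2) C2(2) C3(2) C4(2) by (metis inj_compose)
 qed
 have Ck1: "Ck z = z" if "1 <= norm1 z" for z
  using that C1(3) C2(3) C3(3) C4(3) by (simp add: Ck_def)
 have Ckaxis: "Ck (Complex x 0) = Complex x 0" "Ck (Complex 0 x) = Complex 0 x" for x
  using C1(4) C2(4) C3(4) C4(4) by (simp_all add: Ck_def)
 have Ckk: "\<forall>\<^sub>F z in nhds 0. Ck z = k z"
 proof -
  have "\<forall>\<^sub>F z::complex in nhds 0. norm z < r1"
   unfolding eventually_nhds by (intro exI[of _ "ball 0 r1"]) (use r1 in auto)
  then show ?thesis using C1(5) C2(5) C3(5) C4(5)
  proof eventually_elim
   case (elim z)
   have s: "0 <= Re z ==> 0 <= Im z ==> 0 <= Re (k z) \<and> 0 <= Im (k z)"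
    "Re z <= 0 ==> 0 <= Im z ==> Re (k z) <= 0 \<and> 0 <= Im (k z)"
    "Re z <= 0 ==> Im z <= 0 ==> Re (k z) <= 0 \<and> Im (k z) <= 0"
    "0 <= Re z ==> Im z <= 0 ==> 0 <= Re (k z) \<and> Im (k z) <= 0"
    using r1(2)[of 1 1 z] r1(2)[of "-1" 1 z] r1(2)[of "-1" "-1" z] r1(2)[of 1 "-1" z] elim(1) by auto
   consider "0 < Re z \<and> Im z < 0" | "\<not> (0 < Re z \<and> Im z < 0)" "Re z < 0 \<and> Im z < 0"
    | "\<not> (0 < Re z \<and> Im z < 0)" "\<not> (Re z < 0 \<and> Im z < 0)" "Re z < 0 \<and> 0 < Im z"
    | "\<not> (0 < Re z \<and> Im z < 0)" "\<not> (Re z < 0 \<and> Im z < 0)" "\<not> (Re z < 0 \<and> 0 < Im z)" by blast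
   then show ?case
   proof cases
    case 1
    then have q: "C4 z = k z" "0 <= Re (k z) \<and> Im (k z) <= 0" using elim s(4) by auto
    then show ?thesis using C1(4)[of "k z"] C2(4)[of "k z"] C3(4)[of "k z"] by (simp add: Ck_def)
   next
    case 2
    then have q: "C4 z = z" "C3 z = k z" "Re (k z) <= 0 \<and> Im (k z) <= 0" using C4(4) elim s(3) by auto
    then show ?thesis using C1(4)[of "k z"] C2(4)[of "k z"] by (simp add: Ck_def)
   next
    case 3
    then have q: "C4 z = z" "C3 z = z" "C2 z = k z" "Re (k z) <= 0 \<and> 0 <= Im (k z)"
     using C4(4) C3(4) elim s(2) by auto
    then show ?thesis using C1(4)[of "k z"] by (simp add: Ck_def)
   next
    case 4
    then have q: "C4 z = z" "C3 z = z" "C2 z = z" using C4(4) C3(4) C2(4) by auto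
    show ?thesis
    proof (cases "0 <= Re z \<and> 0 <= Im z")
     case True
     then show ?thesis using q elim by (simp add: Ck_def)
    next
     case False
     then have ax: "Re z = 0 \<or> Im z = 0" using 4 by linarith
     then have "C1 z = z" using C1(4) by auto
     moreover have "k z = z"
     proof -
      have "Re z <= 0 \<and> 0 <= Im z \<or> Re z <= 0 \<and> Im z <= 0 \<or> 0 <= Re z \<and> Im z <= 0" using False by linarith
      moreover have "C2 z = z" "C3 z = z" "C4 z = z" using q by auto
      ultimately show ?thesis using elim by metis
     qed
     ultimately show ?thesis using q by (simp add: Ck_def)
    qed
   qed
  qed
 qed
 define A where "A = cut_re f"
 define B where "B z = swap (cut_re g (swap z))" for z
 note Af = cut_re[OF f(1) fc f(3), folded A_def]
 note Bg = cut_re[OF g(1) gc g(3)]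
 have Bc: "continuous_on UNIV B"
  unfolding B_def[abs_def] by (intro continuous_intros continuous_on_compose2[OF Bg(1)]) auto
 have Bi: "inj B" unfolding B_def[abs_def] using Bg(2) by (metis (no_types, lifting) injD injI swap_simps(3))
 obtain f' where f': "strict_mono f'" "continuous_on UNIV f'" "\<And>x. 1 <= \<bar>x\<bar> ==> f' x = x" "\<And>x. A (Complex x 0) = Complex (f' x) 0"
  using Af(5) by blast
 obtain g' where g': "strict_mono g'" "continuous_on UNIV g'" "\<And>x. 1 <= \<bar>x\<bar> ==> g' x = x" "\<And>x. cut_re g (Complex x 0) = Complex (g' x) 0"
  using Bg(5) by blast
 have B_axis: "B (Complex x 0) = Complex x 0" "B (Complex 0 x) = Complex 0 (g' x)" for x
  by (simp_all add: B_def Bg(4) g'(4))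
 have Bev: "\<forall>\<^sub>F z in nhds 0. B z = Complex (Re z) (g (Im z))"
 proof -
  have "\<forall>\<^sub>F z in nhds 0. cut_re g (swap z) = Complex (g (Re (swap z))) (Im (swap z))"
   by (rule eventually_compose_nhds[OF _ _ Bg(6)]) (auto intro!: continuous_intros)
  then show ?thesis by eventually_elim (simp add: B_def)
 qed
 define C where "C z = A (B (Ck z))" for z
 show ?thesis
 proof (rule that[of C f' g'])
  show "continuous_on UNIV C"
   unfolding C_def[abs_def] by (intro continuous_on_compose2[OF Af(1)] continuous_on_compose2[OF Bc] Ckc) auto
  have "C = A \<circ> (B \<circ> Ck)" by (simp add: C_def fun_eq_iff)
  then show "inj C" using Af(2) Bi Cki by (metis inj_compose)
  show "C z = z" if "1 <= norm1 z" for z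
   using that Ck1 Af(3) Bg(3)[of "swap z"] by (simp add: C_def B_def)
  show "C (Complex x 0) = Complex (f' x) 0" "C (Complex 0 x) = Complex 0 (g' x)" for x
   by (simp_all add: C_def Ckaxis B_axis f'(4) Af(4))
  have "k 0 = 0" using kaxes[of 0] \<rho> by (simp add: zero_complex.code[symmetric])
  then have "\<forall>\<^sub>F z in nhds 0. B (k z) = Complex (Re (k z)) (g (Im (k z)))"
   by (intro eventually_compose_nhds[OF kc _ Bev])
  moreover have "\<forall>\<^sub>F z in nhds 0. A (B (k z)) = Complex (f (Re (B (k z)))) (Im (B (k z)))"
  proof (rule eventually_compose_nhds[OF _ _ Af(6)])
   show "continuous_on UNIV (\<lambda>z. B (k z))" by (rule continuous_on_compose2[OF Bc kc]) auto
   show "B (k 0) = 0" using B_axis(1)[of 0] \<open>k 0 = 0\<close> by (simp add: zero_complex.code[symmetric])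
  qed
  ultimately show "\<forall>\<^sub>F z in nhds 0. C z = \<kappa> z" using Ckk
  proof eventually_elim
   case (elim z)
   have "C z = A (B (k z))" using elim by (simp add: C_def)
   also have "\<dots> = Complex (f (Re (k z))) (g (Im (k z)))" using elim by simp
   also have "\<dots> = \<kappa> z" by (simp add: k_def fi)
   finally show ?case .
  qed
 qed (fact f' g')+
qed

section \<open>Uniqueness of the twist\<close>

definition scale :: "real => complex => complex" where
 "scale \<mu> z = of_real \<mu> * z"

lemma scale_simps [simp]: "Re (scale \<mu> z) = \<mu> * Re z" "Im (scale \<mu> z) = \<mu> * Im z"
 by (simp_all add: scale_def)

lemma diffeo_scale: "\<mu> ~= 0 ==> diffeo (scale \<mu>)"
 unfolding scale_def[abs_def] by (rule diffeo_mult) simp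

lemma straight_scale:
 assumes "straight D t s dl sg" "valid D" "0 < \<mu>" "\<mu> <= 1"
 shows "straight (map_diagram (scale (1/\<mu>)) D) t s (dl * \<mu>) sg"
proof -
 note d = straightD[OF assms(1)]
 note sc = straight_curve[OF assms(1,2)]
 have m: "dl * \<mu> <= dl" "0 < dl * \<mu>" using assms d by (auto simp: mult_left_le)
 have m2: "dl * \<mu> < 1/2" using m(1) d(2) by linarith
 have x: "\<bar>\<mu> * x\<bar> <= 1" if "\<bar>x\<bar> <= 1" for x
  using that assms(3,4) by (simp add: abs_mult mult_le_one)
 have "\<bar>off t u\<bar> <= dl * \<mu> \<or> \<bar>off s u\<bar> <= dl * \<mu>" if "scale (1/\<mu>) (curve D u) \<in> disk" for u
 proof -
  have c: "\<bar>Re (curve D u)\<bar> <= \<mu>" "\<bar>Im (curve D u)\<bar> <= \<mu>"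
   using that assms(3) by (auto simp: mem_disk_iff abs_divide)
  then have "curve D u \<in> disk" using assms(4) by (simp add: mem_disk_iff)
  then consider "\<bar>off t u\<bar> <= dl" | "\<bar>off s u\<bar> <= dl" using d(5) by blast
  then show ?thesis
  proof cases
   case 1
   then show ?thesis using sc(1)[OF 1] c(1) d(1) by (simp add: abs_divide field_simps)
  next
   case 2
   then show ?thesis using sc(2)[OF 2] c(2) d(1,3) by (auto simp: abs_divide field_simps)
  qed
 qed
 moreover have "curve D (t + dl * \<mu> * x) = Complex (\<mu> * x) 0 \<and> curve D (s + dl * \<mu> * x) = Complex 0 (sg * (\<mu> * x))"
  "x ~= 0 ==> label D (t + dl * \<mu> * x) = Plain \<and> label D (s + dl * \<mu> * x) = Plain" if "\<bar>x\<bar> <= 1" for x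
  using assms(1,3) x[OF that] unfolding straight_def by (simp_all add: mult.assoc)
 ultimately show ?thesis
  unfolding straight_def using m(2) m2 d(3) assms(3) by (auto simp: complex_eq_iff)
qed

lemma straight_shift:
 assumes "straight D t s dl sg" "valid D"
 shows "straight D (t + of_int m) (s + of_int n) dl sg"
proof -
 have "curve D (a + of_int k + x) = curve D (a + x) \<and> label D (a + of_int k + x) = label D (a + x)" for a k x
  using periodic_int[of "curve D" "a + x" k] periodic_int[of "label D" "a + x" k] validD(1,2)[OF assms(2)]
  by (simp add: ac_simps)
 then show ?thesis using assms(1) unfolding straight_def by simp
qed

definition isotopic_over :: "(real => real) => diagram => diagram => bool" where
 "isotopic_over \<alpha> D E \<longleftrightarrow> (\<exists>\<gamma>. isotopic_by \<gamma> D E \<and> (\<forall>t. label E t = Over --> \<gamma> t = \<alpha> t))"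

lemma isotopic_over_rel: "isotopic_rel_over D E \<longleftrightarrow> isotopic_over (\<lambda>t. t) D E"
 by (simp add: isotopic_rel_over_def isotopic_over_def)

lemma isotopic_over_trans:
 assumes "isotopic_over \<alpha> D E" "isotopic_over \<beta> E F"
 shows "isotopic_over (\<alpha> \<circ> \<beta>) D F"
proof -
 obtain a b where a: "isotopic_by a D E" "\<forall>t. label E t = Over --> a t = \<alpha> t"
  and b: "isotopic_by b E F" "\<forall>t. label F t = Over --> b t = \<beta> t"
  using assms unfolding isotopic_over_def by blast
 have "(a \<circ> b) t = (\<alpha> \<circ> \<beta>) t" if "label F t = Over" for t
  using a b that isotopic_byD(4)[OF b(1), of t] by simp
 then show ?thesis
  unfolding isotopic_over_def using isotopic_by_trans[OF a(1) b(1)] by blast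
qed

lemma isotopic_over_rel_trans:
 assumes "isotopic_rel_over D E" "isotopic_over \<beta> E F" "isotopic_rel_over F G"
 shows "isotopic_over \<beta> D G"
 using isotopic_over_trans[OF isotopic_over_trans[OF assms(1)[unfolded isotopic_over_rel] assms(2)] assms(3)[unfolded isotopic_over_rel]]
 by (simp add: comp_def)

lemma isotopic_by_of_push:
 assumes "valid D" "valid E" "reparam \<beta>" "isotopic_to_id h"
  and "\<And>u. curve E (\<beta> u) = h (curve D u) \<and> label E (\<beta> u) = label D u"
 shows "isotopic_by (inv \<beta>) D E"
proof -
 have "bij \<beta>" by (rule reparam_bij[OF assms(3)])
 then have "\<beta> (inv \<beta> u) = u" for u by (simp add: bij_def surj_f_inv_f)
 then have "curve E u = h (curve D (inv \<beta> u)) \<and> label E u = label D (inv \<beta> u)" for u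
  using assms(5)[of "inv \<beta> u"] by simp
 then show ?thesis
  unfolding isotopic_by_def using assms reparam_inv by blast
qed

text \<open>A homeomorphism of the square that preserves the axes slides a straight crossing along itself.\<close>

lemma straight_push:
 assumes st: "straight D t s dl sg" and v: "valid D"
  and f: "strict_mono f" "continuous_on UNIV f" "\<forall>x. 1 <= \<bar>x\<bar> --> f x = x" "\<And>x. C (Complex x 0) = Complex (f x) 0"
  and g: "strict_mono g" "continuous_on UNIV g" "\<forall>x. 1 <= \<bar>x\<bar> --> g x = x"
   "\<And>x. C (Complex 0 (sg * x)) = Complex 0 (sg * g x)"
  and out: "\<forall>z. z \<notin> disk --> C z = z"
 defines "\<beta> \<equiv> bend t dl f \<circ> bend s dl g"
 shows "reparam \<beta>" "\<bar>off t u\<bar> <= dl ==> off t (\<beta> u) = dl * f (off t u / dl)"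
  "\<bar>off s u\<bar> <= dl ==> off s (\<beta> u) = dl * g (off s u / dl)"
  "\<not> \<bar>off t u\<bar> <= dl ==> \<not> \<bar>off t (\<beta> u)\<bar> <= dl" "\<not> \<bar>off s u\<bar> <= dl ==> \<not> \<bar>off s (\<beta> u)\<bar> <= dl"
  "C (curve D u) = curve D (\<beta> u)" "label D (\<beta> u) = label D u" "label D u ~= Plain ==> \<beta> u = u"
proof -
 note f = f(1,2) f(3)[rule_format] f(4) and g = g(1,2) g(3)[rule_format] g(4)
  and out = out[rule_format]
 note d = straightD[OF st] and sc = straight_curve[OF st v] and disj = straight_disjoint[OF st v]
 have "C (Complex 0 0) = Complex (f 0) 0" using f(4) by blast
 moreover have "C (Complex 0 (sg * 0)) = Complex 0 (sg * g 0)" using g(4) by blast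
 ultimately have f0: "f 0 = 0" and g0: "g 0 = 0" using d(3) by auto
 have outf: "dl * f (off a u / dl) = off a u" if "dl <= \<bar>off a u\<bar>" for a u
  using f(3)[of "off a u / dl"] that d(1) by (simp add: abs_divide)
 have outg: "dl * g (off a u / dl) = off a u" if "dl <= \<bar>off a u\<bar>" for a u
  using g(3)[of "off a u / dl"] that d(1) by (simp add: abs_divide)
 have bs: "bend s dl g u = u" if "dl <= \<bar>off s u\<bar>" for u by (rule bend_outside[OF g(3) d(1) that])
 have bt: "bend t dl f u = u" if "dl <= \<bar>off t u\<bar>" for u by (rule bend_outside[OF f(3) d(1) that])
 have le1: "\<bar>off a u / dl\<bar> <= 1" if "\<bar>off a u\<bar> <= dl" for a u
  using that d(1) by (simp add: abs_divide)
 have offs: "off s (bend s dl g u) = dl * g (off s u / dl)" for u by (rule off_bend[OF g(1,3) d(1,2)])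
 have offt: "off t (bend t dl f u) = dl * f (off t u / dl)" for u by (rule off_bend[OF f(1,3) d(1,2)])
 have ins: "\<bar>off s (bend s dl g u)\<bar> <= dl" if "\<bar>off s u\<bar> <= dl" for u
  unfolding offs using abs_le_if_id_outside[OF g(1) g(3) le1[OF that]] d(1) by (simp add: abs_mult)
 have int: "\<bar>off t (bend t dl f u)\<bar> <= dl" if "\<bar>off t u\<bar> <= dl" for u
  unfolding offt using abs_le_if_id_outside[OF f(1) f(3) le1[OF that]] d(1) by (simp add: abs_mult)
 have cases: "\<bar>off s u\<bar> <= dl \<and> \<beta> u = bend s dl g u \<and> \<not> \<bar>off t u\<bar> <= dl \<and> \<not> \<bar>off t (\<beta> u)\<bar> <= dl
  \<or> \<bar>off t u\<bar> <= dl \<and> \<beta> u = bend t dl f u \<and> \<not> \<bar>off s u\<bar> <= dl \<and> \<not> \<bar>off s (\<beta> u)\<bar> <= dl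
  \<or> \<not> \<bar>off s u\<bar> <= dl \<and> \<not> \<bar>off t u\<bar> <= dl \<and> \<beta> u = u"
 proof (cases "\<bar>off s u\<bar> <= dl")
  case True
  then have "\<not> \<bar>off t (bend s dl g u)\<bar> <= dl" using disj ins by blast
  then have "\<beta> u = bend s dl g u" using bt by (simp add: \<beta>_def)
  then show ?thesis using True disj[of u] \<open>\<not> \<bar>off t (bend s dl g u)\<bar> <= dl\<close> by simp
 next
  case False
  then have b: "\<beta> u = bend t dl f u" using bs by (simp add: \<beta>_def)
  show ?thesis
  proof (cases "\<bar>off t u\<bar> <= dl")
   case True
   then show ?thesis using b False disj[of "\<beta> u"] int[of u] by auto
  next
   case n: False
   then show ?thesis using b bt False by simp
  qed
 qed
 show "reparam \<beta>"
  unfolding \<beta>_def using reparam_compose reparam_bend f g d by blast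
 show "off t (\<beta> u) = dl * f (off t u / dl)" if "\<bar>off t u\<bar> <= dl"
  using cases offt that by metis
 show "off s (\<beta> u) = dl * g (off s u / dl)" if "\<bar>off s u\<bar> <= dl"
  using cases offs that by metis
 show "\<not> \<bar>off t (\<beta> u)\<bar> <= dl" if "\<not> \<bar>off t u\<bar> <= dl"
  using cases that by metis
 show "\<not> \<bar>off s (\<beta> u)\<bar> <= dl" if "\<not> \<bar>off s u\<bar> <= dl"
  using cases that by metis
 have fz: "f x = 0 \<longleftrightarrow> x = 0" and gz: "g x = 0 \<longleftrightarrow> x = 0" for x
  using strict_mono_eq[OF f(1), of x 0] strict_mono_eq[OF g(1), of x 0] f0 g0 by auto
 show "C (curve D u) = curve D (\<beta> u)" "label D (\<beta> u) = label D u" "label D u ~= Plain ==> \<beta> u = u"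
 proof -
  have "C (curve D u) = curve D (\<beta> u) \<and> label D (\<beta> u) = label D u \<and> (label D u ~= Plain --> \<beta> u = u)"
  proof (cases "\<bar>off s u\<bar> <= dl")
   case True
   then have b: "\<beta> u = bend s dl g u" "off s (\<beta> u) = dl * g (off s u / dl)" "\<bar>off s (\<beta> u)\<bar> <= dl"
    using cases offs ins by metis+
   have "C (curve D u) = curve D (\<beta> u)"
   proof -
    have "off s (\<beta> u) / dl = g (off s u / dl)" using b(2) d(1) by simp
    then show ?thesis using sc(2)[OF True] sc(2)[OF b(3)] g(4)[of "off s u / dl"] by metis
   qed
   moreover have "label D (\<beta> u) = label D u \<and> (label D u ~= Plain --> \<beta> u = u)"
   proof (cases "off s u = 0")
    case True
    then have "\<beta> u = u" using b(1) g0 by (simp add: bend_def)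
    then show ?thesis by simp
   next
    case False
    then have "off s (\<beta> u) ~= 0" using b(2) gz d(1) by simp
    then show ?thesis using sc(4)[OF True False] sc(4)[OF b(3)] by simp
   qed
   ultimately show ?thesis by blast
  next
   case False
   show ?thesis
   proof (cases "\<bar>off t u\<bar> <= dl")
    case True
    then have b: "\<beta> u = bend t dl f u" "off t (\<beta> u) = dl * f (off t u / dl)" "\<bar>off t (\<beta> u)\<bar> <= dl"
     using cases offt int by metis+
    have "C (curve D u) = curve D (\<beta> u)"
     using sc(1)[OF True] sc(1)[OF b(3)] b(2) f(4) d(1) by simp
    moreover have "label D (\<beta> u) = label D u \<and> (label D u ~= Plain --> \<beta> u = u)"
    proof (cases "off t u = 0")
     case True
     then have "\<beta> u = u" using b(1) f0 by (simp add: bend_def)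
     then show ?thesis by simp
    next
     case False
     then have "off t (\<beta> u) ~= 0" using b(2) fz d(1) by simp
     then show ?thesis using sc(3)[OF True False] sc(3)[OF b(3)] by simp
    qed
    ultimately show ?thesis by blast
   next
    case n: False
    then have "curve D u \<notin> disk" "\<beta> u = u" using d(5) False cases by blast+
    then show ?thesis using out by simp
   qed
  qed
  then show "C (curve D u) = curve D (\<beta> u)" "label D (\<beta> u) = label D u" "label D u ~= Plain ==> \<beta> u = u"
   by blast+
 qed
qed

text \<open>
 The twist does not depend on its size: a homeomorphism of the square that fixes the boundary and is
 multiplication by \<open>\<mu>\<close> on the half-size square carries one to the other.
\<close>

definition sup_norm :: "complex => real" where
 "sup_norm z = max \<bar>Re z\<bar> \<bar>Im z\<bar>"

definition shrink_factor :: "real => real => real" where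
 "shrink_factor \<mu> r = min 1 (max \<mu> (2 - \<mu> - (1 - \<mu>) / max r (1/4)))"

definition shrink :: "real => complex => complex" where
 "shrink \<mu> z = shrink_factor \<mu> (sup_norm z) *\<^sub>R z"

lemma shrink_factor_inner: "0 < \<mu> ==> \<mu> <= 1 ==> r <= 1/2 ==> shrink_factor \<mu> r = \<mu>"
proof -
 assume m: "0 < \<mu>" "\<mu> <= 1" and r: "r <= 1/2"
 have "2 - 2 * \<mu> <= (1 - \<mu>) / max r (1/4)"
 proof -
  have "(2 - 2 * \<mu>) * max r (1/4) <= (2 - 2 * \<mu>) * (1/2)" using m r by (intro mult_left_mono) auto
  then show ?thesis by (simp add: pos_le_divide_eq)
 qed
 then show ?thesis using m by (simp add: shrink_factor_def)
qed

lemma shrink_factor_outer: "0 < \<mu> ==> \<mu> <= 1 ==> 1 <= r ==> shrink_factor \<mu> r = 1"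
proof -
 assume m: "0 < \<mu>" "\<mu> <= 1" and r: "1 <= r"
 have "(1 - \<mu>) / r <= 1 - \<mu>" using divide_left_mono[of 1 r "1 - \<mu>"] m r by simp
 then show ?thesis using m r by (simp add: shrink_factor_def)
qed

lemma shrink_factor_mono:
 assumes m: "0 < \<mu>" "\<mu> <= 1" and r: "0 <= r" "r < r'"
 shows "r * shrink_factor \<mu> r < r' * shrink_factor \<mu> r'"
proof -
 have pos: "shrink_factor \<mu> x \<ge> \<mu>" for x using m by (simp add: shrink_factor_def)
 have mono: "shrink_factor \<mu> r <= shrink_factor \<mu> r'"
 proof -
  have "(1 - \<mu>) / max r' (1/4) <= (1 - \<mu>) / max r (1/4)"
   using m r by (intro divide_left_mono) (auto simp: max_def)
  then show ?thesis by (simp add: shrink_factor_def)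
 qed
 have "r * shrink_factor \<mu> r <= r * shrink_factor \<mu> r'" using mono r by (intro mult_left_mono)
 also have "\<dots> < r' * shrink_factor \<mu> r'" using r pos[of r'] m by (intro mult_strict_right_mono) auto
 finally show ?thesis .
qed

lemma shrink:
 assumes m: "0 < \<mu>" "\<mu> <= 1"
 shows "isotopic_to_id (shrink \<mu>)" "z \<notin> disk ==> shrink \<mu> z = z"
  "sup_norm z <= 1/2 ==> shrink \<mu> z = scale \<mu> z"
proof -
 have sn: "sup_norm z \<ge> 0" "sup_norm z = 0 \<longleftrightarrow> z = 0" "sup_norm (c *\<^sub>R z) = \<bar>c\<bar> * sup_norm z" for z c
  by (auto simp: sup_norm_def complex_eq_iff abs_mult max_mult_distrib_left)
 have pos: "shrink_factor \<mu> x \<ge> \<mu>" for x using m by (simp add: shrink_factor_def)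
 have "inj (shrink \<mu>)"
 proof (rule injI)
  fix z w assume e: "shrink \<mu> z = shrink \<mu> w"
  have n: "sup_norm (shrink \<mu> z) = sup_norm z * shrink_factor \<mu> (sup_norm z)" for z
   using pos[of "sup_norm z"] m sn(3) by (simp add: shrink_def)
  have "sup_norm z = sup_norm w"
  proof (rule linorder_cases[of "sup_norm z" "sup_norm w"])
   assume "sup_norm z < sup_norm w"
   then show ?thesis using shrink_factor_mono[OF m sn(1)] n e by (metis less_irrefl)
  next
   assume "sup_norm w < sup_norm z"
   then show ?thesis using shrink_factor_mono[OF m sn(1)] n e by (metis less_irrefl)
  qed
  then show "z = w" using e pos[of "sup_norm w"] m by (simp add: shrink_def)
 qed
 moreover have "continuous_on UNIV (shrink \<mu>)"
 proof -
  have "max x (1/4) ~= (0::real)" for x by (simp add: max_def)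
  then show ?thesis
   unfolding shrink_def[abs_def] shrink_factor_def sup_norm_def by (intro continuous_intros) simp
 qed
 moreover have out: "shrink \<mu> z = z" if "1 <= sup_norm z" for z
  using shrink_factor_outer[OF m that] by (simp add: shrink_def)
 moreover have "1 <= sup_norm z" if "2 <= norm z" for z
  using that cmod_le[of z] by (auto simp: sup_norm_def)
 ultimately show "isotopic_to_id (shrink \<mu>)"
  using isotopic_to_id_compact_support[of "shrink \<mu>" 2] by blast
 show "z \<notin> disk ==> shrink \<mu> z = z" using out by (auto simp: mem_disk_iff sup_norm_def)
 show "sup_norm z <= 1/2 ==> shrink \<mu> z = scale \<mu> z"
  using shrink_factor_inner[OF m] by (simp add: shrink_def scale_def scaleR_conv_of_real)
qed

lemma twisted_scale:
 assumes st: "straight D t s dl sg" and v: "valid D" and m: "0 < \<mu>" "\<mu> <= 1"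
 shows "isotopic_rel_over (twisted D t s dl sg) (twisted (map_diagram (scale (1/\<mu>)) D) t s (dl * \<mu>) sg)"
proof -
 let ?D = "map_diagram (scale (1/\<mu>)) D"
 let ?E = "twisted D t s dl sg" and ?F = "twisted ?D t s (dl * \<mu>) sg"
 note d = straightD[OF st] and sc = straight_curve[OF st v]
 have st': "straight ?D t s (dl * \<mu>) sg" by (rule straight_scale[OF st v m])
 have v': "valid ?D" using valid_map[OF diffeo_scale v] m by simp
 define f where "f x = shrink_factor \<mu> \<bar>x\<bar> * x" for x
 have f_odd: "f (- x) = - f x" for x by (simp add: f_def)
 have f_in: "f x = \<mu> * x" if "\<bar>x\<bar> <= 1/2" for x using shrink_factor_inner[OF m that] by (simp add: f_def)
 have f_out: "f x = x" if "1 <= \<bar>x\<bar>" for x using shrink_factor_outer[OF m that] by (simp add: f_def)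
 have f_pos: "f x < f y" if "0 <= x" "x < y" for x y
  using shrink_factor_mono[OF m that] that by (simp add: f_def mult.commute)
 have fm: "strict_mono f"
 proof (rule strict_monoI)
  fix x y :: real assume xy: "x < y"
  have f0: "f 0 = 0" by (simp add: f_def)
  consider "0 <= x" | "x < 0" "0 <= y" | "y < 0" using xy by linarith
  then show "f x < f y"
  proof cases
   case 1
   then show ?thesis using f_pos xy by blast
  next
   case 2
   then have "f 0 < f (- x)" using f_pos[of 0 "- x"] by simp
   moreover have "f 0 <= f y" using f_pos[of 0 y] 2 by (cases "y = 0") auto
   ultimately show ?thesis using f_odd[of x] f0 by simp
  next
   case 3
   then have "f (- y) < f (- x)" using f_pos[of "- y" "- x"] xy by simp
   then show ?thesis using f_odd by simp
  qed
 qed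
 have fc: "continuous_on UNIV f"
 proof -
  have "max x (1/4) ~= (0::real)" for x by (simp add: max_def)
  then show ?thesis unfolding f_def[abs_def] shrink_factor_def by (intro continuous_intros) simp
 qed
 have fx: "shrink \<mu> (Complex x 0) = Complex (f x) 0" for x
  by (simp add: shrink_def sup_norm_def f_def complex_eq_iff)
 have fy: "shrink \<mu> (Complex 0 (sg * x)) = Complex 0 (sg * f x)" for x
 proof -
  have "\<bar>sg * x\<bar> = \<bar>x\<bar>" using d(3) by (auto simp: abs_mult)
  then show ?thesis by (simp add: shrink_def sup_norm_def f_def complex_eq_iff)
 qed
 have f_out': "\<forall>x. 1 <= \<bar>x\<bar> --> f x = x" and out': "\<forall>z. z \<notin> disk --> shrink \<mu> z = z"
  using f_out shrink(2)[OF m] by blast+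
 define \<beta> where "\<beta> = bend t dl f \<circ> bend s dl f"
 note push = straight_push[OF st v fm fc f_out' fx fm fc f_out' fy out', folded \<beta>_def]
 have fabs: "\<bar>f x\<bar> = f \<bar>x\<bar>" for x
  using m by (simp add: f_def shrink_factor_def abs_mult)
 have abs_f: "\<bar>f x\<bar> < \<bar>f y\<bar>" if "\<bar>x\<bar> < \<bar>y\<bar>" for x y
  using f_pos[of "\<bar>x\<bar>" "\<bar>y\<bar>"] that by (simp add: fabs)
 have quarter: "\<bar>dl * f x\<bar> = dl * \<mu> / 4 \<longleftrightarrow> \<bar>x\<bar> = 1/4" for x
 proof -
  have f4: "\<bar>f (1/4)\<bar> = \<mu> / 4"
   using m by (subst f_in) simp_all
  have "\<bar>dl * f x\<bar> = dl * \<mu> / 4 \<longleftrightarrow> \<bar>f x\<bar> = \<mu> / 4"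
   using d(1) by (simp add: abs_mult)
  also have "\<dots> \<longleftrightarrow> \<bar>f x\<bar> = \<bar>f (1/4)\<bar>" by (simp only: f4)
  also have "\<dots> \<longleftrightarrow> \<bar>x\<bar> = \<bar>1/4\<bar>"
   by (simp only: fabs strict_mono_eq[OF fm])
  finally show ?thesis by simp
 qed
 have dm: "dl * \<mu> <= dl" "0 < dl * \<mu>" using d(1) m by (auto simp: mult_left_le)
 have lab4: "\<bar>off a (\<beta> u)\<bar> = dl * \<mu> / 4 \<longleftrightarrow> \<bar>off a u\<bar> = dl / 4" if "a = t \<or> a = s" for a u
 proof (cases "\<bar>off a u\<bar> <= dl")
  case True
  then have "off a (\<beta> u) = dl * f (off a u / dl)" using that push(2,3) by blast
  then show ?thesis using quarter[of "off a u / dl"] d(1) by (auto simp: abs_divide field_simps)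
 next
  case False
  then have "\<not> \<bar>off a (\<beta> u)\<bar> <= dl" using that push(4,5) by blast
  then have "\<bar>off a (\<beta> u)\<bar> ~= dl * \<mu> / 4" "\<bar>off a u\<bar> ~= dl / 4" using False dm d(1) by linarith+
  then show ?thesis by blast
 qed
 have "curve ?F (\<beta> u) = (scale (1/\<mu>) \<circ> shrink \<mu>) (curve ?E u) \<and> label ?F (\<beta> u) = label ?E u" for u
 proof
  show "label ?F (\<beta> u) = label ?E u"
   by (simp only: label_twisted lab4[OF disjI1[OF refl]] lab4[OF disjI2[OF refl]] map_diagram_simps) (simp add: push(7))
  show "curve ?F (\<beta> u) = (scale (1/\<mu>) \<circ> shrink \<mu>) (curve ?E u)"
  proof (cases "\<bar>off s u\<bar> <= dl/2")
   case True
   then have u: "\<bar>off s u\<bar> <= dl" "\<bar>off s u / dl\<bar> <= 1/2" using d(1) by (auto simp: abs_divide field_simps)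
   have o: "off s (\<beta> u) = dl * \<mu> * (off s u / dl)" using push(3)[OF u(1)] f_in[OF u(2)] by simp
   then have ob: "\<bar>off s (\<beta> u)\<bar> <= dl * \<mu>" "off s (\<beta> u) / (dl * \<mu>) = off s u / dl"
    using u d(1) m by (auto simp: abs_mult field_simps)
   have flip: "sup_norm (cflip sg z) = sup_norm z" for z
    using d(3) by (auto simp: sup_norm_def)
   have "sup_norm (cflip sg (hook (off s u / dl))) <= 1/2"
    unfolding flip using abs_hook_x[of "off s u / dl"] abs_hook_y[OF u(2)] by (simp add: sup_norm_def)
   then have "shrink \<mu> (curve ?E u) = scale \<mu> (cflip sg (hook (off s u / dl)))"
    using u by (simp add: curve_twisted shrink(3)[OF m])
   moreover have "curve ?F (\<beta> u) = cflip sg (hook (off s u / dl))"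
    using ob by (simp add: curve_twisted)
   ultimately show ?thesis using m by (simp add: complex_eq_iff)
  next
   case False
   then have E: "curve ?E u = curve D u" using curve_twisted_outside[OF st v] by simp
   have "dl * \<mu> / 2 <= \<bar>off s (\<beta> u)\<bar>"
   proof (cases "\<bar>off s u\<bar> <= dl")
    case True
    have "1/2 < \<bar>off s u / dl\<bar>" using False d(1) by (simp add: abs_divide field_simps)
    then have "\<bar>f (1/2)\<bar> < \<bar>f (off s u / dl)\<bar>" by (intro abs_f) simp
    then show ?thesis using push(3)[OF True] f_in[of "1/2"] d(1) m by (simp add: abs_mult)
   next
    case n: False
    then show ?thesis using push(5)[OF n] dm by linarith
   qed
   then have "curve ?F (\<beta> u) = curve ?D (\<beta> u)" using curve_twisted_outside[OF st' v'] by simp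
   then show ?thesis using E push(6)[of u] by simp
  qed
 qed
 moreover have "isotopic_to_id (scale (1/\<mu>) \<circ> shrink \<mu>)"
  using isotopic_to_id_compose diffeoD(1)[OF diffeo_scale] shrink(1)[OF m] m by simp
 ultimately have iso: "isotopic_by (inv \<beta>) ?E ?F"
  using isotopic_by_of_push[OF valid_twisted[OF st v] valid_twisted[OF st' v'] push(1)] by blast
 have "inv \<beta> u = u" if "label ?F u = Over" for u
 proof -
  have "label D u ~= Plain" using that by (simp add: label_twisted split: if_splits)
  then have "\<beta> u = u" by (rule push(8))
  then show ?thesis using reparam_bij[OF push(1)] by (metis bij_def inv_f_f)
 qed
 then show ?thesis unfolding isotopic_rel_over_def using iso by blast
qed

lemma reparam_mod_int:
 assumes "reparam \<alpha>"
 shows "\<alpha> u - \<alpha> v \<in> \<int> \<longleftrightarrow> u - v \<in> \<int>"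
proof
 assume "u - v \<in> \<int>"
 then obtain n where "u = v + of_int n" by (metis Ints_cases add.commute diff_add_cancel)
 then show "\<alpha> u - \<alpha> v \<in> \<int>" using reparam_int[OF assms, of v n] by simp
next
 assume "\<alpha> u - \<alpha> v \<in> \<int>"
 then obtain n where "\<alpha> u = \<alpha> v + of_int n" by (metis Ints_cases add.commute diff_add_cancel)
 then have "\<alpha> u = \<alpha> (v + of_int n)" using reparam_int[OF assms] by simp
 then have "u = v + of_int n" using reparam_bij[OF assms] by (meson bij_def injD)
 then show "u - v \<in> \<int>" by simp
qed

lemma isotopic_by_double_pair:
 assumes "isotopic_by \<alpha> D E"
 shows "double_pair (curve E) u v \<longleftrightarrow> double_pair (curve D) (\<alpha> u) (\<alpha> v)"
proof -
 obtain h where h: "isotopic_to_id h" "\<And>t. curve E t = h (curve D (\<alpha> t))"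
  using assms unfolding isotopic_by_def by blast
 have "h z = h w \<longleftrightarrow> z = w" for z w
  using isotopic_to_idD(2)[OF h(1)] by (auto simp: bij_def inj_def)
 then show ?thesis
  unfolding double_pair_def h(2) using reparam_mod_int[OF isotopic_byD(3)[OF assms]] by simp
qed

text \<open>
 An isotopy between diagrams with a straight crossing can be changed into one that is, near the
 crossing, the identity or the complex conjugation.
\<close>

lemma isotopy_standard_near_crossing:
 assumes st: "straight D t s dl sg" "straight D' t' s' dl' sg'"
  and iso: "isotopic_by \<alpha> D D'" and at: "\<alpha> t' = t" "\<alpha> s' = s"
 shows "\<exists>\<beta> h r. reparam \<beta> \<and> isotopic_to_id h \<and> 0 < r \<and>
  (\<forall>u. curve D' u = h (curve D (\<beta> u)) \<and> label D' u = label D (\<beta> u)) \<and>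
  (\<forall>z. norm z < r --> h z = cflip sg' (cflip sg z)) \<and>
  (\<forall>u. label D' u ~= Plain --> \<beta> u = \<alpha> u)"
proof -
 note v = isotopic_byD(1,2)[OF iso] and ra = isotopic_byD(3)[OF iso]
 note d = straightD[OF st(1)] and d' = straightD[OF st(2)]
 note sc = straight_curve[OF st(1) v(1)] and sc' = straight_curve[OF st(2) v(2)]
 obtain h where h: "isotopic_to_id h" "\<And>u. curve D' u = h (curve D (\<alpha> u))" "\<And>u. label D' u = label D (\<alpha> u)"
  using iso unfolding isotopic_by_def by blast
 note hb = isotopic_to_idD[OF h(1)]
 have ba: "bij \<alpha>" by (rule reparam_bij[OF ra])
 have ia: "\<alpha> (inv \<alpha> x) = x" "inv \<alpha> (\<alpha> x) = x" for x using ba by (auto simp: bij_def surj_f_inv_f)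
 have rai: "strict_mono (inv \<alpha>)" "surj (inv \<alpha>)"
  using reparam_inv[OF ra] reparam_bij[OF reparam_inv[OF ra]] by (auto simp: reparam_def bij_def)
 \<comment> \<open>The inverse of \<open>\<alpha>\<close> in the parameters of the straight strands.\<close>
 define F where "F a a' x = (inv \<alpha> (a + dl * x) - a') / dl'" for a a' x
 have F: "strict_mono (F a a')" "surj (F a a')" "\<alpha> a' = a ==> F a a' 0 = 0"
  "inv \<alpha> (a + dl * x) = a' + dl' * F a a' x" for a a' x
 proof -
  show "strict_mono (F a a')"
  proof (rule strict_monoI)
   fix x y :: real assume "x < y"
   then have "a + dl * x < a + dl * y" using d(1) by simp
   then have "inv \<alpha> (a + dl * x) < inv \<alpha> (a + dl * y)" using rai(1) by (simp add: strict_mono_less)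
   then show "F a a' x < F a a' y" using d'(1) by (simp add: F_def divide_strict_right_mono)
  qed
  have "F a a' ((\<alpha> (a' + dl' * y) - a) / dl) = y" for y
   using d(1) d'(1) ia by (simp add: F_def)
  then show "surj (F a a')" unfolding surj_def by metis
  show "\<alpha> a' = a ==> F a a' 0 = 0" using ia by (auto simp: F_def)
  show "inv \<alpha> (a + dl * x) = a' + dl' * F a a' x" using d'(1) by (simp add: F_def)
 qed
 define f g where "f = F t t'" and "g = F s s'"
 note f = F(1)[of t t', folded f_def] F(2)[of t t', folded f_def] F(3)[of t' t, folded f_def, OF at(1)]
  F(4)[of t _ t', folded f_def]
 note g = F(1)[of s s', folded g_def] F(2)[of s s', folded g_def] F(3)[of s' s, folded g_def, OF at(2)]
  F(4)[of s _ s', folded g_def]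
 obtain \<rho> where \<rho>: "0 < \<rho>" "\<rho> <= 1" "\<And>x. \<bar>x\<bar> < \<rho> ==> \<bar>f x\<bar> <= 1 \<and> \<bar>g x\<bar> <= 1"
 proof -
  have ex: "\<exists>e>0. \<forall>x. \<bar>x\<bar> < e --> \<bar>k x\<bar> <= 1" if "strict_mono k" "surj k" "k 0 = 0" for k :: "real => real"
  proof -
   have "isCont k 0" using continuous_strict_mono_surj[OF that(1,2)] by (simp add: continuous_on_eq_continuous_at)
   then obtain e where "e > 0" "\<forall>x. dist x 0 < e --> dist (k x) (k 0) < 1"
    unfolding continuous_at_eps_delta by (metis zero_less_one)
   then show ?thesis using that(3) by (auto simp: dist_real_def less_imp_le)
  qed
  obtain e1 where e1: "e1 > 0" "\<forall>x. \<bar>x\<bar> < e1 --> \<bar>f x\<bar> <= 1" using ex[OF f(1,2,3)] by blast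
  obtain e2 where e2: "e2 > 0" "\<forall>x. \<bar>x\<bar> < e2 --> \<bar>g x\<bar> <= 1" using ex[OF g(1,2,3)] by blast
  show ?thesis using that[of "min 1 (min e1 e2)"] e1 e2 by auto
 qed
 \<comment> \<open>The end of the isotopy with both crossings flipped to positive orientation: it preserves all half-axes.\<close>
 define \<kappa> where "\<kappa> z = cflip sg' (h (cflip sg z))" for z
 have cfc: "continuous_on S (\<lambda>z. cflip a (k z))" if "continuous_on S k" for S a and k :: "complex => complex"
  unfolding cflip_def Complex_eq by (intro continuous_intros that)
 have \<kappa>c: "continuous_on UNIV \<kappa>"
  unfolding \<kappa>_def[abs_def] by (intro cfc continuous_on_compose2[OF hb(1)] continuous_on_id) auto
 have cc: "cflip sg (cflip sg z) = z" "cflip sg' (cflip sg' z) = z" for z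
  using cflip_cflip d(3) d'(3) by auto
 have \<kappa>b: "bij \<kappa>"
 proof (rule bij_betw_byWitness[where f' = "\<lambda>z. cflip sg (inv h (cflip sg' z))"])
  show "\<forall>z\<in>UNIV. cflip sg (inv h (cflip sg' (\<kappa> z))) = z" "\<forall>z\<in>UNIV. \<kappa> (cflip sg (inv h (cflip sg' z))) = z"
   using hb(2) by (simp_all add: \<kappa>_def cc bij_def surj_f_inv_f)
 qed auto
 have \<kappa>axes: "\<kappa> (Complex x 0) = Complex (f x) 0 \<and> \<kappa> (Complex 0 x) = Complex 0 (g x)" if x: "\<bar>x\<bar> < \<rho>" for x
 proof -
  have x1: "\<bar>x\<bar> <= 1" "\<bar>f x\<bar> <= 1" "\<bar>g x\<bar> <= 1" using x \<rho> by force+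
  have "curve D (t + dl * x) = Complex x 0" "curve D (s + dl * x) = Complex 0 (sg * x)"
   using st(1) x1 unfolding straight_def by blast+
  then have "curve D' (t' + dl' * f x) = h (Complex x 0)" "curve D' (s' + dl' * g x) = h (Complex 0 (sg * x))"
   using h(2) f(4)[of x] g(4)[of x] ia(1) by metis+
  moreover have "curve D' (t' + dl' * f x) = Complex (f x) 0" "curve D' (s' + dl' * g x) = Complex 0 (sg' * g x)"
   using st(2) x1 unfolding straight_def by blast+
  moreover have "cflip sg (Complex x 0) = Complex x 0" "cflip sg (Complex 0 x) = Complex 0 (sg * x)"
   "cflip sg' (Complex (f x) 0) = Complex (f x) 0" "cflip sg' (Complex 0 (sg' * g x)) = Complex 0 (g x)"
   using d'(4) by (simp_all add: complex_eq_iff mult.assoc[symmetric])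
  ultimately show ?thesis by (simp add: \<kappa>_def)
 qed
 obtain C f' g' where C: "continuous_on UNIV C" "inj C" "\<And>z. 1 <= norm1 z ==> C z = z"
  "\<forall>\<^sub>F z in nhds 0. C z = \<kappa> z"
  and f': "strict_mono f'" "continuous_on UNIV f'" "\<And>x. 1 <= \<bar>x\<bar> ==> f' x = x" "\<And>x. C (Complex x 0) = Complex (f' x) 0"
  and g': "strict_mono g'" "continuous_on UNIV g'" "\<And>x. 1 <= \<bar>x\<bar> ==> g' x = x" "\<And>x. C (Complex 0 x) = Complex 0 (g' x)"
  by (rule cross_germ[OF \<kappa>c \<kappa>b f(1-3) g(1-3) \<rho>(1) \<kappa>axes]) auto
 define Csg where "Csg z = cflip sg (C (cflip sg z))" for z
 have cfx: "cflip sg (Complex x 0) = Complex x 0" "cflip sg (Complex 0 (sg * x)) = Complex 0 x"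
  "cflip sg (Complex 0 x) = Complex 0 (sg * x)" for x
  using d(4) by (simp_all add: complex_eq_iff mult.assoc[symmetric])
 have n1: "norm1 (cflip sg z) = norm1 z" for z using d(3) by (auto simp: norm1_def)
 have Csgout: "Csg z = z" if "1 <= norm1 z" for z using that C(3) n1 cc by (simp add: Csg_def)
 have Csgi: "isotopic_to_id Csg"
 proof (rule isotopic_to_id_compact_support[of _ 1])
  show "continuous_on UNIV Csg"
   unfolding Csg_def[abs_def] by (intro cfc continuous_on_compose2[OF C(1)] continuous_on_id) auto
  show "inj Csg" unfolding Csg_def[abs_def] using C(2) cc(1) by (metis (no_types, lifting) injD injI)
  show "Csg z = z" if "1 <= norm z" for z using Csgout that norm1_bounds(1)[of z] by simp
 qed
 have Csgx: "Csg (Complex x 0) = Complex (f' x) 0" "Csg (Complex 0 (sg * x)) = Complex 0 (sg * g' x)" for x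
 proof -
  show "Csg (Complex x 0) = Complex (f' x) 0" by (simp only: Csg_def cfx(1) f'(4))
  have "Csg (Complex 0 (sg * x)) = cflip sg (C (Complex 0 x))" unfolding Csg_def by (subst cfx(2)) (rule refl)
  then show "Csg (Complex 0 (sg * x)) = Complex 0 (sg * g' x)" by (simp only: g'(4) cfx(3))
 qed
 have "Csg z = z" if "z \<notin> disk" for z
  using that by (intro Csgout) (auto simp: mem_disk_iff norm1_def)
 then have Csgdisk: "\<forall>z. z \<notin> disk --> Csg z = z" by blast
 have f'3: "\<forall>x. 1 <= \<bar>x\<bar> --> f' x = x" and g'3: "\<forall>x. 1 <= \<bar>x\<bar> --> g' x = x"
  using f'(3) g'(3) by blast+
 define b where "b = bend t dl f' \<circ> bend s dl g'"
 note push = straight_push[OF st(1) v(1) f'(1,2) f'3 Csgx(1) g'(1,2) g'3 Csgx(2) Csgdisk, folded b_def]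
 have Csginv: "inv Csg (Csg z) = z" "Csg (inv Csg z) = z" for z
  using isotopic_to_idD(2)[OF Csgi] by (auto simp: bij_def surj_f_inv_f)
 \<comment> \<open>Cancel the germ of the isotopy by a map that only slides the diagram along itself.\<close>
 define k where "k = h \<circ> inv Csg"
 have ki: "isotopic_to_id k"
  unfolding k_def by (rule isotopic_to_id_compose[OF h(1) isotopic_to_id_inv[OF Csgi]])
 have "\<forall>\<^sub>F z in nhds 0. k z = cflip sg' (cflip sg z)"
 proof -
  have "C (Complex 0 0) = \<kappa> (Complex 0 0)" using eventually_nhds_x_imp_x[OF C(4)] by (simp add: zero_complex.code[symmetric])
  moreover have "\<kappa> (Complex 0 0) = Complex 0 0" using \<kappa>axes[of 0] \<rho>(1) f(3) by simp
  moreover have z0: "Complex 0 0 = 0" "cflip a 0 = 0" for a by (simp_all add: complex_eq_iff)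
  ultimately have "Csg 0 = 0" by (simp add: Csg_def)
  then have i0: "inv Csg 0 = 0" using Csginv(1) by metis
  have "\<forall>\<^sub>F z in nhds 0. C (cflip sg z) = \<kappa> (cflip sg z)"
   by (rule eventually_compose_nhds[OF _ _ C(4)]) (auto intro!: cfc continuous_on_id simp: z0)
  then have "\<forall>\<^sub>F z in nhds 0. Csg z = cflip sg (cflip sg' (h z))"
   by eventually_elim (simp add: Csg_def \<kappa>_def cc)
  then have "\<forall>\<^sub>F z in nhds 0. Csg (inv Csg z) = cflip sg (cflip sg' (h (inv Csg z)))"
   by (rule eventually_compose_nhds[OF isotopic_to_idD(1)[OF isotopic_to_id_inv[OF Csgi]] i0])
  then show ?thesis
  proof eventually_elim
   case (elim z)
   then have "z = cflip sg (cflip sg' (k z))" using Csginv by (simp add: k_def)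
   then have "cflip sg' (cflip sg z) = k z" using cc by metis
   then show ?case by simp
  qed
 qed
 then obtain S where S: "open S" "0 \<in> S" "\<forall>z\<in>S. k z = cflip sg' (cflip sg z)"
  unfolding eventually_nhds by blast
 then obtain r where r: "r > 0" "ball 0 r \<subseteq> S" using open_contains_ball by blast
 have "curve D' u = k (curve D ((b \<circ> \<alpha>) u)) \<and> label D' u = label D ((b \<circ> \<alpha>) u)" for u
 proof -
  have "curve D (b (\<alpha> u)) = Csg (curve D (\<alpha> u))" using push(6) by simp
  then show ?thesis using h(2,3) Csginv push(7) by (simp add: k_def)
 qed
 moreover have "(b \<circ> \<alpha>) u = \<alpha> u" if "label D' u ~= Plain" for u
  using push(8)[of "\<alpha> u"] h(3) that by simp
 moreover have "\<forall>z. norm z < r --> k z = cflip sg' (cflip sg z)" using S r by auto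
 ultimately show ?thesis
  using reparam_compose[OF push(1) ra] ki r(1) by blast
qed

text \<open>
 After the isotopy has been made standard near the crossing, the same isotopy carries one twisted
 diagram to the other.
\<close>

lemma isotopic_over_twisted:
 assumes st: "straight D t s dl sg" "straight D' t' s' dl' sg'"
  and iso: "isotopic_by \<alpha> D D'" and at: "\<alpha> t' = t" "\<alpha> s' = s"
  and lab: "label D t ~= Plain" "label D s ~= Plain"
 shows "isotopic_over \<alpha> (twisted D t s dl sg) (twisted D' t' s' dl' sg')"
proof -
 note v = isotopic_byD(1,2)[OF iso] and ra = isotopic_byD(3)[OF iso]
 note d = straightD[OF st(1)] and d' = straightD[OF st(2)]
 note sc = straight_curve[OF st(1) v(1)] and sc' = straight_curve[OF st(2) v(2)]
 obtain \<beta> h r where \<beta>: "reparam \<beta>" "isotopic_to_id h" "0 < r"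
  and h: "\<And>u. curve D' u = h (curve D (\<beta> u))" "\<And>u. label D' u = label D (\<beta> u)"
   "\<And>z. norm z < r ==> h z = cflip sg' (cflip sg z)" "\<And>u. label D' u ~= Plain ==> \<beta> u = \<alpha> u"
  using isotopy_standard_near_crossing[OF st iso at] by blast
 have cc: "cflip sg (cflip sg z) = z" "cflip sg' (cflip sg' z) = z" for z
  using cflip_cflip d(3) d'(3) by auto
 have hinj: "h z = h w \<longleftrightarrow> z = w" for z w
  using isotopic_to_idD(2)[OF \<beta>(2)] by (auto simp: bij_def inj_def)
 \<comment> \<open>The twists are shrunk into the region where \<open>h\<close> is standard.\<close>
 define \<mu> where "\<mu> = min 1 (r/2)"
 have m: "0 < \<mu>" "\<mu> <= 1" "\<mu> < r" using \<beta>(3) by (auto simp: \<mu>_def)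
 have "label D' t' ~= Plain" "label D' s' ~= Plain"
  using iso lab at unfolding isotopic_by_def by auto
 then have bt: "\<beta> t' = t" "\<beta> s' = s" using h(4) at by auto
 have dpb: "u - w \<in> \<int>" if "\<beta> u - \<beta> w \<in> \<int>" for u w
  using that reparam_mod_int[OF \<beta>(1)] by blast
 let ?x = "\<lambda>x. Complex x 0"
 have ht: "h (Complex x 0) = Complex x 0" "h (Complex 0 (sg * x)) = Complex 0 (sg' * x)" if "\<bar>x\<bar> <= \<mu>" for x
 proof -
  have "norm (Complex x 0) < r" "norm (Complex 0 (sg * x)) < r"
   using that m d(3) by (auto simp: cmod_def)
  then show "h (Complex x 0) = Complex x 0" "h (Complex 0 (sg * x)) = Complex 0 (sg' * x)"
   using h(3) d(4) by (simp_all add: complex_eq_iff mult.assoc[symmetric])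
 qed
 have lin: "off t (\<beta> (t' + dl' * x)) = dl * x" "off s (\<beta> (s' + dl' * x)) = dl * x" if x: "\<bar>x\<bar> <= \<mu>" for x
 proof -
  have x1: "\<bar>x\<bar> <= 1" using x m by simp
  then have dx: "\<bar>dl * x\<bar> <= dl" using d(1) by (simp add: abs_mult mult_left_le)
  then have o: "off t (t + dl * x) = dl * x" "off s (s + dl * x) = dl * x" using d(2) by auto
  have c: "curve D (t + dl * x) = Complex x 0" "curve D (s + dl * x) = Complex 0 (sg * x)"
   "curve D' (t' + dl' * x) = Complex x 0" "curve D' (s' + dl' * x) = Complex 0 (sg' * x)"
   using st x1 unfolding straight_def by blast+
  have e: "curve D (\<beta> (t' + dl' * x)) = curve D (t + dl * x)"
   using h(1)[of "t' + dl' * x"] c ht(1)[OF x] hinj by metis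
  show "off t (\<beta> (t' + dl' * x)) = dl * x"
  proof (cases "x = 0")
   case True
   then show ?thesis using bt off_self[of 0 t] by simp
  next
   case False
   then have "\<not> double_pair (curve D) (t + dl * x) (\<beta> (t' + dl' * x))"
    using double_pair_in_arcs(2)[OF st(1) v(1)] o(1) dx d(1) by (metis less_irrefl mult_eq_0_iff)
   then have "(t + dl * x) - \<beta> (t' + dl' * x) \<in> \<int>" using e by (simp add: double_pair_def)
   then show ?thesis using o(1) off_eq_iff by metis
  qed
  have e: "curve D (\<beta> (s' + dl' * x)) = curve D (s + dl * x)"
   using h(1)[of "s' + dl' * x"] c ht(2)[OF x] hinj by metis
  show "off s (\<beta> (s' + dl' * x)) = dl * x"
  proof (cases "x = 0")
   case True
   then show ?thesis using bt off_self[of 0 s] by simp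
  next
   case False
   then have "\<not> double_pair (curve D) (s + dl * x) (\<beta> (s' + dl' * x))"
    using double_pair_in_arcs(1)[OF st(1) v(1)] o(2) dx d(1) by (metis less_irrefl mult_eq_0_iff)
   then have "(s + dl * x) - \<beta> (s' + dl' * x) \<in> \<int>" using e by (simp add: double_pair_def)
   then show ?thesis using o(2) off_eq_iff by metis
  qed
 qed
 have off_iff: "off a (\<beta> u) = dl * x \<longleftrightarrow> off a' u = dl' * x"
  if x: "\<bar>x\<bar> <= \<mu>" and a: "a = t \<and> a' = t' \<or> a = s \<and> a' = s'" for x u a a'
 proof
  have l: "off a (\<beta> (a' + dl' * x)) = dl * x" using lin[OF x] a by blast
  have "\<bar>dl' * x\<bar> <= dl'" using x m d'(1) by (simp add: abs_mult mult_left_le)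
  then have o: "off a' (a' + dl' * x) = dl' * x" using d'(2) by auto
  assume "off a (\<beta> u) = dl * x"
  then have "\<beta> u - \<beta> (a' + dl' * x) \<in> \<int>" using l off_eq_iff by metis
  then show "off a' u = dl' * x" using o dpb off_eq_iff by metis
 next
  assume "off a' u = dl' * x"
  then obtain n where "u = a' + dl' * x + of_int n" by (metis off_decomp)
  then have "\<beta> u = \<beta> (a' + dl' * x) + of_int n" using reparam_int[OF \<beta>(1)] by metis
  then show "off a (\<beta> u) = dl * x" using lin[OF x] a by auto
 qed
 have near: "\<bar>off a (\<beta> u)\<bar> <= dl * \<mu> \<longleftrightarrow> \<bar>off a' u\<bar> <= dl' * \<mu>"
   "\<bar>off a' u\<bar> <= dl' * \<mu> ==> off a (\<beta> u) / dl = off a' u / dl'"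
   "\<bar>off a (\<beta> u)\<bar> = dl * \<mu> / 4 \<longleftrightarrow> \<bar>off a' u\<bar> = dl' * \<mu> / 4"
  if a: "a = t \<and> a' = t' \<or> a = s \<and> a' = s'" for a a' u
 proof -
  have 1: "off a (\<beta> u) = dl * (off a' u / dl')" if "\<bar>off a' u\<bar> <= dl' * \<mu>"
   by (rule off_iff[OF _ a, THEN iffD2]) (use that d'(1) in \<open>auto simp: abs_divide field_simps\<close>)
  have 2: "off a' u = dl' * (off a (\<beta> u) / dl)" if "\<bar>off a (\<beta> u)\<bar> <= dl * \<mu>"
   by (rule off_iff[OF _ a, THEN iffD1]) (use that d(1) in \<open>auto simp: abs_divide field_simps\<close>)
  show n: "\<bar>off a (\<beta> u)\<bar> <= dl * \<mu> \<longleftrightarrow> \<bar>off a' u\<bar> <= dl' * \<mu>"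
  proof
   assume l: "\<bar>off a (\<beta> u)\<bar> <= dl * \<mu>"
   then have "\<bar>off a (\<beta> u) / dl\<bar> <= \<mu>" using d(1) by (simp add: abs_divide field_simps)
   then show "\<bar>off a' u\<bar> <= dl' * \<mu>" 
    unfolding 2[OF l] using mult_left_mono[of _ \<mu> dl'] d'(1) by (simp only: abs_mult abs_of_pos less_imp_le)
  next
   assume l: "\<bar>off a' u\<bar> <= dl' * \<mu>"
   then have "\<bar>off a' u / dl'\<bar> <= \<mu>" using d'(1) by (simp add: abs_divide field_simps)
   then show "\<bar>off a (\<beta> u)\<bar> <= dl * \<mu>" 
    unfolding 1[OF l] using mult_left_mono[of _ \<mu> dl] d(1) by (simp only: abs_mult abs_of_pos less_imp_le)
  qed
  show 3: "off a (\<beta> u) / dl = off a' u / dl'" if "\<bar>off a' u\<bar> <= dl' * \<mu>"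
   using 1[OF that] d(1) by simp
  have pos: "0 < dl * \<mu>" "0 < dl' * \<mu>" using d(1) d'(1) m by auto
  show "\<bar>off a (\<beta> u)\<bar> = dl * \<mu> / 4 \<longleftrightarrow> \<bar>off a' u\<bar> = dl' * \<mu> / 4"
  proof (cases "\<bar>off a' u\<bar> <= dl' * \<mu>")
   case True
   have "\<bar>off a (\<beta> u)\<bar> / dl = \<bar>off a' u\<bar> / dl'" using arg_cong[OF 3[OF True], of abs] d(1) d'(1) by (simp add: abs_divide)
   then have e: "\<bar>off a (\<beta> u)\<bar> = dl * (\<bar>off a' u\<bar> / dl')" using d(1) by (simp add: field_simps)
   show ?thesis unfolding e using d(1) d'(1) by (auto simp: field_simps)
  next
   case False
   then show ?thesis using n pos by auto
  qed
 qed
 let ?A = "map_diagram (scale (1/\<mu>)) D" and ?A' = "map_diagram (scale (1/\<mu>)) D'"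
 let ?E = "twisted ?A t s (dl * \<mu>) sg" and ?E' = "twisted ?A' t' s' (dl' * \<mu>) sg'"
 have vA: "valid ?A" "valid ?A'"
  using valid_map[OF diffeo_scale] v m by simp_all
 have vE: "valid ?E" "valid ?E'"
  using valid_twisted straight_scale st v vA m by blast+
 have main: "isotopic_by \<beta> ?E ?E'"
 proof -
  let ?h = "scale (1/\<mu>) \<circ> (h \<circ> scale \<mu>)"
  have "isotopic_to_id ?h"
   using isotopic_to_id_compose \<beta>(2) diffeoD(1)[OF diffeo_scale] m by simp
  moreover have "curve ?E' u = ?h (curve ?E (\<beta> u)) \<and> label ?E' u = label ?E (\<beta> u)" for u
  proof
   show "label ?E' u = label ?E (\<beta> u)"
    using near(3)[of t t' u] near(3)[of s s' u] h(2) by (simp add: label_twisted)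
   show "curve ?E' u = ?h (curve ?E (\<beta> u))"
   proof (cases "\<bar>off s' u\<bar> <= dl' * \<mu>")
    case True
    define y where "y = off s' u / (dl' * \<mu>)"
    have y1: "\<bar>y\<bar> <= 1" using True d'(1) m by (simp add: y_def abs_divide)
    have "off s (\<beta> u) / (dl * \<mu>) = (off s (\<beta> u) / dl) / \<mu>" by simp
    also have "\<dots> = y" using near(2)[of s s' u] True by (simp add: y_def)
    finally have "curve ?E (\<beta> u) = cflip sg (hook y)"
     using near(1)[of s s' u] True by (simp add: curve_twisted)
    moreover have "curve ?E' u = cflip sg' (hook y)" using True by (simp add: curve_twisted y_def)
    moreover have "h (scale \<mu> (cflip sg (hook y))) = cflip sg' (cflip sg (scale \<mu> (cflip sg (hook y))))"
    proof (rule h(3))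
     have "\<bar>hook_x y\<bar> + \<bar>y - hook_x y\<bar> <= 1"
      using abs_hook_x[of y] abs_hook_y[of y] hook_outside[of y] y1
      by (cases "\<bar>y\<bar> <= 1/2") (auto simp: complex_eq_iff)
     moreover have "norm1 (scale \<mu> z) = \<mu> * norm1 z" "norm1 (cflip sg z) = norm1 z" for z
      using m(1) d(3) by (auto simp: norm1_def abs_mult distrib_left)
     then have "norm1 (scale \<mu> (cflip sg (hook y))) = \<mu> * (\<bar>hook_x y\<bar> + \<bar>y - hook_x y\<bar>)"
      by (simp add: norm1_def[of "hook y"])
     ultimately have "norm1 (scale \<mu> (cflip sg (hook y))) <= \<mu>" using m(1) by (simp add: mult_left_le)
     then show "norm (scale \<mu> (cflip sg (hook y))) < r" using norm1_bounds(1) m(3) by (meson le_less_trans order_trans)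
    qed
    moreover have "scale (1/\<mu>) (cflip sg' (cflip sg (scale \<mu> (cflip sg (hook y))))) = cflip sg' (hook y)"
     using m(1) d(4) by (simp add: complex_eq_iff mult.assoc[symmetric])
    ultimately show ?thesis by simp
   next
    case False
    then have F: "\<not> \<bar>off s (\<beta> u)\<bar> <= dl * \<mu>" using near(1)[of s s' u] by simp
    have "scale \<mu> (scale (1/\<mu>) z) = z" for z using m(1) by (simp add: complex_eq_iff)
    then show ?thesis using F False h(1)[of u] by (simp add: curve_twisted)
   qed
  qed
  ultimately show ?thesis
   unfolding isotopic_by_def using vE \<beta>(1) by blast
 qed
 have "isotopic_over \<alpha> ?E ?E'"
  unfolding isotopic_over_def
 proof (intro exI conjI allI impI)
  fix u assume "label ?E' u = Over"
  then have "label D' u ~= Plain" by (simp add: label_twisted split: if_splits)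
  then show "\<beta> u = \<alpha> u" by (rule h(4))
 qed (rule main)
 moreover have "isotopic_rel_over (twisted D t s dl sg) ?E" by (rule twisted_scale[OF st(1) v(1) m(1,2)])
 moreover have "isotopic_rel_over ?E' (twisted D' t' s' dl' sg')"
  by (rule isotopic_rel_over_sym[OF twisted_scale[OF st(2) v(2) m(1,2)]])
 ultimately show ?thesis using isotopic_over_rel_trans by blast
qed

text \<open>The diagram \<open>E\<close> arises from \<open>D\<close> by twisting the real crossing with over-passage \<open>t\<close>.\<close>

definition twist_at :: "real => diagram => diagram => bool" where
 "twist_at t D E \<longleftrightarrow> valid D \<and> label D t = Over \<and>
   (\<exists>h s dl sg. diffeo h \<and> straight (map_diagram h D) t s dl sg \<and>
    map_diagram h E = twisted (map_diagram h D) t s dl sg)"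

lemma twist_atE:
 assumes "twist_at t D E"
 obtains h s dl sg where "valid D" "label D t = Over" "diffeo h"
  "straight (map_diagram h D) t s dl sg" "map_diagram h E = twisted (map_diagram h D) t s dl sg"
  "valid (map_diagram h D)" "valid E"
  "label D s = Under" "double_pair (curve D) t s"
proof -
 obtain h s dl sg where h: "valid D" "label D t = Over" "diffeo h"
  "straight (map_diagram h D) t s dl sg" "map_diagram h E = twisted (map_diagram h D) t s dl sg"
  using assms unfolding twist_at_def by blast
 have v: "valid (map_diagram h D)" by (rule valid_map[OF h(3,1)])
 have "valid (map_diagram (inv h) (map_diagram h E))"
  unfolding h(5) by (intro valid_map[OF diffeo_inv[OF h(3)]] valid_twisted[OF h(4) v])
 then have vE: "valid E" using map_diagram_inv(1)[OF diffeoD(2)[OF h(3)]] by simp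
 have dp: "double_pair (curve (map_diagram h D)) t s" by (rule straight_double_pair[OF h(4) v])
 then have "double_pair (curve D) t s"
  using diffeoD(2)[OF h(3)] by (auto simp: double_pair_def bij_def inj_def)
 moreover have "label D s = Under"
  using validD(4)[OF v dp] h(2) by (auto simp: real_crossing_def virtual_crossing_def)
 ultimately show ?thesis using that h v vE by blast
qed

lemma twist_at_valid: "twist_at t D E ==> valid D" "twist_at t D E ==> valid E"
 by (erule twist_atE; simp)+

lemma twist_at_label:
 assumes "twist_at t D E" "label D u ~= Plain"
 shows "label E u = label D u"
proof -
 obtain h s dl sg where h: "diffeo h" "straight (map_diagram h D) t s dl sg"
  "map_diagram h E = twisted (map_diagram h D) t s dl sg" "valid (map_diagram h D)"
  using assms(1) by (auto elim: twist_atE)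
 have "label (map_diagram h E) u = (if \<bar>off s u\<bar> = dl/4 \<or> \<bar>off t u\<bar> = dl/4 then Virtual else label D u)"
  unfolding h(3) by (simp add: label_twisted)
 moreover have "\<not> (\<bar>off s u\<bar> = dl/4 \<or> \<bar>off t u\<bar> = dl/4)"
  using straight_curve(3,4)[OF h(2,4), of u] straightD(1)[OF h(2)] assms(2) by auto
 ultimately show ?thesis by simp
qed

lemma twist_at_Over_iff:
 assumes "twist_at t D E"
 shows "label E u = Over \<longleftrightarrow> label D u = Over" "label E u = Wen \<longleftrightarrow> label D u = Wen"
proof -
 obtain h s dl sg where h: "map_diagram h E = twisted (map_diagram h D) t s dl sg"
  using assms(1) by (auto elim: twist_atE)
 have l: "label E u = (if \<bar>off s u\<bar> = dl/4 \<or> \<bar>off t u\<bar> = dl/4 then Virtual else label D u)"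
  using arg_cong[OF h, of "\<lambda>D. label D u"] by (simp add: label_twisted)
 show "label E u = Over \<longleftrightarrow> label D u = Over" "label E u = Wen \<longleftrightarrow> label D u = Wen"
  using twist_at_label[OF assms, of u] by (auto simp: l)
qed

lemma twist_at_shift:
 assumes "twist_at t D E"
 shows "twist_at (t + of_int n) D E"
proof -
 obtain h s dl sg where h: "valid D" "label D t = Over" "diffeo h" "straight (map_diagram h D) t s dl sg"
  "map_diagram h E = twisted (map_diagram h D) t s dl sg" "valid (map_diagram h D)"
  using assms(1) by (auto elim: twist_atE)
 have "straight (map_diagram h D) (t + of_int n) s dl sg"
  using straight_shift[OF h(4,6), of n 0] by simp
 moreover have "label D (t + of_int n) = Over"
  using periodic_int[of "label D" t n] validD(2)[OF h(1)] h(2) by simp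
 moreover have "twisted (map_diagram h D) (t + of_int n) s dl sg = twisted (map_diagram h D) t s dl sg"
  by (simp add: twisted_def cong: if_cong)
 ultimately show ?thesis unfolding twist_at_def using h by metis
qed

text \<open>Twisting is well defined on isotopy classes of diagrams with named crossings.\<close>

theorem twist_at_unique:
 assumes iso: "isotopic_by \<alpha> D D'" and E: "twist_at (\<alpha> t) D E" and E': "twist_at t D' E'"
 shows "isotopic_over \<alpha> E E'"
proof -
 obtain h s dl sg where h: "valid D" "label D (\<alpha> t) = Over" "diffeo h"
  "straight (map_diagram h D) (\<alpha> t) s dl sg" "map_diagram h E = twisted (map_diagram h D) (\<alpha> t) s dl sg"
  "valid (map_diagram h D)" "valid E"
  "label D s = Under" "double_pair (curve D) (\<alpha> t) s"
  using E by (rule twist_atE)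
 obtain h' s' dl' sg' where h': "valid D'" "label D' t = Over" "diffeo h'"
  "straight (map_diagram h' D') t s' dl' sg'" "map_diagram h' E' = twisted (map_diagram h' D') t s' dl' sg'"
  "valid (map_diagram h' D')" "valid E'"
  "label D' s' = Under" "double_pair (curve D') t s'"
  using E' by (rule twist_atE)
 have "double_pair (curve D) (\<alpha> t) (\<alpha> s')" using isotopic_by_double_pair[OF iso] h'(9) by simp
 then have "\<not> double_pair (curve D) s (\<alpha> s')"
  using validD(3)[OF h(1), of s "\<alpha> t" "\<alpha> s'"] h(9) double_pair_sym by blast
 then have "s - \<alpha> s' \<in> \<int>"
  using h(9) \<open>double_pair (curve D) (\<alpha> t) (\<alpha> s')\<close> by (auto simp: double_pair_def)
 then obtain n where n: "\<alpha> s' = s + of_int n"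
  by (metis Ints_cases Ints_minus add.commute diff_add_cancel minus_diff_eq)
 have st: "straight (map_diagram h D) (\<alpha> t) (\<alpha> s') dl sg"
  using straight_shift[OF h(4,6), of 0 n] n by simp
 have tw: "twisted (map_diagram h D) (\<alpha> t) (\<alpha> s') dl sg = map_diagram h E"
  unfolding h(5) n by (simp add: twisted_def cong: if_cong)
 have iso': "isotopic_by \<alpha> (map_diagram h D) (map_diagram h' D')"
 proof -
  obtain k where k: "isotopic_to_id k" "\<And>u. curve D' u = k (curve D (\<alpha> u)) \<and> label D' u = label D (\<alpha> u)"
   using iso unfolding isotopic_by_def by blast
  have "isotopic_to_id (h' \<circ> (k \<circ> inv h))"
   using isotopic_to_id_compose isotopic_to_id_inv k(1) diffeoD(1) h(3) h'(3) by blast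
  moreover have "inv h (h z) = z" for z using diffeoD(2)[OF h(3)] by (simp add: bij_def)
  ultimately show ?thesis
   unfolding isotopic_by_def using h(6) h'(6) isotopic_byD(3)[OF iso] k(2)
   by (intro conjI exI[of _ "h' \<circ> (k \<circ> inv h)"]) auto
 qed
 have "label D (\<alpha> s') ~= Plain"
  using isotopic_byD(4)[OF iso, of s'] h'(8) by simp
 then have "isotopic_over \<alpha> (map_diagram h E) (map_diagram h' E')"
  using isotopic_over_twisted[OF st h'(4) iso' refl refl] h(2) unfolding tw h'(5) by simp
 moreover have "isotopic_rel_over E (map_diagram h E)" "isotopic_rel_over (map_diagram h' E') E'"
 proof -
  have r: "isotopic_rel_over F (map_diagram k F)" if "valid F" "diffeo k" for k F
   unfolding isotopic_rel_over_def using isotopic_by_map[OF that] by blast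
  show "isotopic_rel_over E (map_diagram h E)" using r h by blast
  show "isotopic_rel_over (map_diagram h' E') E'" using r h' isotopic_rel_over_sym by blast
 qed
 ultimately show ?thesis using isotopic_over_rel_trans by blast
qed

section \<open>Straightening a crossing\<close>

lemma has_vector_derivative_either:
 assumes f: "(f has_vector_derivative d) (at x)" and g: "(g has_vector_derivative d) (at x)"
  and e: "f x = g x" and h: "\<And>u. h u = f u \<or> h u = g u"
 shows "(h has_vector_derivative d) (at x)"
proof -
 have hx: "h x = f x" using e h[of x] by auto
 have F: "\<And>e. e > 0 ==> \<exists>d'>0. \<forall>y. norm (y - x) < d' --> norm (f y - f x - (y - x) *\<^sub>R d) <= e * norm (y - x)"
  and G: "\<And>e. e > 0 ==> \<exists>d'>0. \<forall>y. norm (y - x) < d' --> norm (g y - g x - (y - x) *\<^sub>R d) <= e * norm (y - x)"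
  using f g unfolding has_vector_derivative_def has_derivative_at_alt by blast+
 have "\<exists>d'>0. \<forall>y. norm (y - x) < d' --> norm (h y - h x - (y - x) *\<^sub>R d) <= \<epsilon> * norm (y - x)" if pos: "\<epsilon> > 0" for \<epsilon>
 proof -
  obtain d1 where d1: "d1 > 0" "\<forall>y. norm (y - x) < d1 --> norm (f y - f x - (y - x) *\<^sub>R d) <= \<epsilon> * norm (y - x)"
   using F[OF pos] by blast
  obtain d2 where d2: "d2 > 0" "\<forall>y. norm (y - x) < d2 --> norm (g y - g x - (y - x) *\<^sub>R d) <= \<epsilon> * norm (y - x)"
   using G[OF pos] by blast
  have "norm (h y - h x - (y - x) *\<^sub>R d) <= \<epsilon> * norm (y - x)" if "norm (y - x) < min d1 d2" for y
   using h[of y] d1(2) d2(2) that hx e by auto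
  then show ?thesis using d1(1) d2(1) by (intro exI[of _ "min d1 d2"]) auto
 qed
 moreover have "bounded_linear (\<lambda>t. t *\<^sub>R d)" by (rule bounded_linear_scaleR_left)
 ultimately show ?thesis unfolding has_vector_derivative_def has_derivative_at_alt by blast
qed

text \<open>A curve continued along its tangents outside \<open>[-w, w]\<close>.\<close>

definition tangent_ext :: "real => (real => complex) => (real => complex) => real => complex" where
 "tangent_ext w \<gamma> V u = \<gamma> (max (-w) (min w u)) + (u - max (-w) (min w u)) *\<^sub>R V (max (-w) (min w u))"

lemma tangent_ext_inside: "\<bar>u\<bar> <= w ==> tangent_ext w \<gamma> V u = \<gamma> u"
 by (auto simp: tangent_ext_def)

lemma tangent_ext_derivative:
 assumes V: "\<And>u. (\<gamma> has_vector_derivative V u) (at u)" and w: "0 < w"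
 shows "(tangent_ext w \<gamma> V has_vector_derivative V (max (-w) (min w u))) (at u)"
proof -
 have lin: "((\<lambda>u. \<gamma> c + (u - c) *\<^sub>R V c) has_vector_derivative V c) (at u)" for c u
  by (auto intro!: derivative_eq_intros)
 consider "\<bar>u\<bar> < w" | "w < u" | "u < - w" | "u = w" | "u = - w" by linarith
 then show ?thesis
 proof cases
  case 1
  then have c: "max (-w) (min w u) = u" by simp
  show ?thesis
   unfolding c by (rule has_vector_derivative_transform_within_open[OF V[of u], of "{-w<..<w}"])
    (use 1 in \<open>auto simp: tangent_ext_inside\<close>)
 next
  case 2
  then have c: "max (-w) (min w u) = w" using w by simp
  show ?thesis
   unfolding c by (rule has_vector_derivative_transform_within_open[OF lin[of w u], of "{w<..}"])
    (use 2 w in \<open>auto simp: tangent_ext_def\<close>)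
 next
  case 3
  then have c: "max (-w) (min w u) = - w" using w by simp
  show ?thesis
   unfolding c by (rule has_vector_derivative_transform_within_open[OF lin[of "-w" u], of "{..<-w}"])
    (use 3 w in \<open>auto simp: tangent_ext_def\<close>)
 next
  case 4
  have "((\<lambda>u. if u <= w then \<gamma> u else \<gamma> w + (u - w) *\<^sub>R V w) has_vector_derivative V w) (at w)"
   by (rule has_vector_derivative_either[OF V lin[of w]]) auto
  then have "(tangent_ext w \<gamma> V has_vector_derivative V w) (at w)"
   by (rule has_vector_derivative_transform_within_open[of _ _ _ "{-w<..}"])
    (use w in \<open>auto simp: tangent_ext_def\<close>)
  then show ?thesis using 4 w by simp
 next
  case 5
  have "((\<lambda>u. if - w <= u then \<gamma> u else \<gamma> (-w) + (u - (-w)) *\<^sub>R V (-w)) has_vector_derivative V (-w)) (at (-w))"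
   by (rule has_vector_derivative_either[OF V lin[of "-w"]]) auto
  then have "(tangent_ext w \<gamma> V has_vector_derivative V (-w)) (at (-w))"
   by (rule has_vector_derivative_transform_within_open[of _ _ _ "{..<w}"])
    (use w in \<open>auto simp: tangent_ext_def\<close>)
  then show ?thesis using 5 w by simp
 qed
qed

lemma tangent_ext_near_linear:
 assumes V: "\<And>u. (\<gamma> has_vector_derivative V u) (at u)" and w: "0 < w"
  and \<epsilon>: "\<And>u. \<bar>u\<bar> <= w ==> norm (V u - V 0) <= \<epsilon>"
 shows "norm ((tangent_ext w \<gamma> V x - x *\<^sub>R V 0) - (tangent_ext w \<gamma> V y - y *\<^sub>R V 0)) <= \<epsilon> * \<bar>x - y\<bar>"
proof -
 let ?c = "\<lambda>u. max (-w) (min w u)"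
 have "norm ((tangent_ext w \<gamma> V x - x *\<^sub>R V 0) - (tangent_ext w \<gamma> V y - y *\<^sub>R V 0)) <= \<epsilon> * norm (x - y)"
 proof (rule differentiable_bound[where S = UNIV and f' = "\<lambda>u t. t *\<^sub>R (V (?c u) - V 0)"])
  show "((\<lambda>u. tangent_ext w \<gamma> V u - u *\<^sub>R V 0) has_derivative (\<lambda>t. t *\<^sub>R (V (?c u) - V 0))) (at u within UNIV)" for u
  proof -
   have "((\<lambda>u. tangent_ext w \<gamma> V u - u *\<^sub>R V 0) has_vector_derivative (V (?c u) - V 0)) (at u)"
    by (intro has_vector_derivative_diff tangent_ext_derivative[OF V w]) (auto intro!: derivative_eq_intros)
   then show ?thesis by (simp add: has_vector_derivative_def)
  qed
  show "onorm (\<lambda>t. t *\<^sub>R (V (?c u) - V 0)) <= \<epsilon>" for u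
  proof (rule onorm_le)
   have n: "norm (V (?c u) - V 0) <= \<epsilon>" by (rule \<epsilon>) (use w in auto)
   then show "norm (t *\<^sub>R (V (?c u) - V 0)) <= \<epsilon> * norm t" for t
    using mult_right_mono[OF n abs_ge_zero[of t]] by (simp add: mult.commute)
  qed
 qed auto
 then show ?thesis by simp
qed

lemma abs_cross_le: "\<bar>cross p q\<bar> <= norm p * norm q"
proof -
 have "cross p q = Im (cnj p * q)" by (simp add: cross_def)
 then show ?thesis using abs_Im_le_cmod[of "cnj p * q"] by (simp add: norm_mult)
qed

text \<open>
 Two transversal curves through a point are the coordinate axes of the chart \<open>(u, v) \<mapsto> \<gamma>\<^sub>1 u + \<gamma>\<^sub>2 v - x\<close>.
 With the curves continued along tangents this map is Lipschitz-close to its derivative at the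
 origin, hence a diffeomorphism of the whole plane.
\<close>

lemma transversal_chart:
 fixes \<gamma>1 \<gamma>2 V1 V2 :: "real => complex"
 assumes V: "\<And>u. (\<gamma>1 has_vector_derivative V1 u) (at u)" "\<And>u. (\<gamma>2 has_vector_derivative V2 u) (at u)"
  and cont: "continuous_on UNIV V1" "continuous_on UNIV V2"
  and x: "\<gamma>1 0 = x" "\<gamma>2 0 = x" and c: "cross (V1 0) (V2 0) > 0"
 obtains F w where "diffeo F" "0 < w"
  "\<And>u. \<bar>u\<bar> <= w ==> F (Complex u 0) = \<gamma>1 u" "\<And>u. \<bar>u\<bar> <= w ==> F (Complex 0 u) = \<gamma>2 u"
proof -
 define a b d where "a = V1 0" and "b = V2 0" and "d = cross a b"
 have d: "d > 0" using c by (simp add: a_def b_def d_def)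
 define N where "N = norm a + norm b + 1"
 have N: "N \<ge> 1" "norm a + norm b <= N" by (auto simp: N_def)
 \<comment> \<open>Then \<open>F\<close>, followed by the inverse \<open>Li\<close> of its derivative at the origin, differs from the identity by a map with Lipschitz constant 1/2.\<close>
 define \<epsilon> where "\<epsilon> = min 1 (d / (4 * N))"
 have \<epsilon>: "\<epsilon> > 0" "\<epsilon> <= 1" "\<epsilon> * N <= d / 4"
  using d N by (auto simp: \<epsilon>_def min_def field_simps)
 have "\<exists>e>0. \<forall>u. \<bar>u\<bar> < e --> norm (V u - V 0) <= \<epsilon>" if "continuous_on UNIV V" for V :: "real => complex"
 proof -
  have "isCont V 0" using that by (simp add: continuous_on_eq_continuous_at)
  then obtain e where "e > 0" "\<forall>u. dist u 0 < e --> dist (V u) (V 0) < \<epsilon>"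
   unfolding continuous_at_eps_delta using \<epsilon>(1) by metis
  then show ?thesis by (auto simp: dist_norm less_imp_le)
 qed
 then obtain e1 e2 where e: "e1 > 0" "e2 > 0" "\<And>u. \<bar>u\<bar> < e1 ==> norm (V1 u - a) <= \<epsilon>"
  "\<And>u. \<bar>u\<bar> < e2 ==> norm (V2 u - b) <= \<epsilon>"
  using cont unfolding a_def b_def by metis
 define w where "w = min e1 e2 / 2"
 have w: "0 < w" "\<And>u. \<bar>u\<bar> <= w ==> norm (V1 u - V1 0) <= \<epsilon>" "\<And>u. \<bar>u\<bar> <= w ==> norm (V2 u - V2 0) <= \<epsilon>"
  using e by (auto simp: w_def a_def b_def)
 let ?c = "\<lambda>u. max (-w) (min w u)"
 have cl: "\<bar>?c u\<bar> <= w" for u using w(1) by auto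
 define f1 f2 where "f1 = tangent_ext w \<gamma>1 V1" and "f2 = tangent_ext w \<gamma>2 V2"
 define F where "F z = f1 (Re z) + f2 (Im z) - x" for z
 define L where "L z = Re z *\<^sub>R a + Im z *\<^sub>R b" for z
 define Li where "Li z = Complex (cross z b / d) (cross a z / d)" for z
 have LLi: "L (Li z) = z" for z
 proof -
  have "d *\<^sub>R L (Li z) = cross z b *\<^sub>R a + cross a z *\<^sub>R b"
   using d by (simp add: L_def Li_def scaleR_add_right)
  also have "\<dots> = d *\<^sub>R z"
   by (simp add: complex_eq_iff cross_def d_def algebra_simps)
  finally show ?thesis using d by simp
 qed
 have LiL: "Li (L z) = z" for z
 proof -
  have "cross (L z) b = Re z * d" "cross a (L z) = Im z * d"
   by (simp_all add: L_def cross_def d_def algebra_simps)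
  then show ?thesis using d by (simp add: Li_def complex_eq_iff)
 qed
 have Li_diff: "Li p - Li q = Li (p - q)" for p q
 proof -
  have "cross (p - q) b = cross p b - cross q b" "cross a (p - q) = cross a p - cross a q"
   by (simp_all add: cross_def algebra_simps)
  then show ?thesis by (simp add: Li_def complex_eq_iff diff_divide_distrib)
 qed
 have Li_bound: "norm (Li p) <= N / d * norm p" for p
 proof -
  have "norm (Li p) <= \<bar>cross p b / d\<bar> + \<bar>cross a p / d\<bar>" using cmod_le[of "Li p"] by (simp add: Li_def)
  also have "\<dots> <= (norm p * norm b) / d + (norm a * norm p) / d"
   using d abs_cross_le[of p b] abs_cross_le[of a p] by (intro add_mono) (simp_all add: abs_divide divide_right_mono)
  also have "\<dots> = (norm a + norm b) / d * norm p" using d by (simp add: field_simps)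
  also have "\<dots> <= N / d * norm p" using N(2) d by (intro mult_right_mono divide_right_mono) auto
  finally show ?thesis .
 qed
 define g where "g z = Li (F z - x) - z" for z
 have g_lip: "dist (g z) (g z') <= dist z z' / 2" for z z'
 proof -
  have x2: "F z - x - L z - (F z' - x - L z') =
   ((f1 (Re z) - Re z *\<^sub>R V1 0) - (f1 (Re z') - Re z' *\<^sub>R V1 0)) + ((f2 (Im z) - Im z *\<^sub>R V2 0) - (f2 (Im z') - Im z' *\<^sub>R V2 0))"
   by (simp add: F_def L_def a_def b_def)
  have "norm (F z - x - L z - (F z' - x - L z')) <= \<epsilon> * \<bar>Re z - Re z'\<bar> + \<epsilon> * \<bar>Im z - Im z'\<bar>"
   unfolding x2 f1_def f2_def
   by (rule norm_triangle_mono[OF tangent_ext_near_linear[OF V(1) w(1,2)] tangent_ext_near_linear[OF V(2) w(1,3)]])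
  also have "\<dots> <= \<epsilon> * norm (z - z') + \<epsilon> * norm (z - z')"
   using \<epsilon>(1) abs_Re_le_cmod[of "z - z'"] abs_Im_le_cmod[of "z - z'"] by (intro add_mono mult_left_mono) auto
  finally have q: "norm (F z - x - L z - (F z' - x - L z')) <= 2 * \<epsilon> * norm (z - z')" by simp
  have "g z = Li (F z - x - L z)" for z
   using Li_diff[of "F z - x" "L z"] LiL by (simp add: g_def)
  then have "g z - g z' = Li (F z - x - L z - (F z' - x - L z'))" using Li_diff by simp
  then have "norm (g z - g z') <= N / d * (2 * \<epsilon> * norm (z - z'))"
   using Li_bound q N(1) d by (smt (verit) divide_nonneg_nonneg mult_left_mono)
  also have "\<dots> = (2 * (\<epsilon> * N) / d) * norm (z - z')" by (simp add: field_simps)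
  also have "\<dots> <= (1/2) * norm (z - z')"
   using \<epsilon>(3) d by (intro mult_right_mono) (auto simp: field_simps)
  finally show ?thesis by (simp add: dist_norm)
 qed
 have a0: "a ~= 0" using d by (auto simp: d_def cross_def)
 have "isotopic_to_id L"
 proof -
  have "Im (b / a) = d / (norm a)\<^sup>2"
   by (simp add: Im_divide d_def cross_def cmod_power2 algebra_simps)
  then have "Im (b / a) > 0" using d a0 by simp
  then have "isotopic_to_id ((\<lambda>z. a * z) \<circ> (\<lambda>z. of_real (Re z) + (b / a) * of_real (Im z)))"
   by (intro isotopic_to_id_compose isotopic_to_id_mult isotopic_to_id_shear a0)
  moreover have "(\<lambda>z. a * z) \<circ> (\<lambda>z. of_real (Re z) + (b / a) * of_real (Im z)) = L"
   using a0 by (simp add: fun_eq_iff L_def scaleR_conv_of_real algebra_simps)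
  ultimately show ?thesis by simp
 qed
 then have "isotopic_to_id ((\<lambda>z. x + z) \<circ> (L \<circ> (\<lambda>z. z + g z)))"
  by (intro isotopic_to_id_compose isotopic_to_id_translate isotopic_to_id_perturbation g_lip)
 moreover have "(\<lambda>z. x + z) \<circ> (L \<circ> (\<lambda>z. z + g z)) = F"
  by (simp add: fun_eq_iff g_def LLi)
 ultimately have "isotopic_to_id F" by simp
 moreover have "(F has_derivative (\<lambda>h. Re h *\<^sub>R V1 (?c (Re z)) + Im h *\<^sub>R V2 (?c (Im z)))) (at z)" for z
 proof -
  have "((\<lambda>z. f1 (Re z)) has_derivative (\<lambda>h. Re h *\<^sub>R V1 (?c (Re z)))) (at z)"
   using diff_chain_at[OF bounded_linear_imp_has_derivative[OF bounded_linear_Re]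
     tangent_ext_derivative[OF V(1) w(1), of "Re z", unfolded has_vector_derivative_def]]
   by (simp add: f1_def comp_def)
  moreover have "((\<lambda>z. f2 (Im z)) has_derivative (\<lambda>h. Im h *\<^sub>R V2 (?c (Im z)))) (at z)"
   using diff_chain_at[OF bounded_linear_imp_has_derivative[OF bounded_linear_Im]
     tangent_ext_derivative[OF V(2) w(1), of "Im z", unfolded has_vector_derivative_def]]
   by (simp add: f2_def comp_def)
  ultimately show ?thesis unfolding F_def[abs_def] by (auto intro!: derivative_eq_intros)
 qed
 moreover have "continuous_on UNIV (\<lambda>z. V1 (?c (Re z)))" "continuous_on UNIV (\<lambda>z. V2 (?c (Im z)))"
  by (rule continuous_on_compose2[OF cont(1)] continuous_on_compose2[OF cont(2)]; auto intro!: continuous_intros)+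
 moreover have "cross (V1 (?c u)) (V2 (?c v)) ~= 0" for u v
 proof -
  define p q where "p = V1 (?c u) - a" and "q = V2 (?c v) - b"
  have pq: "norm p <= \<epsilon>" "norm q <= \<epsilon>" using w(2,3)[OF cl] by (auto simp: p_def q_def a_def b_def)
  have "cross (V1 (?c u)) (V2 (?c v)) = d + (cross p b + cross a q + cross p q)"
   by (simp add: p_def q_def d_def cross_def algebra_simps)
  moreover have "\<bar>cross p b\<bar> <= \<epsilon> * norm b"
   by (rule order_trans[OF abs_cross_le mult_right_mono[OF pq(1) norm_ge_zero]])
  moreover have "\<bar>cross a q\<bar> <= \<epsilon> * norm a"
   using abs_cross_le[of a q] mult_right_mono[OF pq(2) norm_ge_zero[of a]] by (simp add: mult.commute)
  moreover have "\<bar>cross p q\<bar> <= \<epsilon> * 1"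
   by (rule order_trans[OF abs_cross_le mult_mono[OF pq(1) order_trans[OF pq(2) \<epsilon>(2)]]]) (use \<epsilon> in auto)
  moreover have "\<epsilon> * norm b + \<epsilon> * norm a + \<epsilon> * 1 = \<epsilon> * N" by (simp add: N_def algebra_simps)
  moreover have "x ~= 0" if "x = d + (x1 + x2 + x3)" "\<bar>x1\<bar> <= y1" "\<bar>x2\<bar> <= y2" "\<bar>x3\<bar> <= y3"
    "y1 + y2 + y3 = y" "y <= d / 4" for x x1 x2 x3 y1 y2 y3 y
   using that d by linarith
  ultimately show ?thesis using \<epsilon>(3) by metis
 qed
 ultimately have "diffeo F" unfolding diffeo_def by blast
 then show ?thesis
 proof (rule that[OF _ w(1)])
  show "F (Complex u 0) = \<gamma>1 u" if "\<bar>u\<bar> <= w" for u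
   using tangent_ext_inside[OF that, of \<gamma>1 V1] tangent_ext_inside[of 0 w \<gamma>2 V2] w(1) x(2)
   by (simp add: F_def f1_def f2_def)
  show "F (Complex 0 u) = \<gamma>2 u" if "\<bar>u\<bar> <= w" for u
   using tangent_ext_inside[OF that, of \<gamma>2 V2] tangent_ext_inside[of 0 w \<gamma>1 V1] w(1) x(1)
   by (simp add: F_def f1_def f2_def)
 qed
qed

lemma frac_mod: "off a (frac u) = off a u"
 using off_add_int[of a "frac u" "\<lfloor>u\<rfloor>"] by (simp add: frac_def)

lemma frac_periodic:
 fixes f :: "real => 'a"
 assumes "\<And>t. f (t + 1) = f t"
 shows "f (frac u) = f u"
 using periodic_int[of f "frac u" "\<lfloor>u\<rfloor>"] assms by (simp add: frac_def)

lemma finite_labels: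
 assumes "valid D"
 shows "finite {u \<in> {0..<1}. label D u ~= Plain}"
proof (rule finite_subset)
 show "{u \<in> {0..<1}. label D u ~= Plain} \<subseteq>
  {u \<in> {0..<1}. \<exists>s. double_pair (curve D) s u} \<union> {u \<in> {0..<1}. label D u = Wen}"
 proof
  fix u assume "u \<in> {u \<in> {0..<1}. label D u ~= Plain}"
  then show "u \<in> {u \<in> {0..<1}. \<exists>s. double_pair (curve D) s u} \<union> {u \<in> {0..<1}. label D u = Wen}"
   using validD(5)[OF assms, of u] by (cases "label D u") auto
 qed
qed (use validD(6,7)[OF assms] in blast)

text \<open>
 Up to the period only finitely many parameters carry marks, so marks do not accumulate.
\<close>

lemma label_gap:
 assumes v: "valid D"
 obtains w where "0 < w" "w < 1/2" "\<And>u. label D u ~= Plain ==> off t u ~= 0 ==> w < \<bar>off t u\<bar>"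
proof -
 define S where "S = (\<lambda>u. \<bar>off t u\<bar>) ` {u \<in> {0..<1}. label D u ~= Plain} - {0}"
 have fin: "finite S" unfolding S_def using finite_labels[OF v] by blast
 define m where "m = Min (insert (1/2) S)"
 have "m \<in> insert (1/2) S" unfolding m_def by (rule Min_in) (use fin in auto)
 moreover have "y > 0" if "y \<in> insert (1/2) S" for y using that by (auto simp: S_def)
 ultimately have m0: "m > 0" by blast
 have m1: "m <= y" if "y \<in> insert (1/2) S" for y unfolding m_def by (rule Min_le) (use fin that in auto)
 have "m <= \<bar>off t u\<bar>" if "label D u ~= Plain" "off t u ~= 0" for u
 proof (rule m1)
  have "frac u \<in> {u \<in> {0..<1}. label D u ~= Plain}"
   using that(1) frac_periodic[of "label D" u] validD(2)[OF v] frac_lt_1[of u] by auto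
  then show "\<bar>off t u\<bar> \<in> insert (1/2) S"
   unfolding S_def using that(2) frac_mod[of t u] by (metis (no_types, lifting) DiffI abs_eq_0_iff image_eqI insertI2 singletonD)
 qed
 then have "m/2 < \<bar>off t u\<bar>" if "label D u ~= Plain" "off t u ~= 0" for u using that m0 by force
 then show ?thesis using that[of "m/2"] m0 m1[of "1/2"] by auto
qed

lemma open_off_less: "c <= 1/2 ==> open {u. \<bar>off a u\<bar> < c}"
proof (subst open_subopen, intro ballI)
 fix u assume c: "c <= 1/2" and "u \<in> {u. \<bar>off a u\<bar> < c}"
 then obtain n where n: "u \<in> {a + of_int n - c <..< a + of_int n + c}"
  "\<forall>w\<in>{a + of_int n - c <..< a + of_int n + c}. off a w = w - a - of_int n"
  using off_locally[of a u c] by blast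
 then have "{a + of_int n - c <..< a + of_int n + c} \<subseteq> {u. \<bar>off a u\<bar> < c}" by auto
 then show "\<exists>T. open T \<and> u \<in> T \<and> T \<subseteq> {u. \<bar>off a u\<bar> < c}"
  using n(1) open_greaterThanLessThan by blast
qed

lemma continuous_curve:
 assumes "valid D"
 shows "continuous_on UNIV (curve D)"
proof -
 obtain V where "\<And>t. (curve D has_vector_derivative V t) (at t)"
  using valid_velocity[OF assms] by metis
 then show ?thesis
  by (meson continuous_at_imp_continuous_on has_vector_derivative_continuous)
qed

text \<open>
 By compactness, the curve comes close to a double point only at parameters close to its two
 passages.
\<close>

lemma curve_avoids:
 assumes v: "valid D" and w: "0 < w" "w <= 1/2"
  and x: "\<And>u. curve D u = x ==> off t u = 0 \<or> off s u = 0"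
 shows "\<exists>U. open U \<and> x \<in> U \<and> (\<forall>u. curve D u \<in> U --> \<bar>off t u\<bar> < w \<or> \<bar>off s u\<bar> < w)"
proof -
 define K where "K = {0..1} \<inter> (- {u. \<bar>off t u\<bar> < w} \<inter> - {u. \<bar>off s u\<bar> < w})"
 have "compact K"
  unfolding K_def using open_off_less[OF w(2)]
  by (intro compact_Int_closed closed_Int) (auto simp: closed_Compl)
 then have "compact (curve D ` K)"
  by (intro compact_continuous_image continuous_on_subset[OF continuous_curve[OF v]]) auto
 then have "open (- (curve D ` K))" by (simp add: compact_imp_closed open_Compl)
 moreover have "x \<notin> curve D ` K" using x w(1) by (fastforce simp: K_def)
 moreover have "\<bar>off t u\<bar> < w \<or> \<bar>off s u\<bar> < w" if "curve D u \<in> - (curve D ` K)" for u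
 proof (rule ccontr)
  assume "\<not> (\<bar>off t u\<bar> < w \<or> \<bar>off s u\<bar> < w)"
  then have "frac u \<in> K" using frac_mod[of t u] frac_mod[of s u] frac_lt_1[of u] by (simp add: K_def)
  then have "curve D (frac u) \<in> curve D ` K" by blast
  then show False using that frac_periodic[of "curve D" u] validD(1)[OF v] by simp
 qed
 ultimately show ?thesis by blast
qed

lemma small_scale:
 assumes "continuous_on UNIV F" "open W" "F 0 \<in> W"
 obtains d where "0 < d" "\<And>dl z. 0 < dl ==> dl <= d ==> z \<in> disk ==> F (scale dl z) \<in> W"
proof -
 have "open (F -` W)" using assms(1,2) by (simp add: continuous_on_open_vimage)
 then obtain e where e: "e > 0" "ball 0 e \<subseteq> F -` W" using assms(3) open_contains_ball by blast
 have "F (scale dl z) \<in> W" if "0 < dl" "dl <= e/3" "z \<in> disk" for dl z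
 proof -
  have "norm z <= 2" using that(3) cmod_le[of z] by (auto simp: mem_disk_iff)
  have "norm (scale dl z) = dl * norm z" using that(1) by (simp add: scale_def norm_mult)
  also have "\<dots> <= e/3 * 2" by (intro mult_mono) (use that e \<open>norm z <= 2\<close> in auto)
  finally have "norm (scale dl z) <= e/3 * 2" .
  then have "scale dl z \<in> ball 0 e" using e by simp
  then show ?thesis using e by blast
 qed
 then show ?thesis using that[of "e/3"] e by simp
qed

text \<open>
 Charts around a crossing. The chart only depends on the two short arcs; it straightens every
 diagram that contains these arcs and stays away from the crossing otherwise.
\<close>

definition crossing_chart ::
 "(complex => complex) => diagram => real => real => real => real => complex set => bool" where
 "crossing_chart F D t s w sg U \<longleftrightarrow> diffeo F \<and> 0 < w \<and> w < 1/4 \<and> sg \<in> {1, -1} \<and>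
   (\<forall>u. \<bar>u\<bar> <= w --> curve D (t + u) = F (Complex u 0) \<and> curve D (s + u) = F (Complex 0 (sg * u))) \<and>
   (\<forall>u. \<bar>u\<bar> <= w \<and> u ~= 0 --> label D (t + u) = Plain \<and> label D (s + u) = Plain) \<and>
   open U \<and> F 0 \<in> U \<and> (\<forall>u. curve D u \<in> U --> \<bar>off t u\<bar> <= w \<or> \<bar>off s u\<bar> <= w)"

lemma crossing_chart_exists:
 assumes v: "valid D" and dp: "double_pair (curve D) t s" and w0: "0 < w0"
 obtains F w sg U where "crossing_chart F D t s w sg U" "w <= w0"
proof -
 obtain V where V: "\<And>t. (curve D has_vector_derivative V t) (at t)" "continuous_on UNIV V"
  "\<And>t. V t ~= 0" "\<And>s t. double_pair (curve D) s t ==> cross (V s) (V t) ~= 0"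
  using valid_velocity[OF v] by metis
 \<comment> \<open>Charts preserve the orientation, so the second strand is reversed if necessary.\<close>
 define sg where "sg = (if cross (V t) (V s) > 0 then 1 else -1 :: real)"
 have s1: "sg \<in> {1, -1}" "sg * sg = 1" by (auto simp: sg_def)
 have "cross (V t) (sg *\<^sub>R V s) = sg * cross (V t) (V s)" by (simp add: cross_def algebra_simps)
 then have pos: "cross (V t) (sg *\<^sub>R V s) > 0" using V(4)[OF dp] by (auto simp: sg_def)
 have d1: "((\<lambda>u. curve D (t + u)) has_vector_derivative V (t + u)) (at u)" for u
 proof -
  have "((\<lambda>u. t + u) has_vector_derivative 1) (at u)"
   by (auto intro!: derivative_eq_intros simp flip: has_real_derivative_iff_has_vector_derivative)
  then show ?thesis using vector_diff_chain_at[OF _ V(1)] by (force simp: comp_def)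
 qed
 have d2: "((\<lambda>u. curve D (s + sg * u)) has_vector_derivative sg *\<^sub>R V (s + sg * u)) (at u)" for u
 proof -
  have "((\<lambda>u. s + sg * u) has_vector_derivative sg) (at u)"
   by (auto intro!: derivative_eq_intros simp flip: has_real_derivative_iff_has_vector_derivative)
  then show ?thesis using vector_diff_chain_at[OF _ V(1)] by (force simp: comp_def)
 qed
 have c1: "continuous_on UNIV (\<lambda>u. V (t + u))"
  by (rule continuous_on_compose2[OF V(2)]) (auto intro!: continuous_intros)
 have c2: "continuous_on UNIV (\<lambda>u. sg *\<^sub>R V (s + sg * u))"
  by (intro continuous_intros continuous_on_compose2[OF V(2)]) auto
 have e: "curve D t = curve D s" "t - s \<notin> \<int>" using dp by (auto simp: double_pair_def)
 obtain F w1 where F: "diffeo F" "0 < w1"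
  "\<And>u. \<bar>u\<bar> <= w1 ==> F (Complex u 0) = curve D (t + u)"
  "\<And>u. \<bar>u\<bar> <= w1 ==> F (Complex 0 u) = curve D (s + sg * u)"
  by (rule transversal_chart[OF d1 d2 c1 c2, of "curve D t"]) (use e pos in auto)
 obtain w2 where w2: "0 < w2" "w2 < 1/2" "\<And>u. label D u ~= Plain ==> off t u ~= 0 ==> w2 < \<bar>off t u\<bar>"
  by (rule label_gap[OF v, of t]) blast
 obtain w3 where w3: "0 < w3" "w3 < 1/2" "\<And>u. label D u ~= Plain ==> off s u ~= 0 ==> w3 < \<bar>off s u\<bar>"
  by (rule label_gap[OF v, of s]) blast
 define w where "w = min (1/5) (min w0 (min w1 (min w2 w3)))"
 have w: "0 < w" "w < 1/4" "w <= w0" "w <= w1" "w <= w2" "w <= w3"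
  using w0 F(2) w2(1) w3(1) unfolding w_def by simp_all
 have x: "off t u = 0 \<or> off s u = 0" if "curve D u = curve D t" for u
 proof -
  have "\<not> (double_pair (curve D) u t \<and> double_pair (curve D) t s \<and> double_pair (curve D) u s)"
   by (rule validD(3)[OF v])
  then have "u - t \<in> \<int> \<or> u - s \<in> \<int>" using dp that e by (auto simp: double_pair_def)
  then show ?thesis
   using off_eq_iff[of t u t] off_eq_iff[of s u s] off_self[of 0 t] off_self[of 0 s] by auto
 qed
 obtain U where U: "open U" "curve D t \<in> U" "\<And>u. curve D u \<in> U ==> \<bar>off t u\<bar> < w \<or> \<bar>off s u\<bar> < w"
 proof -
  have "w <= 1/2" using w(2) by simp
  then show thesis using curve_avoids[OF v w(1) _ x] that by blast
 qed
 have "curve D (t + u) = F (Complex u 0) \<and> curve D (s + u) = F (Complex 0 (sg * u))" if "\<bar>u\<bar> <= w" for u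
 proof -
  have "\<bar>sg * u\<bar> <= w1" "\<bar>u\<bar> <= w1" using that s1 w by auto
  then show ?thesis using F(3,4) s1 by (simp add: mult.assoc[symmetric])
 qed
 moreover have "label D (t + u) = Plain \<and> label D (s + u) = Plain" if "\<bar>u\<bar> <= w \<and> u ~= 0" for u
 proof -
  have "off t (t + u) = u" "off s (s + u) = u" using that w by auto
  then show ?thesis using w2(3)[of "t + u"] w3(3)[of "s + u"] that w by force
 qed
 moreover have "F 0 = curve D t" using F(3)[of 0] F(2) by (simp add: zero_complex.code[symmetric])
 moreover have "\<bar>off t u\<bar> <= w \<or> \<bar>off s u\<bar> <= w" if "curve D u \<in> U" for u using U(3)[OF that] by linarith
 ultimately have "crossing_chart F D t s w sg U"
  unfolding crossing_chart_def using F(1) w s1 U(1,2) by simp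
 then show ?thesis using that w by blast
qed

lemma crossing_chart_straight:
 assumes ch: "crossing_chart F D t s w sg U" and v: "valid D"
  and dl: "0 < dl" "dl <= w" and U: "\<And>z. z \<in> disk ==> F (scale dl z) \<in> U"
 shows "straight (map_diagram (scale (1/dl) \<circ> inv F) D) t s dl sg"
proof -
 note c = ch[unfolded crossing_chart_def]
 have Fi: "inv F (F z) = z" "F (inv F z) = z" for z
  using diffeoD(2)[of F] c by (auto simp: bij_def surj_f_inv_f)
 have sc: "scale (1/dl) (scale dl z) = z" "scale dl (scale (1/dl) z) = z" for z
  using dl(1) by (simp_all add: complex_eq_iff)
 let ?h = "scale (1/dl) \<circ> inv F"
 have x: "\<bar>dl * x\<bar> <= w" if "\<bar>x\<bar> <= 1" for x
 proof -
  have "\<bar>dl * x\<bar> <= dl * 1" using that dl(1) by (simp add: abs_mult)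
  then show ?thesis using dl(2) by simp
 qed
 have cv: "?h (curve D (t + dl * x)) = Complex x 0" "?h (curve D (s + dl * x)) = Complex 0 (sg * x)" if "\<bar>x\<bar> <= 1" for x
 proof -
  have "curve D (t + dl * x) = F (Complex (dl * x) 0)" "curve D (s + dl * x) = F (Complex 0 (sg * (dl * x)))"
   using c x[OF that] by blast+
  then have e: "inv F (curve D (t + dl * x)) = Complex (dl * x) 0" "inv F (curve D (s + dl * x)) = Complex 0 (sg * (dl * x))"
   by (simp_all only: Fi)
  show "?h (curve D (t + dl * x)) = Complex x 0" unfolding comp_apply e using dl(1) by (simp add: complex_eq_iff)
  show "?h (curve D (s + dl * x)) = Complex 0 (sg * x)" unfolding comp_apply e using dl(1) by (simp add: complex_eq_iff)
 qed
 have "\<bar>off t u\<bar> <= dl \<or> \<bar>off s u\<bar> <= dl" if d: "?h (curve D u) \<in> disk" for u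
 proof -
  have "F (scale dl (?h (curve D u))) \<in> U" by (rule U[OF d])
  then have "curve D u \<in> U" by (simp add: sc Fi)
  then consider "\<bar>off t u\<bar> <= w" | "\<bar>off s u\<bar> <= w" using c by blast
  then show ?thesis
  proof cases
   case 1
   have "curve D u = curve D (t + off t u)" by (rule periodic_off) (rule validD(1)[OF v])
   also have "\<dots> = F (Complex (off t u) 0)" using c 1 by blast
   finally have "Re (?h (curve D u)) = off t u / dl" by (simp add: Fi)
   then show ?thesis using d dl(1) by (auto simp: mem_disk_iff abs_divide)
  next
   case 2
   have "curve D u = curve D (s + off s u)" by (rule periodic_off) (rule validD(1)[OF v])
   also have "\<dots> = F (Complex 0 (sg * off s u))" using c 2 by blast
   finally have "Im (?h (curve D u)) = sg * off s u / dl" by (simp add: Fi)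
   then show ?thesis using d dl(1) c by (auto simp: mem_disk_iff abs_divide)
  qed
 qed
 then show ?thesis
  unfolding straight_def using cv c x dl by (auto simp del: comp_apply)
qed

text \<open>
 The effect of a twist on the diagram itself: the under-strand is rerouted along \<open>f\<close> near \<open>s\<close>. One
 patch serves for all diagrams that look alike near the crossing.
\<close>

definition patch :: "diagram => real => real => real => (real => complex) => diagram" where
 "patch D t s \<eta> f = Diagram
   (\<lambda>u. if \<bar>off s u\<bar> <= \<eta> then f (off s u) else curve D u)
   (\<lambda>u. if \<bar>off s u\<bar> = \<eta>/4 \<or> \<bar>off t u\<bar> = \<eta>/4 then Virtual else label D u)"

definition patchable :: "diagram => real => real => complex set => real => real => (real => complex) => bool" where
 "patchable D0 t s W w \<eta> f \<longleftrightarrow>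
   (\<forall>u. curve D0 u \<in> W --> \<bar>off t u\<bar> <= w \<or> \<bar>off s u\<bar> <= w) \<and> (\<forall>u. \<bar>u\<bar> <= \<eta> --> f u \<in> W) \<and>
   (\<forall>D. valid D -->
    (\<forall>u. \<bar>off t u\<bar> <= w \<or> \<bar>off s u\<bar> <= w --> curve D u = curve D0 u \<and> label D u = label D0 u) -->
    (\<forall>u. curve D u \<in> W --> \<bar>off t u\<bar> <= w \<or> \<bar>off s u\<bar> <= w) -->
    twist_at t D (patch D t s \<eta> f))"

lemma patchableD:
 assumes "patchable D0 t s W w \<eta> f"
 shows "curve D0 u \<in> W ==> \<bar>off t u\<bar> <= w \<or> \<bar>off s u\<bar> <= w" "\<bar>x\<bar> <= \<eta> ==> f x \<in> W"
  "valid D ==>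
    (\<And>u. \<bar>off t u\<bar> <= w \<or> \<bar>off s u\<bar> <= w ==> curve D u = curve D0 u \<and> label D u = label D0 u) ==>
    (\<And>u. curve D u \<in> W ==> \<bar>off t u\<bar> <= w \<or> \<bar>off s u\<bar> <= w) ==>
    twist_at t D (patch D t s \<eta> f)"
 using assms unfolding patchable_def by simp_all

lemma twist_patch:
 assumes v0: "valid D0" and o: "label D0 t = Over" and dp: "double_pair (curve D0) t s"
  and W0: "open W0" "curve D0 t \<in> W0" and w0: "0 < w0"
 obtains W w \<eta> f where "open W" "curve D0 t \<in> W" "W \<subseteq> W0" "0 < w" "w <= w0" "w < 1/4" "0 < \<eta>" "\<eta> <= w"
  "patchable D0 t s W w \<eta> f"
proof -
 obtain F w sg U where ch: "crossing_chart F D0 t s w sg U" and ww: "w <= w0"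
  by (rule crossing_chart_exists[OF v0 dp w0])
 note c = ch[unfolded crossing_chart_def]
 have Fi: "inv F (F z) = z" "F (inv F z) = z" for z
  using diffeoD(2)[of F] c by (auto simp: bij_def surj_f_inv_f)
 define W where "W = U \<inter> W0"
 have F0: "F 0 = curve D0 t" using c by (metis add.right_neutral abs_zero less_imp_le zero_complex.code)
 have W: "open W" "curve D0 t \<in> W" "W \<subseteq> W0" using c W0 F0 by (auto simp: W_def)
 have "continuous_on UNIV F" using c diffeoD(3) by blast
 then obtain d where d: "0 < d" "\<And>dl z. 0 < dl ==> dl <= d ==> z \<in> disk ==> F (scale dl z) \<in> W"
  using small_scale[of F W] W F0 by metis
 define \<eta> where "\<eta> = min d w"
 have \<eta>: "0 < \<eta>" "\<eta> <= w" "\<eta> <= d" using d c by (auto simp: \<eta>_def)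
 define f where "f u = F (scale \<eta> (cflip sg (hook (u / \<eta>))))" for u
 have fW: "f u \<in> W" if "\<bar>u\<bar> <= \<eta>" for u
 proof -
  have "hook (u / \<eta>) \<in> disk" by (rule hook_in_disk) (use that \<eta> in \<open>simp add: abs_divide\<close>)
  then have "cflip sg (hook (u / \<eta>)) \<in> disk" using cflip_mem_disk c by blast
  then show ?thesis unfolding f_def by (intro d(2) \<eta>)
 qed
 have tw: "twist_at t D (patch D t s \<eta> f)"
  if v: "valid D"
   and agree: "\<And>u. \<bar>off t u\<bar> <= w \<or> \<bar>off s u\<bar> <= w ==> curve D u = curve D0 u \<and> label D u = label D0 u"
   and DW: "\<And>u. curve D u \<in> W ==> \<bar>off t u\<bar> <= w \<or> \<bar>off s u\<bar> <= w" for D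
 proof -
  have in_arc: "\<bar>off t (t + u)\<bar> <= w" "\<bar>off s (s + u)\<bar> <= w" if "\<bar>u\<bar> <= w" for u using that c by auto
  have chD: "crossing_chart F D t s w sg W"
   unfolding crossing_chart_def
   using c W F0 DW agree[OF disjI1[OF in_arc(1)]] agree[OF disjI2[OF in_arc(2)]] by auto
  let ?h = "scale (1/\<eta>) \<circ> inv F"
  have st: "straight (map_diagram ?h D) t s \<eta> sg"
   by (rule crossing_chart_straight[OF chD v \<eta>(1,2)]) (rule d(2)[OF \<eta>(1,3)])
  have dh: "diffeo ?h"
   by (intro diffeo_compose diffeo_scale diffeo_inv) (use c \<eta> in auto)
  have sc: "scale (1/\<eta>) (scale \<eta> z) = z" for z using \<eta>(1) by (simp add: complex_eq_iff)
  have "map_diagram ?h (patch D t s \<eta> f) = twisted (map_diagram ?h D) t s \<eta> sg"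
   by (simp add: map_diagram_def patch_def twisted_def fun_eq_iff f_def Fi sc)
  moreover have "label D t = Over" using agree[of t] o off_self[of 0 t] c by auto
  ultimately show ?thesis unfolding twist_at_def using v dh st by blast
 qed
 show ?thesis
 proof (rule that[of W w \<eta> f])
  show "patchable D0 t s W w \<eta> f"
   unfolding patchable_def
  proof (intro conjI allI impI)
   fix D
   assume v: "valid D"
    and h: "\<forall>u. \<bar>off t u\<bar> <= w \<or> \<bar>off s u\<bar> <= w --> curve D u = curve D0 u \<and> label D u = label D0 u"
     "\<forall>u. curve D u \<in> W --> \<bar>off t u\<bar> <= w \<or> \<bar>off s u\<bar> <= w"
   show "twist_at t D (patch D t s \<eta> f)" by (rule tw[OF v]) (use h in blast)+
  next
   fix u assume "curve D0 u \<in> W"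
   then show "\<bar>off t u\<bar> <= w \<or> \<bar>off s u\<bar> <= w" using c by (simp add: W_def)
  next
   fix u assume "\<bar>u\<bar> <= \<eta>"
   then show "f u \<in> W" by (rule fW)
  qed
 qed (use W ww c \<eta> in auto)
qed

section \<open>Twisting several crossings\<close>

definition set_wen :: "real => diagram => diagram" where
 "set_wen p D = Diagram (curve D)
   (\<lambda>u. if u - p \<in> \<int> then Wen else if label D u = Wen then Plain else label D u)"

lemma set_wen_simps [simp]:
 "curve (set_wen p D) = curve D"
 "label (set_wen p D) u = (if u - p \<in> \<int> then Wen else if label D u = Wen then Plain else label D u)"
 by (simp_all add: set_wen_def)

definition no_wen :: "diagram => diagram" where
 "no_wen D = Diagram (curve D) (\<lambda>u. if label D u = Wen then Plain else label D u)"

lemma no_wen_simps [simp]: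
 "curve (no_wen D) = curve D"
 "label (no_wen D) u = (if label D u = Wen then Plain else label D u)"
 by (simp_all add: no_wen_def)

lemma set_wen_no_wen: "set_wen p (no_wen D) = set_wen p D"
 by (simp add: set_wen_def no_wen_def fun_eq_iff)

lemma set_wen_int: "set_wen (p + of_int n) D = set_wen p D"
proof -
 have "u - (p + of_int n) \<in> \<int> \<longleftrightarrow> u - p \<in> \<int>" for u
  by (metis Ints_diff Ints_of_int diff_diff_eq Ints_add diff_add_cancel)
 then show ?thesis by (simp add: set_wen_def)
qed

lemma crossing_label: "(a, b) \<in> real_crossing \<union> virtual_crossing ==> a ~= Plain \<and> a ~= Wen \<and> b ~= Plain \<and> b ~= Wen"
 by (auto simp: real_crossing_def virtual_crossing_def)

lemma label_mod_int:
 assumes "valid D" "u - p \<in> \<int>"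
 shows "label D u = label D p"
proof -
 obtain n where "u = p + of_int n" using assms(2) by (metis Ints_cases add.commute diff_add_cancel)
 then show ?thesis using periodic_int[of "label D" p n] validD(2)[OF assms(1)] by simp
qed

lemma valid_relabel:
 assumes v: "valid D" and c: "curve E = curve D"
  and per: "\<And>u. label E (u + 1) = label E u"
  and same: "\<And>u. label D u \<in> {Over, Under, Virtual} ==> label E u = label D u"
  and new: "\<And>u. label D u \<notin> {Over, Under, Virtual} ==> label E u \<in> {Plain, Wen}"
  and fin: "finite {u \<in> {0..<1}. label E u = Wen}"
 shows "valid E"
proof -
 have "(label E s, label E t) \<in> real_crossing \<union> virtual_crossing" if "double_pair (curve D) s t" for s t
 proof -
  have l: "(label D s, label D t) \<in> real_crossing \<union> virtual_crossing" by (rule validD(4)[OF v that])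
  then have "label D s \<in> {Over, Under, Virtual}" "label D t \<in> {Over, Under, Virtual}"
   by (auto simp: real_crossing_def virtual_crossing_def)
  then show ?thesis using l same by metis
 qed
 moreover have "\<exists>s. double_pair (curve D) s t" if "label E t \<in> {Over, Under, Virtual}" for t
 proof -
  have "label D t \<in> {Over, Under, Virtual}" using new[of t] that by (cases "label D t") auto
  then show ?thesis using validD(5)[OF v] by blast
 qed
 ultimately show ?thesis
  using v per fin unfolding virtual_knot_diagram_def c by blast
qed

lemma valid_no_wen:
 assumes v: "valid D"
 shows "valid (no_wen D)"
proof (rule valid_relabel[OF v])
 fix u
 show "label D u \<notin> {Over, Under, Virtual} ==> label (no_wen D) u \<in> {Plain, Wen}"
  by (cases "label D u") auto
next
 have "{u \<in> {0..<1}. label (no_wen D) u = Wen} = {}" by auto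
 then show "finite {u \<in> {0..<1}. label (no_wen D) u = Wen}" by (metis finite.emptyI)
qed (use validD(2)[OF v] in auto)

lemma valid_set_wen:
 assumes v: "valid D" and p: "label D p \<in> {Plain, Wen}"
 shows "valid (set_wen p D)"
proof (rule valid_relabel[OF v])
 fix u
 have "u + 1 - p \<in> \<int> \<longleftrightarrow> u - p \<in> \<int>"
  by (metis Ints_1 Ints_add Ints_diff add_diff_cancel_right' add_diff_eq diff_add_eq)
 then show "label (set_wen p D) (u + 1) = label (set_wen p D) u"
  using validD(2)[OF v] by simp
 show "label (set_wen p D) u = label D u" if "label D u \<in> {Over, Under, Virtual}"
  using that p label_mod_int[OF v, of u p] by auto
 show "label D u \<notin> {Over, Under, Virtual} ==> label (set_wen p D) u \<in> {Plain, Wen}"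
  by (cases "label D u") auto
next
 have "{u \<in> {0..<1}. label (set_wen p D) u = Wen} \<subseteq> {u \<in> {0..<1}. off p u = 0}"
  using off_eq_iff[of p _ p] off_self[of 0 p] by auto
 then show "finite {u \<in> {0..<1}. label (set_wen p D) u = Wen}" using finite_off finite_subset by blast
qed simp

text \<open>Several twists in a row, at over-passages that keep their names.\<close>

primrec twists :: "diagram => real list => diagram => bool" where
 "twists D [] E \<longleftrightarrow> valid D \<and> E = D"
| "twists D (t # ts) E \<longleftrightarrow> (\<exists>D'. twist_at t D D' \<and> twists D' ts E)"

lemma twists_append: "twists D (ts @ us) E \<longleftrightarrow> (\<exists>D'. twists D ts D' \<and> twists D' us E)"
proof (induction ts arbitrary: D)
 case Nil
 have "valid D" if "twists D us E"
  using that twist_at_valid(1) by (cases us) auto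
 then show ?case by auto
qed auto

lemma twists_props:
 assumes "twists D ts E"
 shows "valid D" "valid E"
  "label E u = Over \<longleftrightarrow> label D u = Over" "label E u = Wen \<longleftrightarrow> label D u = Wen"
  "label D u ~= Plain ==> label E u = label D u" "t \<in> set ts ==> label D t = Over"
proof -
 have "valid D \<and> valid E \<and> (label E u = Over \<longleftrightarrow> label D u = Over) \<and>
   (label E u = Wen \<longleftrightarrow> label D u = Wen) \<and> (label D u ~= Plain --> label E u = label D u) \<and> (\<forall>t\<in>set ts. label D t = Over)"
  using assms
 proof (induction ts arbitrary: D)
  case (Cons t ts)
  then obtain D' where D': "twist_at t D D'" "twists D' ts E" by auto
  note IH = Cons.IH[OF D'(2)]
  have "label D t = Over" using D'(1) twist_at_def by blast
  then show ?case
   using IH twist_at_valid[OF D'(1)] twist_at_Over_iff[OF D'(1)] twist_at_label[OF D'(1), of u] by auto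
 qed simp
 then show "valid D" "valid E"
  "label E u = Over \<longleftrightarrow> label D u = Over" "label E u = Wen \<longleftrightarrow> label D u = Wen"
  "label D u ~= Plain ==> label E u = label D u" "t \<in> set ts ==> label D t = Over" by blast+
qed

text \<open>
 Over-passages keep their names under twists, so uniqueness of a single twist can be iterated.
\<close>

lemma twists_unique:
 assumes "isotopic_over \<alpha> D D'" "twists D (map \<alpha> ts) E" "twists D' ts E'"
 shows "isotopic_over \<alpha> E E'"
 using assms
proof (induction ts arbitrary: D D')
 case (Cons t ts)
 obtain D1 where D1: "twist_at (\<alpha> t) D D1" "twists D1 (map \<alpha> ts) E" using Cons.prems(2) by auto
 obtain D1' where D1': "twist_at t D' D1'" "twists D1' ts E'" using Cons.prems(3) by auto
 obtain \<gamma> where \<gamma>: "isotopic_by \<gamma> D D'" "\<forall>u. label D' u = Over --> \<gamma> u = \<alpha> u"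
  using Cons.prems(1) isotopic_over_def by blast
 have "label D' t = Over" using D1'(1) twist_at_def by blast
 then have "isotopic_over \<gamma> D1 D1'"
  using twist_at_unique[OF \<gamma>(1) _ D1'(1), of D1] D1(1) \<gamma>(2) by simp
 then have "isotopic_over \<alpha> D1 D1'"
  unfolding isotopic_over_def using \<gamma>(2) twist_at_Over_iff(1)[OF D1'(1)] by metis
 then show ?case using Cons.IH D1(2) D1'(2) by blast
qed simp

lemma twists_unique_rel:
 assumes "isotopic_rel_over D D'" "twists D ts E" "twists D' ts E'"
 shows "isotopic_rel_over E E'"
 using twists_unique[of "\<lambda>t. t"] assms by (simp add: isotopic_over_rel)

lemma twists_shift:
 assumes "twists D ts E"
 shows "twists D (map (\<lambda>t. t + of_int n) ts) E"
 using assms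
proof (induction ts arbitrary: D)
 case (Cons t ts)
 then show ?case using twist_at_shift by force
qed simp

lemma arcs_disjoint:
 assumes "2 * w < \<bar>off a b\<bar>" "\<bar>off a u\<bar> <= w" "w < 1/4"
 shows "\<not> \<bar>off b u\<bar> <= w"
proof
 assume b: "\<bar>off b u\<bar> <= w"
 obtain m where m: "u = a + off a u + of_int m" by (rule off_decomp)
 obtain n where n: "u = b + off b u + of_int n" by (rule off_decomp)
 have "b = a + (off a u - off b u) + of_int (m - n)" using m n by simp
 then have "off a b = off a u - off b u" by (rule off_unique) (use b assms in auto)
 then show False using assms b by linarith
qed

lemma patch_simps [simp]:
 "curve (patch D t s \<eta> f) u = (if \<bar>off s u\<bar> <= \<eta> then f (off s u) else curve D u)"
 "label (patch D t s \<eta> f) u = (if \<bar>off s u\<bar> = \<eta>/4 \<or> \<bar>off t u\<bar> = \<eta>/4 then Virtual else label D u)"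
 by (simp_all add: patch_def)

lemma over_partner:
 assumes v: "valid D" and t: "label D t = Over"
 obtains s where "double_pair (curve D) t s" "label D s = Under"
proof -
 obtain s where s: "double_pair (curve D) s t" using validD(5)[OF v, of t] t by auto
 moreover have "label D s = Under"
  using validD(4)[OF v s] t by (auto simp: real_crossing_def virtual_crossing_def)
 ultimately show ?thesis using that double_pair_sym by blast
qed

lemma off_eq_0_iff: "off a u = 0 \<longleftrightarrow> u - a \<in> \<int>"
 using off_eq_iff[of a u a] off_self[of 0 a] by simp

text \<open>Twists at different crossings commute: take patches with disjoint supports.\<close>

lemma twist_at_swap:
 assumes a: "twist_at t1 D D1" and b: "twist_at t2 D1 E" and ne: "t1 - t2 \<notin> \<int>"
 shows "\<exists>D2 E'. twist_at t2 D D2 \<and> twist_at t1 D2 E' \<and> isotopic_rel_over E E'"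
proof -
 have v: "valid D" and o1: "label D t1 = Over" using a twist_at_def by blast+
 have o2: "label D t2 = Over" using b twist_at_Over_iff(1)[OF a] twist_at_def by blast
 obtain s1 where s1: "double_pair (curve D) t1 s1" "label D s1 = Under" by (rule over_partner[OF v o1])
 obtain s2 where s2: "double_pair (curve D) t2 s2" "label D s2 = Under" by (rule over_partner[OF v o2])
 have nint: "s1 - t2 \<notin> \<int>" "s2 - t1 \<notin> \<int>"
  using label_mod_int[OF v] s1(2) s2(2) o1 o2 by force+
 have xne: "curve D t1 ~= curve D t2"
 proof
  assume e: "curve D t1 = curve D t2"
  then have "double_pair (curve D) t2 t1" using ne double_pair_sym[of _ t1 t2] by (simp add: double_pair_def)
  moreover have "double_pair (curve D) s1 t2" using e s1(1) nint by (simp add: double_pair_def)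
  ultimately show False
   using validD(3)[OF v, of t2 t1 s1] s1(1) double_pair_sym by blast
 qed
 have nint2: "s1 - s2 \<notin> \<int>"
 proof
  assume "s1 - s2 \<in> \<int>"
  then obtain n where "s1 = s2 + of_int n" by (metis Ints_cases add.commute diff_add_cancel)
  then have "curve D s1 = curve D s2" using periodic_int[of "curve D" s2 n] validD(1)[OF v] by simp
  then show False using s1(1) s2(1) xne by (simp add: double_pair_def)
 qed
 obtain A B where AB: "open A" "open B" "curve D t1 \<in> A" "curve D t2 \<in> B" "A \<inter> B = {}"
  using hausdorff[OF xne] by blast
 have nz: "off t2 t1 ~= 0" "off t2 s1 ~= 0" "off s2 t1 ~= 0" "off s2 s1 ~= 0"
  unfolding off_eq_0_iff using ne nint nint2 Ints_minus[of "t1 - s2"] by (auto simp: minus_diff_eq)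
 define w0 where "w0 = min (min \<bar>off t2 t1\<bar> \<bar>off t2 s1\<bar>) (min \<bar>off s2 t1\<bar> \<bar>off s2 s1\<bar>) / 3"
 have w0: "0 < w0" "2 * w0 < \<bar>off t2 t1\<bar>" "2 * w0 < \<bar>off t2 s1\<bar>" "2 * w0 < \<bar>off s2 t1\<bar>" "2 * w0 < \<bar>off s2 s1\<bar>"
  using nz unfolding w0_def by linarith+
 obtain W1 w1 \<eta>1 f1 where P1': "open W1" "curve D t1 \<in> W1" "W1 \<subseteq> A" "0 < w1" "w1 <= w0" "w1 < 1/4" "0 < \<eta>1" "\<eta>1 <= w1"
  and pa1: "patchable D t1 s1 W1 w1 \<eta>1 f1"
  by (rule twist_patch[OF v o1 s1(1) AB(1,3) w0(1)])
 note P1 = P1' patchableD[OF pa1]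
 obtain W2 w2 \<eta>2 f2 where P2': "open W2" "curve D t2 \<in> W2" "W2 \<subseteq> B" "0 < w2" "w2 <= w0" "w2 < 1/4" "0 < \<eta>2" "\<eta>2 <= w2"
  and pa2: "patchable D t2 s2 W2 w2 \<eta>2 f2"
  by (rule twist_patch[OF v o2 s2(1) AB(2,4) w0(1)])
 note P2 = P2' patchableD[OF pa2]
 define w where "w = max w1 w2"
 have w: "w1 <= w" "w2 <= w" "w <= w0" "w < 1/4" using P1(5,6) P2(5,6) by (auto simp: w_def)
 have dis: "\<not> \<bar>off b u\<bar> <= w" if "\<bar>off a u\<bar> <= w" "a = t2 \<or> a = s2" "b = t1 \<or> b = s1" for a b u
  using arcs_disjoint[OF _ that(1) w(4), of b] w0 w(3) that(2,3) by fastforce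
 have dis12: "\<not> ((\<bar>off t1 u\<bar> <= w1 \<or> \<bar>off s1 u\<bar> <= w1) \<and> (\<bar>off t2 u\<bar> <= w2 \<or> \<bar>off s2 u\<bar> <= w2))" for u
 proof
  assume h: "(\<bar>off t1 u\<bar> <= w1 \<or> \<bar>off s1 u\<bar> <= w1) \<and> (\<bar>off t2 u\<bar> <= w2 \<or> \<bar>off s2 u\<bar> <= w2)"
  obtain b where b: "b = t1 \<or> b = s1" "\<bar>off b u\<bar> <= w" using h w(1) order_trans by blast
  obtain a where a: "a = t2 \<or> a = s2" "\<bar>off a u\<bar> <= w" using h w(2) order_trans by blast
  show False using dis[OF a(2,1) b(1)] b(2) by blast
 qed
 have W12: "W1 \<inter> W2 = {}" using P1(3) P2(3) AB(5) by blast
 \<comment> \<open>Patches with disjoint supports commute literally; uniqueness of twists then takes care of the given \<open>E\<close>.\<close>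
 define D1' where "D1' = patch D t1 s1 \<eta>1 f1"
 define D2' where "D2' = patch D t2 s2 \<eta>2 f2"
 have T1: "twist_at t1 D D1'" unfolding D1'_def by (rule P1(11)[OF v]) (use P1(9) in auto)
 have T2: "twist_at t2 D D2'" unfolding D2'_def by (rule P2(11)[OF v]) (use P2(9) in auto)
 have in1: "\<bar>off s1 u\<bar> <= \<eta>1 \<or> \<bar>off s1 u\<bar> = \<eta>1/4 \<or> \<bar>off t1 u\<bar> = \<eta>1/4 ==> \<bar>off t1 u\<bar> <= w1 \<or> \<bar>off s1 u\<bar> <= w1" for u
  using P1(7,8) by linarith
 have in2: "\<bar>off s2 u\<bar> <= \<eta>2 \<or> \<bar>off s2 u\<bar> = \<eta>2/4 \<or> \<bar>off t2 u\<bar> = \<eta>2/4 ==> \<bar>off t2 u\<bar> <= w2 \<or> \<bar>off s2 u\<bar> <= w2" for u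
  using P2(7,8) by linarith
 have T12: "twist_at t2 D1' (patch D1' t2 s2 \<eta>2 f2)"
 proof (rule P2(11)[OF twist_at_valid(2)[OF T1]])
  show "curve D1' u = curve D u \<and> label D1' u = label D u" if "\<bar>off t2 u\<bar> <= w2 \<or> \<bar>off s2 u\<bar> <= w2" for u
   using that dis12[of u] in1[of u] by (auto simp: D1'_def)
  show "\<bar>off t2 u\<bar> <= w2 \<or> \<bar>off s2 u\<bar> <= w2" if "curve D1' u \<in> W2" for u
   using that P1(10)[of "off s1 u"] P2(9)[of u] W12 by (auto simp: D1'_def split: if_splits)
 qed
 have T21: "twist_at t1 D2' (patch D2' t1 s1 \<eta>1 f1)"
 proof (rule P1(11)[OF twist_at_valid(2)[OF T2]])
  show "curve D2' u = curve D u \<and> label D2' u = label D u" if "\<bar>off t1 u\<bar> <= w1 \<or> \<bar>off s1 u\<bar> <= w1" for u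
   using that dis12[of u] in2[of u] by (auto simp: D2'_def)
  show "\<bar>off t1 u\<bar> <= w1 \<or> \<bar>off s1 u\<bar> <= w1" if "curve D2' u \<in> W1" for u
   using that P2(10)[of "off s2 u"] P1(9)[of u] W12 by (auto simp: D2'_def split: if_splits)
 qed
 have c: "curve (patch D1' t2 s2 \<eta>2 f2) u = curve (patch D2' t1 s1 \<eta>1 f1) u" for u
  using dis12[of u] in1[of u] in2[of u] by (auto simp: D1'_def D2'_def)
 have l: "label (patch D1' t2 s2 \<eta>2 f2) u = label (patch D2' t1 s1 \<eta>1 f1) u" for u
  by (auto simp: D1'_def D2'_def)
 have eq: "patch D1' t2 s2 \<eta>2 f2 = patch D2' t1 s1 \<eta>1 f1"
  using c l by (simp add: diagram.expand fun_eq_iff)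
 have "isotopic_rel_over D1 D1'"
  using twist_at_unique[OF isotopic_by_refl[OF v] a T1] by (simp add: isotopic_over_rel)
 then have "isotopic_rel_over E (patch D1' t2 s2 \<eta>2 f2)"
  using twists_unique_rel[of D1 D1' "[t2]" E] b T12 twist_at_valid(2) by auto
 then show ?thesis using T2 T21 eq by auto
qed

text \<open>A finite set \<open>P\<close> of points may be kept away from the supports of the twists.\<close>

lemma twists_exist:
 assumes "valid X" "\<And>t. t \<in> set ts ==> label X t = Over"
  "finite P" "\<And>p. p \<in> P ==> label X p = Plain" "\<And>u. label X u ~= Wen"
 shows "\<exists>Y. twists X ts Y \<and> (\<forall>p\<in>P. label Y p = Plain \<and> twists (set_wen p X) ts (set_wen p Y))"
 using assms
proof (induction ts arbitrary: X)
 case Nil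
 then show ?case using valid_set_wen by auto
next
 case (Cons t ts)
 note v = Cons.prems(1)
 have o: "label X t = Over" using Cons.prems(2) by simp
 obtain s where s: "double_pair (curve X) t s" "label X s = Under" by (rule over_partner[OF v o])
 define S where "S = insert (1/4) ((\<lambda>p. \<bar>off t p\<bar>) ` P \<union> (\<lambda>p. \<bar>off s p\<bar>) ` P)"
 have finS: "finite S" "S ~= {}" using Cons.prems(3) by (auto simp: S_def)
 have "off t p ~= 0 \<and> off s p ~= 0" if "p \<in> P" for p
  using label_mod_int[OF v, of p t] label_mod_int[OF v, of p s] Cons.prems(4)[OF that] o s(2)
  by (auto simp: off_eq_0_iff)
 then have "Min S > 0" using finS by (auto simp: S_def)
 define w0 where "w0 = Min S / 2"
 have w0: "0 < w0" using \<open>Min S > 0\<close> by (simp add: w0_def)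
 have far: "w0 < \<bar>off t p\<bar> \<and> w0 < \<bar>off s p\<bar>" if "p \<in> P" for p
 proof -
  have "Min S <= \<bar>off t p\<bar>" "Min S <= \<bar>off s p\<bar>" using that finS by (auto intro!: Min_le simp: S_def)
  then show ?thesis using w0 by (simp add: w0_def)
 qed
 obtain W w \<eta> f where P': "open W" "curve X t \<in> W" "W \<subseteq> UNIV" "0 < w" "w <= w0" "w < 1/4" "0 < \<eta>" "\<eta> <= w"
  and pa: "patchable X t s W w \<eta> f"
  by (rule twist_patch[OF v o s(1) open_UNIV UNIV_I w0])
 note P = P'(1,2,4,5,7,8) patchableD(1,3)[OF pa]
 define Y where "Y = patch X t s \<eta> f"
 have T: "twist_at t X Y" unfolding Y_def by (rule P(8)[OF v]) (use P(7) in auto)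
 have pw: "off a u = off a p" if "u - p \<in> \<int>" for a u p using that off_eq_iff by blast
 have Tp: "twist_at t (set_wen p X) (set_wen p Y) \<and> label Y p = Plain" if p: "p \<in> P" for p
 proof
  have np: "u - p \<notin> \<int>" if "\<bar>off t u\<bar> <= w \<or> \<bar>off s u\<bar> <= w" for u
   using that far[OF p] pw[of u p] P(4) by force
  have "twist_at t (set_wen p X) (patch (set_wen p X) t s \<eta> f)"
   by (rule P(8)) (use Cons.prems(4)[OF p] Cons.prems(5) np P(7) in \<open>auto intro: valid_set_wen[OF v]\<close>)
  moreover have "patch (set_wen p X) t s \<eta> f = set_wen p Y"
  proof -
   have "\<not> (\<bar>off s u\<bar> = \<eta>/4 \<or> \<bar>off t u\<bar> = \<eta>/4)" if "u - p \<in> \<int>" for u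
    using that np[of u] P(5,6) by auto
   then show ?thesis by (auto simp: diagram.expand fun_eq_iff Y_def)
  qed
  ultimately show "twist_at t (set_wen p X) (set_wen p Y)" by simp
  have "\<not> (\<bar>off s p\<bar> = \<eta>/4 \<or> \<bar>off t p\<bar> = \<eta>/4)" using np[of p] P(5,6) by auto
  then show "label Y p = Plain" using Cons.prems(4)[OF p] by (simp add: Y_def)
 qed
 have "\<exists>Z. twists Y ts Z \<and> (\<forall>p\<in>P. label Z p = Plain \<and> twists (set_wen p Y) ts (set_wen p Z))"
 proof (rule Cons.IH)
  show "label Y u = Over" if "u \<in> set ts" for u
   using Cons.prems(2)[of u] that twist_at_Over_iff(1)[OF T] by simp
  show "label Y u ~= Wen" for u using Cons.prems(5) twist_at_Over_iff(2)[OF T] by simp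
  show "label Y p = Plain" if "p \<in> P" for p using Tp[OF that] by blast
 qed (rule twist_at_valid(2)[OF T], rule Cons.prems(3))
 then show ?case using T Tp by (metis twists.simps(2))
qed

lemma twists_exist_any:
 assumes "valid X" "\<And>t. t \<in> set ts ==> label X t = Over"
 shows "\<exists>Y. twists X ts Y"
 using assms
proof (induction ts arbitrary: X)
 case (Cons t ts)
 have o: "label X t = Over" using Cons.prems(2) by simp
 obtain s where s: "double_pair (curve X) t s" by (rule over_partner[OF Cons.prems(1) o])
 obtain W w \<eta> f where pa: "patchable X t s W w \<eta> f"
  by (rule twist_patch[OF Cons.prems(1) o s open_UNIV UNIV_I zero_less_one])
 have T: "twist_at t X (patch X t s \<eta> f)"
  by (rule patchableD(3)[OF pa Cons.prems(1)]) (use patchableD(1)[OF pa] in auto)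
 have "\<exists>Y. twists (patch X t s \<eta> f) ts Y"
  using Cons.IH[OF twist_at_valid(2)[OF T]] twist_at_Over_iff(1)[OF T] Cons.prems(2) by simp
 then show ?case using T by auto
qed auto

lemma twists_first_to_last:
 assumes "twists D (t # ts) E" "\<And>u. u \<in> set ts ==> t - u \<notin> \<int>"
 shows "\<exists>E'. twists D (ts @ [t]) E' \<and> isotopic_rel_over E E'"
 using assms
proof (induction ts arbitrary: D E)
 case Nil
 then show ?case using isotopic_rel_over_refl twists_props(2) by (metis append_Nil)
next
 case (Cons u ts)
 obtain D1 D2 where D: "twist_at t D D1" "twist_at u D1 D2" "twists D2 ts E"
  using Cons.prems(1) by auto
 obtain D2' E2 where S: "twist_at u D D2'" "twist_at t D2' E2" "isotopic_rel_over D2 E2"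
  using twist_at_swap[OF D(1,2)] Cons.prems(2) by auto
 have "label E2 x = Over" if "x \<in> set ts" for x
  using twists_props(6)[OF D(3) that] twist_at_Over_iff(1) D(1,2) S(1,2) by metis
 then obtain E3 where E3: "twists E2 ts E3"
  using twists_exist_any twist_at_valid(2)[OF S(2)] by blast
 have i: "isotopic_rel_over E E3" by (rule twists_unique_rel[OF S(3) D(3) E3])
 have "twists D2' (t # ts) E3" using S(2) E3 by auto
 then obtain E' where E': "twists D2' (ts @ [t]) E'" "isotopic_rel_over E3 E'"
  using Cons.IH Cons.prems(2) by (meson list.set_intros(2))
 then show ?case using S(1) isotopic_rel_over_trans[OF i] by auto
qed

section \<open>Moves at a distance from the twisted crossings\<close>

text \<open>
 An instance of \<open>local_move\<close> with pictures and arcs exposed. Being off the arcs is expressed by distances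
 on the circle, which can be compared with the supports of twists.
\<close>

definition move_at :: "picture => picture => (nat => real) => (nat => real) => diagram => diagram => bool" where
 "move_at A B m r D D' \<longleftrightarrow> valid D \<and> valid D' \<and>
   length A = length B \<and> disjoint_arcs m r (length A) \<and> shows_picture m r A D \<and> shows_picture m r B D' \<and>
   (\<forall>t. (\<forall>j<length A. \<bar>r j\<bar> < \<bar>off (m j) t\<bar>) -->
    curve D t = curve D' t \<and> label D t = label D' t \<and> curve D t \<notin> disk)"

lemma disjoint_arcs_width:
 assumes "disjoint_arcs m r k" "j < k"
 shows "r j ~= 0" "\<bar>r j\<bar> < 1/2"
proof -
 have d: "x = y" if "\<bar>x\<bar> <= 1" "\<bar>y\<bar> <= 1" "arc_param m r j x - arc_param m r j y \<in> \<int>" for x y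
  using assms that unfolding disjoint_arcs_def by (metis abs_le_iff atLeastAtMost_iff minus_le_iff)
 show r: "r j ~= 0"
 proof
  assume "r j = 0"
  then show False using d[of 1 0] by (simp add: arc_param_def)
 qed
 show "\<bar>r j\<bar> < 1/2"
 proof (rule ccontr)
  assume "\<not> \<bar>r j\<bar> < 1/2"
  then have "\<bar>1 / (2 * r j)\<bar> <= 1" using r by (simp add: abs_divide abs_mult field_simps)
  then have "1 / (2 * r j) = - (1 / (2 * r j))"
   by (intro d) (use r in \<open>auto simp: arc_param_def field_simps\<close>)
  then show False using r by simp
 qed
qed

lemma off_arc_iff:
 assumes "r ~= 0" "\<bar>r\<bar> < 1/2"
 shows "(\<exists>x\<in>{-1..1}. u - (m + r * x) \<in> \<int>) \<longleftrightarrow> \<bar>off m u\<bar> <= \<bar>r\<bar>"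
proof
 assume "\<exists>x\<in>{-1..1}. u - (m + r * x) \<in> \<int>"
 then obtain x where x: "\<bar>x\<bar> <= 1" "u - (m + r * x) \<in> \<int>" by (auto simp: abs_le_iff)
 then obtain n where "u = m + r * x + of_int n" by (metis Ints_cases add.commute diff_add_cancel)
 moreover have rx: "\<bar>r * x\<bar> <= \<bar>r\<bar>" using x(1) by (simp add: abs_mult mult_left_le)
 ultimately have "off m u = r * x" by (intro off_unique) (use assms(2) in auto)
 then show "\<bar>off m u\<bar> <= \<bar>r\<bar>" using rx by simp
next
 assume o: "\<bar>off m u\<bar> <= \<bar>r\<bar>"
 obtain n where "u = m + off m u + of_int n" by (rule off_decomp)
 then have "u - (m + r * (off m u / r)) = of_int n" using assms by simp
 moreover have "\<bar>off m u / r\<bar> <= 1" using o assms(1) by (simp add: abs_divide)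
 ultimately show "\<exists>x\<in>{-1..1}. u - (m + r * x) \<in> \<int>"
  by (intro bexI[of _ "off m u / r"]) (metis Ints_of_int, simp only: atLeastAtMost_iff abs_le_iff, argo)
qed

lemma local_move_iff: "local_move M D D' \<longleftrightarrow> (\<exists>A B m r. (A, B) \<in> M \<and> move_at A B m r D D')"
proof -
 have "(\<forall>j<length A. \<forall>x\<in>{-1..1}. t - arc_param m r j x \<notin> \<int>) \<longleftrightarrow> (\<forall>j<length A. \<bar>r j\<bar> < \<bar>off (m j) t\<bar>)"
  if "disjoint_arcs m r (length A)" for A :: picture and m r t
  using off_arc_iff[OF disjoint_arcs_width[OF that], of _ t] unfolding arc_param_def by (meson not_le)
 note out = this
 have "local_move M D D' \<longleftrightarrow> (\<exists>A B m r. (A, B) \<in> M \<and> valid D \<and> valid D' \<and>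
   length A = length B \<and> disjoint_arcs m r (length A) \<and> shows_picture m r A D \<and> shows_picture m r B D' \<and>
   (\<forall>t. (\<forall>j<length A. \<forall>x\<in>{-1..1}. t - arc_param m r j x \<notin> \<int>) -->
    curve D t = curve D' t \<and> label D t = label D' t \<and> curve D t \<notin> disk))"
  unfolding local_move_def by (simp only: Bex_def split_paired_Ex prod.case) blast
 also have "\<dots> \<longleftrightarrow> (\<exists>A B m r. (A, B) \<in> M \<and> move_at A B m r D D')"
  by (simp only: move_at_def out cong: conj_cong)
 finally show ?thesis .
qed

lemma shows_picture_at:
 assumes "shows_picture m r A D" "valid D" "disjoint_arcs m r (length A)" "j < length A"
  "\<bar>off (m j) u\<bar> <= \<bar>r j\<bar>"
 shows "curve D u = fst (A ! j) (off (m j) u / r j)" "label D u = mark (snd (A ! j)) (off (m j) u / r j)"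
  "\<bar>off (m j) u / r j\<bar> <= 1"
proof -
 have r: "r j ~= 0" using disjoint_arcs_width[OF assms(3,4)] by simp
 show x: "\<bar>off (m j) u / r j\<bar> <= 1" using assms(5) r by (simp add: abs_divide)
 have "arc_param m r j (off (m j) u / r j) = m j + off (m j) u" using r by (simp add: arc_param_def)
 moreover have "off (m j) u / r j \<in> {-1..1}" using x abs_le_iff[of "off (m j) u / r j" 1] by (simp only: atLeastAtMost_iff) argo
 ultimately have "curve D (m j + off (m j) u) = fst (A ! j) (off (m j) u / r j)"
  "label D (m j + off (m j) u) = mark (snd (A ! j)) (off (m j) u / r j)"
  using assms(1,4) unfolding shows_picture_def by metis+
 then show "curve D u = fst (A ! j) (off (m j) u / r j)" "label D u = mark (snd (A ! j)) (off (m j) u / r j)"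
  using periodic_off[of "curve D" u "m j"] periodic_off[of "label D" u "m j"] validD(1,2)[OF assms(2)] by auto
qed

lemma abs_off_le: "\<bar>off a (a + x + of_int n)\<bar> <= \<bar>x\<bar>"
proof (cases "\<bar>x\<bar> < 1/2")
 case True
 then have "off a (a + x + of_int n) = x" by (intro off_unique) auto
 then show ?thesis by simp
next
 case False
 then show ?thesis using off_bounds[of a "a + x + of_int n"] by linarith
qed

lemma off_triangle: "\<bar>off a t\<bar> <= \<bar>off a u\<bar> + \<bar>off t u\<bar>"
proof -
 obtain m where m: "u = a + off a u + of_int m" by (rule off_decomp)
 obtain n where n: "u = t + off t u + of_int n" by (rule off_decomp)
 have "t = a + (off a u - off t u) + of_int (m - n)" using m n by simp
 then have "\<bar>off a t\<bar> <= \<bar>off a u - off t u\<bar>" using abs_off_le by metis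
 then show ?thesis by linarith
qed

lemma double_point_params:
 assumes v: "valid D" and dp: "double_pair (curve D) t s" and c: "curve D u = curve D t"
 shows "off t u = 0 \<or> off s u = 0"
proof -
 have "\<not> (double_pair (curve D) u t \<and> double_pair (curve D) t s \<and> double_pair (curve D) u s)"
  by (rule validD(3)[OF v])
 then show ?thesis using dp c by (auto simp: double_pair_def off_eq_0_iff)
qed

lemma mark_mem: "mark ps x = l ==> l ~= Plain ==> (x, l) \<in> set ps"
 by (auto simp: mark_def split: option.splits dest: map_of_SomeD)

definition marks_in_disk :: "picture => bool" where
 "marks_in_disk A \<longleftrightarrow> (\<forall>S\<in>set A. \<forall>x l. (x, l) \<in> set (snd S) --> fst S x \<in> disk)"

text \<open>
 A crossing outside the disk of a move may be twisted inside a neighbourhood that misses the disk; one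
 patch serves before and after the move.
\<close>

lemma move_at_twist:
 assumes mv: "move_at A B m r X X'" and md: "marks_in_disk A"
  and o: "label X t = Over" and out': "\<forall>j<length A. \<bar>r j\<bar> < \<bar>off (m j) t\<bar>"
 shows "\<exists>Y Y'. twist_at t X Y \<and> twist_at t X' Y' \<and> move_at A B m r Y Y'"
proof -
 have out: "\<bar>r j\<bar> < \<bar>off (m j) t\<bar>" if "j < length A" for j using out' that by blast
 have v: "valid X" "valid X'" and len: "length A = length B"
  and da: "disjoint_arcs m r (length A)" and sh: "shows_picture m r A X" "shows_picture m r B X'"
  and same: "\<And>u. (\<And>j. j < length A ==> \<bar>r j\<bar> < \<bar>off (m j) u\<bar>) ==>
    curve X u = curve X' u \<and> label X u = label X' u \<and> curve X u \<notin> disk"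
  using mv unfolding move_at_def by blast+
 obtain s where s: "double_pair (curve X) t s" "label X s = Under" by (rule over_partner[OF v(1) o])
 have t': "curve X t = curve X' t" "curve X t \<notin> disk" using same[OF out] by blast+
 \<comment> \<open>The under-passage is off the arcs too: marks on the arcs belong to points of the disk.\<close>
 have out_s: "\<bar>r j\<bar> < \<bar>off (m j) s\<bar>" if j: "j < length A" for j
 proof (rule ccontr)
  assume "\<not> \<bar>r j\<bar> < \<bar>off (m j) s\<bar>"
  then have le: "\<bar>off (m j) s\<bar> <= \<bar>r j\<bar>" by simp
  note at = shows_picture_at[OF sh(1) v(1) da j le]
  have "(off (m j) s / r j, Under) \<in> set (snd (A ! j))" using mark_mem[OF at(2)[symmetric]] s(2) by simp
  then have "curve X s \<in> disk" using md j at(1) unfolding marks_in_disk_def by (metis nth_mem)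
  then show False using s(1) t'(2) by (simp add: double_pair_def)
 qed
 define S where "S = insert (1/2) ((\<lambda>j. \<bar>off (m j) t\<bar> - \<bar>r j\<bar>) ` {..<length A} \<union> (\<lambda>j. \<bar>off (m j) s\<bar> - \<bar>r j\<bar>) ` {..<length A})"
 have S: "finite S" "S ~= {}" by (simp_all add: S_def)
 have "Min S > 0" using S out out_s by (auto simp: S_def)
 moreover have "Min S <= 1/2" using S by (intro Min_le) (auto simp: S_def)
 ultimately obtain w0 where w0: "0 < w0" "w0 < Min S" "w0 <= 1/2" using dense by (metis less_imp_le less_le_trans)
 have far: "\<bar>r j\<bar> < \<bar>off (m j) u\<bar>" if "\<bar>off t u\<bar> <= w0 \<or> \<bar>off s u\<bar> <= w0" "j < length A" for u j
 proof -
  have "Min S <= \<bar>off (m j) t\<bar> - \<bar>r j\<bar>" "Min S <= \<bar>off (m j) s\<bar> - \<bar>r j\<bar>"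
   using that(2) S by (auto intro!: Min_le simp: S_def)
  then show ?thesis
   using that(1) w0(2) off_triangle[of "m j" t u] off_triangle[of "m j" s u] by linarith
 qed
 have dp': "double_pair (curve X') t s"
  using s(1) same[OF out] same[OF out_s] by (simp add: double_pair_def)
 have "\<exists>U. open U \<and> curve X' t \<in> U \<and> (\<forall>u. curve X' u \<in> U --> \<bar>off t u\<bar> < w0 \<or> \<bar>off s u\<bar> < w0)"
  by (rule curve_avoids[OF v(2) w0(1,3)]) (rule double_point_params[OF v(2) dp'])
 then obtain U where U: "open U" "curve X t \<in> U" "\<And>u. curve X' u \<in> U ==> \<bar>off t u\<bar> < w0 \<or> \<bar>off s u\<bar> < w0"
  using t'(1) by auto
 have "open (U \<inter> - disk)" using U(1) by (auto simp: disk_def intro!: open_Int open_Compl closed_cbox)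
 moreover have "curve X t \<in> U \<inter> - disk" using U(2) t'(2) by simp
 ultimately obtain W w \<eta> f where P': "open W" "curve X t \<in> W" "W \<subseteq> U \<inter> - disk" "0 < w" "w <= w0" "w < 1/4" "0 < \<eta>" "\<eta> <= w"
  and pa: "patchable X t s W w \<eta> f"
  by (rule twist_patch[OF v(1) o s(1) _ _ w0(1)])
 note P = P'(3,4,5,7,8) patchableD[OF pa]
 have far_w: "\<bar>r j\<bar> < \<bar>off (m j) u\<bar>" if "\<bar>off t u\<bar> <= w \<or> \<bar>off s u\<bar> <= w" "j < length A" for u j
  using far[OF _ that(2), of u] that(1) P(3) by linarith
 let ?Y = "patch X t s \<eta> f" and ?Y' = "patch X' t s \<eta> f"
 have T: "twist_at t X ?Y" by (rule P(8)[OF v(1)]) (use P(6) in auto)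
 have T': "twist_at t X' ?Y'"
 proof (rule P(8)[OF v(2)])
  show "curve X' u = curve X u \<and> label X' u = label X u" if "\<bar>off t u\<bar> <= w \<or> \<bar>off s u\<bar> <= w" for u
   using same[OF far_w[OF that]] by simp
  show "\<bar>off t u\<bar> <= w \<or> \<bar>off s u\<bar> <= w" if "curve X' u \<in> W" for u
  proof -
   have "curve X' u \<in> U" using that P(1) by blast
   then have "\<bar>off t u\<bar> <= w0 \<or> \<bar>off s u\<bar> <= w0" using U(3) by fastforce
   then have "curve X u = curve X' u" using same[OF far] by blast
   then show ?thesis using P(6) that by simp
  qed
 qed
 have away: "\<not> \<bar>off s u\<bar> <= \<eta> \<and> \<not> (\<bar>off s u\<bar> = \<eta>/4 \<or> \<bar>off t u\<bar> = \<eta>/4)"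
  if "j < length A" "\<bar>off (m j) u\<bar> <= \<bar>r j\<bar>" for u j
  using far_w[OF _ that(1), of u] that(2) P(4,5) by force
 have keep: "shows_picture m r C (patch Z t s \<eta> f)" if "shows_picture m r C Z" "length C = length A" for C Z
 proof -
  have "\<bar>off (m j) (arc_param m r j x)\<bar> <= \<bar>r j\<bar>" if "j < length A" "x \<in> {-1..1}" for j x
  proof -
   have "\<bar>off (m j) (m j + r j * x + of_int 0)\<bar> <= \<bar>r j * x\<bar>" by (rule abs_off_le)
   also have "\<dots> <= \<bar>r j\<bar>" using that(2) by (simp add: abs_mult mult_left_le abs_le_iff)
   finally show ?thesis by (simp add: arc_param_def)
  qed
  then show ?thesis using that away unfolding shows_picture_def by simp
 qed
 have "move_at A B m r ?Y ?Y'"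
  unfolding move_at_def
 proof (intro conjI allI impI)
  fix u assume u: "\<forall>j<length A. \<bar>r j\<bar> < \<bar>off (m j) u\<bar>"
  show "curve ?Y u = curve ?Y' u" "label ?Y u = label ?Y' u" using same[of u] u by auto
  show "curve ?Y u \<notin> disk" using same[of u] u P(7)[of "off s u"] P(1) by auto
 qed (use twist_at_valid(2)[OF T] twist_at_valid(2)[OF T'] len da keep[OF sh(1)] keep[OF sh(2)] in auto)
 then show ?thesis using T T' by blast
qed

lemma move_at_twists:
 assumes "move_at A B m r X X'" "marks_in_disk A"
  "\<And>t. t \<in> set ts ==> label X t = Over \<and> (\<forall>j<length A. \<bar>r j\<bar> < \<bar>off (m j) t\<bar>)"
 shows "\<exists>Y Y'. twists X ts Y \<and> twists X' ts Y' \<and> move_at A B m r Y Y'"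
 using assms
proof (induction ts arbitrary: X X')
 case Nil
 have "valid X" "valid X'" using Nil.prems(1) move_at_def by blast+
 then show ?case using Nil.prems(1) by auto
next
 case (Cons t ts)
 obtain X1 X1' where X1: "twist_at t X X1" "twist_at t X' X1'" "move_at A B m r X1 X1'"
  using move_at_twist[OF Cons.prems(1,2), of t] Cons.prems(3)[of t] by (meson list.set_intros(1))
 have "\<exists>Y Y'. twists X1 ts Y \<and> twists X1' ts Y' \<and> move_at A B m r Y Y'"
  by (rule Cons.IH[OF X1(3) Cons.prems(2)]) (use Cons.prems(3) twist_at_Over_iff(1)[OF X1(1)] in auto)
 then show ?case using X1 by auto
qed

abbreviation wen_moves :: "(picture \<times> picture) set" where
 "wen_moves \<equiv> reidemeister_moves \<union> W1 \<union> W2 \<union> W3"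

abbreviation equivalent :: "diagram => diagram => bool" (infix "\<asymp>" 50) where
 "D \<asymp> E \<equiv> move_equivalent wen_moves D E"

lemma equivalent_refl: "D \<asymp> D"
 unfolding move_equivalent_def by simp

lemma equivalent_sym: "D \<asymp> E ==> E \<asymp> D"
 unfolding move_equivalent_def by (rule equivclp_sym)

lemma equivalent_trans [trans]: "D \<asymp> E ==> E \<asymp> F ==> D \<asymp> F"
 unfolding move_equivalent_def by (rule equivclp_trans)

lemma equivalent_isotopic_by: "isotopic_by \<alpha> D E ==> D \<asymp> E"
 unfolding move_equivalent_def isotopic_iff_isotopic_by by (intro r_into_equivclp) blast

lemma equivalent_isotopic_over: "isotopic_over \<alpha> D E ==> D \<asymp> E"
 unfolding isotopic_over_def using equivalent_isotopic_by by blast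

lemma equivalent_isotopic_rel: "isotopic_rel_over D E ==> D \<asymp> E"
 unfolding isotopic_rel_over_def using equivalent_isotopic_by by blast

lemma equivalent_move_at: "(A, B) \<in> wen_moves ==> move_at A B m r D E ==> D \<asymp> E"
 unfolding move_equivalent_def using local_move_iff by (intro r_into_equivclp) blast

lemma marks_in_disk_moves:
 assumes "(A, B) \<in> wen_moves \<union> W4"
 shows "marks_in_disk A"
proof -
 have h: "horizontal c x \<in> disk" if "\<bar>c\<bar> <= 1" "\<bar>x\<bar> <= 1" for c x
  using that by (simp add: horizontal_def mem_disk_iff)
 have tri: "marks_in_disk (fst (triangle_move X Y Z))" for X Y Z
 proof -
  obtain a a' b b' c c' where "X = (a, a')" "Y = (b, b')" "Z = (c, c')" by (metis surj_pair)
  moreover have "8 * ((1 - x * x) * (1 - x * x)) <= 9" if "x * 2 = 1" for x :: real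
  proof -
   have "x = 1/2" using that by simp
   then show ?thesis by (simp only:) simp
  qed
  ultimately show ?thesis
   by (auto simp: marks_in_disk_def rising_def falling_def bent_def bump_def mem_disk_iff power2_eq_square)
 qed
 have tri': "marks_in_disk A" if "(A, B) = triangle_move X Y Z" for X Y Z
  using tri[of X Y Z] that by (metis fst_conv)
 consider "(A, B) \<in> R3 \<union> R6 \<union> R7 \<union> R8" | "(A, B) \<in> R1 \<union> R2 \<union> R4 \<union> R5 \<union> W1 \<union> W2 \<union> W3 \<union> W4"
  using assms unfolding reidemeister_moves_def by blast
 then show ?thesis
 proof cases
  case 1
  then show ?thesis unfolding R3_def R6_def R7_def R8_def using tri' by blast
 next
  case 2
  then show ?thesis
   unfolding R1_def R2_def R4_def R5_def W1_def W2_def W3_def W4_def kink_moves_def bigon_moves_def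
   by (auto simp: marks_in_disk_def horizontal_def vertical_def mem_disk_iff)
 qed
qed

section \<open>Moving a wen along the curve\<close>

lemma Ints_abs_less_1: "\<bar>y\<bar> < 1 ==> (y::real) \<in> \<int> \<longleftrightarrow> y = 0"
 by (auto elim!: Ints_cases)

lemma map_diagram_set_wen: "map_diagram h (set_wen p D) = set_wen p (map_diagram h D)"
 by (simp add: map_diagram_def set_wen_def cong: if_cong)

lemma equivalent_map:
 assumes "diffeo h" "valid D" "valid E" "map_diagram h D \<asymp> map_diagram h E"
 shows "D \<asymp> E"
proof -
 have "D \<asymp> map_diagram h D" by (rule equivalent_isotopic_by[OF isotopic_by_map[OF assms(2,1)]])
 also note assms(4)
 also have "map_diagram h E \<asymp> E"
  by (rule equivalent_sym[OF equivalent_isotopic_by[OF isotopic_by_map[OF assms(3,1)]]])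
 finally show ?thesis .
qed

text \<open>
 Away from the crossings a wen is moved by an isotopy: straighten a short arc and translate along it
 with a cut-off.
\<close>

lemma slide_free:
 assumes v: "valid Y" and nw: "\<And>u. label Y u ~= Wen" and p: "label Y p = Plain"
 shows "\<exists>e>0. \<forall>q. \<bar>q - p\<bar> < e --> label Y q = Plain \<and> set_wen p Y \<asymp> set_wen q Y"
proof -
 obtain V where V: "\<And>t. (curve Y has_vector_derivative V t) (at t)" "continuous_on UNIV V" "\<And>t. V t ~= 0"
  using valid_velocity[OF v] by metis
 have d1: "((\<lambda>u. curve Y (p + u)) has_vector_derivative V (p + u)) (at u)" for u
 proof -
  have "((\<lambda>u. p + u) has_vector_derivative 1) (at u)"
   by (auto intro!: derivative_eq_intros simp flip: has_real_derivative_iff_has_vector_derivative)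
  then show ?thesis using vector_diff_chain_at[OF _ V(1)] by (force simp: comp_def)
 qed
 have d2: "((\<lambda>u. curve Y p + u *\<^sub>R (\<i> * V p)) has_vector_derivative \<i> * V p) (at u)" for u
  by (auto intro!: derivative_eq_intros)
 have c1: "continuous_on UNIV (\<lambda>u. V (p + u))"
  by (rule continuous_on_compose2[OF V(2)]) (auto intro!: continuous_intros)
 have "cross (V p) (\<i> * V p) = (norm (V p))\<^sup>2" unfolding cmod_power2 by (simp add: cross_def power2_eq_square)
 then have pos: "cross (V (p + 0)) (\<i> * V p) > 0" using V(3)[of p] by simp
 obtain F w1 where F: "diffeo F" "0 < w1" "\<And>u. \<bar>u\<bar> <= w1 ==> F (Complex u 0) = curve Y (p + u)"
  by (rule transversal_chart[OF d1 d2 c1 continuous_on_const, of "curve Y p"]) (use pos in auto)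
 obtain w2 where w2: "0 < w2" "w2 < 1/2" "\<And>u. label Y u ~= Plain ==> off p u ~= 0 ==> w2 < \<bar>off p u\<bar>"
  by (rule label_gap[OF v, of p]) blast
 define w where "w = min (1/4) (min w1 w2)"
 have w: "0 < w" "w <= 1/4" "w <= w1" "w <= w2" using F(2) w2(1) by (simp_all add: w_def)
 have plain: "label Y u = Plain" if "\<bar>off p u\<bar> <= w" for u
 proof (cases "off p u = 0")
  case True
  then show ?thesis using label_mod_int[OF v, of u p] p by (simp add: off_eq_0_iff)
 next
  case False
  then show ?thesis using w2(3)[of u] that w(4) by force
 qed
 have x: "off p u = 0 \<or> off p u = 0" if "curve Y u = curve Y p" for u
 proof (rule ccontr)
  assume "\<not> (off p u = 0 \<or> off p u = 0)"
  then have "double_pair (curve Y) u p" using that by (simp add: double_pair_def off_eq_0_iff)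
  then show False using validD(4)[OF v] p by (force simp: real_crossing_def virtual_crossing_def)
 qed
 have w12: "w <= 1/2" using w(2) by simp
 have "\<exists>U. open U \<and> curve Y p \<in> U \<and> (\<forall>u. curve Y u \<in> U --> \<bar>off p u\<bar> < w \<or> \<bar>off p u\<bar> < w)"
  by (rule curve_avoids[OF v w(1) w12]) (rule x)
 then obtain U where U: "open U" "curve Y p \<in> U" "\<forall>u. curve Y u \<in> U --> \<bar>off p u\<bar> < w"
  by auto
 have Fi: "inv F (F z) = z" "F (inv F z) = z" for z
  using diffeoD(2)[OF F(1)] by (auto simp: bij_def surj_f_inv_f)
 have "F 0 = curve Y p" using F(3)[of 0] F(2) by (simp add: zero_complex.code[symmetric])
 then have "F 0 \<in> U" using U(2) by simp
 then obtain d where d: "0 < d" "\<And>dl z. 0 < dl ==> dl <= d ==> z \<in> disk ==> F (scale dl z) \<in> U"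
  using small_scale[OF diffeoD(3)[OF F(1)] U(1)] by blast
 define dl where "dl = min d w"
 have dl: "0 < dl" "dl <= d" "dl <= w" "dl < 1/2" using d(1) w by (auto simp: dl_def)
 define h where "h = scale (1/dl) \<circ> inv F"
 have dh: "diffeo h" unfolding h_def by (intro diffeo_compose diffeo_scale diffeo_inv F) (use dl in auto)
 have sc: "scale dl (scale (1/dl) z) = z" for z using dl(1) by (simp add: complex_eq_iff)
 have arc: "h (curve Y u) = Complex (off p u / dl) 0" if "\<bar>off p u\<bar> <= w" for u
 proof -
  have "curve Y u = curve Y (p + off p u)" by (rule periodic_off) (rule validD(1)[OF v])
  also have "\<dots> = F (Complex (off p u) 0)" using F(3)[of "off p u"] that w(3) by simp
  finally have "h (curve Y u) = scale (1/dl) (Complex (off p u) 0)" by (simp only: h_def comp_def Fi)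
  then show ?thesis by (simp add: complex_eq_iff)
 qed
 have out: "\<bar>off p u\<bar> <= dl" if "h (curve Y u) \<in> disk" for u
 proof -
  have "F (scale dl (h (curve Y u))) \<in> U" by (rule d(2)[OF dl(1,2) that])
  then have "\<bar>off p u\<bar> < w" by (intro U(3)[rule_format]) (simp add: h_def sc Fi)
  then show ?thesis using arc[of u] that dl(1) by (simp add: mem_disk_iff abs_divide)
 qed
 have "label Y (p + dl * c) = Plain \<and> set_wen p Y \<asymp> set_wen (p + dl * c) Y" if c: "\<bar>c\<bar> < 1/3" for c
 proof
  let ?q = "p + dl * c"
  have dc: "\<bar>dl * c\<bar> <= dl * 1" using c dl(1) unfolding abs_mult by (intro mult_mono) auto
  then have oq: "off p ?q = dl * c" using dl(4) by (intro off_self) simp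
  show lq: "label Y ?q = Plain" by (rule plain) (use oq dc dl(3) in simp)
  \<comment> \<open>The displacement is a tent function: \<open>f\<close> moves the origin to \<open>c\<close> and fixes all points outside \<open>[-1, 1]\<close>.\<close>
  define f where "f x = x + c * max 0 (1 - \<bar>x\<bar>)" for x
  have fm: "strict_mono f"
  proof (rule strict_monoI)
   fix x y :: real assume xy: "x < y"
   have "\<bar>c\<bar> * \<bar>max 0 (1 - \<bar>x\<bar>) - max 0 (1 - \<bar>y\<bar>)\<bar> <= (1/3) * (y - x)"
    using c xy by (intro mult_mono) (auto simp: max_def abs_if)
   then have "\<bar>c * max 0 (1 - \<bar>x\<bar>) - c * max 0 (1 - \<bar>y\<bar>)\<bar> <= (1/3) * (y - x)"
    by (simp add: abs_mult[symmetric] right_diff_distrib)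
   then show "f x < f y" using xy unfolding f_def by argo
  qed
  have fc: "continuous_on UNIV f" unfolding f_def[abs_def] by (intro continuous_intros)
  have fo: "f x = x" if "1 <= \<bar>x\<bar>" for x using that by (simp add: f_def)
  define C where "C = push 1 (complex_of_real c)"
  have Ci: "isotopic_to_id C" unfolding C_def by (rule isotopic_to_id_push) (use c in simp)
  have Cx: "C (Complex x 0) = Complex (f x) 0" for x
   by (simp add: C_def push_def f_def norm1_def complex_eq_iff)
  have Co: "C z = z" if "z \<notin> disk" for z
   unfolding C_def by (rule push_outside) (use that in \<open>auto simp: mem_disk_iff norm1_def\<close>)
  define \<beta> where "\<beta> = bend p dl f"
  have rb: "reparam \<beta>" unfolding \<beta>_def by (rule reparam_bend[OF fm fc fo dl(1,4)])
  have ob: "off p (\<beta> u) = dl * f (off p u / dl)" for u unfolding \<beta>_def by (rule off_bend[OF fm fo dl(1,4)])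
  have bo: "\<beta> u = u" if "\<not> \<bar>off p u\<bar> <= dl" for u
   unfolding \<beta>_def using bend_outside[OF fo dl(1)] that by force
  have bin: "\<bar>off p (\<beta> u)\<bar> <= dl" if "\<bar>off p u\<bar> <= dl" for u
  proof -
   have "\<bar>off p u / dl\<bar> <= 1" using that dl(1) by (simp add: abs_divide)
   then have "\<bar>f (off p u / dl)\<bar> <= 1" using abs_le_if_id_outside[of f] fm fo by blast
   then show ?thesis using ob[of u] dl(1) by (simp add: abs_mult)
  qed
  have bp: "\<beta> p = ?q" using off_self[of 0 p] by (simp add: \<beta>_def bend_def f_def)
  let ?Z = "map_diagram h Y"
  have cv: "C (curve ?Z u) = curve ?Z (\<beta> u)" for u
  proof (cases "\<bar>off p u\<bar> <= dl")
   case True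
   then have "curve ?Z u = Complex (off p u / dl) 0" "curve ?Z (\<beta> u) = Complex (off p (\<beta> u) / dl) 0"
    using arc[of u] arc[of "\<beta> u"] bin[OF True] dl(3) by auto
   then show ?thesis using Cx ob dl(1) by simp
  next
   case False
   then show ?thesis using bo[OF False] out[of u] Co by auto
  qed
  have lb: "label Y (\<beta> u) = label Y u" for u
  proof (cases "\<bar>off p u\<bar> <= dl")
   case True
   then show ?thesis using plain[of u] plain[of "\<beta> u"] bin[OF True] dl(3) by auto
  qed (simp add: bo)
  have "isotopic_by (inv \<beta>) (set_wen p ?Z) (set_wen ?q ?Z)"
  proof (rule isotopic_by_of_push[OF _ _ rb Ci])
   show "valid (set_wen p ?Z)" "valid (set_wen ?q ?Z)"
    using valid_set_wen[OF valid_map[OF dh v]] p lq by auto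
   fix u
   have "\<beta> u - ?q \<in> \<int> \<longleftrightarrow> u - p \<in> \<int>" using reparam_mod_int[OF rb, of u p] bp by simp
   then show "curve (set_wen ?q ?Z) (\<beta> u) = C (curve (set_wen p ?Z) u) \<and> label (set_wen ?q ?Z) (\<beta> u) = label (set_wen p ?Z) u"
    using cv lb by simp
  qed
  then have "map_diagram h (set_wen p Y) \<asymp> map_diagram h (set_wen ?q Y)"
   unfolding map_diagram_set_wen by (rule equivalent_isotopic_by)
  then show "set_wen p Y \<asymp> set_wen ?q Y"
   by (rule equivalent_map[OF dh, rotated 2]) (use valid_set_wen[OF v] p lq in auto)
 qed
 note main = this
 have "label Y q = Plain \<and> set_wen p Y \<asymp> set_wen q Y" if "\<bar>q - p\<bar> < dl/3" for q
 proof -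
  have "\<bar>(q - p) / dl\<bar> < 1/3" using that dl(1) by (simp add: abs_divide field_simps)
  then show ?thesis using main[of "(q - p) / dl"] dl(1) by simp
 qed
 then show ?thesis using dl(1) by (intro exI[of _ "dl/3"]) auto
qed

lemma slide_interval:
 assumes v: "valid Y" and nw: "\<And>u. label Y u ~= Wen"
  and p: "\<And>u. u \<in> {a..b} ==> label Y u = Plain" and ab: "x \<in> {a..b}" "y \<in> {a..b}"
 shows "set_wen x Y \<asymp> set_wen y Y"
proof (rule connected_equivalence_relation[of "{a..b}" x y "\<lambda>x y. set_wen x Y \<asymp> set_wen y Y"])
 fix c assume c: "c \<in> {a..b}"
 obtain e where e: "e > 0" "\<forall>q. \<bar>q - c\<bar> < e --> label Y q = Plain \<and> set_wen c Y \<asymp> set_wen q Y"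
  using slide_free[OF v nw p[OF c]] by blast
 show "\<exists>T. openin (top_of_set {a..b}) T \<and> c \<in> T \<and> (\<forall>x\<in>T. set_wen c Y \<asymp> set_wen x Y)"
  using e c by (intro exI[of _ "{a..b} \<inter> ball c e"]) (auto simp: dist_real_def abs_minus_commute openin_open)
next
 show "set_wen y Y \<asymp> set_wen x Y" if "set_wen x Y \<asymp> set_wen y Y" for x y by (rule equivalent_sym[OF that])
 show "set_wen x Y \<asymp> set_wen z Y" if "set_wen x Y \<asymp> set_wen y Y" "set_wen y Y \<asymp> set_wen z Y" for x y z
  by (rule equivalent_trans[OF that])
qed (use ab in simp_all)

definition two :: "'a => 'a => nat => 'a" where
 "two x y j = (if j = 0 then x else y)"

lemma two_simps [simp]: "two x y 0 = x" "two x y (Suc 0) = y" "two x y 1 = y"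
 by (simp_all add: two_def)

lemma less_2_iff: "(j::nat) < Suc (Suc 0) \<longleftrightarrow> j = 0 \<or> j = Suc 0"
 by auto

lemma straight_disjoint_arcs:
 assumes st: "straight D t s dl sg" and v: "valid D" and r: "\<bar>r1\<bar> = dl" "\<bar>r2\<bar> = dl"
 shows "disjoint_arcs (two t s) (two r1 r2) 2"
proof -
 note d = straightD[OF st]
 have o: "off a (a + c * x) = c * x" "\<bar>c * x\<bar> <= dl" if "x \<in> {-1..1}" "\<bar>c\<bar> = dl" for a c x
 proof -
  have "\<bar>c\<bar> * \<bar>x\<bar> <= dl * 1" using that d(1) by (intro mult_mono) auto
  then show "\<bar>c * x\<bar> <= dl" by (simp add: abs_mult)
  then show "off a (a + c * x) = c * x" using d(2) by (intro off_self) simp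
 qed
 have same: "x = y" if "x \<in> {-1..1}" "y \<in> {-1..1}" "\<bar>c\<bar> = dl" "(a + c * x) - (a + c * y) \<in> \<int>" for a c x y
  using o(1)[OF that(1,3), of a] o(1)[OF that(2,3), of a] that(3,4) off_eq_iff[of a "a + c * x" "a + c * y"] d(1) by auto
 have diff: "\<not> (t + r1 * x) - (s + r2 * y) \<in> \<int>" if "x \<in> {-1..1}" "y \<in> {-1..1}" for x y
 proof
  assume "(t + r1 * x) - (s + r2 * y) \<in> \<int>"
  then have "off s (t + r1 * x) = off s (s + r2 * y)" using off_eq_iff by blast
  then show False
   using straight_disjoint[OF st v, of "t + r1 * x"] o(1)[OF that(1) r(1), of t] o(2)[OF that(1) r(1)] o(1)[OF that(2) r(2), of s] o(2)[OF that(2) r(2)] by simp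
 qed
 then have diff': "\<not> (s + r2 * y) - (t + r1 * x) \<in> \<int>" if "x \<in> {-1..1}" "y \<in> {-1..1}" for x y
  using that by (metis Ints_minus minus_diff_eq)
 show ?thesis
  unfolding disjoint_arcs_def arc_param_def numeral_2_eq_2 less_2_iff
  using same[OF _ _ r(1)] same[OF _ _ r(2)] diff diff' by auto
qed

lemma on_arcs:
 assumes st: "straight D t s dl sg" and v: "valid D" and x: "\<bar>x\<bar> <= 1" and c: "\<bar>c\<bar> = dl"
 shows "off t (t + c * x) = c * x" "off s (s + c * x) = c * x"
  "\<not> \<bar>off s (t + c * x)\<bar> <= dl" "\<not> \<bar>off t (s + c * x)\<bar> <= dl" "\<bar>c * x\<bar> <= dl"
proof -
 note d = straightD[OF st]
 have "\<bar>c\<bar> * \<bar>x\<bar> <= dl * 1" using x c d(1) by (intro mult_mono) auto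
 then show cx: "\<bar>c * x\<bar> <= dl" by (simp add: abs_mult)
 then show o: "off t (t + c * x) = c * x" "off s (s + c * x) = c * x" using d(2) by simp_all
 show "\<not> \<bar>off s (t + c * x)\<bar> <= dl" using straight_disjoint[OF st v, of "t + c * x"] o cx by simp
 show "\<not> \<bar>off t (s + c * x)\<bar> <= dl" using straight_disjoint[OF st v, of "s + c * x"] o cx by simp
qed

lemma straight_wen_label:
 assumes st: "straight D t s dl sg" and v: "valid D" and a: "\<bar>a\<bar> <= 1" "a ~= 0"
 shows "label D (t + dl * a) = Plain"
 using st a unfolding straight_def by blast

lemma set_wen_on_arcs:
 assumes st: "straight D t s dl sg" and v: "valid D" and x: "\<bar>x\<bar> <= 1" and a: "\<bar>a\<bar> <= 1" and c: "\<bar>c\<bar> = dl"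
 shows "(t + c * x) - (t + c * a) \<in> \<int> \<longleftrightarrow> x = a" "(s + b * x) - (t + c * a) \<notin> \<int> \<or> \<bar>b\<bar> ~= dl"
proof -
 note d = straightD[OF st]
 show "(t + c * x) - (t + c * a) \<in> \<int> \<longleftrightarrow> x = a"
  using off_eq_iff[of t "t + c * x" "t + c * a"] on_arcs(1)[OF st v x c] on_arcs(1)[OF st v a c] c d(1) by auto
 show "(s + b * x) - (t + c * a) \<notin> \<int> \<or> \<bar>b\<bar> ~= dl"
 proof (rule disjCI)
  assume "\<not> \<bar>b\<bar> ~= dl"
  then have b: "\<bar>b\<bar> = dl" by simp
  show "(s + b * x) - (t + c * a) \<notin> \<int>"
   using off_eq_iff[of t "s + b * x" "t + c * a"] on_arcs(4)[OF st v x b] on_arcs(1,5)[OF st v a c] by auto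
 qed
qed

lemma pass_under_straight:
 assumes st: "straight Z t s dl sg" and v: "valid Z" and nw: "\<And>u. label Z u ~= Wen"
  and l: "label Z t = Under \<and> label Z s = Over \<or> label Z t = Virtual \<and> label Z s = Virtual"
 shows "set_wen (t - dl/2) Z \<asymp> set_wen (t + dl/2) Z"
proof -
 note d = straightD[OF st]
 have r2: "\<bar>sg * dl\<bar> = dl" "\<bar>dl\<bar> = dl" using d(1,3) by (auto simp: abs_mult)
 let ?m = "two t s" and ?r = "two dl (sg * dl)"
 define A :: picture where "A = [(horizontal 0, [(-1/2, Wen), (0, label Z t)]), (vertical, [(0, label Z s)])]"
 define B :: picture where "B = [(horizontal 0, [(0, label Z t), (1/2, Wen)]), (vertical, [(0, label Z s)])]"
 have len: "length A = Suc (Suc 0)" "length B = Suc (Suc 0)" by (simp_all add: A_def B_def)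
 have mem: "(A, B) \<in> wen_moves"
  using l unfolding A_def B_def W1_def W3_def by auto
 have vs: "valid (set_wen (t + dl * a) Z)" if "a \<in> {1/2, -1/2}" for a
  using straight_wen_label[OF st v, of a] that by (intro valid_set_wen[OF v]) auto
 have c0: "curve Z (t + dl * x) = horizontal 0 x" "curve Z (s + sg * dl * x) = vertical x" if "\<bar>x\<bar> <= 1" for x
 proof -
  have "\<bar>sg * x\<bar> <= 1" using that d(3) by auto
  then have "curve Z (t + dl * x) = Complex x 0" "curve Z (s + dl * (sg * x)) = Complex 0 (sg * (sg * x))"
   using st that unfolding straight_def by blast+
  then show "curve Z (t + dl * x) = horizontal 0 x" "curve Z (s + sg * dl * x) = vertical x"
   using d(4) by (simp_all add: horizontal_def vertical_def mult.assoc[symmetric] mult.commute[of dl sg])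
 qed
 have l0: "x ~= 0 ==> label Z (t + dl * x) = Plain" "x ~= 0 ==> label Z (s + sg * dl * x) = Plain" if "\<bar>x\<bar> <= 1" for x
 proof -
  have "\<bar>sg * x\<bar> <= 1" "sg ~= 0" using that d(3) by auto
  then show "x ~= 0 ==> label Z (t + dl * x) = Plain" "x ~= 0 ==> label Z (s + sg * dl * x) = Plain"
   using st that unfolding straight_def by (metis mult.assoc mult.commute mult_eq_0_iff)+
 qed
 have "move_at A B ?m ?r (set_wen (t + dl * (-1/2)) Z) (set_wen (t + dl * (1/2)) Z)"
  unfolding move_at_def
 proof (intro conjI)
  show "length A = length B" by (simp add: A_def B_def)
  show "disjoint_arcs ?m ?r (length A)"
   using straight_disjoint_arcs[OF st v r2(2,1)] by (simp add: A_def numeral_2_eq_2)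
  have s1: "(t + dl * x) - (t + dl * a) \<in> \<int> \<longleftrightarrow> x = a" "(s + sg * dl * x) - (t + dl * a) \<notin> \<int>"
   if "\<bar>x\<bar> <= 1" "\<bar>a\<bar> <= 1" for x a
   using set_wen_on_arcs(1)[OF st v that r2(2)] set_wen_on_arcs(2)[OF st v that r2(2), of "sg * dl"] r2 by auto
  have m1: "\<bar>-1/2\<bar> <= (1::real)" "\<bar>1/2\<bar> <= (1::real)" by auto
  show "shows_picture ?m ?r A (set_wen (t + dl * (-1/2)) Z)"
   unfolding shows_picture_def
  proof (unfold len less_2_iff, intro allI impI ballI, elim disjE)
   fix j :: nat and x :: real assume j: "j = 0" and "x \<in> {-1..1}"
   then have x: "\<bar>x\<bar> <= 1" by (simp add: abs_le_iff)
   show "curve (set_wen (t + dl * (-1/2)) Z) (arc_param ?m ?r j x) = fst (A ! j) x \<and>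
    label (set_wen (t + dl * (-1/2)) Z) (arc_param ?m ?r j x) = mark (snd (A ! j)) x"
    unfolding j A_def arc_param_def two_simps set_wen_simps s1(1)[OF x m1(1)]
    using c0(1)[OF x] l0(1)[OF x] nw[of t] by (simp add: mark_def)
  next
   fix j :: nat and x :: real assume j: "j = Suc 0" and "x \<in> {-1..1}"
   then have x: "\<bar>x\<bar> <= 1" by (simp add: abs_le_iff)
   show "curve (set_wen (t + dl * (-1/2)) Z) (arc_param ?m ?r j x) = fst (A ! j) x \<and>
    label (set_wen (t + dl * (-1/2)) Z) (arc_param ?m ?r j x) = mark (snd (A ! j)) x"
    unfolding j A_def arc_param_def two_simps set_wen_simps
    using s1(2)[OF x m1(1)] c0(2)[OF x] l0(2)[OF x] nw[of s] by (simp add: mark_def)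
  qed
  show "shows_picture ?m ?r B (set_wen (t + dl * (1/2)) Z)"
   unfolding shows_picture_def
  proof (unfold len less_2_iff, intro allI impI ballI, elim disjE)
   fix j :: nat and x :: real assume j: "j = 0" and "x \<in> {-1..1}"
   then have x: "\<bar>x\<bar> <= 1" by (simp add: abs_le_iff)
   show "curve (set_wen (t + dl * (1/2)) Z) (arc_param ?m ?r j x) = fst (B ! j) x \<and>
    label (set_wen (t + dl * (1/2)) Z) (arc_param ?m ?r j x) = mark (snd (B ! j)) x"
    unfolding j B_def arc_param_def two_simps set_wen_simps s1(1)[OF x m1(2)]
    using c0(1)[OF x] l0(1)[OF x] nw[of t] by (simp add: mark_def)
  next
   fix j :: nat and x :: real assume j: "j = Suc 0" and "x \<in> {-1..1}"
   then have x: "\<bar>x\<bar> <= 1" by (simp add: abs_le_iff)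
   show "curve (set_wen (t + dl * (1/2)) Z) (arc_param ?m ?r j x) = fst (B ! j) x \<and>
    label (set_wen (t + dl * (1/2)) Z) (arc_param ?m ?r j x) = mark (snd (B ! j)) x"
    unfolding j B_def arc_param_def two_simps set_wen_simps
    using s1(2)[OF x m1(2)] c0(2)[OF x] l0(2)[OF x] nw[of s] by (simp add: mark_def)
  qed
  show "\<forall>u. (\<forall>j<length A. \<bar>?r j\<bar> < \<bar>off (?m j) u\<bar>) -->
    curve (set_wen (t + dl * (-1/2)) Z) u = curve (set_wen (t + dl * (1/2)) Z) u \<and>
    label (set_wen (t + dl * (-1/2)) Z) u = label (set_wen (t + dl * (1/2)) Z) u \<and>
    curve (set_wen (t + dl * (-1/2)) Z) u \<notin> disk"
  proof (intro allI impI)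
   fix u assume "\<forall>j<length A. \<bar>?r j\<bar> < \<bar>off (?m j) u\<bar>"
   then have u: "dl < \<bar>off t u\<bar>" "dl < \<bar>off s u\<bar>"
    using r2 by (auto simp: A_def less_2_iff)
   have "u - (t + dl * a) \<notin> \<int>" if "\<bar>a\<bar> <= 1" for a
    using off_eq_iff[of t u "t + dl * a"] on_arcs(1,5)[OF st v that r2(2)] u by auto
   then have "u - (t + dl * (-1/2)) \<notin> \<int>" "u - (t + dl * (1/2)) \<notin> \<int>" using m1 by blast+
   moreover have "curve Z u \<notin> disk" using d(5)[of u] u by auto
   ultimately show "curve (set_wen (t + dl * (-1/2)) Z) u = curve (set_wen (t + dl * (1/2)) Z) u \<and>
    label (set_wen (t + dl * (-1/2)) Z) u = label (set_wen (t + dl * (1/2)) Z) u \<and>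
    curve (set_wen (t + dl * (-1/2)) Z) u \<notin> disk" by simp
  qed
 qed (use vs[of "1/2"] vs[of "-1/2"] in simp_all)
 then have "set_wen (t + dl * (-1/2)) Z \<asymp> set_wen (t + dl * (1/2)) Z" by (rule equivalent_move_at[OF mem])
 then show ?thesis by simp
qed

text \<open>
 The wen passes an under-passage by W1 and a virtual passage by W3, once the crossing is straight.
\<close>

lemma pass_under:
 assumes v: "valid Y" and nw: "\<And>u. label Y u ~= Wen" and l: "label Y t \<in> {Under, Virtual}"
 shows "\<exists>dl>0. set_wen (t - dl) Y \<asymp> set_wen (t + dl) Y \<and>
  (\<forall>u. t - 2 * dl < u \<and> u < t + 2 * dl \<and> u ~= t --> label Y u = Plain)"
proof -
 obtain s where "double_pair (curve Y) s t" using validD(5)[OF v, of t] l by auto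
 then have dp: "double_pair (curve Y) t s" using double_pair_sym by blast
 obtain F w sg U where ch: "crossing_chart F Y t s w sg U" "w <= 1"
  by (rule crossing_chart_exists[OF v dp zero_less_one])
 note c = ch(1)[unfolded crossing_chart_def]
 have F: "diffeo F" "open U" "F 0 \<in> U" using c by blast+
 obtain d where d: "0 < d" "\<And>dl z. 0 < dl ==> dl <= d ==> z \<in> disk ==> F (scale dl z) \<in> U"
  using small_scale[OF diffeoD(3)[OF F(1)] F(2,3)] by blast
 define dl where "dl = min d w"
 have dl: "0 < dl" "dl <= d" "dl <= w" using d(1) c by (auto simp: dl_def)
 define h where "h = scale (1/dl) \<circ> inv F"
 have st: "straight (map_diagram h Y) t s dl sg"
  unfolding h_def by (rule crossing_chart_straight[OF ch(1) v dl(1,3)]) (rule d(2)[OF dl(1,2)])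
 have dh: "diffeo h" unfolding h_def by (intro diffeo_compose diffeo_scale diffeo_inv F) (use dl in auto)
 have "(label Y t, label Y s) \<in> real_crossing \<union> virtual_crossing" by (rule validD(4)[OF v dp])
 then have ll: "label Y t = Under \<and> label Y s = Over \<or> label Y t = Virtual \<and> label Y s = Virtual"
  using l by (auto simp: real_crossing_def virtual_crossing_def)
 have "set_wen (t - dl/2) (map_diagram h Y) \<asymp> set_wen (t + dl/2) (map_diagram h Y)"
  by (rule pass_under_straight[OF st valid_map[OF dh v]]) (use nw ll in auto)
 then have e: "map_diagram h (set_wen (t - dl/2) Y) \<asymp> map_diagram h (set_wen (t + dl/2) Y)"
  by (simp only: map_diagram_set_wen)
 have "label Y (t - dl/2) = Plain" "label Y (t + dl/2) = Plain"
  using straight_wen_label[OF st valid_map[OF dh v], of "1/2"]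
   straight_wen_label[OF st valid_map[OF dh v], of "-1/2"] by auto
 then have "valid (set_wen (t - dl/2) Y)" "valid (set_wen (t + dl/2) Y)"
  using valid_set_wen[OF v] by auto
 then have "set_wen (t - dl/2) Y \<asymp> set_wen (t + dl/2) Y" by (rule equivalent_map[OF dh _ _ e])
 moreover have "label Y u = Plain" if "t - 2 * (dl/2) < u \<and> u < t + 2 * (dl/2) \<and> u ~= t" for u
 proof -
  have "\<bar>(u - t) / dl\<bar> <= 1" "(u - t) / dl ~= 0" using that dl(1) by (auto simp: abs_divide abs_le_iff divide_le_eq)
  then show ?thesis using straight_wen_label[OF st valid_map[OF dh v], of "(u - t) / dl"] dl(1) by simp
 qed
 ultimately show ?thesis using dl(1) by (intro exI[of _ "dl/2"]) auto
qed

text \<open>Hence a wen moves freely along an arc without over-passages.\<close>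

lemma slide_no_over:
 assumes v: "valid Y" and nw: "\<And>u. label Y u ~= Wen"
  and no: "\<And>u. u \<in> {p..q} ==> label Y u ~= Over"
  and pq: "p <= q" "label Y p = Plain" "label Y q = Plain"
 shows "set_wen p Y \<asymp> set_wen q Y"
proof (cases "p = q")
 case True
 then show ?thesis using equivalent_refl by simp
next
 case False
 have near: "\<exists>w>0. w < 1/2 \<and> (\<forall>u. \<bar>u - a\<bar> <= w \<and> u ~= a --> label Y u = Plain)" for a
 proof -
  obtain w where w: "0 < w" "w < 1/2" "\<And>u. label Y u ~= Plain ==> off a u ~= 0 ==> w < \<bar>off a u\<bar>"
   by (rule label_gap[OF v, of a]) blast
  have "label Y u = Plain" if "\<bar>u - a\<bar> <= w \<and> u ~= a" for u
  proof -
   have "off a (a + (u - a)) = u - a" using that w(2) by (intro off_self) auto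
   then show ?thesis using w(3)[of u] that by force
  qed
  then show ?thesis using w by blast
 qed
 show ?thesis
 proof (rule connected_equivalence_relation_gen[of "{p..q}" p q "\<lambda>u. label Y u = Plain" "\<lambda>x y. set_wen x Y \<asymp> set_wen y Y"])
  fix T a assume T: "openin (top_of_set {p..q}) T" "a \<in> T"
  then obtain e where e: "e > 0" "\<And>x. x \<in> {p..q} ==> dist x a < e ==> x \<in> T"
   by (metis openin_euclidean_subtopology_iff)
  have a: "a \<in> {p..q}" using T openin_imp_subset by blast
  obtain w where w: "w > 0" "\<forall>u. \<bar>u - a\<bar> <= w \<and> u ~= a --> label Y u = Plain" using near[of a] by blast
  define k where "k = min (min (e/2) w) ((q - p)/2)"
  have pq': "p < q" using False pq(1) by simp
  have k: "k > 0" "k < e" "k <= w" "k <= (q - p)/2" using e(1) w(1) pq' unfolding k_def by (simp_all add: min_def)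
  show "\<exists>z. z \<in> T \<and> label Y z = Plain"
  proof (cases "a + k <= q")
   case True
   then show ?thesis using e(2)[of "a + k"] w(2) k a by (intro exI[of _ "a + k"]) (auto simp: dist_real_def)
  next
   case False
   moreover have "2 * k <= q - p" using k(4) by simp
   ultimately have "p <= a - k" by argo
   then show ?thesis using e(2)[of "a - k"] w(2) k a by (intro exI[of _ "a - k"]) (auto simp: dist_real_def)
  qed
 next
  fix a assume a: "a \<in> {p..q}"
  obtain w where w: "w > 0" "\<forall>u. \<bar>u - a\<bar> <= w \<and> u ~= a --> label Y u = Plain" using near[of a] by blast
  have T: "openin (top_of_set {p..q}) ({p..q} \<inter> ball a e)" "\<And>e. 0 < e ==> a \<in> {p..q} \<inter> ball a e" for e
   using a by (auto simp: openin_open)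
  show "\<exists>T. openin (top_of_set {p..q}) T \<and> a \<in> T \<and>
    (\<forall>x\<in>T. \<forall>y\<in>T. label Y x = Plain \<and> label Y y = Plain --> set_wen x Y \<asymp> set_wen y Y)"
  proof (cases "label Y a = Plain")
   case True
   obtain e where e: "e > 0" "\<forall>q. \<bar>q - a\<bar> < e --> label Y q = Plain \<and> set_wen a Y \<asymp> set_wen q Y"
    using slide_free[OF v nw True] by blast
   have "set_wen x Y \<asymp> set_wen y Y" if "\<bar>x - a\<bar> < e" "\<bar>y - a\<bar> < e" for x y
    using e(2) that equivalent_sym equivalent_trans by blast
   then show ?thesis using T[of e] e(1)
    by (intro exI[of _ "{p..q} \<inter> ball a e"]) (auto simp: dist_real_def abs_minus_commute)
  next
   case False
   then have "label Y a \<in> {Under, Virtual}" using no[OF a] nw[of a] by (cases "label Y a") auto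
   then obtain dl where dl: "dl > 0" "set_wen (a - dl) Y \<asymp> set_wen (a + dl) Y"
    "\<And>u. a - 2 * dl < u \<and> u < a + 2 * dl \<and> u ~= a ==> label Y u = Plain"
    using pass_under[OF v nw] by blast
   have left: "set_wen x Y \<asymp> set_wen (a - dl) Y" if "a - 2 * dl < x" "x < a" for x
    by (rule slide_interval[OF v nw, of "min x (a - dl)" "max x (a - dl)"]) (use that dl(1) in \<open>auto intro!: dl(3)\<close>)
   have right: "set_wen x Y \<asymp> set_wen (a + dl) Y" if "a < x" "x < a + 2 * dl" for x
    by (rule slide_interval[OF v nw, of "min x (a + dl)" "max x (a + dl)"]) (use that dl(1) in \<open>auto intro!: dl(3)\<close>)
   have all: "set_wen x Y \<asymp> set_wen (a + dl) Y" if "\<bar>x - a\<bar> < 2 * dl" "label Y x = Plain" for x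
   proof -
    have "x ~= a" using that False by auto
    then show ?thesis
     using left[of x] right[of x] dl(2) that equivalent_trans by (cases "x < a") (auto simp: abs_less_iff)
   qed
   have "set_wen x Y \<asymp> set_wen y Y" if "\<bar>x - a\<bar> < 2 * dl" "\<bar>y - a\<bar> < 2 * dl" "label Y x = Plain" "label Y y = Plain" for x y
    using all[OF that(1,3)] all[OF that(2,4)] equivalent_sym equivalent_trans by blast
   then show ?thesis using T[of "2 * dl"] dl(1)
    by (intro exI[of _ "{p..q} \<inter> ball a (2 * dl)"]) (auto simp: dist_real_def abs_minus_commute)
  qed
 next
  show "set_wen x Y \<asymp> set_wen z Y" if "set_wen x Y \<asymp> set_wen y Y" "set_wen y Y \<asymp> set_wen z Y" for x y z
   by (rule equivalent_trans[OF that])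
 qed (use pq in simp_all)
qed

text \<open>
 In a straight crossing the wen on the over-strand passes from one side to the other in either
 direction; the rotation by \<open>\<rho>\<close> turns the second direction into the first one.
\<close>

lemma pass_over_straight:
 assumes st: "straight X t s dl sg" and v: "valid X" and v': "valid (twisted X t s dl sg)"
  and nw: "\<And>u. label X u ~= Wen" and l: "label X t = Over" "label X s = Under" and \<rho>: "\<rho> \<in> {1, -1}"
 shows "set_wen (t - \<rho> * (dl/2) * (3/4)) X \<asymp> set_wen (t + \<rho> * (dl/2) * (3/4)) (twisted X t s dl sg)"
  "label X (t - \<rho> * (dl/2) * (3/4)) = Plain" "label (twisted X t s dl sg) (t + \<rho> * (dl/2) * (3/4)) = Plain"
proof -
 note d = straightD[OF st]
 let ?Y = "twisted X t s dl sg" and ?m = "two t s" and ?r = "two (\<rho> * (dl/2)) (\<rho> * sg * (dl/2))"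
 define A :: picture where "A = [(horizontal 0, [(-3/4, Wen), (0, Over)]), (vertical, [(0, Under)])]"
 define B :: picture where "B = [(horizontal 0, [(-1/2, Virtual), (0, Over), (1/2, Virtual), (3/4, Wen)]),
      (twist sg, [(-1/2, Virtual), (0, Under), (1/2, Virtual)])]"
 have len: "length A = Suc (Suc 0)" "length B = Suc (Suc 0)" by (simp_all add: A_def B_def)
 have mem: "(A, B) \<in> wen_moves"
  using d(3) unfolding A_def B_def W2_def by auto
 have \<rho>2: "\<rho> * \<rho> = 1" "\<bar>\<rho>\<bar> = 1" "\<bar>sg\<bar> = 1" "\<rho> ~= 0" "sg ~= 0" using \<rho> d(3) by auto
 have r2: "\<bar>\<rho> * (dl/2)\<bar> = dl/2" "\<bar>\<rho> * sg * (dl/2)\<bar> = dl/2" "\<bar>dl\<bar> = dl" using d(1) \<rho>2 by (simp_all add: abs_mult)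
 have off1: "off t (t + \<rho> * (dl/2) * x) = \<rho> * (dl/2) * x" "off s (s + \<rho> * sg * (dl/2) * x) = \<rho> * sg * (dl/2) * x"
  "\<not> \<bar>off s (t + \<rho> * (dl/2) * x)\<bar> <= dl" "\<not> \<bar>off t (s + \<rho> * sg * (dl/2) * x)\<bar> <= dl"
  "curve X (t + \<rho> * (dl/2) * x) = Complex (\<rho> * x/2) 0"
  "curve X (s + \<rho> * sg * (dl/2) * x) = Complex 0 (\<rho> * x/2)"
  "\<bar>\<rho> * sg * (dl/2) * x\<bar> = dl * (\<bar>x\<bar>/2)" "\<bar>\<rho> * (dl/2) * x\<bar> = dl * (\<bar>x\<bar>/2)" "dl * (\<bar>x\<bar>/2) <= dl"
  if x: "\<bar>x\<bar> <= 1" for x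
 proof -
  have y: "\<bar>\<rho> * x/2\<bar> <= 1" "\<bar>\<rho> * sg * x/2\<bar> <= 1" using x \<rho>2 by (simp_all add: abs_mult)
  have e: "\<rho> * (dl/2) * x = dl * (\<rho> * x/2)" "\<rho> * sg * (dl/2) * x = dl * (\<rho> * sg * x/2)" by simp_all
  show "off t (t + \<rho> * (dl/2) * x) = \<rho> * (dl/2) * x" "off s (s + \<rho> * sg * (dl/2) * x) = \<rho> * sg * (dl/2) * x"
   "\<not> \<bar>off s (t + \<rho> * (dl/2) * x)\<bar> <= dl" "\<not> \<bar>off t (s + \<rho> * sg * (dl/2) * x)\<bar> <= dl"
   unfolding e by (rule on_arcs[OF st v _ r2(3)], rule y)+
  show "curve X (t + \<rho> * (dl/2) * x) = Complex (\<rho> * x/2) 0"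
   unfolding e using st y(1) unfolding straight_def by blast
  have "curve X (s + dl * (\<rho> * sg * x/2)) = Complex 0 (sg * (\<rho> * sg * x/2))"
   using st y(2) unfolding straight_def by blast
  also have "sg * (\<rho> * sg * x/2) = (sg * sg) * (\<rho> * x/2)" by simp
  finally show "curve X (s + \<rho> * sg * (dl/2) * x) = Complex 0 (\<rho> * x/2)" unfolding e d(4) by simp
  show "\<bar>\<rho> * sg * (dl/2) * x\<bar> = dl * (\<bar>x\<bar>/2)" "\<bar>\<rho> * (dl/2) * x\<bar> = dl * (\<bar>x\<bar>/2)"
   using \<rho>2 d(1) by (simp_all add: abs_mult)
  have "\<bar>x\<bar>/2 <= 1" using x by simp
  then show "dl * (\<bar>x\<bar>/2) <= dl" using d(1) by (metis less_imp_le mult.right_neutral mult_left_mono)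
 qed
 have lX: "label X (t + \<rho> * (dl/2) * x) = (if x = 0 then Over else Plain)"
  "label X (s + \<rho> * sg * (dl/2) * x) = (if x = 0 then Under else Plain)" if x: "\<bar>x\<bar> <= 1" for x
 proof -
  have b: "\<bar>off t (t + \<rho> * (dl/2) * x)\<bar> <= dl" "\<bar>off s (s + \<rho> * sg * (dl/2) * x)\<bar> <= dl"
   unfolding off1(1,2)[OF x] off1(7,8)[OF x] by (rule off1(9)[OF x])+
  have nz: "off t (t + \<rho> * (dl/2) * x) ~= 0" "off s (s + \<rho> * sg * (dl/2) * x) ~= 0" if "x ~= 0"
   unfolding off1(1,2)[OF x] using that d(1) \<rho>2(4,5) by simp_all
  show "label X (t + \<rho> * (dl/2) * x) = (if x = 0 then Over else Plain)"
   using straight_curve(3)[OF st v b(1) nz(1)] l(1) by (cases "x = 0") simp_all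
  show "label X (s + \<rho> * sg * (dl/2) * x) = (if x = 0 then Under else Plain)"
   using straight_curve(4)[OF st v b(2) nz(2)] l(2) by (cases "x = 0") simp_all
 qed
 have hf: "dl * (\<bar>x\<bar>/2) = dl/4 \<longleftrightarrow> x = -1/2 \<or> x = 1/2" for x
  using d(1) by (auto simp: abs_if field_simps)
 have lY: "label ?Y (t + \<rho> * (dl/2) * x) = (if x = -1/2 \<or> x = 1/2 then Virtual else if x = 0 then Over else Plain)"
  "label ?Y (s + \<rho> * sg * (dl/2) * x) = (if x = -1/2 \<or> x = 1/2 then Virtual else if x = 0 then Under else Plain)"
  if x: "\<bar>x\<bar> <= 1" for x
 proof -
  have n: "\<bar>off s (t + \<rho> * (dl/2) * x)\<bar> ~= dl/4" "\<bar>off t (s + \<rho> * sg * (dl/2) * x)\<bar> ~= dl/4"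
   using off1(3,4)[OF x] d(1) by auto
  show "label ?Y (t + \<rho> * (dl/2) * x) = (if x = -1/2 \<or> x = 1/2 then Virtual else if x = 0 then Over else Plain)"
   unfolding label_twisted off1(1)[OF x] off1(8)[OF x] hf lX[OF x] using n by simp
  show "label ?Y (s + \<rho> * sg * (dl/2) * x) = (if x = -1/2 \<or> x = 1/2 then Virtual else if x = 0 then Under else Plain)"
   unfolding label_twisted off1(2)[OF x] off1(7)[OF x] hf lX[OF x] using n by simp
 qed
 let ?a = "t - \<rho> * (dl/2) * (3/4)" and ?b = "t + \<rho> * (dl/2) * (3/4)"
 have a: "?a = t + \<rho> * (dl/2) * (-3/4)" by simp
 show la: "label X ?a = Plain" and lb: "label ?Y ?b = Plain"
  unfolding a using lX(1)[of "-3/4"] lY(1)[of "3/4"] by simp_all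
 have cY: "curve ?Y (t + \<rho> * (dl/2) * x) = Complex (\<rho> * x/2) 0"
  "scale (2 * \<rho>) (curve ?Y (s + \<rho> * sg * (dl/2) * x)) = twist sg x" if x: "\<bar>x\<bar> <= 1" for x
 proof -
  show "curve ?Y (t + \<rho> * (dl/2) * x) = Complex (\<rho> * x/2) 0"
   unfolding curve_twisted using off1(3,5)[OF x] by simp
  have q: "\<rho> * sg * (dl/2) * x / dl = \<rho> * sg * x / 2" using d(1) by simp
  have "\<bar>\<rho> * sg * x / 2\<bar> <= 1/2" using x \<rho>2 by (simp add: abs_mult)
  then have hk: "hook (\<rho> * sg * x / 2) = (1/2) *\<^sub>R twist 1 (\<rho> * sg * x)" using hook_twist by fastforce
  have b: "bump (\<rho> * sg * x) = bump x" using \<rho>2(1) d(4) by (simp add: bump_def power_mult_distrib power2_eq_square[of \<rho>] power2_eq_square[of sg])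
  have "\<bar>off s (s + \<rho> * sg * (dl/2) * x)\<bar> <= dl" using off1(2,7,9)[OF x] by simp
  then have c: "curve ?Y (s + \<rho> * sg * (dl/2) * x) = cflip sg ((1/2) *\<^sub>R twist 1 (\<rho> * sg * x))"
   unfolding curve_twisted off1(2)[OF x] q hk by simp
  have "2 * \<rho> * ((1/2) * (1 * 16/9 * (\<rho> * sg * x) * bump x)) = (\<rho> * \<rho>) * (sg * 16/9 * x * bump x)"
   "2 * \<rho> * (sg * ((1/2) * ((\<rho> * sg * x) - 16/9 * (\<rho> * sg * x) * bump x))) = (\<rho> * \<rho>) * (sg * sg) * (x - 16/9 * x * bump x)"
   by (simp_all add: algebra_simps)
  then show "scale (2 * \<rho>) (curve ?Y (s + \<rho> * sg * (dl/2) * x)) = twist sg x"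
   unfolding c \<rho>2(1) d(4) by (simp add: complex_eq_iff twist_def b)
 qed
 have cX: "scale (2 * \<rho>) (Complex (\<rho> * x/2) 0) = horizontal 0 x" "scale (2 * \<rho>) (Complex 0 (\<rho> * x/2)) = vertical x" for x
 proof -
  have "2 * \<rho> * (\<rho> * x/2) = (\<rho> * \<rho>) * x" by simp
  then show "scale (2 * \<rho>) (Complex (\<rho> * x/2) 0) = horizontal 0 x" "scale (2 * \<rho>) (Complex 0 (\<rho> * x/2)) = vertical x"
   unfolding \<rho>2(1) by (simp_all add: complex_eq_iff horizontal_def vertical_def)
 qed
 have w: "(t + \<rho> * (dl/2) * x) - (t + \<rho> * (dl/2) * c) \<in> \<int> \<longleftrightarrow> x = c" "(s + \<rho> * sg * (dl/2) * x) - (t + \<rho> * (dl/2) * c) \<notin> \<int>"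
  if "\<bar>x\<bar> <= 1" "\<bar>c\<bar> <= 1" for x c
 proof -
  show "(t + \<rho> * (dl/2) * x) - (t + \<rho> * (dl/2) * c) \<in> \<int> \<longleftrightarrow> x = c"
   unfolding off_eq_iff[of t, symmetric] off1(1)[OF that(1)] off1(1)[OF that(2)] using \<rho>2(4) d(1) by simp
  show "(s + \<rho> * sg * (dl/2) * x) - (t + \<rho> * (dl/2) * c) \<notin> \<int>"
   unfolding off_eq_iff[of t, symmetric] off1(1)[OF that(2)]
   using off1(4)[OF that(1)] off1(8,9)[OF that(2)] by auto
 qed
 have wout: "u - (t + \<rho> * (dl/2) * c) \<notin> \<int>" if "dl/2 < \<bar>off t u\<bar>" "\<bar>c\<bar> <= 1" for u c
 proof -
  have "dl * (\<bar>c\<bar>/2) <= dl/2" using that(2) d(1) by (simp add: mult_left_le)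
  then show ?thesis
   unfolding off_eq_iff[of t, symmetric] off1(1)[OF that(2)] using off1(8)[OF that(2)] that(1) by auto
 qed
 have m1: "\<bar>-3/4\<bar> <= (1::real)" "\<bar>3/4\<bar> <= (1::real)" by auto
 have dh: "diffeo (scale (2 * \<rho>))" by (rule diffeo_scale) (use \<rho>2 in simp)
 let ?U = "set_wen ?a X" and ?V = "set_wen ?b ?Y"
 have vU: "valid ?U" "valid ?V"
  using valid_set_wen[OF v] valid_set_wen[OF v'] la lb by auto
 have "move_at A B ?m ?r (map_diagram (scale (2 * \<rho>)) ?U) (map_diagram (scale (2 * \<rho>)) ?V)"
  unfolding move_at_def
 proof (intro conjI)
  show "length A = length B" by (simp add: A_def B_def)
  have "straight (map_diagram (scale (1/(1/2))) X) t s (dl * (1/2)) sg" by (rule straight_scale[OF st v]) auto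
  moreover have "valid (map_diagram (scale (1/(1/2))) X)"
   by (rule valid_map[OF diffeo_scale v]) simp
  ultimately have "disjoint_arcs ?m ?r 2" by (rule straight_disjoint_arcs) (use r2 in auto)
  then show "disjoint_arcs ?m ?r (length A)" by (simp add: A_def numeral_2_eq_2)
  show "shows_picture ?m ?r A (map_diagram (scale (2 * \<rho>)) ?U)"
   unfolding shows_picture_def
  proof (unfold len less_2_iff, intro allI impI ballI, elim disjE)
   fix j :: nat and x :: real assume j: "j = 0" and "x \<in> {-1..1}"
   then have x: "\<bar>x\<bar> <= 1" by (simp add: abs_le_iff)
   show "curve (map_diagram (scale (2 * \<rho>)) ?U) (arc_param ?m ?r j x) = fst (A ! j) x \<and>
    label (map_diagram (scale (2 * \<rho>)) ?U) (arc_param ?m ?r j x) = mark (snd (A ! j)) x"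
    unfolding j A_def arc_param_def two_simps map_diagram_set_wen set_wen_simps a w(1)[OF x m1(1)]
    using off1(5)[OF x] cX(1)[of x] lX(1)[OF x] by (simp add: map_diagram_def mark_def)
  next
   fix j :: nat and x :: real assume j: "j = Suc 0" and "x \<in> {-1..1}"
   then have x: "\<bar>x\<bar> <= 1" by (simp add: abs_le_iff)
   show "curve (map_diagram (scale (2 * \<rho>)) ?U) (arc_param ?m ?r j x) = fst (A ! j) x \<and>
    label (map_diagram (scale (2 * \<rho>)) ?U) (arc_param ?m ?r j x) = mark (snd (A ! j)) x"
    unfolding j A_def arc_param_def two_simps map_diagram_set_wen set_wen_simps a
    using w(2)[OF x m1(1)] off1(6)[OF x] cX(2)[of x] lX(2)[OF x] by (simp add: map_diagram_def mark_def)
  qed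
  show "shows_picture ?m ?r B (map_diagram (scale (2 * \<rho>)) ?V)"
   unfolding shows_picture_def
  proof (unfold len less_2_iff, intro allI impI ballI, elim disjE)
   fix j :: nat and x :: real assume j: "j = 0" and "x \<in> {-1..1}"
   then have x: "\<bar>x\<bar> <= 1" by (simp add: abs_le_iff)
   show "curve (map_diagram (scale (2 * \<rho>)) ?V) (arc_param ?m ?r j x) = fst (B ! j) x \<and>
    label (map_diagram (scale (2 * \<rho>)) ?V) (arc_param ?m ?r j x) = mark (snd (B ! j)) x"
    unfolding j B_def arc_param_def two_simps map_diagram_set_wen set_wen_simps w(1)[OF x m1(2)]
    using cY(1)[OF x] cX(1)[of x] lY(1)[OF x] by (simp add: map_diagram_def mark_def)
  next
   fix j :: nat and x :: real assume j: "j = Suc 0" and "x \<in> {-1..1}"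
   then have x: "\<bar>x\<bar> <= 1" by (simp add: abs_le_iff)
   show "curve (map_diagram (scale (2 * \<rho>)) ?V) (arc_param ?m ?r j x) = fst (B ! j) x \<and>
    label (map_diagram (scale (2 * \<rho>)) ?V) (arc_param ?m ?r j x) = mark (snd (B ! j)) x"
    unfolding j B_def arc_param_def two_simps map_diagram_set_wen set_wen_simps
    using w(2)[OF x m1(2)] cY(2)[OF x] lY(2)[OF x] by (simp add: map_diagram_def mark_def)
  qed
  show "\<forall>u. (\<forall>j<length A. \<bar>?r j\<bar> < \<bar>off (?m j) u\<bar>) -->
    curve (map_diagram (scale (2 * \<rho>)) ?U) u = curve (map_diagram (scale (2 * \<rho>)) ?V) u \<and>
    label (map_diagram (scale (2 * \<rho>)) ?U) u = label (map_diagram (scale (2 * \<rho>)) ?V) u \<and>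
    curve (map_diagram (scale (2 * \<rho>)) ?U) u \<notin> disk"
  proof (intro allI impI)
   fix u assume "\<forall>j<length A. \<bar>?r j\<bar> < \<bar>off (?m j) u\<bar>"
   then have u: "dl/2 < \<bar>off t u\<bar>" "dl/2 < \<bar>off s u\<bar>" using r2 by (auto simp: A_def less_2_iff)
   have n: "u - ?a \<notin> \<int>" "u - ?b \<notin> \<int>" unfolding a using wout[OF u(1)] m1 by blast+
   have lab: "label ?Y u = label X u" unfolding label_twisted using u d(1) by auto
   have cu: "curve ?Y u = curve X u" by (rule curve_twisted_outside[OF st v]) (use u in simp)
   have "scale (2 * \<rho>) (curve X u) \<notin> disk"
   proof
    assume "scale (2 * \<rho>) (curve X u) \<in> disk"
    then have b: "2 * \<bar>Re (curve X u)\<bar> <= 1" "2 * \<bar>Im (curve X u)\<bar> <= 1" using \<rho>2 by (simp_all add: mem_disk_iff abs_mult)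
    then have "curve X u \<in> disk" by (simp add: mem_disk_iff)
    then consider "\<bar>off t u\<bar> <= dl" | "\<bar>off s u\<bar> <= dl" using d(5) by blast
    then show False
    proof cases
     case 1
     then show False using straight_curve(1)[OF st v 1] b(1) u(1) d(1) by (simp add: abs_divide field_simps)
    next
     case 2
     then show False using straight_curve(2)[OF st v 2] b(2) u(2) d(1) \<rho>2(3) by (simp add: abs_divide abs_mult field_simps)
    qed
   qed
   then show "curve (map_diagram (scale (2 * \<rho>)) ?U) u = curve (map_diagram (scale (2 * \<rho>)) ?V) u \<and>
    label (map_diagram (scale (2 * \<rho>)) ?U) u = label (map_diagram (scale (2 * \<rho>)) ?V) u \<and>
    curve (map_diagram (scale (2 * \<rho>)) ?U) u \<notin> disk"
    using n lab cu by (simp add: map_diagram_def)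
  qed
 qed (use valid_map[OF dh] vU in auto)
 then have "map_diagram (scale (2 * \<rho>)) ?U \<asymp> map_diagram (scale (2 * \<rho>)) ?V" by (rule equivalent_move_at[OF mem])
 then show "?U \<asymp> ?V" by (rule equivalent_map[OF dh vU])
qed

text \<open>
 Passing the over-passage is what a twist is made for: this is the move W2.
\<close>

lemma pass_over:
 assumes tw: "twist_at t X Y" and nw: "\<And>u. label X u ~= Wen"
 shows "\<exists>e>0. set_wen (t - e) X \<asymp> set_wen (t + e) Y \<and> set_wen (t + e) X \<asymp> set_wen (t - e) Y \<and>
  label Y (t - e) = Plain \<and> label Y (t + e) = Plain \<and>
  (\<forall>u. u ~= t \<and> \<bar>u - t\<bar> <= e --> label X u = Plain)"
proof -
 obtain h s dl sg where h: "valid X" "label X t = Over" "diffeo h"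
  "straight (map_diagram h X) t s dl sg" "map_diagram h Y = twisted (map_diagram h X) t s dl sg"
  "valid (map_diagram h X)" "valid Y" "label X s = Under"
  by (rule twist_atE[OF tw]) blast
 note d = straightD[OF h(4)]
 have vY: "valid (twisted (map_diagram h X) t s dl sg)"
  using valid_map[OF h(3,7)] h(5) by simp
 have lm: "label (map_diagram h D) u = label D u" for D u by (simp add: map_diagram_def)
 have lY: "label Y u = label (twisted (map_diagram h X) t s dl sg) u" for u using lm h(5) by metis
 have main: "set_wen (t - \<rho> * (dl/2) * (3/4)) X \<asymp> set_wen (t + \<rho> * (dl/2) * (3/4)) Y \<and> label Y (t + \<rho> * (dl/2) * (3/4)) = Plain"
  if \<rho>: "\<rho> \<in> {1, -1}" for \<rho>
 proof -
  note p = pass_over_straight[OF h(4,6) vY, unfolded lm, OF nw h(2,8) \<rho>]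
  have lb: "label Y (t + \<rho> * (dl/2) * (3/4)) = Plain" using p(3) lY by simp
  have "map_diagram h (set_wen (t - \<rho> * (dl/2) * (3/4)) X) \<asymp> map_diagram h (set_wen (t + \<rho> * (dl/2) * (3/4)) Y)"
   unfolding map_diagram_set_wen h(5) by (rule p(1))
  then have "set_wen (t - \<rho> * (dl/2) * (3/4)) X \<asymp> set_wen (t + \<rho> * (dl/2) * (3/4)) Y"
   by (rule equivalent_map[OF h(3) valid_set_wen[OF h(1)] valid_set_wen[OF h(7)], rotated 2])
    (use p(2) lb in auto)
  then show ?thesis using lb by simp
 qed
 \<comment> \<open>The move shows its wen at parameter 3/4, in a square half as big as that of the straight crossing.\<close>
 define e where "e = (dl/2) * (3/4)"
 have "label X u = Plain" if "u ~= t" "\<bar>u - t\<bar> <= e" for u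
 proof -
  have "\<bar>(u - t) / dl\<bar> <= 1" "(u - t) / dl ~= 0" using that d(1) by (simp_all add: e_def abs_divide field_simps)
  then show ?thesis using straight_wen_label[OF h(4,6), of "(u - t) / dl"] d(1) by (simp add: lm)
 qed
 moreover have "e > 0" using d(1) by (simp add: e_def)
 moreover have "set_wen (t - e) X \<asymp> set_wen (t + e) Y" "label Y (t + e) = Plain"
  using main[of 1] by (simp_all add: e_def)
 moreover have "set_wen (t + e) X \<asymp> set_wen (t - e) Y" "label Y (t - e) = Plain"
  using main[of "-1"] by (simp_all add: e_def)
 ultimately show ?thesis by blast
qed

section \<open>Sweeping one wen around the circle\<close>

text \<open>
 The number of wens modulo two, continuous from the right. As a function on the double cover of the
 circle it exists only if the total number of wens is odd, and it is unique up to the deck transformation.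
\<close>

definition counter :: "diagram => (real => bool) => bool" where
 "counter D N \<longleftrightarrow> (\<forall>t. N (t + 1) \<longleftrightarrow> \<not> N t) \<and>
   (\<forall>t. \<exists>e>0. \<forall>u. (t - e < u \<and> u < t --> (N u \<longleftrightarrow> N t ~= (label D t = Wen))) \<and>
    (t < u \<and> u < t + e --> N u = N t))"

text \<open>
 The over-passages of the crossings that get twisted when the single wen is put at \<open>p\<close>.
\<close>

definition over_set :: "diagram => (real => bool) => real => real set" where
 "over_set D N p = {t. p < t \<and> t < p + 1 \<and> label D t = Over \<and> N t}"

text \<open>
 Sortedness makes the list unique, which is convenient; the order of the twists is immaterial up to
 isotopy.
\<close>

definition swept :: "diagram => (real => bool) => real => diagram => bool" where
 "swept D N p E \<longleftrightarrow> label D p \<in> {Plain, Wen} \<and>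
   (\<exists>ts. sorted_wrt (<) ts \<and> set ts = over_set D N p \<and> twists (set_wen p D) ts E)"

lemma counter_const:
 assumes c: "counter D N" and xy: "x <= y" and no: "\<And>u. x < u ==> u <= y ==> label D u ~= Wen"
 shows "N x = N y"
proof (rule connected_equivalence_relation[of "{x..y}" x y "\<lambda>a b. N a = N b"])
 fix a assume a: "a \<in> {x..y}"
 obtain e where e: "e > 0" "\<forall>u. (a - e < u \<and> u < a --> (N u \<longleftrightarrow> N a ~= (label D a = Wen))) \<and> (a < u \<and> u < a + e --> N u = N a)"
  using c unfolding counter_def by blast
 have "N a = N u" if "u \<in> {x..y}" "\<bar>u - a\<bar> < e" for u
 proof (cases u a rule: linorder_cases)
  case less
  then show ?thesis using e(2) no[of a] a that by (auto simp: abs_if split: if_splits)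
 next
  case greater
  then show ?thesis using e(2) a that by (auto simp: abs_if split: if_splits)
 qed simp
 then have "\<forall>b\<in>{x..y} \<inter> ball a e. N a = N b"
  by (metis IntE abs_minus_commute dist_real_def mem_ball)
 moreover have "openin (top_of_set {x..y}) ({x..y} \<inter> ball a e)" "a \<in> {x..y} \<inter> ball a e"
  using a e(1) by (simp_all add: openin_open_Int)
 ultimately show "\<exists>T. openin (top_of_set {x..y}) T \<and> a \<in> T \<and> (\<forall>b\<in>T. N a = N b)" by blast
qed (use xy in auto)

lemma counter_unique:
 assumes c1: "counter D N" and c2: "counter D M"
 shows "(\<forall>t. M t = N t) \<or> (\<forall>t. M t = (\<not> N t))"
proof -
 have "(N x = M x) = (N y = M y)" for x y
 proof (rule connected_equivalence_relation[of UNIV x y "\<lambda>a b. (N a = M a) = (N b = M b)"])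
  fix a :: real
  obtain e where e: "e > 0" "\<forall>u. (a - e < u \<and> u < a --> (N u \<longleftrightarrow> N a ~= (label D a = Wen))) \<and> (a < u \<and> u < a + e --> N u = N a)"
   using c1 unfolding counter_def by blast
  obtain f where f: "f > 0" "\<forall>u. (a - f < u \<and> u < a --> (M u \<longleftrightarrow> M a ~= (label D a = Wen))) \<and> (a < u \<and> u < a + f --> M u = M a)"
   using c2 unfolding counter_def by blast
  have "(N a = M a) = (N u = M u)" if "\<bar>u - a\<bar> < min e f" for u
  proof (cases u a rule: linorder_cases)
   case less
   then have "N u \<longleftrightarrow> N a ~= (label D a = Wen)" "M u \<longleftrightarrow> M a ~= (label D a = Wen)"
    using e(2) f(2) that by (auto simp: abs_if split: if_splits)
   then show ?thesis by blast
  next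
   case greater
   then have "N u = N a" "M u = M a" using e(2) f(2) that by (auto simp: abs_if split: if_splits)
   then show ?thesis by blast
  qed simp
  then show "\<exists>T. openin (top_of_set UNIV) T \<and> a \<in> T \<and> (\<forall>b\<in>T. (N a = M a) = (N b = M b))"
   using e(1) f(1) by (intro exI[of _ "ball a (min e f)"]) (auto simp: dist_real_def abs_minus_commute)
 qed auto
 then show ?thesis by metis
qed

lemma finite_over_set:
 assumes v: "valid D"
 shows "finite (over_set D N p)"
proof -
 have fr: "label D (frac t) = label D t" for t
  by (rule label_mod_int[OF v]) (simp add: frac_def)
 have "inj_on frac (over_set D N p)"
 proof (rule inj_onI)
  fix x y assume xy: "x \<in> over_set D N p" "y \<in> over_set D N p" "frac x = frac y"
  then have "x - y = of_int (\<lfloor>x\<rfloor> - \<lfloor>y\<rfloor>)" by (simp add: frac_def)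
  moreover have "\<bar>x - y\<bar> < 1" using xy by (auto simp: over_set_def abs_if)
  ultimately show "x = y" using Ints_abs_less_1[of "x - y"] by (metis Ints_of_int eq_iff_diff_eq_0)
 qed
 moreover have "frac ` over_set D N p \<subseteq> {u \<in> {0..<1}. label D u ~= Plain}"
  using fr by (auto simp: over_set_def frac_lt_1)
 ultimately show ?thesis using finite_labels[OF v] by (meson finite_imageD finite_subset)
qed

lemma over_set_list:
 assumes "valid D"
 shows "\<exists>ts. sorted_wrt (<) ts \<and> set ts = over_set D N p"
 using finite_over_set[OF assms, of N p]
 by (intro exI[of _ "sorted_list_of_set (over_set D N p)"]) (simp add: strict_sorted_list_of_set)

lemma over_set_label:
 assumes v: "valid D" and p: "label D p \<in> {Plain, Wen}" and t: "t \<in> over_set D N p"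
 shows "label (set_wen p D) t = Over"
proof -
 have "label D t = Over" using t by (simp add: over_set_def)
 then show ?thesis using label_mod_int[OF v, of t p] p by auto
qed

lemma swept_exists:
 assumes v: "valid D" and p: "label D p \<in> {Plain, Wen}"
 shows "\<exists>E. swept D N p E"
proof -
 obtain ts where ts: "sorted_wrt (<) ts" "set ts = over_set D N p" using over_set_list[OF v] by blast
 have "\<exists>E. twists (set_wen p D) ts E"
  by (rule twists_exist_any[OF valid_set_wen[OF v p]]) (use over_set_label[OF v p] ts(2) in blast)
 then show ?thesis using ts p unfolding swept_def by blast
qed

lemma slide_no_over':
 assumes v: "valid Y" and nw: "\<And>u. label Y u ~= Wen"
  and no: "\<And>u. min p q <= u ==> u <= max p q ==> label Y u ~= Over"
  and pq: "label Y p = Plain" "label Y q = Plain"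
 shows "set_wen p Y \<asymp> set_wen q Y"
proof (cases "p <= q")
 case True
 then show ?thesis by (intro slide_no_over[OF v nw _ _ pq] no) auto
next
 case False
 then have "set_wen q Y \<asymp> set_wen p Y" by (intro slide_no_over[OF v nw _ _ pq(2,1)] no) auto
 then show ?thesis by (rule equivalent_sym)
qed

text \<open>
 Combined with sliding, the wen passes from one side of an over-passage to the other and twists or
 untwists the crossing.
\<close>

lemma pass_twist:
 assumes tw: "twist_at t Y Z" and nw: "\<And>u. label Y u ~= Wen"
  and no: "\<And>u. \<bar>u - t\<bar> <= k ==> u ~= t ==> label Y u ~= Over" and xy: "t - k <= x" "x < t" "t < y" "y <= t + k"
  and pl: "label Y x = Plain" "label Y y = Plain" "label Z x = Plain" "label Z y = Plain"
 shows "set_wen x Y \<asymp> set_wen y Z" "set_wen y Y \<asymp> set_wen x Z"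
proof -
 note v = twist_at_valid[OF tw]
 have nw': "label Z u ~= Wen" for u using nw twist_at_Over_iff(2)[OF tw] by simp
 obtain e where e: "e > 0" "set_wen (t - e) Y \<asymp> set_wen (t + e) Z" "set_wen (t + e) Y \<asymp> set_wen (t - e) Z"
  "label Z (t - e) = Plain" "label Z (t + e) = Plain" "\<forall>u. u ~= t \<and> \<bar>u - t\<bar> <= e --> label Y u = Plain"
  using pass_over[OF tw nw] by blast
 have pe: "label Y (t - e) = Plain" "label Y (t + e) = Plain" using e(1,6) by auto
 have l: "label Y u ~= Over" if "min x (t - e) <= u" "u <= max x (t - e)" for u
 proof (cases "\<bar>u - t\<bar> <= e")
  case True
  then show ?thesis using e(6) that xy e(1) by force
 next
  case False
  then show ?thesis using that xy e(1) by (intro no) (auto simp: abs_if min_def max_def split: if_splits)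
 qed
 have r: "label Y u ~= Over" if "min y (t + e) <= u" "u <= max y (t + e)" for u
 proof (cases "\<bar>u - t\<bar> <= e")
  case True
  then show ?thesis using e(6) that xy e(1) by force
 next
  case False
  then show ?thesis using that xy e(1) by (intro no) (auto simp: abs_if min_def max_def split: if_splits)
 qed
 note oz = twist_at_Over_iff(1)[OF tw]
 have "set_wen x Y \<asymp> set_wen (t - e) Y" by (rule slide_no_over'[OF v(1) nw l pl(1) pe(1)])
 also note e(2)
 also have "set_wen (t + e) Z \<asymp> set_wen y Z"
  by (rule equivalent_sym, rule slide_no_over'[OF v(2) nw' _ pl(4) e(5)]) (use r oz in blast)
 finally show "set_wen x Y \<asymp> set_wen y Z" .
 have "set_wen y Y \<asymp> set_wen (t + e) Y" by (rule slide_no_over'[OF v(1) nw r pl(2) pe(2)])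
 also note e(3)
 also have "set_wen (t - e) Z \<asymp> set_wen x Z"
  by (rule equivalent_sym, rule slide_no_over'[OF v(2) nw' _ pl(3) e(4)]) (use l oz in blast)
 finally show "set_wen y Y \<asymp> set_wen x Z" .
qed

text \<open>
 Moving the starting point across an over-passage \<open>a\<close> with \<open>N a\<close> removes \<open>a\<close> from the twisted crossings;
 if \<open>N a\<close> fails, then \<open>N (a + 1)\<close> holds and the crossing is twisted when the turn ends. Either way the
 two results differ by a single passage of the wen. In all other cases the same crossings are twisted,
 and the wen slides along an arc without over-passages.
\<close>

lemma swept_local:
 assumes v: "valid D" and N: "\<And>t. N (t + 1) \<longleftrightarrow> \<not> N t"
  and w: "w < 1/2" "\<And>u. \<bar>u - a\<bar> <= w ==> u ~= a ==> label D u = Plain"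
  and xy: "a - w/2 < x" "x < y" "y < a + w/2"
  and E: "swept D N x E" and E': "swept D N y E'"
 shows "E \<asymp> E'"
proof -
 have px: "label D x \<in> {Plain, Wen}" "label D y \<in> {Plain, Wen}" using E E' unfolding swept_def by blast+
 obtain xs where xs: "sorted_wrt (<) xs" "set xs = over_set D N x" "twists (set_wen x D) xs E"
  using E unfolding swept_def by blast
 obtain ys where ys: "sorted_wrt (<) ys" "set ys = over_set D N y" "twists (set_wen y D) ys E'"
  using E' unfolding swept_def by blast
 define X where "X = no_wen D"
 have vX: "valid X" unfolding X_def by (rule valid_no_wen[OF v])
 have X: "label X u = Over \<longleftrightarrow> label D u = Over" "label X u ~= Wen" "label D u \<in> {Plain, Wen} ==> label X u = Plain" for u
  by (auto simp: X_def)
 have sX: "set_wen u X = set_wen u D" for u by (simp add: X_def set_wen_no_wen)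
 have xyl: "y < x + 1" using w(1) xy by linarith
 have per: "label D (u + 1) = label D u" for u by (rule validD(2)[OF v])
 have nox: "label D x ~= Over" "label D y ~= Over" using px by auto
 have cmp: "A \<asymp> B" if "twists P us A" "twists P us B" for P us A B
  using twists_unique_rel[OF isotopic_rel_over_refl that] twists_props(1)[OF that(1)] equivalent_isotopic_rel by blast
 show ?thesis
 proof (cases "label D a = Over \<and> x < a \<and> a < y")
  case False
  have no: "label D u ~= Over" if "x <= u" "u <= y" for u
  proof (cases "u = a")
   case True
   then show ?thesis using False that nox by (metis less_eq_real_def)
  next
   case False
   have "\<bar>u - a\<bar> <= w" using that xy by (simp add: abs_if)
   then show ?thesis using w(2) False by simp
  qed
  have "over_set D N x = over_set D N y"
  proof -
   have "t \<in> over_set D N y" if "t \<in> over_set D N x" for t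
    using that no[of t] xy xyl by (force simp: over_set_def)
   moreover have "t \<in> over_set D N x" if "t \<in> over_set D N y" for t
    using that no[of "t - 1"] per[of "t - 1"] xy xyl by (force simp: over_set_def)
   ultimately show ?thesis by blast
  qed
  then have eq: "xs = ys" using strict_sorted_equal xs(1,2) ys(1,2) by metis
  have "\<exists>Y. twists X xs Y \<and> (\<forall>p\<in>{x, y}. label Y p = Plain \<and> twists (set_wen p X) xs (set_wen p Y))"
   by (rule twists_exist[OF vX]) (use xs(2) X px in \<open>auto simp: over_set_def\<close>)
  then obtain Y where Y: "twists X xs Y" "label Y x = Plain" "label Y y = Plain"
   "twists (set_wen x D) xs (set_wen x Y)" "twists (set_wen y D) xs (set_wen y Y)" unfolding sX by blast
  have "E \<asymp> set_wen x Y" by (rule cmp[OF xs(3) Y(4)])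
  also have "set_wen x Y \<asymp> set_wen y Y"
  proof (rule slide_no_over[OF twists_props(2)[OF Y(1)] _ _ _ Y(2,3)])
   show "label Y u ~= Wen" for u using twists_props(4)[OF Y(1)] X(2) by simp
   show "label Y u ~= Over" if "u \<in> {x..y}" for u using twists_props(3)[OF Y(1)] X(1) no that by simp
  qed (use xy in simp)
  also have "set_wen y Y \<asymp> E'" by (rule cmp[OF Y(5) ys(3)[folded eq]])
  finally show ?thesis .
 next
  case True
  then have a: "label D a = Over" "x < a" "a < y" by auto
  have no: "label D u ~= Over" if "\<bar>u - a\<bar> <= w" "u ~= a" for u using w(2) that by simp
  \<comment> \<open>Here \<open>us\<close> are the crossings twisted from both starting points; the crossing at \<open>a\<close> comes on top.\<close>
  have core: "\<exists>Y Z. twist_at a Y Z \<and> twists (set_wen x D) us (set_wen x Y) \<and> twists (set_wen y D) us (set_wen y Y) \<and>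
    twist_at a (set_wen x Y) (set_wen x Z) \<and> twist_at a (set_wen y Y) (set_wen y Z) \<and>
    set_wen x Y \<asymp> set_wen y Z \<and> set_wen y Y \<asymp> set_wen x Z" if us: "\<And>t. t \<in> set us ==> label D t = Over" for us
  proof -
   have "\<exists>Y. twists X us Y \<and> (\<forall>p\<in>{x, y}. label Y p = Plain \<and> twists (set_wen p X) us (set_wen p Y))"
    by (rule twists_exist[OF vX]) (use us X px in auto)
   then obtain Y where Y: "twists X us Y" "label Y x = Plain" "label Y y = Plain"
    "twists (set_wen x D) us (set_wen x Y)" "twists (set_wen y D) us (set_wen y Y)" unfolding sX by blast
   have nwY: "label Y u ~= Wen" for u using twists_props(4)[OF Y(1)] X(2) by simp
   have oY: "label Y u = Over \<longleftrightarrow> label D u = Over" for u using twists_props(3)[OF Y(1)] X(1) by simp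
   have "\<exists>Z. twists Y [a] Z \<and> (\<forall>p\<in>{x, y}. label Z p = Plain \<and> twists (set_wen p Y) [a] (set_wen p Z))"
    by (rule twists_exist[OF twists_props(2)[OF Y(1)]]) (use oY a nwY Y(2,3) in auto)
   then obtain Z where Z: "twist_at a Y Z" "label Z x = Plain" "label Z y = Plain"
    "twist_at a (set_wen x Y) (set_wen x Z)" "twist_at a (set_wen y Y) (set_wen y Z)" by auto
   have "a - w <= x" "y <= a + w" using xy a by linarith+
   then have "set_wen x Y \<asymp> set_wen y Z" "set_wen y Y \<asymp> set_wen x Z"
    using pass_twist[OF Z(1) nwY _ _ a(2,3) _ Y(2,3) Z(2,3), of w] oY no by blast+
   then show ?thesis using Y Z by blast
  qed
  have N1: "N (a + 1) \<longleftrightarrow> \<not> N a" by (rule N)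
  have mid: "u = a" if "label D u = Over" "x < u" "u < y" for u
  proof (rule ccontr)
   assume "u ~= a"
   moreover have "\<bar>u - a\<bar> <= w" using that xy by (simp add: abs_if)
   ultimately show False using no that by blast
  qed
  have both: "t \<in> over_set D N x \<longleftrightarrow> t \<in> over_set D N y" if "t ~= a" "t ~= a + 1" for t
  proof
   assume h: "t \<in> over_set D N x"
   then have "\<not> t < y" using mid[of t] that by (auto simp: over_set_def)
   moreover have "t ~= y" using h nox by (auto simp: over_set_def)
   ultimately show "t \<in> over_set D N y" using h xy by (auto simp: over_set_def)
  next
   assume h: "t \<in> over_set D N y"
   then have o: "label D (t - 1) = Over" using per[of "t - 1"] by (simp add: over_set_def)
   then have "\<not> x < t - 1" using mid[of "t - 1"] that h by (auto simp: over_set_def)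
   moreover have "t - 1 ~= x" using o nox by auto
   ultimately show "t \<in> over_set D N x" using h xyl xy by (auto simp: over_set_def)
  qed
  have al: "label D (a + 1) = Over" using per a(1) by simp
  have mem: "a \<in> over_set D N x \<longleftrightarrow> N a" "a + 1 \<in> over_set D N y \<longleftrightarrow> \<not> N a"
   "a \<notin> over_set D N y" "a + 1 \<notin> over_set D N x"
   using a al xy xyl N1 by (auto simp: over_set_def)
  show ?thesis
  proof (cases "N a")
   case False
   have "insert (a + 1) (over_set D N x) = over_set D N y" 
   proof (rule set_eqI)
    fix u
    show "u \<in> insert (a + 1) (over_set D N x) \<longleftrightarrow> u \<in> over_set D N y"
     using mem False both[of u] by (cases "u = a + 1"; cases "u = a") simp_all
   qed
   then have "set (xs @ [a + 1]) = over_set D N y" using xs(2) by simp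
   moreover have "sorted_wrt (<) (xs @ [a + 1])"
    using xs(1,2) a by (auto simp: sorted_wrt_append over_set_def)
   ultimately have yl: "ys = xs @ [a + 1]" using strict_sorted_equal ys(1,2) by metis
   have "\<And>t. t \<in> set xs ==> label D t = Over" using xs(2) by (simp add: over_set_def)
   note core = core[OF this]
   obtain Y Z where YZ: "twists (set_wen x D) xs (set_wen x Y)" "twists (set_wen y D) xs (set_wen y Y)"
    "twist_at a (set_wen y Y) (set_wen y Z)" "set_wen x Y \<asymp> set_wen y Z"
    using core by blast
   have "twist_at (a + 1) (set_wen y Y) (set_wen y Z)" using twist_at_shift[OF YZ(3), of 1] by simp
   then have "twists (set_wen y D) (xs @ [a + 1]) (set_wen y Z)"
    using YZ(2) twist_at_valid(2) unfolding twists_append by auto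
   then have "set_wen y Z \<asymp> E'" using cmp ys(3) yl by blast
   moreover have "E \<asymp> set_wen x Y" by (rule cmp[OF xs(3) YZ(1)])
   ultimately show ?thesis using YZ(4) equivalent_trans by blast
  next
   case True
   have "insert a (over_set D N y) = over_set D N x" 
   proof (rule set_eqI)
    fix u
    show "u \<in> insert a (over_set D N y) \<longleftrightarrow> u \<in> over_set D N x"
     using mem True both[of u] by (cases "u = a + 1"; cases "u = a") simp_all
   qed
   then have "set (a # ys) = over_set D N x" using ys(2) by simp
   moreover have "sorted_wrt (<) (a # ys)"
    using ys(1,2) a by (auto simp: over_set_def)
   ultimately have xl: "xs = a # ys" using strict_sorted_equal xs(1,2) by metis
   have nint: "a - u \<notin> \<int>" if "u \<in> set ys" for u
   proof
    assume i: "a - u \<in> \<int>"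
    have uy: "u \<in> over_set D N y" using that ys(2) by simp
    then have u: "y < u" "u < y + 1" by (simp_all add: over_set_def)
    have u1: "u ~= a + 1" using uy mem(2) True by metis
    have "(a - u) + 1 \<in> \<int>" by (rule Ints_add[OF i Ints_1])
    then have "a + 1 - u \<in> \<int>" by (simp add: algebra_simps)
    moreover have "\<bar>a + 1 - u\<bar> < 1" using u a xyl by (simp add: abs_if)
    ultimately show False using Ints_abs_less_1 u1 by force
   qed
   obtain E2 where E2: "twists (set_wen x D) (ys @ [a]) E2" "isotopic_rel_over E E2"
    using twists_first_to_last[OF xs(3)[unfolded xl] nint] by blast
   have "\<And>t. t \<in> set ys ==> label D t = Over" using ys(2) by (simp add: over_set_def)
   note core = core[OF this]
   obtain Y Z where YZ: "twists (set_wen x D) ys (set_wen x Y)" "twists (set_wen y D) ys (set_wen y Y)"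
    "twist_at a (set_wen x Y) (set_wen x Z)" "set_wen y Y \<asymp> set_wen x Z"
    using core by blast
   have "twists (set_wen x D) (ys @ [a]) (set_wen x Z)"
    using YZ(1,3) twist_at_valid(2) unfolding twists_append by auto
   then have "E2 \<asymp> set_wen x Z" using cmp E2(1) by blast
   moreover have "set_wen y Y \<asymp> E'" by (rule cmp[OF YZ(2) ys(3)])
   ultimately show ?thesis using YZ(4) equivalent_isotopic_rel[OF E2(2)] equivalent_trans equivalent_sym by blast
  qed
 qed
qed

text \<open>
 The line is connected, so the local statement gives all starting points.
\<close>

lemma swept_equivalent:
 assumes v: "valid D" and N: "\<And>t. N (t + 1) \<longleftrightarrow> \<not> N t"
  and E: "swept D N x E" and E': "swept D N y E'"
 shows "E \<asymp> E'"
proof -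
 define P where "P u \<longleftrightarrow> label D u \<in> {Plain, Wen}" for u
 define R where "R u u' \<longleftrightarrow> P u \<and> P u' \<and> (\<forall>F F'. swept D N u F --> swept D N u' F' --> F \<asymp> F')" for u u'
 have near: "\<exists>w>0. w < 1/2 \<and> (\<forall>u. \<bar>u - a\<bar> <= w --> u ~= a --> label D u = Plain)" for a
 proof -
  obtain w where w: "0 < w" "w < 1/2" "\<And>u. label D u ~= Plain ==> off a u ~= 0 ==> w < \<bar>off a u\<bar>"
   by (rule label_gap[OF v, of a]) blast
  have "label D u = Plain" if "\<bar>u - a\<bar> <= w" "u ~= a" for u
  proof -
   have "off a (a + (u - a)) = u - a" using that w(2) by (intro off_self) auto
   then show ?thesis using w(3)[of u] that by force
  qed
  then show ?thesis using w by blast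
 qed
 have same: "F \<asymp> F'" if s: "swept D N u F" "swept D N u F'" for u F F'
 proof -
  obtain ts where ts: "sorted_wrt (<) ts" "set ts = over_set D N u" "twists (set_wen u D) ts F"
   using s(1) unfolding swept_def by blast
  obtain us where us: "sorted_wrt (<) us" "set us = over_set D N u" "twists (set_wen u D) us F'"
   using s(2) unfolding swept_def by blast
  have "us = ts" using strict_sorted_equal ts(1,2) us(1,2) by metis
  then show ?thesis
   using twists_unique_rel[OF isotopic_rel_over_refl ts(3)] us(3) twists_props(1)[OF ts(3)] equivalent_isotopic_rel by blast
 qed
 have "R x y"
 proof (rule connected_equivalence_relation_gen[of UNIV x y P R])
  show "P x" "P y" using E E' unfolding swept_def P_def by blast+
  show "R u u''" if h: "R u u'" "R u' u''" for u u' u''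
  proof -
   have "\<exists>F. swept D N u' F" by (rule swept_exists[OF v]) (use h in \<open>simp add: R_def P_def\<close>)
   then show ?thesis using h equivalent_trans unfolding R_def by blast
  qed
 next
  fix T :: "real set" and a assume T: "openin (top_of_set UNIV) T" "a \<in> T"
  then obtain e where e: "e > 0" "\<And>u. dist u a < e ==> u \<in> T" by (auto simp: open_dist)
  obtain w where w: "w > 0" "\<forall>u. \<bar>u - a\<bar> <= w --> u ~= a --> label D u = Plain" using near[of a] by blast
  have "a + min (e/2) w \<in> T" using e w(1) by (auto simp: dist_real_def)
  moreover have "label D (a + min (e/2) w) = Plain" using e(1) w by auto
  ultimately show "\<exists>z. z \<in> T \<and> P z" unfolding P_def by blast
 next
  fix a :: real
  obtain w where w: "w > 0" "w < 1/2" "\<forall>u. \<bar>u - a\<bar> <= w --> u ~= a --> label D u = Plain" using near[of a] by blast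
  have lt: "F \<asymp> F'" if "\<bar>u - a\<bar> < w/2" "\<bar>u' - a\<bar> < w/2" "u < u'" "swept D N u F" "swept D N u' F'" for u u' F F'
   by (rule swept_local[OF v N w(2) _ _ that(3) _ that(4,5), of a]) (use w(3) that(1,2) in \<open>auto simp: abs_if split: if_splits\<close>)
  have "R u u'" if "\<bar>u - a\<bar> < w/2" "\<bar>u' - a\<bar> < w/2" "P u" "P u'" for u u'
   unfolding R_def
  proof (intro conjI allI impI)
   fix F F' assume s: "swept D N u F" "swept D N u' F'"
   show "F \<asymp> F'"
   proof (cases u u' rule: linorder_cases)
    case less
    then show ?thesis using lt that(1,2) s by blast
   next
    case equal
    then show ?thesis using same s by blast
   next
    case greater
    then show ?thesis using lt that(1,2) s equivalent_sym by blast
   qed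
  qed (use that in auto)
  then show "\<exists>T. openin (top_of_set UNIV) T \<and> a \<in> T \<and> (\<forall>u\<in>T. \<forall>u'\<in>T. P u \<and> P u' --> R u u')"
   using w(1) by (intro exI[of _ "ball a (w/2)"]) (auto simp: dist_real_def abs_minus_commute)
 qed auto
 then show ?thesis using E E' unfolding R_def by blast
qed

definition sweep_class :: "diagram => diagram => bool" where
 "sweep_class D E \<longleftrightarrow> (\<exists>N p. counter D N \<and> swept D N p E)"

text \<open>
 On the next sheet of the double cover \<open>N\<close> is replaced by its negation.
\<close>

lemma swept_flip:
 assumes "swept D (\<lambda>t. \<not> N t) p E" and N: "\<And>t. N (t + 1) \<longleftrightarrow> \<not> N t" and v: "valid D"
 shows "swept D N (p + 1) E"
proof -
 note per = validD(2)[OF v]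
 obtain ts where ts: "sorted_wrt (<) ts" "set ts = over_set D (\<lambda>t. \<not> N t) p" "twists (set_wen p D) ts E"
  and p: "label D p \<in> {Plain, Wen}"
  using assms(1) unfolding swept_def by blast
 have "sorted_wrt (<) (map (\<lambda>t. t + of_int 1) ts)" using ts(1) by (simp add: sorted_wrt_map)
 moreover have "set (map (\<lambda>t. t + of_int 1) ts) = over_set D N (p + 1)"
 proof -
  have "u - 1 \<in> over_set D (\<lambda>t. \<not> N t) p \<longleftrightarrow> u \<in> over_set D N (p + 1)" for u
   using N[of "u - 1"] per[of "u - 1"] by (auto simp: over_set_def)
  then show ?thesis unfolding list.set_map ts(2) by (force intro: image_eqI[of _ _ "_ - 1"])
 qed
 moreover have "twists (set_wen (p + 1) D) (map (\<lambda>t. t + of_int 1) ts) E"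
  using twists_shift[OF ts(3), of 1] set_wen_int[of p 1 D] by simp
 moreover have "label D (p + 1) \<in> {Plain, Wen}" using p per by simp
 ultimately show ?thesis unfolding swept_def by blast
qed

theorem sweep_class_equivalent:
 assumes v: "valid D" and E: "sweep_class D E" "sweep_class D E'"
 shows "E \<asymp> E'"
proof -
 obtain N p where N: "counter D N" "swept D N p E" using E(1) unfolding sweep_class_def by blast
 obtain M q where M: "counter D M" "swept D M q E'" using E(2) unfolding sweep_class_def by blast
 have per: "N (t + 1) \<longleftrightarrow> \<not> N t" for t using N(1) unfolding counter_def by blast
 consider "M = N" | "M = (\<lambda>t. \<not> N t)" using counter_unique[OF N(1) M(1)] by (auto simp: fun_eq_iff)
 then show ?thesis
 proof cases
  case 1
  then show ?thesis using swept_equivalent[OF v per N(2)] M(2) by blast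
 next
  case 2
  then have "swept D N (q + 1) E'" using swept_flip[of D N q E', OF _ per v] M(2) by blast
  then show ?thesis using swept_equivalent[OF v per N(2)] by blast
 qed
qed

section \<open>Each move preserves the result of the sweep\<close>

text \<open>
 Since the twisted crossings lie outside the disk, the twists can be carried out on both sides of a
 move.
\<close>

lemma sweep_step:
 assumes v: "valid D" "valid D'"
  and p: "label D p \<in> {Plain, Wen}" "label D' p' \<in> {Plain, Wen}"
  and S: "over_set D N p = over_set D' N' p'"
  and mv: "set_wen p D = set_wen p' D' \<or> (\<exists>A B m r. (A, B) \<in> wen_moves \<and>
    move_at A B m r (set_wen p D) (set_wen p' D') \<and> (\<forall>t\<in>over_set D N p. \<forall>j<length A. \<bar>r j\<bar> < \<bar>off (m j) t\<bar>))"
 shows "\<exists>E E'. swept D N p E \<and> swept D' N' p' E' \<and> E \<asymp> E'"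
proof -
 obtain ts where ts: "sorted_wrt (<) ts" "set ts = over_set D N p" using over_set_list[OF v(1)] by blast
 from mv show ?thesis
 proof
  assume e: "set_wen p D = set_wen p' D'"
  obtain E where E: "swept D N p E" using swept_exists[OF v(1) p(1)] by blast
  then have "swept D' N' p' E" using p(2) S e unfolding swept_def by simp
  then show ?thesis using E equivalent_refl by blast
 next
  assume "\<exists>A B m r. (A, B) \<in> wen_moves \<and>
    move_at A B m r (set_wen p D) (set_wen p' D') \<and> (\<forall>t\<in>over_set D N p. \<forall>j<length A. \<bar>r j\<bar> < \<bar>off (m j) t\<bar>)"
  then obtain A B m r where m: "(A, B) \<in> wen_moves" "move_at A B m r (set_wen p D) (set_wen p' D')"
   "\<forall>t\<in>over_set D N p. \<forall>j<length A. \<bar>r j\<bar> < \<bar>off (m j) t\<bar>" by blast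
  have md: "marks_in_disk A" by (rule marks_in_disk_moves[of A B]) (use m(1) in blast)
  have "\<exists>Y Y'. twists (set_wen p D) ts Y \<and> twists (set_wen p' D') ts Y' \<and> move_at A B m r Y Y'"
  proof (rule move_at_twists[OF m(2) md])
   fix t assume "t \<in> set ts"
   then have t: "t \<in> over_set D N p" using ts(2) by simp
   show "label (set_wen p D) t = Over \<and> (\<forall>j<length A. \<bar>r j\<bar> < \<bar>off (m j) t\<bar>)"
    using over_set_label[OF v(1) p(1) t] m(3) t by blast
  qed
  then obtain Y Y' where Y: "twists (set_wen p D) ts Y" "twists (set_wen p' D') ts Y'" "move_at A B m r Y Y'" by blast
  have "swept D N p Y" using p(1) ts Y(1) unfolding swept_def by blast
  moreover have "swept D' N' p' Y'" using p(2) ts Y(2) S unfolding swept_def by auto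
  ultimately show ?thesis using equivalent_move_at[OF m(1) Y(3)] by blast
 qed
qed

lemma isotopic_by_set_wen:
 assumes i: "isotopic_by \<alpha> D D'" and p: "label D' p' \<in> {Plain, Wen}"
 shows "isotopic_by \<alpha> (set_wen (\<alpha> p') D) (set_wen p' D')"
proof -
 note r = isotopic_byD(3)[OF i]
 obtain h where h: "isotopic_to_id h" "\<forall>t. curve D' t = h (curve D (\<alpha> t)) \<and> label D' t = label D (\<alpha> t)"
  using i unfolding isotopic_by_def by blast
 have "label D (\<alpha> p') \<in> {Plain, Wen}" using p h(2) by simp
 then show ?thesis
  unfolding isotopic_by_def
  using valid_set_wen[OF isotopic_byD(1)[OF i]] valid_set_wen[OF isotopic_byD(2)[OF i] p]
   r h reparam_mod_int[OF r] by (intro conjI exI[of _ h]) simp_all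
qed

lemma counter_isotopic:
 assumes i: "isotopic_by \<alpha> D D'" and c: "counter D N"
 shows "counter D' (\<lambda>t. N (\<alpha> t))"
proof -
 have r: "continuous_on UNIV \<alpha>" "strict_mono \<alpha>" "\<And>t. \<alpha> (t + 1) = \<alpha> t + 1"
  using isotopic_byD(3)[OF i] unfolding reparam_def by blast+
 have "\<exists>d>0. \<forall>u. (t - d < u \<and> u < t --> (N (\<alpha> u) \<longleftrightarrow> N (\<alpha> t) ~= (label D' t = Wen))) \<and>
    (t < u \<and> u < t + d --> N (\<alpha> u) = N (\<alpha> t))" for t
 proof -
  obtain e where e: "e > 0" "\<forall>u. (\<alpha> t - e < u \<and> u < \<alpha> t --> (N u \<longleftrightarrow> N (\<alpha> t) ~= (label D (\<alpha> t) = Wen))) \<and>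
    (\<alpha> t < u \<and> u < \<alpha> t + e --> N u = N (\<alpha> t))"
   using c unfolding counter_def by blast
  obtain d where d: "d > 0" "\<And>u. dist u t < d ==> dist (\<alpha> u) (\<alpha> t) < e"
   using r(1) e(1) unfolding continuous_on_iff by (metis UNIV_I)
  have "N (\<alpha> u) \<longleftrightarrow> N (\<alpha> t) ~= (label D' t = Wen)" if u: "t - d < u" "u < t" for u
  proof -
   have "dist (\<alpha> u) (\<alpha> t) < e" by (rule d(2)) (use u in \<open>simp add: dist_real_def\<close>)
   moreover have "\<alpha> u < \<alpha> t" using u r(2) by (simp add: strict_mono_less)
   ultimately have "\<alpha> t - e < \<alpha> u" by (simp add: dist_real_def)
   then show ?thesis using e(2) \<open>\<alpha> u < \<alpha> t\<close> isotopic_byD(4)[OF i] by simp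
  qed
  moreover have "N (\<alpha> u) = N (\<alpha> t)" if u: "t < u" "u < t + d" for u
  proof -
   have "dist (\<alpha> u) (\<alpha> t) < e" by (rule d(2)) (use u in \<open>simp add: dist_real_def\<close>)
   moreover have "\<alpha> t < \<alpha> u" using u r(2) by (simp add: strict_mono_less)
   ultimately have "\<alpha> u < \<alpha> t + e" by (simp add: dist_real_def)
   then show ?thesis using e(2) \<open>\<alpha> t < \<alpha> u\<close> by blast
  qed
  ultimately show ?thesis using d(1) by blast
 qed
 then show ?thesis using c r(3) unfolding counter_def by simp
qed

text \<open>
 The counter, the starting point and the twists are all transported by the reparametrisation.
\<close>

lemma sweep_isotopic:
 assumes i: "isotopic_by \<alpha> D D'" and c: "counter D N"
 shows "\<exists>E E'. sweep_class D E \<and> sweep_class D' E' \<and> E \<asymp> E'"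
proof -
 note v = isotopic_byD(1,2)[OF i] and r = isotopic_byD(3)[OF i]
 have mono: "strict_mono \<alpha>" "strict_mono (inv \<alpha>)" and per: "\<And>t. \<alpha> (t + 1) = \<alpha> t + 1"
  using r reparam_inv[OF r] unfolding reparam_def by blast+
 have inv: "\<alpha> (inv \<alpha> u) = u" "inv \<alpha> (\<alpha> u) = u" for u
  using reparam_bij[OF r] by (simp_all add: bij_def surj_f_inv_f)
 note l = isotopic_byD(4)[OF i]
 obtain w where w: "0 < w" "w < 1/2" "\<And>u. label D u ~= Plain ==> off 0 u ~= 0 ==> w < \<bar>off 0 u\<bar>"
  by (rule label_gap[OF v(1), of 0]) blast
 have "off 0 (0 + w) = w" by (rule off_self) (use w in simp)
 then have pw: "label D w = Plain" using w(3)[of w] w(1) by force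
 define p where "p = inv \<alpha> w"
 have ap: "\<alpha> p = w" by (simp add: p_def inv)
 have lp: "label D' p \<in> {Plain, Wen}" using l[of p] ap pw by simp
 obtain E where E: "swept D N w E" using swept_exists[OF v(1), of w N] pw by blast
 obtain ts where ts: "sorted_wrt (<) ts" "set ts = over_set D N w" "twists (set_wen w D) ts E"
  using E unfolding swept_def by blast
 let ?ts = "map (inv \<alpha>) ts" and ?N = "\<lambda>t. N (\<alpha> t)"
 have mt: "map \<alpha> ?ts = ts" by (simp add: inv comp_def)
 have srt: "sorted_wrt (<) ?ts" using ts(1) mono(2) by (simp add: sorted_wrt_map strict_mono_less)
 have S: "u \<in> over_set D' ?N p \<longleftrightarrow> \<alpha> u \<in> over_set D N w" for u
  using strict_mono_less[OF mono(1), of p u] strict_mono_less[OF mono(1), of u "p + 1"] per[of p] ap l[of u]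
  by (simp add: over_set_def)
 have st: "set ?ts = over_set D' ?N p"
 proof (rule set_eqI)
  fix u
  show "u \<in> set ?ts \<longleftrightarrow> u \<in> over_set D' ?N p" unfolding S ts(2)[symmetric] using inv by (auto simp: image_iff) metis
 qed
 have "\<exists>E'. twists (set_wen p D') ?ts E'"
  by (rule twists_exist_any[OF valid_set_wen[OF v(2) lp]]) (use over_set_label[OF v(2) lp] st in blast)
 then obtain E' where E': "twists (set_wen p D') ?ts E'" by blast
 have "isotopic_by \<alpha> (set_wen w D) (set_wen p D')" using isotopic_by_set_wen[OF i lp] ap by simp
 then have "isotopic_over \<alpha> (set_wen w D) (set_wen p D')" unfolding isotopic_over_def by blast
 then have "isotopic_over \<alpha> E E'" using twists_unique ts(3) E' mt by metis
 then have "E \<asymp> E'" by (rule equivalent_isotopic_over)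
 moreover have "sweep_class D E" using c E unfolding sweep_class_def by blast
 moreover have "sweep_class D' E'"
  using counter_isotopic[OF i c] lp srt st E' unfolding sweep_class_def swept_def by blast
 ultimately show ?thesis by blast
qed

text \<open>
 When wens appear or disappear at the end points of an arc, the counter changes on the arc. The arc
 contains its left end point only, because counters are continuous from the right.
\<close>

definition window :: "real => real => real => bool" where
 "window a c t \<longleftrightarrow> - c <= off a t \<and> off a t < c"

lemma window_locally:
 assumes c: "0 < c" "c < 1/2"
 shows "\<exists>e>0. \<forall>u. (t - e < u \<and> u < t --> (window a c u \<longleftrightarrow> window a c t ~= (\<bar>off a t\<bar> = c))) \<and>
   (t < u \<and> u < t + e --> window a c u = window a c t)"
proof (cases "c < \<bar>off a t\<bar>")
 case True
 then obtain e where e: "e > 0" "\<And>u. dist u t < e ==> c < \<bar>off a u\<bar>"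
  using open_off_greater[of c a] by (auto simp: open_dist)
 have n: "\<not> window a c u" if "c < \<bar>off a u\<bar>" for u using that by (auto simp: window_def abs_if split: if_splits)
 have n2: "\<not> window a c u" if "dist u t < e" for u using n e(2)[OF that] by blast
 show ?thesis using n2 n[OF True] True e(1) by (intro exI[of _ e]) (auto simp: dist_real_def)
next
 case False
 then have "\<bar>off a t\<bar> < 1/2" using c by linarith
 then obtain n where n: "t \<in> {a + of_int n - 1/2 <..< a + of_int n + 1/2}"
  "\<forall>u\<in>{a + of_int n - 1/2 <..< a + of_int n + 1/2}. off a u = u - a - of_int n"
  by (rule off_locally[of a t "1/2"]) auto
 define b where "b = a + of_int n"
 have o: "off a u = u - b" if "b - 1/2 < u" "u < b + 1/2" for u using n(2) that by (simp add: b_def)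
 have t: "b - 1/2 < t" "t < b + 1/2" using n(1) by (simp_all add: b_def)
 define g where "g x = (if t = x then 1 else \<bar>t - x\<bar>)" for x
 have g: "0 < g x" "t ~= x ==> g x = \<bar>t - x\<bar>" for x by (simp_all add: g_def)
 define e where "e = min (min (t - (b - 1/2)) (b + 1/2 - t)) (min (g (b - c)) (g (b + c)))"
 have e: "0 < e" "e <= t - (b - 1/2)" "e <= b + 1/2 - t" "e <= g (b - c)" "e <= g (b + c)"
  using t g(1)[of "b - c"] g(1)[of "b + c"] unfolding e_def by (simp_all add: min_def)
 have gt: "(t < x --> u < x) \<and> (x < t --> x < u)" if "e <= g x" "\<bar>u - t\<bar> < e" for x u
  using that g(2)[of x] by (auto simp: abs_if split: if_splits)
 have L: "window a c u \<longleftrightarrow> window a c t ~= (\<bar>off a t\<bar> = c)" if u: "t - e < u" "u < t" for u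
 proof -
  have u1: "\<bar>u - t\<bar> < e" "b - 1/2 < u" "u < b + 1/2" using u e t by auto
  have "- c <= u - b \<longleftrightarrow> - c < t - b" using gt[OF e(4) u1(1)] u by linarith
  moreover have "u - b < c \<longleftrightarrow> t - b <= c" using gt[OF e(5) u1(1)] u by linarith
  ultimately show ?thesis unfolding window_def o[OF u1(2,3)] o[OF t] using c by (auto simp: abs_if)
 qed
 have "window a c u = window a c t" if u: "t < u" "u < t + e" for u
 proof -
  have u1: "\<bar>u - t\<bar> < e" "b - 1/2 < u" "u < b + 1/2" using u e t by auto
  have "- c <= u - b \<longleftrightarrow> - c <= t - b" using gt[OF e(4) u1(1)] u by linarith
  moreover have "u - b < c \<longleftrightarrow> t - b < c" using gt[OF e(5) u1(1)] u by linarith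
  ultimately show ?thesis unfolding window_def o[OF u1(2,3)] o[OF t] by simp
 qed
 then show ?thesis using L e(1) by blast
qed

lemma counter_window:
 assumes c: "counter D N" and c2: "0 < c" "c < 1/2"
  and w: "\<And>t. ((label D t = Wen) ~= (label D' t = Wen)) \<longleftrightarrow> \<bar>off a t\<bar> = c"
 shows "counter D' (\<lambda>t. N t ~= window a c t)"
proof -
 have "window a c (t + 1) = window a c t" for t using off_add_int[of a t 1] by (simp add: window_def)
 moreover have "\<exists>e>0. \<forall>u. (t - e < u \<and> u < t --> ((N u ~= window a c u) \<longleftrightarrow> (N t ~= window a c t) ~= (label D' t = Wen))) \<and>
    (t < u \<and> u < t + e --> (N u ~= window a c u) = (N t ~= window a c t))" for t
 proof -
  obtain e where e: "e > 0" "\<forall>u. (t - e < u \<and> u < t --> (N u \<longleftrightarrow> N t ~= (label D t = Wen))) \<and> (t < u \<and> u < t + e --> N u = N t)"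
   using c unfolding counter_def by blast
  obtain f where f: "f > 0" "\<forall>u. (t - f < u \<and> u < t --> (window a c u \<longleftrightarrow> window a c t ~= (\<bar>off a t\<bar> = c))) \<and>
    (t < u \<and> u < t + f --> window a c u = window a c t)"
   using window_locally[OF c2] by blast
  have "(N u ~= window a c u) \<longleftrightarrow> (N t ~= window a c t) ~= (label D' t = Wen)" if "t - min e f < u" "u < t" for u
  proof -
   have "N u \<longleftrightarrow> N t ~= (label D t = Wen)" "window a c u \<longleftrightarrow> window a c t ~= (\<bar>off a t\<bar> = c)"
    using e(2) f(2) that by auto
   then show ?thesis using w[of t] by argo
  qed
  moreover have "(N u ~= window a c u) = (N t ~= window a c t)" if "t < u" "u < t + min e f" for u
   using e(2) f(2) that by auto
  ultimately show ?thesis using e(1) f(1) by (intro exI[of _ "min e f"]) simp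
 qed
 ultimately show ?thesis using c unfolding counter_def by simp
qed

lemma counter_cong:
 assumes "counter D N" "\<And>t. label D t = Wen \<longleftrightarrow> label D' t = Wen"
 shows "counter D' N"
 using assms unfolding counter_def by simp

lemma arc_gap:
 assumes da: "disjoint_arcs m r n" and ij: "i < n" "j < n" "i ~= j"
 shows "\<bar>r i\<bar> + \<bar>r j\<bar> < \<bar>m i - m j + of_int k\<bar>"
proof (rule ccontr)
 define d where "d = m i - m j + of_int k"
 define S where "S = \<bar>r i\<bar> + \<bar>r j\<bar>"
 assume "\<not> \<bar>r i\<bar> + \<bar>r j\<bar> < \<bar>m i - m j + of_int k\<bar>"
 then have d: "\<bar>d\<bar> <= S" by (simp add: d_def S_def)
 have r: "r i ~= 0" "r j ~= 0" using disjoint_arcs_width[OF da] ij by blast+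
 then have S: "S > 0" by (simp add: S_def add_pos_pos)
 \<comment> \<open>If the arcs were too close, dividing the distance in the ratio of the lengths would give a common point.\<close>
 define x where "x = - (sgn (r i) * d / S)"
 define y where "y = sgn (r j) * d / S"
 have "\<bar>d\<bar> / S <= 1" using d S by simp
 then have xy: "\<bar>x\<bar> <= 1" "\<bar>y\<bar> <= 1" using r S by (simp_all add: x_def y_def abs_mult abs_divide abs_sgn_eq)
 have "r i * x = - (\<bar>r i\<bar> * d / S)" "r j * y = \<bar>r j\<bar> * d / S"
  by (simp_all add: x_def y_def abs_sgn mult.commute mult.left_commute)
 moreover have "\<bar>r i\<bar> * d / S + \<bar>r j\<bar> * d / S = d"
 proof -
  have "\<bar>r i\<bar> * d / S + \<bar>r j\<bar> * d / S = S * d / S"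
   unfolding S_def by (simp only: distrib_right add_divide_distrib)
  then show ?thesis using S by simp
 qed
 ultimately have "arc_param m r i x - arc_param m r j y = of_int (- k)" by (simp add: arc_param_def d_def)
 then have "arc_param m r i x - arc_param m r j y \<in> \<int>" by (metis Ints_of_int)
 moreover have "x \<in> {-1..1}" "y \<in> {-1..1}" using xy by (auto simp: abs_le_iff)
 ultimately show False using da ij unfolding disjoint_arcs_def by blast
qed

lemma disjoint_arcs_off:
 assumes da: "disjoint_arcs m r n" and ij: "i < n" "j < n" "i ~= j" and t: "\<bar>off (m i) t\<bar> <= \<bar>r i\<bar>"
 shows "\<bar>r j\<bar> < \<bar>off (m j) t\<bar>"
proof (rule ccontr)
 assume "\<not> \<bar>r j\<bar> < \<bar>off (m j) t\<bar>"
 then have tj: "\<bar>off (m j) t\<bar> <= \<bar>r j\<bar>" by simp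
 obtain a where a: "t = m i + off (m i) t + of_int a" by (rule off_decomp)
 obtain b where b: "t = m j + off (m j) t + of_int b" by (rule off_decomp)
 have "m i - m j + of_int (a - b) = off (m j) t - off (m i) t" using a b by simp
 then show False using arc_gap[OF da ij, of "a - b"] t tj by linarith
qed

text \<open>
 A starting point just before the \<open>i\<close>-th arc: from there the arcs \<open>i\<close> and \<open>j\<close> are met in this order.
\<close>

lemma start_before:
 assumes v: "valid D" and da: "disjoint_arcs m r n" and ij: "i < n" "j < n"
  and a: "a = m i + of_int y" and b: "b = m j + of_int z" and ab: "a <= b" "b < a + 1" "i = j ==> a = b"
 shows "\<exists>p. label D p = Plain \<and> (\<forall>k<n. \<bar>r k\<bar> < \<bar>off (m k) p\<bar>) \<and>
  p < a - \<bar>r i\<bar> \<and> a + \<bar>r i\<bar> < p + 1 \<and> p < b - \<bar>r j\<bar> \<and> b + \<bar>r j\<bar> < p + 1"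
proof -
 have ri: "r i ~= 0" "\<bar>r i\<bar> < 1/2" using disjoint_arcs_width[OF da ij(1)] by auto
 have gap: "\<bar>r i\<bar> + \<bar>r j\<bar> < b - a \<and> \<bar>r i\<bar> + \<bar>r j\<bar> < a + 1 - b" if "i ~= j"
  using arc_gap[OF da ij that, of "y - z"] arc_gap[OF da ij that, of "y - z + 1"] ab(1,2) by (simp add: a b)
 have g: "0 < a + 1 - b - \<bar>r i\<bar> - \<bar>r j\<bar>"
 proof (cases "i = j")
  case True
  then show ?thesis using ab(3) ri(2) by simp
 qed (use gap in linarith)
 have lb: "a - \<bar>r i\<bar> <= b - \<bar>r j\<bar>"
 proof (cases "i = j")
  case True
  then show ?thesis using ab(3) by simp
 qed (use gap in linarith)
 define c where "c = a - \<bar>r i\<bar>"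
 obtain w where w: "0 < w" "w < 1/2" "\<And>u. label D u ~= Plain ==> off c u ~= 0 ==> w < \<bar>off c u\<bar>"
  by (rule label_gap[OF v, of c]) blast
 have oc: "off (m i) c = - \<bar>r i\<bar>"
  by (rule off_unique[of _ _ _ y]) (use ri in \<open>auto simp: c_def a\<close>)
 have far: "\<bar>r k\<bar> < \<bar>off (m k) c\<bar>" if "k < n" "k ~= i" for k
  by (rule disjoint_arcs_off[OF da ij(1) that(1) that(2)[symmetric]]) (simp add: oc)
 have "open (\<Inter>k\<in>{..<n} - {i}. {u. \<bar>r k\<bar> < \<bar>off (m k) u\<bar>})" by (intro open_INT ballI open_off_greater) simp
 moreover have "c \<in> (\<Inter>k\<in>{..<n} - {i}. {u. \<bar>r k\<bar> < \<bar>off (m k) u\<bar>})" using far by auto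
 ultimately obtain e where e: "e > 0" "\<And>u. dist u c < e ==> u \<in> (\<Inter>k\<in>{..<n} - {i}. {u. \<bar>r k\<bar> < \<bar>off (m k) u\<bar>})"
  unfolding open_dist by blast
 define q where "q = min (min w (e/2)) (min ((1/2 - \<bar>r i\<bar>)/2) ((a + 1 - b - \<bar>r i\<bar> - \<bar>r j\<bar>)/2))"
 have q: "0 < q" "q <= w" "q < e" "q < 1/2 - \<bar>r i\<bar>" "q < a + 1 - b - \<bar>r i\<bar> - \<bar>r j\<bar>"
  using w(1) e(1) ri(2) g unfolding q_def by (simp_all add: min_def)
 have "off c (c + - q) = - q" by (rule off_self) (use q(1,2) w(2) in simp)
 then have "label D (c - q) = Plain" using w(3)[of "c - q"] q(1,2) by force
 moreover have "\<bar>r k\<bar> < \<bar>off (m k) (c - q)\<bar>" if "k < n" for k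
 proof (cases "k = i")
  case True
  have "off (m i) (c - q) = - \<bar>r i\<bar> - q"
   by (rule off_unique[of _ _ _ y]) (use q(1,4) in \<open>auto simp: c_def a\<close>)
  then show ?thesis using True q(1) by simp
 next
  case False
  then show ?thesis using e(2)[of "c - q"] q(1,3) that by (auto simp: dist_real_def)
 qed
 moreover have "c - q < a - \<bar>r i\<bar>" "a + \<bar>r i\<bar> < c - q + 1" "c - q < b - \<bar>r j\<bar>" "b + \<bar>r j\<bar> < c - q + 1"
  using q lb by (auto simp: c_def)
 ultimately show ?thesis by blast
qed

text \<open>
 Lift the arcs to the line so that \<open>N\<close> fails on them; of the two lifts of the \<open>j\<close>-th arc next to the
 lift of the \<open>i\<close>-th one, on its right and on its left, exactly one qualifies. Start before the first.
\<close>

lemma start_exists: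
 assumes v: "valid D" and da: "disjoint_arcs m r n" and ij: "i < n" "j < n"
  and N: "\<And>t. N (t + 1) \<longleftrightarrow> \<not> N t"
 shows "\<exists>p. label D p = Plain \<and> (\<forall>k<n. \<bar>r k\<bar> < \<bar>off (m k) p\<bar>) \<and>
  (\<forall>k\<in>{i, j}. \<exists>b z. b = m k + of_int z \<and> \<not> N b \<and> p < b - \<bar>r k\<bar> \<and> b + \<bar>r k\<bar> < p + 1)"
proof -
 obtain y where y: "\<not> N (m i + of_int y)"
 proof (cases "N (m i)")
  case True
  then show ?thesis using that[of 1] N by simp
 next
  case False
  then show ?thesis using that[of 0] by simp
 qed
 define a where "a = m i + of_int y"
 show ?thesis
 proof (cases "i = j")
  case True
  then show ?thesis using start_before[OF v da ij a_def a_def[unfolded True]] y[folded a_def] a_def by auto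
 next
  case False
  define z where "z = - \<lfloor>m j - a\<rfloor>"
  define b where "b = m j + of_int z"
  have ab: "a <= b" "b < a + 1" unfolding b_def z_def by linarith+
  have ne: "a ~= b"
   using arc_gap[OF da ij False, of "y - z"] disjoint_arcs_width[OF da] by (auto simp: a_def b_def)
  show ?thesis
  proof (cases "N b")
   case False
   obtain p where "label D p = Plain" "\<forall>k<n. \<bar>r k\<bar> < \<bar>off (m k) p\<bar>"
    "p < a - \<bar>r i\<bar>" "a + \<bar>r i\<bar> < p + 1" "p < b - \<bar>r j\<bar>" "b + \<bar>r j\<bar> < p + 1"
    using start_before[OF v da ij a_def b_def ab] \<open>i ~= j\<close> by blast
   then show ?thesis using False y[folded a_def] a_def b_def by blast
  next
   case True
   define b' where "b' = b - 1"
   have b': "b' = m j + of_int (z - 1)" by (simp add: b'_def b_def)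
   have nb: "\<not> N b'" using True N[of b'] by (simp add: b'_def)
   have "b' <= a" "a < b' + 1" using ab ne by (auto simp: b'_def)
   then obtain p where "label D p = Plain" "\<forall>k<n. \<bar>r k\<bar> < \<bar>off (m k) p\<bar>"
    "p < b' - \<bar>r j\<bar>" "b' + \<bar>r j\<bar> < p + 1" "p < a - \<bar>r i\<bar>" "a + \<bar>r i\<bar> < p + 1"
    using start_before[OF v da ij(2,1) b' a_def] \<open>i ~= j\<close> by blast
   then show ?thesis using nb b' y[folded a_def] a_def by blast
  qed
 qed
qed

lemma outside_or_on_arc:
 obtains "\<forall>j<n. \<bar>r j\<bar> < \<bar>off (m j) t\<bar>" | j where "j < n" "\<bar>off (m j) t\<bar> <= \<bar>r j\<bar>"
 by (meson not_le)

lemma move_atD: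
 assumes "move_at A B m r D D'"
 shows "valid D" "valid D'" "length A = length B" "disjoint_arcs m r (length A)"
  "shows_picture m r A D" "shows_picture m r B D'"
  "\<forall>j<length A. \<bar>r j\<bar> < \<bar>off (m j) t\<bar> ==> curve D t = curve D' t \<and> label D t = label D' t \<and> curve D t \<notin> disk"
 using assms unfolding move_at_def by blast+

lemma move_at_on_arc:
 assumes mv: "move_at A B m r D D'" and j: "j < length A" and t: "\<bar>off (m j) t\<bar> <= \<bar>r j\<bar>"
 shows "curve D t = fst (A ! j) (off (m j) t / r j)" "label D t = mark (snd (A ! j)) (off (m j) t / r j)"
  "curve D' t = fst (B ! j) (off (m j) t / r j)" "label D' t = mark (snd (B ! j)) (off (m j) t / r j)"
  "\<bar>off (m j) t / r j\<bar> <= 1"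
proof -
 note m = move_atD[OF mv]
 have da: "disjoint_arcs m r (length B)" and jB: "j < length B" using m(3,4) j by auto
 show "curve D t = fst (A ! j) (off (m j) t / r j)" "label D t = mark (snd (A ! j)) (off (m j) t / r j)"
  "\<bar>off (m j) t / r j\<bar> <= 1"
  using shows_picture_at[OF m(5,1,4) j t] by blast+
 show "curve D' t = fst (B ! j) (off (m j) t / r j)" "label D' t = mark (snd (B ! j)) (off (m j) t / r j)"
  using shows_picture_at[OF m(6,2) da jB t] by blast+
qed

definition marked :: "label => strand => bool" where
 "marked l S \<longleftrightarrow> (\<exists>x. mark (snd S) x = l)"

text \<open>
 The over-strands of a move are made to start where \<open>N\<close> fails, so that the sweep does not twist any
 crossing inside the disk.
\<close>

lemma sweep_avoiding_move:
 assumes mv: "move_at A B m r D D'" and cN: "counter D N"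
  and out: "\<And>t. \<forall>j<length A. \<bar>r j\<bar> < \<bar>off (m j) t\<bar> ==> N' t = N t"
  and ij: "i < length A" "j < length A"
  and ov: "\<And>k. k < length A ==> marked Over (A ! k) \<or> marked Over (B ! k) ==>
   (k = i \<or> k = j) \<and> \<not> marked Wen (A ! k) \<and> (\<forall>t. \<bar>off (m k) t\<bar> <= \<bar>r k\<bar> --> N' t = N t)"
 shows "\<exists>p. label D p = Plain \<and> (\<forall>k<length A. \<bar>r k\<bar> < \<bar>off (m k) p\<bar>) \<and> over_set D N p = over_set D' N' p \<and>
  (\<forall>t\<in>over_set D N p. \<forall>k<length A. \<bar>r k\<bar> < \<bar>off (m k) t\<bar>)"
proof -
 note m = move_atD[OF mv] and on = move_at_on_arc[OF mv]
 have N: "N (t + 1) \<longleftrightarrow> \<not> N t" for t using cN unfolding counter_def by blast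
 obtain p where p: "label D p = Plain" "\<forall>k<length A. \<bar>r k\<bar> < \<bar>off (m k) p\<bar>"
  "\<forall>k\<in>{i, j}. \<exists>b z. b = m k + of_int z \<and> \<not> N b \<and> p < b - \<bar>r k\<bar> \<and> b + \<bar>r k\<bar> < p + 1"
  using start_exists[OF m(1,4) ij, of N] N by blast
 have key: "\<not> N t \<and> \<not> N' t"
  if t: "p < t" "t < p + 1" and k: "k < length A" "\<bar>off (m k) t\<bar> <= \<bar>r k\<bar>" and o: "label D t = Over \<or> label D' t = Over" for t k
 proof -
  have "marked Over (A ! k) \<or> marked Over (B ! k)" using on(2,4)[OF k] o unfolding marked_def by metis
  note ovk = ov[OF k(1) this]
  then obtain b z where b: "b = m k + of_int z" "\<not> N b" "p < b - \<bar>r k\<bar>" "b + \<bar>r k\<bar> < p + 1" using p(3) by blast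
  obtain n where n: "t = m k + off (m k) t + of_int n" by (rule off_decomp)
  have "t - (b + off (m k) t) = of_int (n - z)" using n b(1) by simp
  moreover have "\<bar>t - (b + off (m k) t)\<bar> < 1" using t k(2) b(3,4) by (auto simp: abs_if split: if_splits)
  ultimately have tb: "t = b + off (m k) t" using Ints_abs_less_1 by (metis Ints_of_int eq_iff_diff_eq_0)
  have nw: "label D u ~= Wen" if "\<bar>u - b\<bar> <= \<bar>r k\<bar>" for u
  proof -
   have "off (m k) u = u - b"
    by (rule off_unique[of _ _ _ z]) (use that b(1) disjoint_arcs_width(2)[OF m(4) k(1)] in auto)
   then have "\<bar>off (m k) u\<bar> <= \<bar>r k\<bar>" using that by simp
   then show ?thesis using on(2)[OF k(1), of u] ovk unfolding marked_def by metis
  qed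
  have "N t = N b"
  proof (cases "t <= b")
   case True
   show ?thesis by (rule counter_const[OF cN True]) (use k(2) tb in \<open>auto intro!: nw\<close>)
  next
   case False
   then have "b <= t" by simp
   then have "N b = N t" by (rule counter_const[OF cN]) (use k(2) tb in \<open>auto intro!: nw\<close>)
   then show ?thesis by simp
  qed
  then show ?thesis using b(2) ovk k(2) by blast
 qed
 have "\<forall>k<length A. \<bar>r k\<bar> < \<bar>off (m k) t\<bar>" if "t \<in> over_set D N p \<or> t \<in> over_set D' N' p" for t
 proof (intro allI impI, rule ccontr)
  fix k assume k: "k < length A" "\<not> \<bar>r k\<bar> < \<bar>off (m k) t\<bar>"
  have "p < t" "t < p + 1" "label D t = Over \<or> label D' t = Over" "N t \<or> N' t"
   using that by (auto simp: over_set_def)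
  then show False using key[of t k] k by simp
 qed
 note outside = this
 have "over_set D N p = over_set D' N' p"
 proof (rule set_eqI)
  fix t
  show "t \<in> over_set D N p \<longleftrightarrow> t \<in> over_set D' N' p"
  proof
   assume h: "t \<in> over_set D N p"
   then have o: "\<forall>k<length A. \<bar>r k\<bar> < \<bar>off (m k) t\<bar>" using outside by blast
   show "t \<in> over_set D' N' p" using h m(7)[OF o] out[OF o] by (simp add: over_set_def)
  next
   assume h: "t \<in> over_set D' N' p"
   then have o: "\<forall>k<length A. \<bar>r k\<bar> < \<bar>off (m k) t\<bar>" using outside by blast
   show "t \<in> over_set D N p" using h m(7)[OF o] out[OF o] by (simp add: over_set_def)
  qed
 qed
 then show ?thesis using p(1,2) outside by blast
qed

lemma move_at_set_wen:
 assumes mv: "move_at A B m r D D'" and p: "label D p \<in> {Plain, Wen}" "label D' p' \<in> {Plain, Wen}"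
  and on: "\<And>j u. j < length A ==> \<bar>off (m j) u\<bar> <= \<bar>r j\<bar> ==>
   (label D u = Wen \<longleftrightarrow> u - p \<in> \<int>) \<and> (label D' u = Wen \<longleftrightarrow> u - p' \<in> \<int>)"
  and out: "\<And>u. \<forall>j<length A. \<bar>r j\<bar> < \<bar>off (m j) u\<bar> ==> u - p \<in> \<int> \<longleftrightarrow> u - p' \<in> \<int>"
 shows "move_at A B m r (set_wen p D) (set_wen p' D')"
proof -
 note m = move_atD[OF mv]
 have arc: "\<bar>off (m j) (arc_param m r j x)\<bar> <= \<bar>r j\<bar>" if "x \<in> {-1..1}" for j x
 proof -
  have "\<bar>off (m j) (m j + r j * x + of_int 0)\<bar> <= \<bar>r j * x\<bar>" by (rule abs_off_le)
  also have "\<dots> <= \<bar>r j\<bar>" using that by (simp add: abs_mult mult_left_le abs_le_iff)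
  finally show ?thesis by (simp add: arc_param_def)
 qed
 have l: "label (set_wen p D) u = label D u" "label (set_wen p' D') u = label D' u"
  if "j < length A" "\<bar>off (m j) u\<bar> <= \<bar>r j\<bar>" for j u
  using on[OF that] by (metis set_wen_simps(2))+
 show ?thesis
  unfolding move_at_def
 proof (intro conjI allI impI)
  show "shows_picture m r A (set_wen p D)" "shows_picture m r B (set_wen p' D')"
   using m(3,5,6) l arc unfolding shows_picture_def set_wen_simps(1) by metis+
  fix t assume t: "\<forall>j<length A. \<bar>r j\<bar> < \<bar>off (m j) t\<bar>"
  show "curve (set_wen p D) t = curve (set_wen p' D') t" "label (set_wen p D) t = label (set_wen p' D') t"
   using m(7)[OF t] out[OF t] by simp_all
  show "curve (set_wen p D) t \<notin> disk" unfolding set_wen_simps using m(7)[OF t] by blast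
 qed (use m(3,4) valid_set_wen[OF m(1) p(1)] valid_set_wen[OF m(2) p(2)] in blast)+
qed

text \<open>Among three strands over each other in a fixed order, the lowest has no over-passage.\<close>

lemma triangle_move_strands:
 assumes e: "(A, B) = triangle_move (a, a') (b, b') (c, c')"
  and w: "Wen \<notin> {a, a', b, b', c, c'}"
  and o: "\<not> (a = Over \<or> b = Over) \<or> \<not> (a' = Over \<or> c = Over) \<or> \<not> (b' = Over \<or> c' = Over)"
 shows "(\<forall>k<length A. \<not> marked Wen (A ! k) \<and> \<not> marked Wen (B ! k)) \<and>
  (\<exists>i<length A. \<exists>j<length A. \<forall>k<length A. marked Over (A ! k) \<or> marked Over (B ! k) --> k = i \<or> k = j)"
proof -
 have A: "A = [(rising, [(0, a), (1/2, b)]), (falling, [(0, a'), (-1/2, c)]), (bent 1, [(1/2, b'), (-1/2, c')])]"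
  and B: "B = [(rising, [(0, a), (-1/2, b)]), (falling, [(0, a'), (1/2, c)]), (bent (-1), [(-1/2, b'), (1/2, c')])]"
  using e by simp_all
 have n: "\<not> marked l (s, [(x, d), (y, d')])" if "Plain ~= l" "d ~= l" "d' ~= l" for l s x y d d'
  using that by (auto simp: marked_def mark_def)
 have w': "a ~= Wen" "b ~= Wen" "c ~= Wen" "a' ~= Wen" "b' ~= Wen" "c' ~= Wen" using w by auto
 have all: "(\<forall>k<length A. P k) \<longleftrightarrow> P 0 \<and> P 1 \<and> P 2" for P
  by (auto simp: A less_Suc_eq numeral_2_eq_2)
 have ex: "(0::nat) < length A" "1 < length A" "2 < length A" by (simp_all add: A)
 have "\<forall>k<length A. \<not> marked Wen (A ! k) \<and> \<not> marked Wen (B ! k)"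
  unfolding all unfolding A B using n[of Wen] w' by simp
 moreover consider "\<not> (a = Over \<or> b = Over)" | "\<not> (a' = Over \<or> c = Over)" | "\<not> (b' = Over \<or> c' = Over)" using o by blast
 then have "\<exists>i<length A. \<exists>j<length A. \<forall>k<length A. marked Over (A ! k) \<or> marked Over (B ! k) --> k = i \<or> k = j"
 proof cases
  case 1
  then have "\<not> marked Over (A ! 0)" "\<not> marked Over (B ! 0)" unfolding A B using n[of Over] by simp_all
  then show ?thesis unfolding all using ex by (intro exI[of _ 1] conjI exI[of _ 2]) auto
 next
  case 2
  then have "\<not> marked Over (A ! 1)" "\<not> marked Over (B ! 1)" unfolding A B using n[of Over] by simp_all
  then show ?thesis unfolding all using ex by (intro exI[of _ 0] conjI exI[of _ 2]) auto
 next
  case 3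
  then have "\<not> marked Over (A ! 2)" "\<not> marked Over (B ! 2)" unfolding A B using n[of Over] by simp_all
  then show ?thesis unfolding all using ex by (intro exI[of _ 0] conjI exI[of _ 1]) auto
 qed
 ultimately show ?thesis by blast
qed

lemma reidemeister_strands:
 assumes "(A, B) \<in> reidemeister_moves"
 shows "(\<forall>k<length A. \<not> marked Wen (A ! k) \<and> \<not> marked Wen (B ! k)) \<and>
  (\<exists>i<length A. \<exists>j<length A. \<forall>k<length A. marked Over (A ! k) \<or> marked Over (B ! k) --> k = i \<or> k = j)"
proof -
 have n: "\<not> marked Wen (s, [(x, d), (y, d')])" if "d ~= Wen" "d' ~= Wen" for s x y d d'
  using that by (auto simp: marked_def mark_def)
 have e: "\<not> marked Wen (s, [])" for s by (simp add: marked_def mark_def)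
 have nw: "a ~= Wen" "b ~= Wen" if "(a, b) \<in> real_crossing \<union> virtual_crossing" for a b
  using crossing_label[OF that] by simp_all
 consider "(A, B) \<in> R1 \<union> R4" | "(A, B) \<in> R2 \<union> R5" | "(A, B) \<in> R3" | "(A, B) \<in> R6 \<union> R7 \<union> R8"
  using assms unfolding reidemeister_moves_def by blast
 then show ?thesis
 proof cases
  case 1
  then obtain a b where ab: "(a, b) \<in> real_crossing \<union> virtual_crossing" "A = [(horizontal 0, [])]" "B = [(kink, [(-1/2, a), (1/2, b)])]"
   unfolding R1_def R4_def kink_moves_def by auto
  show ?thesis unfolding ab(2,3) using n e nw[OF ab(1)] by simp
 next
  case 2
  then obtain a b where ab: "(a, b) \<in> real_crossing \<union> virtual_crossing" "A = [(horizontal 0, []), (horizontal (9/16), [])]"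
   "B = [(horizontal 0, [(-1/2, a), (1/2, a)]), (dip, [(-1/2, b), (1/2, b)])]"
   unfolding R2_def R5_def bigon_moves_def by auto
  have "\<forall>k<length A. \<not> marked Wen (A ! k) \<and> \<not> marked Wen (B ! k)"
   unfolding ab(2,3) using n e nw[OF ab(1)] by (simp add: less_Suc_eq)
  moreover have "\<forall>k<length A. k = 0 \<or> k = 1" "0 < length A" "1 < length A" by (auto simp: ab(2))
  ultimately show ?thesis by blast
 next
  case 3
  then obtain i j k where e: "(A, B) = triangle_move (stacked i j) (stacked i k) (stacked j k)" "distinct [i, j, k]"
   unfolding R3_def by auto
  have st: "stacked a b = (if a > b then Over else Under, if a > b then Under else Over)" for a b
   by (simp add: stacked_def)
  show ?thesis by (rule triangle_move_strands[OF e(1)[unfolded st]]) (use e(2) in auto)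
 next
  case 4
  then obtain a a' b where e: "(A, B) = triangle_move (a, a') (b, Virtual) (b, Virtual) \<and> b = Virtual \<and> Wen \<notin> {a, a'} \<or>
   (A, B) = triangle_move (Virtual, Virtual) (Under, Over) (Under, Over)"
   unfolding R6_def R7_def R8_def real_crossing_def by auto
  then show ?thesis
  proof
   assume "(A, B) = triangle_move (a, a') (b, Virtual) (b, Virtual) \<and> b = Virtual \<and> Wen \<notin> {a, a'}"
   then show ?thesis by (intro triangle_move_strands[of A B a a' b Virtual b Virtual]) auto
  next
   assume "(A, B) = triangle_move (Virtual, Virtual) (Under, Over) (Under, Over)"
   then show ?thesis by (rule triangle_move_strands) auto
  qed
 qed
qed

text \<open>
 Inside the disk there are no wens, so the counter does not change.
\<close>

lemma sweep_reidemeister: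
 assumes mem: "(A, B) \<in> reidemeister_moves" and mv: "move_at A B m r D D'"
 shows "counter D N \<longleftrightarrow> counter D' N"
  "counter D N ==> \<exists>E E'. sweep_class D E \<and> sweep_class D' E' \<and> E \<asymp> E'"
proof -
 note m = move_atD[OF mv] and on = move_at_on_arc[OF mv] and s = reidemeister_strands[OF mem]
 have nw: "label D t ~= Wen" "label D' t ~= Wen" if "k < length A" "\<bar>off (m k) t\<bar> <= \<bar>r k\<bar>" for k t
  using on(2,4)[OF that] s that(1) unfolding marked_def by metis+
 have w: "label D t = Wen \<longleftrightarrow> label D' t = Wen" for t
  by (rule outside_or_on_arc[of "length A" r m t]) (use m(7)[of t] nw in auto)
 show c: "counter D N \<longleftrightarrow> counter D' N" using counter_cong w by metis
 assume cN: "counter D N"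
 obtain i j where ij: "i < length A" "j < length A"
  "\<forall>k<length A. marked Over (A ! k) \<or> marked Over (B ! k) --> k = i \<or> k = j" using s by blast
 obtain p where p: "label D p = Plain" "\<forall>k<length A. \<bar>r k\<bar> < \<bar>off (m k) p\<bar>" "over_set D N p = over_set D' N p"
  "\<forall>t\<in>over_set D N p. \<forall>k<length A. \<bar>r k\<bar> < \<bar>off (m k) t\<bar>"
  using sweep_avoiding_move[OF mv cN _ ij(1,2), of N] ij(3) s by blast
 have p': "label D p \<in> {Plain, Wen}" "label D' p \<in> {Plain, Wen}" using m(7)[OF p(2)] p(1) by auto
 have np: "u - p \<notin> \<int>" if "k < length A" "\<bar>off (m k) u\<bar> <= \<bar>r k\<bar>" for k u
  using p(2) that off_eq_iff[of "m k" u p] by force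
 have "move_at A B m r (set_wen p D) (set_wen p D')"
  by (rule move_at_set_wen[OF mv p']) (use nw np in blast)+
 moreover have "(A, B) \<in> wen_moves" using mem by blast
 ultimately have "\<exists>E E'. swept D N p E \<and> swept D' N p E' \<and> E \<asymp> E'"
  using sweep_step[OF m(1,2) p' p(3)] p(4) by blast
 then show "\<exists>E E'. sweep_class D E \<and> sweep_class D' E' \<and> E \<asymp> E'"
  using cN c unfolding sweep_class_def by blast
qed

text \<open>
 In the wen moves the two pictures differ, as far as wens are concerned, exactly at the parameters
 \<open>\<plusminus>c\<close> of the first strand.
\<close>

definition wen_change :: "real => picture => picture => bool" where
 "wen_change c A B \<longleftrightarrow> 0 < length A \<and>
   (\<forall>x. ((mark (snd (A ! 0)) x = Wen) ~= (mark (snd (B ! 0)) x = Wen)) \<longleftrightarrow> \<bar>x\<bar> = c) \<and>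
   (\<forall>j. 0 < j \<and> j < length A --> \<not> marked Wen (A ! j) \<and> \<not> marked Wen (B ! j))"

lemma move_at_wen_change:
 assumes mv: "move_at A B m r D D'" and wc: "wen_change c A B" and c: "0 < c" "c < 1"
 shows "((label D t = Wen) ~= (label D' t = Wen)) \<longleftrightarrow> \<bar>off (m 0) t\<bar> = c * \<bar>r 0\<bar>" "0 < c * \<bar>r 0\<bar>" "c * \<bar>r 0\<bar> < \<bar>r 0\<bar>" "\<bar>r 0\<bar> < 1/2"
proof -
 note m = move_atD[OF mv] and on = move_at_on_arc[OF mv]
 have l: "0 < length A" using wc unfolding wen_change_def by blast
 have r: "r 0 ~= 0" "\<bar>r 0\<bar> < 1/2" using disjoint_arcs_width[OF m(4) l] by auto
 then show cr: "0 < c * \<bar>r 0\<bar>" "c * \<bar>r 0\<bar> < \<bar>r 0\<bar>" "\<bar>r 0\<bar> < 1/2" using c by simp_all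
 show "((label D t = Wen) ~= (label D' t = Wen)) \<longleftrightarrow> \<bar>off (m 0) t\<bar> = c * \<bar>r 0\<bar>"
 proof (rule outside_or_on_arc[of "length A" r m t])
  assume o: "\<forall>j<length A. \<bar>r j\<bar> < \<bar>off (m j) t\<bar>"
  then have "\<bar>r 0\<bar> < \<bar>off (m 0) t\<bar>" using l by blast
  then show ?thesis using m(7)[OF o] cr(2) by simp
 next
  fix j assume j: "j < length A" "\<bar>off (m j) t\<bar> <= \<bar>r j\<bar>"
  show ?thesis
  proof (cases "j = 0")
   case True
   have "((label D t = Wen) ~= (label D' t = Wen)) \<longleftrightarrow> \<bar>off (m 0) t / r 0\<bar> = c"
    using on(2,4)[OF j] wc unfolding True wen_change_def by simp
   also have "\<dots> \<longleftrightarrow> \<bar>off (m 0) t\<bar> = c * \<bar>r 0\<bar>" using r(1) by (simp add: abs_divide divide_eq_eq)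
   finally show ?thesis .
  next
   case False
   then have "label D t ~= Wen" "label D' t ~= Wen"
    using on(2,4)[OF j] wc j(1) unfolding wen_change_def marked_def by (metis not_gr_zero)+
   moreover have "\<bar>r 0\<bar> < \<bar>off (m 0) t\<bar>" by (rule disjoint_arcs_off[OF m(4) j(1) l False j(2)])
   ultimately show ?thesis using cr(2) by simp
  qed
 qed
qed

lemma counter_wen_change:
 assumes mv: "move_at A B m r D D'" and wc: "wen_change c A B" and c: "0 < c" "c < 1"
 shows "counter D N ==> counter D' (\<lambda>t. N t ~= window (m 0) (c * \<bar>r 0\<bar>) t)"
  "counter D' N ==> counter D (\<lambda>t. N t ~= window (m 0) (c * \<bar>r 0\<bar>) t)"
proof -
 note w = move_at_wen_change[OF mv wc c]
 have c2: "0 < c * \<bar>r 0\<bar>" "c * \<bar>r 0\<bar> < 1/2" using w(2-4) by linarith+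
 show "counter D N ==> counter D' (\<lambda>t. N t ~= window (m 0) (c * \<bar>r 0\<bar>) t)"
  using counter_window[OF _ c2] w(1) by blast
 have "((label D' t = Wen) ~= (label D t = Wen)) \<longleftrightarrow> \<bar>off (m 0) t\<bar> = c * \<bar>r 0\<bar>" for t using w(1)[of t] by blast
 then show "counter D' N ==> counter D (\<lambda>t. N t ~= window (m 0) (c * \<bar>r 0\<bar>) t)"
  using counter_window[OF _ c2] by blast
qed

text \<open>The moves W1, W3 and W4 only concern wens: they change nothing once the wens are forgotten.\<close>

lemma plain_wen_moves:
 assumes "(A, B) \<in> W1 \<union> W3 \<union> W4"
 shows "wen_change (1/2) A B"
  "\<forall>j<length A. fst (A ! j) = fst (B ! j) \<and>
   (\<forall>x. (if mark (snd (A ! j)) x = Wen then Plain else mark (snd (A ! j)) x) =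
    (if mark (snd (B ! j)) x = Wen then Plain else mark (snd (B ! j)) x))"
  "\<forall>k<length A. marked Over (A ! k) \<or> marked Over (B ! k) --> k = length A - 1 \<and> k ~= 0 \<and> \<not> marked Wen (A ! k)"
proof -
 have n1: "marked l (s, [(x, d)]) \<longleftrightarrow> l = d \<or> l = Plain" for l s x d
  by (auto simp: marked_def mark_def intro: exI[of _ "x + 1"])
 have n0: "marked l (s, []) \<longleftrightarrow> l = Plain" for l s by (auto simp: marked_def mark_def)
 have n2: "marked l (s, [(x, d), (y, d')]) ==> l = d \<or> l = d' \<or> l = Plain" for l s x y d d'
  by (auto simp: marked_def mark_def split: if_splits)
 have mk: "mark [(x, d), (y, d')] z = (if z = x then d else if z = y then d' else Plain)"
  "mark [(x, d)] z = (if z = x then d else Plain)" "mark [] z = Plain" for x y z d d'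
  by (auto simp: mark_def)
 have half: "\<bar>x\<bar> = 1/2 \<longleftrightarrow> x = -1/2 \<or> x = 1/2" for x :: real by auto
 have lt2: "(\<forall>j<Suc (Suc 0). P j) \<longleftrightarrow> P 0 \<and> P 1" "(\<forall>j<Suc 0. P j) \<longleftrightarrow> P 0" for P by (auto simp: less_Suc_eq)
 have pos: "(\<forall>j. 0 < j \<and> j < Suc (Suc 0) --> P j) \<longleftrightarrow> P 1" "(\<forall>j. 0 < j \<and> j < Suc 0 --> P j) \<longleftrightarrow> True" for P
  by (auto simp: less_Suc_eq)
 show "wen_change (1/2) A B"
  using assms unfolding W1_def W3_def W4_def
  by (elim UnE; simp add: wen_change_def mk half pos n1 n0; auto)
 show "\<forall>j<length A. fst (A ! j) = fst (B ! j) \<and>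
   (\<forall>x. (if mark (snd (A ! j)) x = Wen then Plain else mark (snd (A ! j)) x) =
    (if mark (snd (B ! j)) x = Wen then Plain else mark (snd (B ! j)) x))"
  using assms unfolding W1_def W3_def W4_def by (elim UnE; simp add: mk lt2)
 show "\<forall>k<length A. marked Over (A ! k) \<or> marked Over (B ! k) --> k = length A - 1 \<and> k ~= 0 \<and> \<not> marked Wen (A ! k)"
  using assms n2[of Over] unfolding W1_def W3_def W4_def by (elim UnE; simp add: lt2 n1 n0; blast)
qed

lemma sweep_plain_wen_move:
 assumes mem: "(A, B) \<in> W1 \<union> W3 \<union> W4" and mv: "move_at A B m r D D'" and cN: "counter D N"
 shows "\<exists>E E'. sweep_class D E \<and> sweep_class D' E' \<and> E \<asymp> E'"
proof -
 note m = move_atD[OF mv] and on = move_at_on_arc[OF mv] and pw = plain_wen_moves[OF mem]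
 note w = move_at_wen_change[OF mv pw(1)]
 let ?N = "\<lambda>t. N t ~= window (m 0) (1/2 * \<bar>r 0\<bar>) t"
 have cN': "counter D' ?N" by (rule counter_wen_change(1)[OF mv pw(1) _ _ cN]) auto
 have same: "?N t = N t" if "\<bar>r 0\<bar> < \<bar>off (m 0) t\<bar>" for t
  using that by (auto simp: window_def abs_if split: if_splits)
 have l: "0 < length A" "length A - 1 < length A" using pw(1) unfolding wen_change_def by auto
 have "\<exists>p. label D p = Plain \<and> (\<forall>k<length A. \<bar>r k\<bar> < \<bar>off (m k) p\<bar>) \<and> over_set D N p = over_set D' ?N p \<and>
  (\<forall>t\<in>over_set D N p. \<forall>k<length A. \<bar>r k\<bar> < \<bar>off (m k) t\<bar>)"
 proof (rule sweep_avoiding_move[OF mv cN _ l(2) l(2)])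
  show "?N t = N t" if "\<forall>j<length A. \<bar>r j\<bar> < \<bar>off (m j) t\<bar>" for t using same that l(1) by blast
  show "(k = length A - 1 \<or> k = length A - 1) \<and> \<not> marked Wen (A ! k) \<and> (\<forall>t. \<bar>off (m k) t\<bar> <= \<bar>r k\<bar> --> ?N t = N t)"
   if k: "k < length A" "marked Over (A ! k) \<or> marked Over (B ! k)" for k
  proof -
   have k0: "k = length A - 1" "k ~= 0" "\<not> marked Wen (A ! k)" using pw(3) k by blast+
   have "?N t = N t" if "\<bar>off (m k) t\<bar> <= \<bar>r k\<bar>" for t
    by (rule same[OF disjoint_arcs_off[OF m(4) k(1) l(1) k0(2) that]])
   then show ?thesis using k0 by blast
  qed
 qed
 then obtain p where p: "label D p = Plain" "\<forall>k<length A. \<bar>r k\<bar> < \<bar>off (m k) p\<bar>" "over_set D N p = over_set D' ?N p" by blast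
 have p': "label D p \<in> {Plain, Wen}" "label D' p \<in> {Plain, Wen}" using m(7)[OF p(2)] p(1) by auto
 have "curve D u = curve D' u \<and> (if label D u = Wen then Plain else label D u) = (if label D' u = Wen then Plain else label D' u)" for u
 proof (rule outside_or_on_arc[of "length A" r m u])
  assume "\<forall>j<length A. \<bar>r j\<bar> < \<bar>off (m j) u\<bar>"
  then show ?thesis using m(7) by simp
 next
  fix j assume j: "j < length A" "\<bar>off (m j) u\<bar> <= \<bar>r j\<bar>"
  have e: "fst (A ! j) = fst (B ! j)" "\<forall>x. (if mark (snd (A ! j)) x = Wen then Plain else mark (snd (A ! j)) x) =
    (if mark (snd (B ! j)) x = Wen then Plain else mark (snd (B ! j)) x)" using pw(2) j(1) by blast+
  show ?thesis unfolding on(1-4)[OF j] e(1) by (intro conjI refl e(2)[rule_format])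
 qed
 then have "set_wen p D = set_wen p D'" unfolding set_wen_def by (simp add: fun_eq_iff)
 then have "\<exists>E E'. swept D N p E \<and> swept D' ?N p E' \<and> E \<asymp> E'"
  using sweep_step[OF m(1,2) p' p(3)] by blast
 then show ?thesis using cN cN' unfolding sweep_class_def by blast
qed

lemma wen_change_W2:
 assumes "(A, B) \<in> W2"
 shows "wen_change (3/4) A B"
proof -
 obtain sg where A: "A = [(horizontal 0, [(-3/4, Wen), (0, Over)]), (vertical, [(0, Under)])]"
  and B: "B = [(horizontal 0, [(-1/2, Virtual), (0, Over), (1/2, Virtual), (3/4, Wen)]),
      (twist sg, [(-1/2, Virtual), (0, Under), (1/2, Virtual)])]"
  using assms unfolding W2_def by blast
 have 0: "mark (snd (A ! 0)) x = Wen \<longleftrightarrow> x = -3/4" "mark (snd (B ! 0)) x = Wen \<longleftrightarrow> x = 3/4" for x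
  by (auto simp: A B mark_def)
 have 1: "\<not> marked Wen (A ! 1)" "\<not> marked Wen (B ! 1)" by (auto simp: A B marked_def mark_def)
 have "j = 1" if "0 < j" "j < length A" for j using that by (simp add: A)
 moreover have "0 < length A" by (simp add: A)
 ultimately show ?thesis unfolding wen_change_def 0 using 1 by (auto simp: abs_if)
qed

text \<open>
 For W2 the sweeps start at the wen that moves. It begins behind the over-passage in one diagram and
 in front of it in the other, and \<open>N\<close> is chosen so that neither sweep twists that crossing.
\<close>

lemma sweep_W2:
 assumes mem: "(A, B) \<in> W2" and mv: "move_at A B m r D D'" and cM: "counter D M"
 shows "\<exists>E E'. sweep_class D E \<and> sweep_class D' E' \<and> E \<asymp> E'"
proof -
 obtain sg where A: "A = [(horizontal 0, [(-3/4, Wen), (0, Over)]), (vertical, [(0, Under)])]"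
  and B: "B = [(horizontal 0, [(-1/2, Virtual), (0, Over), (1/2, Virtual), (3/4, Wen)]),
      (twist sg, [(-1/2, Virtual), (0, Under), (1/2, Virtual)])]"
  using mem unfolding W2_def by blast
 note m = move_atD[OF mv] and on = move_at_on_arc[OF mv]
 have l2: "length A = 2" "0 < length A" "1 < length A" by (simp_all add: A)
 have A0: "mark (snd (A ! 0)) x = Wen \<longleftrightarrow> x = -3/4" "mark (snd (A ! 0)) x = Over \<longleftrightarrow> x = 0"
  and B0: "mark (snd (B ! 0)) x = Wen \<longleftrightarrow> x = 3/4" "mark (snd (B ! 0)) x = Over \<longleftrightarrow> x = 0" for x
  by (auto simp: A B mark_def)
 have A1: "\<not> marked Wen (A ! 1)" "\<not> marked Over (A ! 1)" and B1: "\<not> marked Wen (B ! 1)" "\<not> marked Over (B ! 1)"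
  by (auto simp: A B marked_def mark_def)
 have j1: "j = 1" if "0 < j" "j < length A" for j using that l2(1) by simp
 have wc: "wen_change (3/4) A B" by (rule wen_change_W2[OF mem])
 note w = move_at_wen_change[OF mv wc]
 have r: "r 0 ~= 0" "\<bar>r 0\<bar> < 1/2" using disjoint_arcs_width[OF m(4) l2(2)] by auto
 define c where "c = 3/4 * \<bar>r 0\<bar>"
 have c: "0 < c" "c < \<bar>r 0\<bar>" "c < 1/2" using r by (simp_all add: c_def)
 have "\<exists>N. counter D N \<and> (r 0 > 0 --> \<not> N (m 0)) \<and> (r 0 < 0 --> N (m 0))"
 proof -
  have "\<exists>e>0. \<forall>u. (t - e < u \<and> u < t --> ((\<not> M u) \<longleftrightarrow> (\<not> M t) ~= (label D t = Wen))) \<and>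
    (t < u \<and> u < t + e --> (\<not> M u) = (\<not> M t))" for t
  proof -
   obtain e where "e > 0" "\<forall>u. (t - e < u \<and> u < t --> (M u \<longleftrightarrow> M t ~= (label D t = Wen))) \<and> (t < u \<and> u < t + e --> M u = M t)"
    using cM unfolding counter_def by blast
   then show ?thesis by (intro exI[of _ e]) auto
  qed
  then have "counter D (\<lambda>t. \<not> M t)" using cM unfolding counter_def by simp
  then show ?thesis using cM by (cases "M (m 0) = (r 0 > 0)") force+
 qed
 then obtain N where cN: "counter D N" and N0: "r 0 > 0 ==> \<not> N (m 0)" "r 0 < 0 ==> N (m 0)" by blast
 have per: "N (t + 1) \<longleftrightarrow> \<not> N t" for t using cN unfolding counter_def by blast
 let ?N = "\<lambda>t. N t ~= window (m 0) c t"
 have cN': "counter D' ?N" unfolding c_def by (rule counter_wen_change(1)[OF mv wc _ _ cN]) auto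
 have per': "?N (t + 1) \<longleftrightarrow> \<not> ?N t" for t using cN' unfolding counter_def by blast
 \<comment> \<open>The two positions of the moving wen.\<close>
 define p where "p = m 0 - 3/4 * r 0"
 define p' where "p' = m 0 + 3/4 * r 0"
 have op: "off (m 0) p = - (3/4 * r 0)" "off (m 0) p' = 3/4 * r 0"
 proof -
  have "\<bar>3/4 * r 0\<bar> < 1/2" using r(2) by (simp add: abs_mult)
  then show "off (m 0) p = - (3/4 * r 0)" "off (m 0) p' = 3/4 * r 0"
   unfolding p_def p'_def using off_self[of "- (3/4 * r 0)" "m 0"] off_self[of "3/4 * r 0" "m 0"] by simp_all
 qed
 have on0: "label D u = Wen \<longleftrightarrow> u - p \<in> \<int>" "label D' u = Wen \<longleftrightarrow> u - p' \<in> \<int>"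
  "label D u = Over \<longleftrightarrow> off (m 0) u = 0" "label D' u = Over \<longleftrightarrow> off (m 0) u = 0" if u: "\<bar>off (m 0) u\<bar> <= \<bar>r 0\<bar>" for u
  unfolding off_eq_iff[of "m 0", symmetric] op on(2,4)[OF l2(2) u] A0 B0 using r(1) by (simp_all add: divide_eq_eq)
 have on1: "label D u ~= Wen" "label D' u ~= Wen" "label D u ~= Over" "label D' u ~= Over" if u: "\<bar>off (m 1) u\<bar> <= \<bar>r 1\<bar>" for u
  unfolding on(2,4)[OF l2(3) u] using A1 B1 unfolding marked_def by blast+
 have far: "u - p \<notin> \<int>" "u - p' \<notin> \<int>" if u: "\<bar>r 0\<bar> < \<bar>off (m 0) u\<bar>" for u
  unfolding off_eq_iff[of "m 0", symmetric] op using u by (auto simp: abs_mult)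
 have far1: "\<bar>r 0\<bar> < \<bar>off (m 0) u\<bar>" if "\<bar>off (m 1) u\<bar> <= \<bar>r 1\<bar>" for u
  by (rule disjoint_arcs_off[OF m(4) l2(3,2) _ that]) simp
 have le: "\<bar>off (m 0) p\<bar> <= \<bar>r 0\<bar>" "\<bar>off (m 0) p'\<bar> <= \<bar>r 0\<bar>" unfolding op by (simp_all add: abs_mult)
 have lp: "label D p \<in> {Plain, Wen}" "label D' p' \<in> {Plain, Wen}"
  using on0(1)[OF le(1)] on0(2)[OF le(2)] by simp_all
 have mw: "move_at A B m r (set_wen p D) (set_wen p' D')"
 proof (rule move_at_set_wen[OF mv lp])
  show "(label D u = Wen \<longleftrightarrow> u - p \<in> \<int>) \<and> (label D' u = Wen \<longleftrightarrow> u - p' \<in> \<int>)"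
   if j: "j < length A" "\<bar>off (m j) u\<bar> <= \<bar>r j\<bar>" for j u
  proof (cases "j = 0")
   case True
   then show ?thesis using on0(1,2) j(2) by blast
  next
   case False
   then have u: "\<bar>off (m 1) u\<bar> <= \<bar>r 1\<bar>" using j j1[of j] by simp
   show ?thesis using on1(1,2)[OF u] far[OF far1[OF u]] by blast
  qed
  show "u - p \<in> \<int> \<longleftrightarrow> u - p' \<in> \<int>" if "\<forall>j<length A. \<bar>r j\<bar> < \<bar>off (m j) u\<bar>" for u
   using far[of u] that l2(2) by blast
 qed
 have win: "window (m 0) c t = (\<bar>off (m 0) t\<bar> < c)" if "\<bar>off (m 0) t\<bar> ~= c" for t
  using that by (auto simp: window_def abs_if)
 have out: "\<forall>k<length A. \<bar>r k\<bar> < \<bar>off (m k) t\<bar>" if t: "t \<in> over_set D N p \<or> t \<in> over_set D' ?N p'" for t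
 proof (intro allI impI, rule ccontr)
  fix k assume k: "k < length A" "\<not> \<bar>r k\<bar> < \<bar>off (m k) t\<bar>"
  have o: "label D t = Over \<or> label D' t = Over" using t by (auto simp: over_set_def)
  show False
  proof (cases "k = 0")
   case False
   then have u: "\<bar>off (m 1) t\<bar> <= \<bar>r 1\<bar>" using k j1[of k] by simp
   show False using on1(3,4)[OF u] o by blast
  next
   case True
   then have u: "\<bar>off (m 0) t\<bar> <= \<bar>r 0\<bar>" using k(2) by simp
   then have o0: "off (m 0) t = 0" using on0(3,4)[OF u] o by blast
   obtain n where n: "t = m 0 + off (m 0) t + of_int n" by (rule off_decomp)
   then have tn: "t = m 0 + of_int n" using o0 by simp
   have wt: "window (m 0) c t" unfolding window_def using o0 c(1) by simp
   \<comment> \<open>The over-passages on the arc are the lifts \<open>m 0 + n\<close> of its centre, with \<open>n\<close> equal to 0 or 1 within the turns in question.\<close>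
   have rng: "- (3/4 * r 0) < of_int n \<and> of_int n < 1 - 3/4 * r 0 \<and> N t \<or> 3/4 * r 0 < of_int n \<and> of_int n < 1 + 3/4 * r 0 \<and> \<not> N t"
    using t wt tn by (auto simp: over_set_def p_def p'_def)
   have b: "\<bar>3/4 * r 0\<bar> < 1/2" using r(2) by (simp add: abs_mult)
   then have "n = 0 \<or> n = 1"
   proof -
    have "-1 < (of_int n :: real)" "(of_int n :: real) < 2" using rng b by linarith+
    then show ?thesis by linarith
   qed
   then consider "t = m 0" "n = 0" | "t = m 0 + 1" "n = 1" using tn by auto
   then show False
   proof cases
    case 1
    then show False using rng N0 r(1) by (cases "r 0 > 0") auto
   next
    case 2
    then show False using rng N0 r(1) per[of "m 0"] by (cases "r 0 > 0") auto
   qed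
  qed
 qed
 have "over_set D N p = over_set D' ?N p'"
 proof (rule set_eqI)
  fix t
  have rest: "p < t \<and> t < p + 1 \<longleftrightarrow> p' < t \<and> t < p' + 1" if o: "\<bar>r 0\<bar> < \<bar>off (m 0) t\<bar>"
   and s: "p < t \<and> t < p + 1 \<or> p' < t \<and> t < p' + 1"
  proof -
   have "\<not> \<bar>t - m 0\<bar> <= \<bar>r 0\<bar>" "\<not> \<bar>t - (m 0 + 1)\<bar> <= \<bar>r 0\<bar>"
    using abs_off_le[of "m 0" "t - m 0" 0] abs_off_le[of "m 0" "t - (m 0 + 1)" 1] o by auto
   then show ?thesis using s unfolding p_def p'_def by (auto simp: abs_if split: if_splits)
  qed
  have same: "label D t = label D' t" "?N t = N t" "\<bar>r 0\<bar> < \<bar>off (m 0) t\<bar>" if o: "\<forall>k<length A. \<bar>r k\<bar> < \<bar>off (m k) t\<bar>"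
  proof -
   show o0: "\<bar>r 0\<bar> < \<bar>off (m 0) t\<bar>" using o l2(2) by blast
   show "label D t = label D' t" using m(7)[OF o] by blast
   have "\<not> window (m 0) c t" using o0 c(2) by (auto simp: window_def abs_if split: if_splits)
   then show "?N t = N t" by simp
  qed
  show "t \<in> over_set D N p \<longleftrightarrow> t \<in> over_set D' ?N p'"
  proof
   assume t: "t \<in> over_set D N p"
   note s = same[OF out[OF disjI1[OF t]]]
   have "p < t \<and> t < p + 1" "label D t = Over" "N t" using t by (simp_all add: over_set_def)
   then show "t \<in> over_set D' ?N p'" using s(1,2) rest[OF s(3)] unfolding over_set_def by simp
  next
   assume t: "t \<in> over_set D' ?N p'"
   note s = same[OF out[OF disjI2[OF t]]]
   have "p' < t \<and> t < p' + 1" "label D' t = Over" "?N t" using t by (simp_all add: over_set_def)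
   then show "t \<in> over_set D N p" using s(1,2) rest[OF s(3)] unfolding over_set_def by simp
  qed
 qed
 note S = this
 have "(A, B) \<in> wen_moves" using mem by blast
 then have "\<exists>E E'. swept D N p E \<and> swept D' ?N p' E' \<and> E \<asymp> E'"
  using sweep_step[OF m(1,2) lp S] mw out by blast
 then show "\<exists>E E'. sweep_class D E \<and> sweep_class D' E' \<and> E \<asymp> E'"
  using cN cN' unfolding sweep_class_def by blast
qed

section \<open>One wen suffices\<close>

lemma sweep_local_move:
 assumes mv: "local_move (wen_moves \<union> W4) D D'" and c: "counter D N \<or> counter D' N"
 shows "\<exists>E E'. sweep_class D E \<and> sweep_class D' E' \<and> E \<asymp> E'"
proof -
 obtain A B m r where AB: "(A, B) \<in> wen_moves \<union> W4" and mv: "move_at A B m r D D'"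
  using mv unfolding local_move_iff by blast
 consider "(A, B) \<in> reidemeister_moves" | "(A, B) \<in> W1 \<union> W3 \<union> W4" | "(A, B) \<in> W2" using AB by blast
 then show ?thesis
 proof cases
  case 1
  then show ?thesis using sweep_reidemeister[OF 1 mv, of N] c by blast
 next
  case 2
  have "\<exists>M. counter D M" using counter_wen_change(2)[OF mv plain_wen_moves(1)[OF 2]] c by fastforce
  then show ?thesis using sweep_plain_wen_move[OF 2 mv] by blast
 next
  case 3
  have wc: "wen_change (3/4) A B" by (rule wen_change_W2[OF 3])
  have "\<exists>M. counter D M" using counter_wen_change(2)[OF mv wc] c by fastforce
  then show ?thesis using sweep_W2[OF 3 mv] by blast
 qed
qed

text \<open>
 The counter that starts at the wen vanishes during the first turn, hence nothing is twisted.
\<close>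

lemma sweep_one_wen:
 assumes v: "valid D" and one: "wens D = 1"
 shows "sweep_class D D"
proof -
 obtain w where w: "{t \<in> {0..<1}. label D t = Wen} = {w}"
  using one unfolding wens_def by (auto simp: card_1_singleton_iff)
 then have lw: "label D w = Wen" by blast
 have wen: "label D u = Wen \<longleftrightarrow> u - w \<in> \<int>" for u
 proof
  assume u: "label D u = Wen"
  have "label D (frac u) = label D u" by (rule label_mod_int[OF v]) (simp add: frac_def)
  then have "frac u \<in> {t \<in> {0..<1}. label D t = Wen}" using u by (simp add: frac_lt_1)
  then have "frac u = w" using w by blast
  then have "u - w = of_int \<lfloor>u\<rfloor>" by (simp add: frac_def)
  then show "u - w \<in> \<int>" by (metis Ints_of_int)
 next
  show "label D u = Wen" if "u - w \<in> \<int>" using label_mod_int[OF v that] lw by simp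
 qed
 define N where "N t \<longleftrightarrow> odd \<lfloor>t - w\<rfloor>" for t
 have "counter D N"
  unfolding counter_def
 proof (intro conjI allI)
  fix t
  have "\<lfloor>t + 1 - w\<rfloor> = \<lfloor>t - w\<rfloor> + 1" by linarith
  then show "N (t + 1) \<longleftrightarrow> \<not> N t" by (simp add: N_def)
  show "\<exists>e>0. \<forall>u. (t - e < u \<and> u < t --> (N u \<longleftrightarrow> N t ~= (label D t = Wen))) \<and> (t < u \<and> u < t + e --> N u = N t)"
  proof -
   let ?f = "t - w - of_int \<lfloor>t - w\<rfloor>"
   have f: "0 <= ?f" "?f < 1" by linarith+
   have R: "N u = N t" if "t < u" "u < t + (1 - ?f)" for u
   proof -
    have "\<lfloor>u - w\<rfloor> = \<lfloor>t - w\<rfloor>" using that f by linarith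
    then show ?thesis by (simp add: N_def)
   qed
   show ?thesis
   proof (cases "?f = 0")
    case True
    then have "t - w = of_int \<lfloor>t - w\<rfloor>" by simp
    then have "label D t = Wen" unfolding wen by (metis Ints_of_int)
    moreover have "N u \<longleftrightarrow> \<not> N t" if "t - 1 < u" "u < t" for u
    proof -
     have "\<lfloor>u - w\<rfloor> = \<lfloor>t - w\<rfloor> - 1" using that True by linarith
     then show ?thesis by (simp add: N_def)
    qed
    ultimately show ?thesis using R True by (intro exI[of _ 1]) simp
   next
    case False
    have "label D t ~= Wen"
    proof
     assume "label D t = Wen"
     then obtain n where "t - w = of_int n" unfolding wen by (auto elim: Ints_cases)
     then show False using False by simp
    qed
    moreover have "N u \<longleftrightarrow> N t" if "t - ?f < u" "u < t" for u
    proof -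
     have "\<lfloor>u - w\<rfloor> = \<lfloor>t - w\<rfloor>" using that f by linarith
     then show ?thesis by (simp add: N_def)
    qed
    moreover have "0 < ?f" using f(1) False by (metis less_eq_real_def)
    ultimately show ?thesis using R f(2) by (intro exI[of _ "min ?f (1 - ?f)"]) auto
   qed
  qed
 qed
 moreover have "over_set D N w = {}"
 proof -
  have "\<not> N t" if "w < t" "t < w + 1" for t
  proof -
   have "\<lfloor>t - w\<rfloor> = 0" using that by linarith
   then show ?thesis by (simp add: N_def)
  qed
  then show ?thesis by (auto simp: over_set_def)
 qed
 moreover have "set_wen w D = D"
 proof (rule diagram.expand, intro conjI ext)
  show "label (set_wen w D) u = label D u" for u using wen[of u] by (metis set_wen_simps(2))
 qed simp
 ultimately have "swept D N w D" using lw v unfolding swept_def by (intro conjI exI[of _ "[]"]) auto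
 then show ?thesis using \<open>counter D N\<close> unfolding sweep_class_def by blast
qed

theorem theorem1p1:
 fixes D D' :: diagram
 assumes "virtual_knot_diagram D" and "wens D = 1"
  and "virtual_knot_diagram D'" and "wens D' = 1"
  and "move_equivalent (reidemeister_moves \<union> W1 \<union> W2 \<union> W3 \<union> W4) D D'"
 shows "move_equivalent (reidemeister_moves \<union> W1 \<union> W2 \<union> W3) D D'"
proof -
 have "\<exists>E. sweep_class D' E \<and> D \<asymp> E"
  using assms(5) unfolding move_equivalent_def
 proof (induction rule: equivclp_induct)
  case base
  then show ?case using sweep_one_wen[OF assms(1,2)] equivalent_refl unfolding move_equivalent_def by blast
 next
  case (step F G)
  obtain E where E: "sweep_class F E" "D \<asymp> E" using step.IH unfolding move_equivalent_def by blast
  then obtain N where N: "counter F N" unfolding sweep_class_def by blast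
  have "valid F \<and> (\<exists>E1 E2. sweep_class F E1 \<and> sweep_class G E2 \<and> E1 \<asymp> E2)"
   using step.hyps(2)
  proof (elim disjE)
   assume "isotopic F G"
   then obtain \<alpha> where i: "isotopic_by \<alpha> F G" unfolding isotopic_iff_isotopic_by by blast
   show ?thesis using sweep_isotopic[OF i N] isotopic_byD(1)[OF i] by blast
  next
   assume "isotopic G F"
   then obtain \<alpha> where i: "isotopic_by \<alpha> G F" unfolding isotopic_iff_isotopic_by by blast
   show ?thesis using sweep_isotopic[OF isotopic_by_sym[OF i] N] isotopic_byD(2)[OF i] by blast
  next
   assume l: "local_move (wen_moves \<union> W4) F G"
   then show ?thesis using sweep_local_move[OF l] N unfolding local_move_def by blast
  next
   assume l: "local_move (wen_moves \<union> W4) G F"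
   have "valid F" using l unfolding local_move_def by blast
   then show ?thesis using sweep_local_move[OF l, of N] N equivalent_sym by blast
  qed
  then obtain E1 E2 where E12: "virtual_knot_diagram F" "sweep_class F E1" "sweep_class G E2" "E1 \<asymp> E2" by blast
  have "D \<asymp> E2"
   using E(2) sweep_class_equivalent[OF E12(1) E(1) E12(2)] E12(4) equivalent_trans by blast
  then show ?case using E12(3) unfolding move_equivalent_def by blast
 qed
 then obtain E where E: "sweep_class D' E" "D \<asymp> E" by blast
 have "E \<asymp> D'" by (rule sweep_class_equivalent[OF assms(3) E(1) sweep_one_wen[OF assms(3,4)]])
 then show ?thesis by (rule equivalent_trans[OF E(2)])
qed

end
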